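(* Let $k\geq 2$ be a fixed integer. Then, uniformly for real $x\geq 2$ and real $u_1,\ldots,u_{k-1}\geq 0$ satisfying $u_1+\cdots+u_{k-1}\leq 1$, \[ \frac{1}{x}\sum_{n\leq x}\frac{1}{\tau_k(n)}\ \sum_{\substack{d_1\leq n^{u_1},\ \ldots,\ d_{k-1}\leq n^{u_{k-1}}\\ d_1\cdots d_{k-1}\mid n}} 1 \;=\; F(u_1,\ldots,u_{k-1})+O\!\left(\frac{1}{(\log x)^{1/k}}\right), \] where $n$ and $d_1,\ldots,d_{k-1}$ run over positive integers and the implied constant depends only on $k$.
   Context: $\tau_k(n)$ denotes the number of $k$-tuples $(d_1,\ldots,d_k)$ of positive integers with $n=d_1\cdots d_k$. For $u_1,\ldots,u_{k-1}\geq 0$ with $u_1+\cdots+u_{k-1}\leq 1$, $F$ is the distribution function of the Dirichlet distribution $\mathrm{Dir}(\frac1k,\ldots,\frac1k)$: \[F(u_1,\ldots,u_{k-1})=\frac{1}{\Gamma(1/k)^k}\int_0^{u_1}\cdots\int_0^{u_{k-1}} t_1^{\frac1k-1}\cdots t_{k-1}^{\frac1k-1}(1-t_1-\cdots-t_{k-1})^{\frac1k-1}\,dt_1\cdots dt_{k-1}.\] *)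

theory Defs
  imports "HOL-Analysis.Analysis"
begin

text \<open>
  Tuples \<open>(d\<^sub>1, \<dots>, d\<^sub>m)\<close> are extensional functions on \<open>{1..m}\<close>, so that
  distinct tuples are distinct functions and cardinalities are the intended counts.
\<close>

definition tau :: "nat \<Rightarrow> nat \<Rightarrow> nat" where
  "tau k n = card {d \<in> {1..k} \<rightarrow>\<^sub>E {1..}. (\<Prod>i=1..k. d i) = n}"

definition divisor_count :: "nat \<Rightarrow> (nat \<Rightarrow> real) \<Rightarrow> nat \<Rightarrow> nat" where
  "divisor_count k u n =
     card {d \<in> {1..k-1} \<rightarrow>\<^sub>E {1..}.
             (\<forall>i\<in>{1..k-1}. real (d i) \<le> real n powr u i) \<and> (\<Prod>i=1..k-1. d i) dvd n}"

text \<open>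
  The integral is taken with respect to the \<open>(k-1)\<close>-dimensional Lebesgue measure over the box
  \<open>[0, u\<^sub>1] \<times> \<dots> \<times> [0, u\<^sub>k\<^sub>-\<^sub>1]\<close>. For \<open>u\<close> in the simplex the box is contained in the simplex, so all
  bases of \<open>powr\<close> are nonnegative there; the points where some base vanishes form a null set.
\<close>

definition dirichlet_F :: "nat \<Rightarrow> (nat \<Rightarrow> real) \<Rightarrow> real" where
  "dirichlet_F k u =
     1 / Gamma (1 / real k) ^ k *
     set_lebesgue_integral (\<Pi>\<^sub>M i\<in>{1..k-1}. lborel) (\<Pi>\<^sub>E i\<in>{1..k-1}. {0..u i})
       (\<lambda>t. (\<Prod>i=1..k-1. t i powr (1 / real k - 1)) *
             (1 - (\<Sum>i=1..k-1. t i)) powr (1 / real k - 1))"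

end

theory Submission
  imports Defs "HOL-Number_Theory.Prime_Powers" "HOL-Computational_Algebra.Squarefree"
    "HOL-Probability.Probability" "HOL-Complex_Analysis.Complex_Analysis" "HOL-Real_Asymp.Real_Asymp"
begin

text \<open>
  Put \<open>a = 1/k\<close> and let \<open>tz z\<close> be the arithmetic function with Dirichlet series \<open>\<zeta>(s)\<^bsup>z\<^esup>\<close>. Since
  \<open>\<zeta> = (\<zeta>\<^bsup>a\<^esup>)\<^bsup>k\<^esup>\<close>, the weights \<open>\<Prod>i. tz a (d i)\<close> form a probability distribution on the factorizations of
  \<open>n\<close> into \<open>k\<close> factors, which is the uniform one when \<open>n\<close> is squarefree.

  For this model law, the number \<open>N\<close> of weighted tuples with product at most \<open>x\<close> and cut-offs on the first \<open>k - 1\<close>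
  coordinates is computed by weighting with the logarithm of the product: \<open>N ln x\<close> splits into \<open>k\<close> sums,
  each with one factor \<open>ln d\<close>, and \<open>tz a \<cdot> ln = a (\<Lambda> * tz a)\<close> turns that factor into a value of \<open>psi\<close>. All that is needed
  about primes is \<open>(\<Sum>m\<le>x. \<bar>psi(x/m) - x/m\<bar>) = O(x sqrt (ln x))\<close>, which follows by Cauchy-Schwarz
  from an \<open>L\<^sup>2\<close> bound for \<open>psi(e\<^sup>v) e\<^bsup>-v\<^esup> - 1\<close>, and this from Plancherel and a bound for \<open>\<zeta>'/\<zeta>\<close> near the line
  of real part one (the 3-4-1 inequality). The remaining coordinates are replaced one at a time by integrals
  against \<open>v\<^bsup>a-1\<^esup>\<close>, using the elementary asymptotics of \<open>\<Sum>d\<le>e\<^sup>v. tz a d / d\<close>. The Dirichlet integral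
  satisfies the identity matching the logarithmic weighting, and the unknown constant in
  the asymptotics is fixed by the case without cut-offs.

  Finally write \<open>n = s q\<close> with \<open>s\<close> squarefree and coprime to \<open>q\<close>. Both laws at \<open>n\<close> are products of the law at \<open>s\<close>
  with a law at \<open>q\<close>, so they differ by at most the mass which the law at \<open>s\<close> gives to a
  window of logarithmic width of order \<open>ln q\<close>; the Hoelder continuity of the limit distribution makes this small
  on average, and the sum over \<open>q\<close> converges.
\<close>

section \<open>Chebyshev and Mertens estimates\<close>

text \<open>Partial sums of \<open>tz a\<close> have no elementary asymptotics of the required
  precision; the logarithmic sums \<open>Lf\<close> do, with bounded error. Weighting by ln of the
  product is arranged so that only the latter occur, together with values of \<open>psi\<close>
  whose errors must be controlled. In that error the weights of the k - 1 other coordinates meet one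
  more \<open>tz a\<close> coming from \<open>tz_rec\<close>, and the convolution of all of them is
  \<open>tz 1\<close>, constantly 1. So only the plain average of the errors over m is needed. It
  has to stay below x (ln x) powr (1 - a), which after division by ln x is the claimed error, and x
  sqrt (ln x) is good enough precisely because k >= 2 makes a <= 1/2. Therefore neither a zero-free
  region nor a pointwise error term for primes is required: a bounded mean square of the relative
  error of \<open>psi\<close> suffices. Plancherel yields it from any polynomial bound of exponent
  below 1/2 for the logarithmic derivative of zeta, uniform as the line of real part one is
  approached; the exponent reached here is 1/4.\<close>

lemma in_upto_iff: "n \<in> {1..nat \<lfloor>x\<rfloor>} \<longleftrightarrow> 1 \<le> n \<and> real n \<le> x"
  by (auto simp: le_nat_iff le_floor_iff) linarith

lemma sum_divisors_flip:
  fixes f :: "nat \<Rightarrow> nat \<Rightarrow> 'a :: comm_monoid_add"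
  assumes "n > 0"
  shows "(\<Sum>d | d dvd n. f d (n div d)) = (\<Sum>d | d dvd n. f (n div d) d)"
  by (rule sum.reindex_bij_witness[of _ "\<lambda>d. n div d" "\<lambda>d. n div d"])
     (use assms in \<open>auto simp: dvd_div_eq_mult div_div_eq_right dest: div_dvd_div\<close>)

text \<open>Both sides run over the ordered factorizations n = r * e * f. This is associativity of
  Dirichlet convolution, before any product structure is put on the summand.\<close>

lemma sum_divisors_assoc:
  fixes f :: "nat \<Rightarrow> nat \<Rightarrow> nat \<Rightarrow> 'a :: comm_monoid_add"
  assumes n: "n > 0"
  shows "(\<Sum>d | d dvd n. \<Sum>r | r dvd d. f r (d div r) (n div d)) =
         (\<Sum>r | r dvd n. \<Sum>e | e dvd n div r. f r e (n div r div e))"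
proof -
  have fin: "finite {r. r dvd d}" if "d dvd n" for d
    using that n by (intro finite_divisors_nat) (rule dvd_pos_nat)
  have fin': "finite {e. e dvd n div r}" if "r dvd n" for r
    using that n by (intro finite_divisors_nat) (auto elim!: dvdE)
  have "(\<Sum>d | d dvd n. \<Sum>r | r dvd d. f r (d div r) (n div d)) =
      (\<Sum>(d,r)\<in>(SIGMA d:{d. d dvd n}. {r. r dvd d}). f r (d div r) (n div d))"
    by (rule sum.Sigma) (use n fin in auto)
  also have "\<dots> = (\<Sum>(r,e)\<in>(SIGMA r:{r. r dvd n}. {e. e dvd n div r}). f r e (n div r div e))"
    by (rule sum.reindex_bij_witness[of _ "\<lambda>(r,e). (r * e, r)" "\<lambda>(d,r). (r, d div r)"])
       (use n in \<open>auto elim!: dvdE simp: div_mult2_eq\<close>)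
  also have "\<dots> = (\<Sum>r | r dvd n. \<Sum>e | e dvd n div r. f r e (n div r div e))"
    by (rule sum.Sigma[symmetric]) (use n fin' in auto)
  finally show ?thesis .
qed

lemma sum_divisors_upto:
  fixes f :: "nat \<Rightarrow> nat \<Rightarrow> 'a :: comm_monoid_add"
  shows "(\<Sum>n\<in>{1..nat \<lfloor>x\<rfloor>}. \<Sum>d | d dvd n. f d (n div d)) =
         (\<Sum>d\<in>{1..nat \<lfloor>x\<rfloor>}. \<Sum>m\<in>{1..nat \<lfloor>x / real d\<rfloor>}. f d m)"
proof -
  have "(\<Sum>n\<in>{1..nat \<lfloor>x\<rfloor>}. \<Sum>d | d dvd n. f d (n div d)) =
      (\<Sum>(n,d)\<in>(SIGMA n:{1..nat \<lfloor>x\<rfloor>}. {d. d dvd n}). f d (n div d))"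
    by (rule sum.Sigma) auto
  also have "\<dots> = (\<Sum>(d,m)\<in>(SIGMA d:{1..nat \<lfloor>x\<rfloor>}. {1..nat \<lfloor>x / real d\<rfloor>}). f d m)"
  proof (rule sum.reindex_bij_witness[of _ "\<lambda>(d,m). (d * m, d)" "\<lambda>(n,d). (d, n div d)"], goal_cases)
    case (2 a)
    then obtain n d where nd: "a = (n, d)" "n \<in> {1..nat \<lfloor>x\<rfloor>}" "d dvd n" by auto
    then obtain m where m: "n = d * m" by (elim dvdE)
    have "n \<ge> 1" "real n \<le> x" using nd(2) unfolding in_upto_iff by auto
    hence dm: "d \<ge> 1" "m \<ge> 1" using m by (auto simp: Suc_le_eq)
    have "real d * real m \<le> x" using \<open>real n \<le> x\<close> m by simp
    moreover have "real d * 1 \<le> real d * real m" using dm by (intro mult_left_mono) auto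
    ultimately have "real d \<le> x" "real m \<le> x / real d" using dm by (linarith, simp add: field_simps)
    thus ?case using dm m nd unfolding nd(1) by (auto simp: in_upto_iff in_upto_iff[unfolded One_nat_def] simp del: atLeastAtMost_iff)
  next
    case (4 b)
    then obtain d m where dm: "b = (d, m)" "d \<in> {1..nat \<lfloor>x\<rfloor>}" "m \<in> {1..nat \<lfloor>x / real d\<rfloor>}" by auto
    have "d \<ge> 1" "m \<ge> 1" "real m \<le> x / real d" using dm unfolding in_upto_iff by auto
    hence "real (d * m) \<le> x" "d * m \<ge> 1" by (auto simp: field_simps)
    hence "d * m \<in> {1..nat \<lfloor>x\<rfloor>}" unfolding in_upto_iff by blast
    thus ?case unfolding dm(1) by auto
  qed (auto simp: in_upto_iff)
  also have "\<dots> = (\<Sum>d\<in>{1..nat \<lfloor>x\<rfloor>}. \<Sum>m\<in>{1..nat \<lfloor>x / real d\<rfloor>}. f d m)"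
    by (rule sum.Sigma[symmetric]) auto
  finally show ?thesis .
qed

definition psi :: "real \<Rightarrow> real" where
  "psi x = (\<Sum>n\<in>{1..nat \<lfloor>x\<rfloor>}. mangoldt n)"

lemma psi_nonneg: "psi x \<ge> 0"
  unfolding psi_def by (intro sum_nonneg mangoldt_nonneg)

lemma psi_mono: "x \<le> y \<Longrightarrow> psi x \<le> psi y"
  unfolding psi_def by (intro sum_mono2) (auto intro: mangoldt_nonneg nat_mono floor_mono order_trans)

text \<open>Legendre's formula for the factorial, from Lambda * 1 = ln. Both the Chebyshev and the
  Mertens bound below are read off from it.\<close>

lemma sum_ln_upto:
  "(\<Sum>n\<in>{1..nat \<lfloor>x\<rfloor>}. ln (real n)) = (\<Sum>d\<in>{1..nat \<lfloor>x\<rfloor>}. mangoldt d * real (nat \<lfloor>x / real d\<rfloor>))"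
proof -
  have "(\<Sum>n\<in>{1..nat \<lfloor>x\<rfloor>}. ln (real n)) = (\<Sum>n\<in>{1..nat \<lfloor>x\<rfloor>}. \<Sum>d | d dvd n. mangoldt d)"
    by (intro sum.cong refl) (auto simp: mangoldt_sum)
  also have "\<dots> = (\<Sum>d\<in>{1..nat \<lfloor>x\<rfloor>}. \<Sum>m\<in>{1..nat \<lfloor>x / real d\<rfloor>}. mangoldt d)"
    using sum_divisors_upto[of "\<lambda>d _. mangoldt d :: real"] .
  finally show ?thesis by (simp add: mult.commute)
qed

text \<open>Chebyshev's argument: the logarithm of the central binomial coefficient is a sum of
  Lambda(d) with nonnegative coefficients, these are at least 1 for n < d <= 2n, and the coefficient
  itself is at most 4^n.\<close>

lemma psi_double: "psi (2 * real n) - psi (real n) \<le> 2 * real n * ln 2"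
proof -
  have lnf: "ln (fact m) = (\<Sum>i\<in>{1..m}. ln (real i))" for m :: nat
    by (induction m) (simp_all add: ln_mult del: fact_Suc add: fact_Suc[of _, where 'a = real])
  \<comment> \<open>All factorials are expanded over one common range; the additional terms have m
    div d = 0. The coefficients can then be compared term by term.\<close>
  have S: "(\<Sum>i\<in>{1..m}. ln (real i)) = (\<Sum>d\<in>{1..M}. mangoldt d * real (m div d))" if "m \<le> M" for m M
  proof -
    have "(\<Sum>i\<in>{1..m}. ln (real i)) = (\<Sum>d\<in>{1..m}. mangoldt d * real (m div d))"
      using sum_ln_upto[of "real m"] by (simp add: floor_divide_of_nat_eq)
    also have "\<dots> = (\<Sum>d\<in>{1..M}. mangoldt d * real (m div d))"
      by (rule sum.mono_neutral_left) (use that in auto)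
    finally show ?thesis .
  qed
  have "psi (2 * real n) - psi (real n) = (\<Sum>d\<in>{n+1..2*n}. mangoldt d)"
  proof -
    have e: "2 * real n = real (2 * n)" by simp
    have "{1..2*n} = {1..n} \<union> {n+1..2*n}" by auto
    hence "(\<Sum>d\<in>{1..2*n}. mangoldt d :: real) = (\<Sum>d\<in>{1..n}. mangoldt d) + (\<Sum>d\<in>{n+1..2*n}. mangoldt d)"
      by (simp only:) (rule sum.union_disjoint, auto)
    thus ?thesis unfolding psi_def e floor_of_nat nat_int by simp
  qed
  also have "\<dots> \<le> (\<Sum>d\<in>{n+1..2*n}. mangoldt d * (real (2*n div d) - 2 * real (n div d)))"
  proof (rule sum_mono)
    fix d assume d: "d \<in> {n+1..2*n}"
    hence "n div d = 0" "2*n div d \<ge> 1" by (auto simp: Suc_le_eq div_greater_zero_iff)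
    hence "1 \<le> real (2*n div d) - 2 * real (n div d)" by linarith
    hence "mangoldt d * 1 \<le> mangoldt d * (real (2*n div d) - 2 * real (n div d))"
      by (intro mult_left_mono mangoldt_nonneg)
    thus "mangoldt d \<le> mangoldt d * (real (2*n div d) - 2 * real (n div d))" by simp
  qed
  also have "\<dots> \<le> (\<Sum>d\<in>{1..2*n}. mangoldt d * (real (2*n div d) - 2 * real (n div d)))"
  proof (rule sum_mono2)
    fix d assume "d \<in> {1..2*n} - {n+1..2*n}"
    have "2 * (n div d) \<le> 2 * n div d"
    proof (cases "d = 0")
      case False
      have "n div d * d \<le> n" by simp
      hence "2 * (n div d) * d \<le> 2 * n" by simp
      thus ?thesis using False by (simp add: less_eq_div_iff_mult_less_eq)
    qed simp
    thus "0 \<le> mangoldt d * (real (2*n div d) - 2 * real (n div d))"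
      by (intro mult_nonneg_nonneg mangoldt_nonneg) linarith
  qed auto
  also have "\<dots> = ln (fact (2*n)) - 2 * ln (fact n)"
    using S[of "2*n" "2*n"] S[of n "2*n"]
    by (simp add: lnf sum_subtractf algebra_simps sum_distrib_left)
  also have "\<dots> = ln (real (2*n choose n))"
  proof -
    have "fact n * fact n * (2*n choose n) = (fact (2*n) :: nat)"
      using binomial_fact_lemma[of n "2*n"] by simp
    hence "(fact (2*n) :: real) = fact n * fact n * real (2*n choose n)"
      by (metis of_nat_fact of_nat_mult)
    hence "ln (fact (2*n) :: real) = ln (fact n * fact n * real (2*n choose n))" by simp
    also have "\<dots> = 2 * ln (fact n) + ln (real (2*n choose n))"
      by (subst ln_mult; simp)+
    finally show ?thesis by simp
  qed
  also have "\<dots> \<le> ln (2 ^ (2*n))"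
  proof -
    have "real (2*n choose n) \<le> real (2 ^ (2*n))"
      using binomial_le_pow2[of "2*n" n] by (simp only: of_nat_le_iff)
    thus ?thesis by (subst ln_le_cancel_iff) auto
  qed
  also have "\<dots> = 2 * real n * ln 2" by (simp add: ln_realpow)
  finally show ?thesis .
qed

text \<open>Adding \<open>psi_double\<close> over powers of two gives 2 * 2^j * ln 2 at 2^j.
  Rounding x up to the next power costs another factor 2, and ln 2 < 1 leaves 4.\<close>

lemma psi_bound:
  assumes "x \<ge> 0"
  shows "psi x \<le> 4 * x"
proof (cases "x < 1")
  case True
  thus ?thesis using assms by (simp add: psi_def)
next
  case False
  have p2: "psi (2 ^ j) \<le> 2 * 2 ^ j * ln 2" for j :: nat
  proof (induction j)
    case 0
    show ?case by (simp add: psi_def)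
  next
    case (Suc j)
    show ?case using psi_double[of "2^j"] Suc by (simp add: algebra_simps)
  qed
  define j where "j = nat \<lfloor>log 2 x\<rfloor>"
  have "log 2 x \<ge> 0" using False by simp
  hence jj: "real j \<le> log 2 x" "log 2 x < real j + 1" unfolding j_def by linarith+
  have "2 powr (real j) \<le> x" using jj(1) False by (simp add: le_log_iff)
  moreover have "x < 2 powr (real (Suc j))" using jj(2) False by (simp add: log_less_iff add.commute)
  ultimately have x: "2 ^ j \<le> x" "x < 2 ^ Suc j"
    by (auto simp: powr_realpow simp del: power_Suc of_nat_Suc)
  have "psi x \<le> psi (2 ^ Suc j)" using x by (intro psi_mono) auto
  also have "\<dots> \<le> 2 * 2 ^ Suc j * ln 2" by (rule p2)
  also have "\<dots> = 4 * 2 ^ j * ln 2" by simp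
  also have "\<dots> \<le> 4 * 2 ^ j * 1" using ln_2_less_1 by (intro mult_left_mono) auto
  also have "\<dots> \<le> 4 * x" using x by simp
  finally show ?thesis .
qed

text \<open>From ln y <= 2 sqrt y. It serves as a crude Stirling formula, and later bounds the cost
  of replacing the logarithm of a product by ln x.\<close>

lemma sum_ln_quotient_le:
  assumes x: "x \<ge> 1"
  shows "(\<Sum>n\<in>{1..nat \<lfloor>x\<rfloor>}. ln x - ln (real n)) \<le> 4 * x"
proof -
  have s: "(\<Sum>n\<in>{1..N}. 1 / sqrt (real n)) \<le> 2 * sqrt (real N)" for N :: nat
  proof (induction N)
    case (Suc N)
    let ?a = "sqrt (real N)" and ?b = "sqrt (real (Suc N))"
    have b: "?b > 0" "?a \<ge> 0" "?a \<le> ?b" "?b * ?b - ?a * ?a = 1" by auto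
    have "1 = (?b - ?a) * (?b + ?a)" using b(4) by (simp add: algebra_simps)
    also have "\<dots> \<le> (?b - ?a) * (2 * ?b)" using b by (intro mult_left_mono) auto
    finally have "1 / ?b \<le> 2 * (?b - ?a)" using b by (simp add: field_simps)
    thus ?case using Suc by simp
  qed simp
  have "(\<Sum>n\<in>{1..nat \<lfloor>x\<rfloor>}. ln x - ln (real n)) \<le> (\<Sum>n\<in>{1..nat \<lfloor>x\<rfloor>}. 2 * sqrt x * (1 / sqrt (real n)))"
  proof (rule sum_mono)
    fix n assume n: "n \<in> {1..nat \<lfloor>x\<rfloor>}"
    hence n1: "n \<ge> 1" by auto
    have "ln x - ln (real n) = ln (x / real n)" using n1 x by (simp add: ln_div)
    also have "\<dots> = 2 * ln (sqrt (x / real n))" using n1 x by (simp add: ln_sqrt)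
    also have "\<dots> \<le> 2 * (sqrt (x / real n) - 1)" using n1 x by (intro mult_left_mono ln_le_minus_one) auto
    also have "\<dots> \<le> 2 * sqrt x * (1 / sqrt (real n))" by (simp add: real_sqrt_divide)
    finally show "ln x - ln (real n) \<le> 2 * sqrt x * (1 / sqrt (real n))" .
  qed
  also have "\<dots> = 2 * sqrt x * (\<Sum>n\<in>{1..nat \<lfloor>x\<rfloor>}. 1 / sqrt (real n))" by (simp add: sum_distrib_left)
  also have "\<dots> \<le> 2 * sqrt x * (2 * sqrt (real (nat \<lfloor>x\<rfloor>)))" using x by (intro mult_left_mono s) auto
  also have "\<dots> \<le> 2 * sqrt x * (2 * sqrt x)" using x by (intro mult_left_mono) auto
  also have "\<dots> = 4 * x" using x by simp
  finally show ?thesis .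
qed

text \<open>Dropping the floors in \<open>sum_ln_upto\<close> costs at most psi x <= 4 x in one
  direction; in the other, \<open>sum_ln_quotient_le\<close> costs 4 x and the rounding of x at most
  ln x <= x. Dividing by x gives 5.\<close>

lemma mertens_mangoldt:
  assumes x: "x \<ge> 1"
  shows "\<bar>(\<Sum>r\<in>{1..nat \<lfloor>x\<rfloor>}. mangoldt r / real r) - ln x\<bar> \<le> 5"
proof -
  define S where "S = (\<Sum>n\<in>{1..nat \<lfloor>x\<rfloor>}. ln (real n))"
  define A where "A = (\<Sum>r\<in>{1..nat \<lfloor>x\<rfloor>}. mangoldt r / real r)"
  have SA: "x * A - S = (\<Sum>r\<in>{1..nat \<lfloor>x\<rfloor>}. mangoldt r * (x / real r - real (nat \<lfloor>x / real r\<rfloor>)))"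
    unfolding S_def A_def sum_ln_upto by (simp add: sum_distrib_left sum_subtractf algebra_simps)
  have b: "0 \<le> x / real r - real (nat \<lfloor>x / real r\<rfloor>)" "x / real r - real (nat \<lfloor>x / real r\<rfloor>) \<le> 1" for r
  proof -
    have "x / real r \<ge> 0" using x by simp
    thus "0 \<le> x / real r - real (nat \<lfloor>x / real r\<rfloor>)" "x / real r - real (nat \<lfloor>x / real r\<rfloor>) \<le> 1"
      by linarith+
  qed
  have lo: "x * A - S \<ge> 0" unfolding SA using b by (intro sum_nonneg mult_nonneg_nonneg mangoldt_nonneg)
  have "x * A - S \<le> (\<Sum>r\<in>{1..nat \<lfloor>x\<rfloor>}. mangoldt r * 1)"
    unfolding SA using b by (intro sum_mono mult_left_mono mangoldt_nonneg)
  also have "\<dots> \<le> 4 * x" using psi_bound[of x] x by (simp add: psi_def)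
  finally have hi: "x * A - S \<le> 4 * x" .
  have fl: "real (nat \<lfloor>x\<rfloor>) \<le> x" "real (nat \<lfloor>x\<rfloor>) \<ge> x - 1" using x by linarith+
  have q: "(\<Sum>n\<in>{1..nat \<lfloor>x\<rfloor>}. ln x - ln (real n)) = real (nat \<lfloor>x\<rfloor>) * ln x - S"
    by (simp add: sum_subtractf S_def)
  have l0: "ln x \<ge> 0" "ln x \<le> x" using x ln_le_minus_one[of x] by auto
  have "0 \<le> (\<Sum>n\<in>{1..nat \<lfloor>x\<rfloor>}. ln x - ln (real n))"
    by (intro sum_nonneg) (use x in \<open>auto simp: in_upto_iff in_upto_iff[unfolded One_nat_def] simp del: atLeastAtMost_iff\<close>)
  hence S1: "S \<le> x * ln x" using q mult_right_mono[OF fl(1) l0(1)] by simp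
  have "real (nat \<lfloor>x\<rfloor>) * ln x - S \<le> 4 * x" using sum_ln_quotient_le[OF x] q by simp
  moreover have "real (nat \<lfloor>x\<rfloor>) * ln x \<ge> (x - 1) * ln x" using mult_right_mono[OF fl(2) l0(1)] by simp
  ultimately have S2: "S \<ge> x * ln x - 5 * x" using l0 by (simp add: algebra_simps)
  have "x * (A - ln x) \<le> x * 5" "x * (- 5) \<le> x * (A - ln x)"
    using S1 S2 lo hi x by (auto simp: algebra_simps)
  hence "A - ln x \<le> 5" "- 5 \<le> A - ln x"
    using x mult_left_le_imp_le[of x "A - ln x" 5] mult_left_le_imp_le[of x "- 5" "A - ln x"] by auto
  thus ?thesis unfolding A_def by linarith
qed

section \<open>Generalized divisor functions\<close>

text \<open>The coefficients of \<open>\<zeta>(s)\<^bsup>z\<^esup>\<close>; the recursion is the logarithmic derivative of that power.\<close>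

function tz :: "real \<Rightarrow> nat \<Rightarrow> real" where
  "tz z n = (if n = 0 then 0 else if n = 1 then 1
     else z / ln (real n) * (\<Sum>r\<in>{r. r dvd n \<and> r \<noteq> 1}. mangoldt r * tz z (n div r)))"
  by auto
termination
  by (relation "Wellfounded.measure snd") (auto intro!: div_less_dividend elim!: dvdE)

declare tz.simps [simp del]

lemma tz_0 [simp]: "tz z 0 = 0" and tz_Suc_0 [simp]: "tz z (Suc 0) = 1"
  by (subst tz.simps; simp)+

text \<open>The recursion for \<open>tz\<close> leaves out r = 1 in order to terminate. As Lambda(1)
  = 0, it agrees with the full convolution used everywhere else.\<close>

lemma mangoldt_sum_except_1:
  fixes f :: "nat \<Rightarrow> real"
  assumes "n > 0"
  shows "(\<Sum>r | r dvd n. mangoldt r * f r) = (\<Sum>r\<in>{r. r dvd n \<and> r \<noteq> 1}. mangoldt r * f r)"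
  by (rule sum.mono_neutral_right) (use assms in auto)

lemma tz_rec:
  assumes "n > 0"
  shows "tz z n * ln (real n) = z * (\<Sum>r | r dvd n. mangoldt r * tz z (n div r))"
proof (cases "n = 1")
  case True
  thus ?thesis by simp
next
  case False
  hence "ln (real n) > 0" using assms by simp
  thus ?thesis using False assms
    by (subst tz.simps) (simp add: mangoldt_sum_except_1[OF assms])
qed

text \<open>For n > 1 the factor ln n is nonzero, and the only term of the convolution containing f
  n itself carries Lambda(1) = 0, so the recursion determines f. This replaces comparing
  coefficients of Dirichlet series: an identity for \<open>tz\<close> is proved by checking its
  logarithmic derivative.\<close>

lemma tz_unique:
  assumes f1: "f 1 = 1"
    and rec: "\<And>n. n > 0 \<Longrightarrow> f n * ln (real n) = z * (\<Sum>r | r dvd n. mangoldt r * f (n div r))"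
    and n: "n > 0"
  shows "f n = tz z n"
  using n
proof (induction n rule: less_induct)
  case (less n)
  show ?case
  proof (cases "n = 1")
    case True
    thus ?thesis using f1 by simp
  next
    case False
    hence l: "ln (real n) > 0" using less.prems by simp
    have "(\<Sum>r | r dvd n. mangoldt r * f (n div r)) = (\<Sum>r | r dvd n. mangoldt r * tz z (n div r))"
    proof (rule sum.cong[OF refl])
      fix r assume r: "r \<in> {r. r dvd n}"
      show "mangoldt r * f (n div r) = mangoldt r * tz z (n div r)"
      proof (cases "r = 1")
        case True
        thus ?thesis by simp
      next
        case r1: False
        obtain m where m: "n = r * m" using r by auto
        with less.prems r1 have "m < n" "m > 0" "n div r = m" by auto
        thus ?thesis using less.IH by simp
      qed
    qed
    hence "f n * ln (real n) = tz z n * ln (real n)"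
      using rec[OF less.prems] tz_rec[OF less.prems] by simp
    thus ?thesis using l by simp
  qed
qed

lemma tz_zero: "n > 0 \<Longrightarrow> tz 0 n = (if n = 1 then 1 else 0)"
  by (subst tz.simps) simp

lemma tz_one: "n > 0 \<Longrightarrow> tz 1 n = 1"
  by (rule tz_unique[of "\<lambda>_. 1", symmetric]) (auto simp: mangoldt_sum)

lemma tz_nonneg: "z \<ge> 0 \<Longrightarrow> tz z n \<ge> 0"
proof (induction n rule: less_induct)
  case (less n)
  have "n div r < n" if "r dvd n" "r \<noteq> 1" "n > 0" for r
    using that by (intro div_less_dividend) (auto elim!: dvdE simp: Suc_lessI)
  hence "(\<Sum>r\<in>{r. r dvd n \<and> r \<noteq> 1}. mangoldt r * tz z (n div r)) \<ge> 0" if "n > 0"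
    using less that by (intro sum_nonneg mult_nonneg_nonneg mangoldt_nonneg) auto
  thus ?case using less.prems by (subst tz.simps) auto
qed

text \<open>Inductively the recursion is dominated by the sum of Lambda over the divisors of n,
  which is ln n.\<close>

lemma tz_le_1: "0 \<le> z \<Longrightarrow> z \<le> 1 \<Longrightarrow> tz z n \<le> 1"
proof (induction n rule: less_induct)
  case (less n)
  show ?case
  proof (cases "n \<le> 1")
    case True
    hence "n = 0 \<or> n = 1" by auto
    thus ?thesis by auto
  next
    case False
    hence l: "ln (real n) > 0" and n: "n > 0" by auto
    have lt: "n div r < n" if "r dvd n" "r \<noteq> 1" for r
      using that n by (intro div_less_dividend) (auto elim!: dvdE simp: Suc_lessI)
    have "tz z n * ln (real n) = z * (\<Sum>r\<in>{r. r dvd n \<and> r \<noteq> 1}. mangoldt r * tz z (n div r))"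
      using tz_rec[OF n] mangoldt_sum_except_1[OF n] by simp
    also have "\<dots> \<le> 1 * (\<Sum>r\<in>{r. r dvd n \<and> r \<noteq> 1}. mangoldt r * 1)"
      using less lt
      by (intro mult_mono sum_mono mult_left_mono mangoldt_nonneg sum_nonneg mult_nonneg_nonneg tz_nonneg) auto
    also have "\<dots> = ln (real n)"
      using mangoldt_sum_except_1[OF n, of "\<lambda>_. 1"] mangoldt_sum[of n, where 'a = real] n by simp
    finally show ?thesis using l by simp
  qed
qed

text \<open>Multiplication by ln is a derivation for Dirichlet convolution, so the convolution
  satisfies the recursion with parameter a + b, and \<open>tz_unique\<close> applies.\<close>

lemma tz_conv:
  assumes n: "n > 0"
  shows "(\<Sum>d | d dvd n. tz a d * tz b (n div d)) = tz (a + b) n"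
proof (rule tz_unique[of "\<lambda>n. \<Sum>d | d dvd n. tz a d * tz b (n div d)", OF _ _ n])
  show "(\<Sum>d | d dvd 1. tz a d * tz b (1 div d)) = 1" by simp
next
  fix n :: nat assume n: "n > 0"
  define c where "c = (\<lambda>a b n. \<Sum>d | d dvd n. tz a d * tz b (n div d))"
  have c_flip: "c a b n = c b a n" if "n > 0" for a b n
    unfolding c_def using sum_divisors_flip[OF that, of "\<lambda>d e. tz a d * tz b e"] by (simp add: mult.commute)
  have *: "(\<Sum>d | d dvd n. tz a d * tz b (n div d) * ln (real d)) = a * (\<Sum>r | r dvd n. mangoldt r * c a b (n div r))"
    for a b
  proof -
    have "(\<Sum>d | d dvd n. tz a d * tz b (n div d) * ln (real d)) =
        (\<Sum>d | d dvd n. \<Sum>r | r dvd d. a * (mangoldt r * tz a (d div r) * tz b (n div d)))"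
    proof (rule sum.cong[OF refl])
      fix d assume "d \<in> {d. d dvd n}"
      hence d: "d > 0" using n by (auto intro: dvd_pos_nat)
      have "tz a d * tz b (n div d) * ln (real d) = (tz a d * ln (real d)) * tz b (n div d)" by simp
      also have "\<dots> = (\<Sum>r | r dvd d. a * (mangoldt r * tz a (d div r) * tz b (n div d)))"
        unfolding tz_rec[OF d, of a] by (simp add: sum_distrib_left sum_distrib_right mult_ac)
      finally show "tz a d * tz b (n div d) * ln (real d) =
          (\<Sum>r | r dvd d. a * (mangoldt r * tz a (d div r) * tz b (n div d)))" .
    qed
    also have "\<dots> = (\<Sum>r | r dvd n. \<Sum>e | e dvd n div r. a * (mangoldt r * tz a e * tz b (n div r div e)))"
      by (rule sum_divisors_assoc[OF n, of "\<lambda>r e f. a * (mangoldt r * tz a e * tz b f)"])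
    also have "\<dots> = a * (\<Sum>r | r dvd n. mangoldt r * c a b (n div r))"
      unfolding c_def by (simp add: sum_distrib_left mult_ac)
    finally show ?thesis .
  qed
  have "c a b n * ln (real n) =
      (\<Sum>d | d dvd n. tz a d * tz b (n div d) * ln (real d) + tz a d * tz b (n div d) * ln (real (n div d)))"
    unfolding c_def sum_distrib_right
  proof (rule sum.cong[OF refl])
    fix d assume "d \<in> {d. d dvd n}"
    then obtain e where e: "n = d * e" by auto
    with n have "d > 0" "e > 0" by auto
    thus "tz a d * tz b (n div d) * ln (real n) =
        tz a d * tz b (n div d) * ln (real d) + tz a d * tz b (n div d) * ln (real (n div d))"
      unfolding e by (simp add: ln_mult algebra_simps)
  qed
  also have "\<dots> = (\<Sum>d | d dvd n. tz a d * tz b (n div d) * ln (real d)) +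
      (\<Sum>d | d dvd n. tz b d * tz a (n div d) * ln (real d))"
    using sum_divisors_flip[OF n, of "\<lambda>d e. tz a d * tz b e * ln (real e)"]
    by (simp add: sum.distrib mult_ac)
  also have "\<dots> = a * (\<Sum>r | r dvd n. mangoldt r * c a b (n div r)) + b * (\<Sum>r | r dvd n. mangoldt r * c b a (n div r))"
    unfolding * by simp
  also have "(\<Sum>r | r dvd n. mangoldt r * c b a (n div r)) = (\<Sum>r | r dvd n. mangoldt r * c a b (n div r))"
    by (intro sum.cong refl) (use n in \<open>auto simp: c_flip[of _ b a] elim!: dvdE\<close>)
  finally show "(\<Sum>d | d dvd n. tz a d * tz b (n div d)) * ln (real n) =
     (a + b) * (\<Sum>r | r dvd n. mangoldt r * (\<Sum>d | d dvd n div r. tz a d * tz b (n div r div d)))"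
    unfolding c_def by (simp add: algebra_simps)
qed

lemma primepow_dvd_mult_coprime:
  assumes "primepow r" "coprime m n" "r dvd m * n"
  shows "r dvd m \<or> r dvd (n::nat)"
proof -
  obtain p k where p: "prime p" "r = p ^ k" using assms(1) by (auto simp: primepow_def)
  have "\<not> p dvd m \<or> \<not> p dvd n"
    using assms(2) p(1) by (meson coprime_common_divisor not_prime_unit)
  hence "coprime p m \<or> coprime p n"
    using p(1) by (auto intro: prime_imp_coprime)
  hence "coprime r m \<or> coprime r n" using p(2) by auto
  thus ?thesis using assms(3) by (auto simp: coprime_dvd_mult_left_iff coprime_dvd_mult_right_iff)
qed

text \<open>Lambda lives on prime powers, and a prime power dividing m * n divides exactly one of
  the coprime factors. The recursion at m * n therefore splits into those at m and at n.\<close>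

lemma tz_mult_coprime:
  "coprime m n \<Longrightarrow> m > 0 \<Longrightarrow> n > 0 \<Longrightarrow> tz z (m * n) = tz z m * tz z n"
proof (induction "m * n" arbitrary: m n rule: less_induct)
  case less
  show ?case
  proof (cases "m * n = 1")
    case True
    thus ?thesis by simp
  next
    case False
    have pos: "m * n > 0" using less.prems by simp
    have "1 < m * n" using False pos by linarith
    hence "real 1 < real (m * n)" by (simp only: of_nat_less_iff)
    hence l: "ln (real (m * n)) > 0" by simp
    have "(\<Sum>r | r dvd m * n. mangoldt r * tz z (m * n div r)) =
        (\<Sum>r\<in>{r. r dvd m \<and> r \<noteq> 1} \<union> {r. r dvd n \<and> r \<noteq> 1}. mangoldt r * tz z (m * n div r))"
    proof (rule sum.mono_neutral_right)
      show "finite {r. r dvd m * n}" using pos by simp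
      show "\<forall>r\<in>{r. r dvd m * n} - ({r. r dvd m \<and> r \<noteq> 1} \<union> {r. r dvd n \<and> r \<noteq> 1}).
          mangoldt r * tz z (m * n div r) = 0"
        using primepow_dvd_mult_coprime[OF _ less.prems(1)] by (auto simp: mangoldt_def)
    qed auto
    also have "\<dots> = (\<Sum>r\<in>{r. r dvd m \<and> r \<noteq> 1}. mangoldt r * tz z (m * n div r)) +
        (\<Sum>r\<in>{r. r dvd n \<and> r \<noteq> 1}. mangoldt r * tz z (m * n div r))"
    proof (rule sum.union_disjoint)
      show "finite {r. r dvd m \<and> r \<noteq> 1}" "finite {r. r dvd n \<and> r \<noteq> 1}"
        using less.prems by (auto intro: finite_subset[OF _ finite_divisors_nat])
      show "{r. r dvd m \<and> r \<noteq> 1} \<inter> {r. r dvd n \<and> r \<noteq> 1} = {}"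
        using coprime_common_divisor_nat[OF less.prems(1)] by blast
    qed
    also have "(\<Sum>r\<in>{r. r dvd m \<and> r \<noteq> 1}. mangoldt r * tz z (m * n div r)) =
        (\<Sum>r\<in>{r. r dvd m \<and> r \<noteq> 1}. mangoldt r * tz z (m div r)) * tz z n"
      unfolding sum_distrib_right
    proof (rule sum.cong[OF refl])
      fix r assume r: "r \<in> {r. r dvd m \<and> r \<noteq> 1}"
      then obtain e where e: "m = r * e" by auto
      have "e * n < m * n" "e > 0" "coprime e n" using e r less.prems by auto
      hence "tz z (e * n) = tz z e * tz z n" using less.hyps less.prems by blast
      thus "mangoldt r * tz z (m * n div r) = mangoldt r * tz z (m div r) * tz z n"
        using e less.prems by (auto simp: mult.assoc)
    qed
    also have "(\<Sum>r\<in>{r. r dvd n \<and> r \<noteq> 1}. mangoldt r * tz z (m * n div r)) =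
        tz z m * (\<Sum>r\<in>{r. r dvd n \<and> r \<noteq> 1}. mangoldt r * tz z (n div r))"
      unfolding sum_distrib_left
    proof (rule sum.cong[OF refl])
      fix r assume r: "r \<in> {r. r dvd n \<and> r \<noteq> 1}"
      then obtain e where e: "n = r * e" by auto
      have "m * e < m * n" "e > 0" "coprime m e" using e r less.prems by auto
      hence "tz z (m * e) = tz z m * tz z e" using less.hyps less.prems by blast
      moreover have "m * n div r = m * e" using e less.prems by auto
      ultimately show "mangoldt r * tz z (m * n div r) = tz z m * (mangoldt r * tz z (n div r))"
        using e less.prems by auto
    qed
    finally have "tz z (m * n) * ln (real (m * n)) = tz z m * ln (real m) * tz z n + tz z m * (tz z n * ln (real n))"
      using tz_rec[OF pos, of z] tz_rec[OF less.prems(2), of z] tz_rec[OF less.prems(3), of z]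
        mangoldt_sum_except_1[OF less.prems(2)] mangoldt_sum_except_1[OF less.prems(3)]
      by (simp add: algebra_simps)
    also have "\<dots> = tz z m * tz z n * ln (real (m * n))"
      using less.prems by (simp add: ln_mult algebra_simps)
    finally show ?thesis using l by simp
  qed
qed

section \<open>Ordered factorizations of an integer\<close>

definition tup :: "nat set \<Rightarrow> nat \<Rightarrow> (nat \<Rightarrow> nat) set" where
  "tup I n = {d \<in> I \<rightarrow>\<^sub>E {1..}. (\<Prod>i\<in>I. d i) = n}"

lemma tup_dvd: "finite I \<Longrightarrow> d \<in> tup I n \<Longrightarrow> i \<in> I \<Longrightarrow> d i dvd n"
  unfolding tup_def by (auto intro: dvd_prodI)

lemma tup_ge_1: "d \<in> tup I n \<Longrightarrow> i \<in> I \<Longrightarrow> d i \<ge> 1"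
  unfolding tup_def by (auto simp: PiE_iff)

lemma tup_subset: "finite I \<Longrightarrow> n > 0 \<Longrightarrow> tup I n \<subseteq> I \<rightarrow>\<^sub>E {1..n}"
proof
  fix d assume *: "finite I" "n > 0" "d \<in> tup I n"
  hence "d i \<in> {1..n}" if "i \<in> I" for i
    using tup_dvd[OF *(1,3) that] tup_ge_1[OF *(3) that] by (auto dest: dvd_imp_le)
  thus "d \<in> I \<rightarrow>\<^sub>E {1..n}" using * by (auto simp: tup_def PiE_iff)
qed

lemma finite_tup [simp]: "finite I \<Longrightarrow> n > 0 \<Longrightarrow> finite (tup I n)"
  by (rule finite_subset[OF tup_subset]) (auto intro: finite_PiE)

text \<open>The induction step for everything about tuples; index sets are arbitrary finite sets so
  that any coordinate can be split off.\<close>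

lemma sum_tup_insert:
  fixes f :: "(nat \<Rightarrow> nat) \<Rightarrow> 'a :: comm_monoid_add"
  assumes I: "finite I" "j \<notin> I" and n: "n > 0"
  shows "(\<Sum>d\<in>tup (insert j I) n. f d) = (\<Sum>a | a dvd n. \<Sum>d\<in>tup I (n div a). f (d(j := a)))"
proof -
  have "(\<Sum>a | a dvd n. \<Sum>d\<in>tup I (n div a). f (d(j := a))) =
      (\<Sum>(a,d)\<in>(SIGMA a:{a. a dvd n}. tup I (n div a)). f (d(j := a)))"
    using n I by (intro sum.Sigma) (auto intro!: finite_tup elim!: dvdE)
  also have "\<dots> = (\<Sum>d\<in>tup (insert j I) n. f d)"
  proof (rule sum.reindex_bij_witness[of _ "\<lambda>d. (d j, restrict d I)" "\<lambda>(a,d). d(j := a)"], goal_cases)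
    case (1 p)
    thus ?case using I by (auto simp: tup_def PiE_iff restrict_def extensional_def fun_eq_iff)
  next
    case (2 p)
    then obtain a d where p: "p = (a, d)" "a dvd n" "d \<in> tup I (n div a)" by auto
    have "(\<Prod>i\<in>I. (d(j := a)) i) = (\<Prod>i\<in>I. d i)" using I by (intro prod.cong) auto
    moreover have "a \<ge> 1" using p n by (auto simp: Suc_le_eq intro: dvd_pos_nat)
    ultimately show ?case using p I by (auto simp: tup_def PiE_iff extensional_def)
  next
    case (3 d)
    thus ?case using I by (auto simp: tup_def PiE_iff extensional_def fun_eq_iff restrict_def)
  next
    case (4 d)
    have "(\<Prod>i\<in>I. restrict d I i) = (\<Prod>i\<in>I. d i)" by (intro prod.cong) auto
    thus ?case using 4 I n by (auto simp: tup_def PiE_iff)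
  qed auto
  finally show ?thesis ..
qed

lemma sum_tup_tz:
  assumes "finite I" "n > 0"
  shows "(\<Sum>d\<in>tup I n. \<Prod>i\<in>I. tz z (d i)) = tz (real (card I) * z) n"
  using assms
proof (induction I arbitrary: n rule: finite_induct)
  case empty
  have "tup {} n = (if n = 1 then {\<lambda>_. undefined} else {})" by (auto simp: tup_def)
  thus ?case using empty by (auto simp: tz_zero)
next
  case (insert j I)
  have "(\<Sum>d\<in>tup (insert j I) n. \<Prod>i\<in>insert j I. tz z (d i)) =
      (\<Sum>a | a dvd n. \<Sum>d\<in>tup I (n div a). tz z a * (\<Prod>i\<in>I. tz z (d i)))"
    unfolding sum_tup_insert[OF insert.hyps insert.prems]
  proof (intro sum.cong refl)
    fix a d
    have "(\<Prod>i\<in>I. tz z ((d(j := a)) i)) = (\<Prod>i\<in>I. tz z (d i))"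
      using insert.hyps by (intro prod.cong) auto
    thus "(\<Prod>i\<in>insert j I. tz z ((d(j := a)) i)) = tz z a * (\<Prod>i\<in>I. tz z (d i))"
      using insert.hyps by simp
  qed
  also have "\<dots> = (\<Sum>a | a dvd n. tz z a * tz (real (card I) * z) (n div a))"
    unfolding sum_distrib_left[symmetric]
    by (intro sum.cong refl) (use insert in \<open>auto elim!: dvdE\<close>)
  also have "\<dots> = tz (z + real (card I) * z) n" by (rule tz_conv) fact
  also have "z + real (card I) * z = real (card (insert j I)) * z"
    using insert.hyps by (simp add: algebra_simps)
  finally show ?case .
qed

section \<open>A Plancherel inequality\<close>

text \<open>The squared modulus of the transform is the transform of the autocorrelation
  \<open>R\<close>. Testing it against a wide Gaussian and exchanging the integrals yields a
  Gaussian average of \<open>R\<close> near 0; shrinking that average recovers the value of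
  \<open>R\<close> at 0, the square integral of \<open>g\<close>. Integrability enters only through
  \<open>g\<close> and the majorant \<open>h\<close>.\<close>

lemma plancherel_le:
  fixes g h :: "real \<Rightarrow> real"
  assumes gi: "integrable lborel g" and gb: "\<And>v. \<bar>g v\<bar> \<le> B"
    and gc: "AE v in lborel. isCont g v"
    and hi: "integrable lborel h"
    and hb: "\<And>t. (norm (CLINT v|lborel. g v * iexp (t * v)))\<^sup>2 \<le> h t"
  shows "(\<integral>v. (g v)\<^sup>2 \<partial>lborel) \<le> (\<integral>t. h t \<partial>lborel) / (2 * pi)"
proof -
  have gm [measurable]: "g \<in> borel_measurable borel" using gi by simp
  have B0: "B \<ge> 0" using gb[of 0] by linarith
  define G where "G t = (CLINT v|lborel. g v * iexp (t * v))" for t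
  define R where "R u = (\<integral>v. g v * g (v + u) \<partial>lborel)" for u
  define N1 where "N1 = (\<integral>v. \<bar>g v\<bar> \<partial>lborel)"
  have gsh: "integrable lborel (\<lambda>u. g (v + u))" for v
    using lborel_integrable_real_affine[OF gi, of 1 v] by simp
  have ngsh: "(\<integral>u. \<bar>g (v + u)\<bar> \<partial>lborel) = N1" for v
    unfolding N1_def using lborel_integral_real_affine[of 1 "\<lambda>u. \<bar>g u\<bar>" v] by simp
  have int_iexp: "integrable lborel (\<lambda>v. complex_of_real (f v) * iexp (t * v))"
    if "integrable lborel f" for f :: "real \<Rightarrow> real" and t
  proof (rule Bochner_Integration.integrable_bound[of lborel "f"])
    show "integrable lborel f" by fact
    have [measurable]: "f \<in> borel_measurable borel" using that by simp
    show "(\<lambda>v. complex_of_real (f v) * iexp (t * v)) \<in> borel_measurable lborel" by measurable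
  qed (auto simp: norm_mult)
  have Fint: "integrable (lborel \<Otimes>\<^sub>M lborel) (\<lambda>(v,u). g v * g (v + u))"
  proof (rule lborel_pair.Fubini_integrable)
    have "(\<lambda>x. \<integral>y. norm (case (x, y) of (v, u) \<Rightarrow> g v * g (v + u)) \<partial>lborel) = (\<lambda>x. \<bar>g x\<bar> * N1)"
      by (simp add: abs_mult ngsh)
    thus "integrable lborel (\<lambda>x. \<integral>y. norm (case (x, y) of (v, u) \<Rightarrow> g v * g (v + u)) \<partial>lborel)"
      using gi by simp
    show "AE x in lborel. integrable lborel (\<lambda>y. case (x, y) of (v, u) \<Rightarrow> g v * g (v + u))"
      using gsh by simp
  qed measurable
  have Ri: "integrable lborel R"
    using lborel_pair.integrable_snd[of "\<lambda>v u. g v * g (v + u)"] Fint unfolding R_def by simp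
  have Rm [measurable]: "R \<in> borel_measurable borel" using Ri by simp
  have Rb: "\<bar>R u\<bar> \<le> B * N1" for u
  proof -
    have "norm (R u) \<le> (\<integral>v. \<bar>g v\<bar> * B \<partial>lborel)" unfolding R_def
    proof (rule Bochner_Integration.integral_norm_bound_integral)
      have "integrable lborel (\<lambda>v. \<bar>g v\<bar> * B)" using gi by simp
      thus "integrable lborel (\<lambda>v. g v * g (v + u))"
        by (rule Bochner_Integration.integrable_bound)
           (auto simp: abs_mult intro!: mult_left_mono order_trans[OF gb])
      show "integrable lborel (\<lambda>v. \<bar>g v\<bar> * B)" by fact
    qed (auto simp: abs_mult intro!: mult_left_mono gb)
    thus ?thesis by (simp add: N1_def mult.commute)
  qed
  \<comment> \<open>Fubini: the conjugate of the transform times the transform is a double integral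
    over v and v + u.\<close>
  have GR: "complex_of_real ((norm (G t))\<^sup>2) = (CLINT u|lborel. R u * iexp (t * u))" for t
  proof -
    have Fc: "integrable (lborel \<Otimes>\<^sub>M lborel) (\<lambda>(v,u). complex_of_real (g v * g (v + u)) * iexp (t * u))"
    proof (rule Bochner_Integration.integrable_bound[OF Fint])
      show "(\<lambda>(v, u). complex_of_real (g v * g (v + u)) * iexp (t * u)) \<in> borel_measurable (lborel \<Otimes>\<^sub>M lborel)"
        by measurable
    qed (auto simp: norm_mult)
    have "(CLINT u|lborel. R u * iexp (t * u)) =
        (CLINT u|lborel. CLINT v|lborel. complex_of_real (g v * g (v + u)) * iexp (t * u))"
    proof (rule Bochner_Integration.integral_cong[OF refl])
      fix u
      have "complex_of_real (R u) = (CLINT v|lborel. complex_of_real (g v * g (v + u)))"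
        unfolding R_def by (rule integral_complex_of_real[symmetric])
      thus "complex_of_real (R u) * iexp (t * u) =
          (CLINT v|lborel. complex_of_real (g v * g (v + u)) * iexp (t * u))" by simp
    qed
    also have "\<dots> = (CLINT v|lborel. CLINT u|lborel. complex_of_real (g v * g (v + u)) * iexp (t * u))"
      by (rule lborel_pair.Fubini_integral) (use Fc in simp)
    also have "\<dots> = (CLINT v|lborel. g v * iexp (- (t * v)) * G t)"
    proof (rule Bochner_Integration.integral_cong[OF refl])
      fix v
      have "G t = (CLINT u|lborel. g (v + u) * iexp (t * (v + u)))"
        unfolding G_def using lborel_integral_real_affine[of 1 "\<lambda>u. complex_of_real (g u) * iexp (t * u)" v]
        by (simp add: distrib_left)
      hence "g v * iexp (- (t * v)) * G t =
          (CLINT u|lborel. g v * iexp (- (t * v)) * (g (v + u) * iexp (t * (v + u))))" by simp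
      also have "\<dots> = (CLINT u|lborel. complex_of_real (g v * g (v + u)) * iexp (t * u))"
        by (intro Bochner_Integration.integral_cong refl)
           (simp add: exp_minus field_simps exp_add distrib_left)
      finally show "(CLINT u|lborel. complex_of_real (g v * g (v + u)) * iexp (t * u)) =
          g v * iexp (- (t * v)) * G t" ..
    qed
    also have "\<dots> = (CLINT v|lborel. g v * iexp (- (t * v))) * G t" by simp
    also have "(CLINT v|lborel. g v * iexp (- (t * v))) = cnj (G t)"
    proof -
      have "cnj (G t) = (CLINT v|lborel. cnj (g v * iexp (t * v)))"
        unfolding G_def by (simp only: Bochner_Integration.integral_cnj)
      thus ?thesis by (simp add: exp_cnj)
    qed
    also have "cnj (G t) * G t = complex_of_real ((norm (G t))\<^sup>2)"
      unfolding complex_norm_square by (rule mult.commute)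
    finally show ?thesis ..
  qed
  define \<phi> where "\<phi> = std_normal_density"
  have phm [measurable]: "\<phi> \<in> borel_measurable borel" unfolding \<phi>_def by simp
  have phi: "integrable lborel \<phi>" unfolding \<phi>_def using integrable_normal_density[of 1 0] by simp
  have ph0: "\<phi> z \<ge> 0" for z unfolding \<phi>_def by simp
  have ph1: "(\<integral>z. \<phi> z \<partial>lborel) = 1" unfolding \<phi>_def using integral_normal_density[of 1 0] by simp
  have phb: "\<phi> z \<le> 1 / sqrt (2 * pi)" for z
    unfolding \<phi>_def std_normal_density_def by (simp add: divide_right_mono)
  have phexp: "exp (- z\<^sup>2 / 2) = sqrt (2 * pi) * \<phi> z" for z
    unfolding \<phi>_def std_normal_density_def by simp
  have phchar: "(CLINT z|lborel. \<phi> z * iexp (a * z)) = complex_of_real (exp (- a\<^sup>2 / 2))" for a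
  proof -
    have "char std_normal_distribution a = (CLINT z|lborel. \<phi> z * iexp (a * z))"
      unfolding char_def \<phi>_def by (subst integral_density) (auto simp: scaleR_conv_of_real)
    thus ?thesis by (simp add: char_std_normal_distribution)
  qed
  \<comment> \<open>The Gaussian reproduces itself under the transform, so averaging
    \<open>R\<close> at scale e amounts to integrating the squared transform against \<phi> at scale
    1/e. Bounding \<phi> by 1 / sqrt (2 pi), and the normalization of \<phi> on the other side, give
    the factor 1 / (2 pi); the powers of e cancel.\<close>
  have main: "(\<integral>z. R (e * z) * \<phi> z \<partial>lborel) \<le> (\<integral>t. h t \<partial>lborel) / (2 * pi)" if e: "e > 0" for e
  proof -
    have "integrable lborel (\<lambda>z. h (0 + (1/e) * z))"
      by (rule lborel_integrable_real_affine[OF hi]) (use e in auto)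
    hence hsi: "integrable lborel (\<lambda>z. h (z / e))" by simp
    have h0: "h t \<ge> 0" for t using hb[of t] order_trans zero_le_power2 by blast
    define A where "A = (CLINT z|lborel. CLINT u|lborel. complex_of_real (\<phi> z * R u) * iexp (z / e * u))"
    have Pint: "integrable (lborel \<Otimes>\<^sub>M lborel) (\<lambda>(z,u). complex_of_real (\<phi> z * R u) * iexp (z / e * u))"
    proof (rule lborel_pair.Fubini_integrable)
      have "(\<lambda>x. \<integral>y. norm (case (x, y) of (z, u) \<Rightarrow> complex_of_real (\<phi> z * R u) * iexp (z / e * u)) \<partial>lborel) =
          (\<lambda>x. \<phi> x * (\<integral>y. \<bar>R y\<bar> \<partial>lborel))"
        by (simp add: norm_mult abs_mult ph0)
      thus "integrable lborel (\<lambda>x. \<integral>y. norm (case (x, y) of (z, u) \<Rightarrow> complex_of_real (\<phi> z * R u) * iexp (z / e * u)) \<partial>lborel)"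
        using phi by simp
      have "integrable lborel (\<lambda>y. complex_of_real (\<phi> x * R y) * iexp (x / e * y))" for x
        by (rule int_iexp) (use Ri in simp)
      thus "AE x in lborel. integrable lborel (\<lambda>y. case (x, y) of (z, u) \<Rightarrow> complex_of_real (\<phi> z * R u) * iexp (z / e * u))"
        by simp
    qed measurable
    have "A = (CLINT z|lborel. complex_of_real (\<phi> z * (norm (G (z / e)))\<^sup>2))"
      unfolding A_def
    proof (rule Bochner_Integration.integral_cong[OF refl])
      fix z
      show "(CLINT u|lborel. complex_of_real (\<phi> z * R u) * iexp (z / e * u)) =
          complex_of_real (\<phi> z * (norm (G (z / e)))\<^sup>2)"
        unfolding of_real_mult GR by (simp add: mult.assoc)
    qed
    hence A1: "A = complex_of_real (\<integral>z. \<phi> z * (norm (G (z / e)))\<^sup>2 \<partial>lborel)"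
      by (simp only: integral_complex_of_real)
    have "A = (CLINT u|lborel. CLINT z|lborel. complex_of_real (\<phi> z * R u) * iexp (z / e * u))"
      unfolding A_def by (rule lborel_pair.Fubini_integral[symmetric]) (use Pint in simp)
    also have "\<dots> = (CLINT u|lborel. complex_of_real (R u * exp (- (u / e)\<^sup>2 / 2)))"
    proof (rule Bochner_Integration.integral_cong[OF refl])
      fix u
      have "(CLINT z|lborel. complex_of_real (\<phi> z * R u) * iexp (z / e * u)) =
          (CLINT z|lborel. R u * (\<phi> z * iexp (u / e * z)))"
        by (intro Bochner_Integration.integral_cong refl) (simp add: mult_ac)
      also have "\<dots> = R u * (CLINT z|lborel. \<phi> z * iexp (u / e * z))" by simp
      finally show "(CLINT z|lborel. complex_of_real (\<phi> z * R u) * iexp (z / e * u)) =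
          complex_of_real (R u * exp (- (u / e)\<^sup>2 / 2))"
        unfolding phchar by simp
    qed
    also have "\<dots> = complex_of_real (\<integral>u. R u * exp (- (u / e)\<^sup>2 / 2) \<partial>lborel)"
      by (simp only: integral_complex_of_real)
    finally have "(\<integral>u. R u * exp (- (u / e)\<^sup>2 / 2) \<partial>lborel) = (\<integral>z. \<phi> z * (norm (G (z / e)))\<^sup>2 \<partial>lborel)"
      unfolding A1 of_real_eq_iff by simp
    also have "\<dots> \<le> (\<integral>z. 1 / sqrt (2 * pi) * h (z / e) \<partial>lborel)"
    proof (rule Bochner_Integration.integral_mono')
      show "integrable lborel (\<lambda>z. 1 / sqrt (2 * pi) * h (z / e))" using hsi by simp
      fix z
      show "\<phi> z * (norm (G (z / e)))\<^sup>2 \<le> 1 / sqrt (2 * pi) * h (z / e)"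
        using hb[of "z / e"] unfolding G_def[symmetric] by (intro mult_mono phb ph0) auto
      show "0 \<le> 1 / sqrt (2 * pi) * h (z / e)" using h0 by simp
    qed
    also have "\<dots> = 1 / sqrt (2 * pi) * (e * (\<integral>t. h t \<partial>lborel))"
      using lborel_integral_real_affine[of "1/e" h 0] e by simp
    finally have 1: "(\<integral>u. R u * exp (- (u / e)\<^sup>2 / 2) \<partial>lborel) \<le> 1 / sqrt (2 * pi) * (e * (\<integral>t. h t \<partial>lborel))" .
    have "(\<integral>u. R u * exp (- (u / e)\<^sup>2 / 2) \<partial>lborel) = e * (\<integral>z. R (e * z) * exp (- z\<^sup>2 / 2) \<partial>lborel)"
      using lborel_integral_real_affine[of e "\<lambda>u. R u * exp (- (u / e)\<^sup>2 / 2)" 0] e by simp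
    also have "\<dots> = e * sqrt (2 * pi) * (\<integral>z. R (e * z) * \<phi> z \<partial>lborel)"
      unfolding phexp by (simp only: mult.left_commute[of "R _"] Bochner_Integration.integral_mult_right_zero mult.assoc)
    finally have "e * (sqrt (2 * pi) * (\<integral>z. R (e * z) * \<phi> z \<partial>lborel)) \<le> e * (1 / sqrt (2 * pi) * (\<integral>t. h t \<partial>lborel))"
      using 1 by (simp add: mult_ac)
    hence "sqrt (2 * pi) * (\<integral>z. R (e * z) * \<phi> z \<partial>lborel) \<le> 1 / sqrt (2 * pi) * (\<integral>t. h t \<partial>lborel)"
      using e by (simp only: mult_le_cancel_left_pos)
    hence "sqrt (2 * pi) * (sqrt (2 * pi) * (\<integral>z. R (e * z) * \<phi> z \<partial>lborel)) \<le>
        sqrt (2 * pi) * (1 / sqrt (2 * pi) * (\<integral>t. h t \<partial>lborel))"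
      by (rule mult_left_mono) simp
    hence "(2 * pi) * (\<integral>z. R (e * z) * \<phi> z \<partial>lborel) \<le> (\<integral>t. h t \<partial>lborel)"
      by (simp add: mult.assoc[symmetric])
    thus ?thesis by (simp add: field_simps)
  qed
  \<comment> \<open>Continuity of \<open>g\<close> almost everywhere takes the place of continuity
    of translations in the mean; its boundedness supplies the integrable majorant.\<close>
  have R_lim: "(\<lambda>n. R (inverse (real (Suc n)) * z)) \<longlonglongrightarrow> (\<integral>v. (g v)\<^sup>2 \<partial>lborel)" for z
    unfolding R_def
  proof (rule integral_dominated_convergence[where w = "\<lambda>v. \<bar>g v\<bar> * B"])
    show "integrable lborel (\<lambda>v. \<bar>g v\<bar> * B)" using gi by simp
    have lim0: "(\<lambda>n. v + inverse (real (Suc n)) * z) \<longlonglongrightarrow> v" for v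
      using tendsto_add[OF tendsto_const[of v] tendsto_mult_right[OF LIMSEQ_inverse_real_of_nat, of z]] by simp
    show "AE v in lborel. (\<lambda>n. g v * g (v + inverse (real (Suc n)) * z)) \<longlonglongrightarrow> (g v)\<^sup>2"
      using gc
    proof eventually_elim
      fix v assume "isCont g v"
      hence "(\<lambda>n. g (v + inverse (real (Suc n)) * z)) \<longlonglongrightarrow> g v"
        using isCont_tendsto_compose lim0 by blast
      thus "(\<lambda>n. g v * g (v + inverse (real (Suc n)) * z)) \<longlonglongrightarrow> (g v)\<^sup>2"
        unfolding power2_eq_square by (rule tendsto_mult_left)
    qed
    show "AE v in lborel. norm (g v * g (v + inverse (real (Suc n)) * z)) \<le> \<bar>g v\<bar> * B" for n
      using gb by (auto simp: abs_mult intro!: mult_left_mono)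
  qed measurable
  have "(\<lambda>n. \<integral>z. R (inverse (real (Suc n)) * z) * \<phi> z \<partial>lborel) \<longlonglongrightarrow> (\<integral>z. (\<integral>v. (g v)\<^sup>2 \<partial>lborel) * \<phi> z \<partial>lborel)"
  proof (rule integral_dominated_convergence[where w = "\<lambda>z. B * N1 * \<phi> z"])
    show "integrable lborel (\<lambda>z. B * N1 * \<phi> z)" using phi by simp
    show "AE z in lborel. (\<lambda>n. R (inverse (real (Suc n)) * z) * \<phi> z) \<longlonglongrightarrow> (\<integral>v. (g v)\<^sup>2 \<partial>lborel) * \<phi> z"
      using R_lim by (intro AE_I2 tendsto_mult_right)
    show "AE z in lborel. norm (R (inverse (real (Suc n)) * z) * \<phi> z) \<le> B * N1 * \<phi> z" for n
      using Rb ph0 by (auto simp: abs_mult intro!: mult_right_mono)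
  qed measurable
  hence "(\<lambda>n. \<integral>z. R (inverse (real (Suc n)) * z) * \<phi> z \<partial>lborel) \<longlonglongrightarrow> (\<integral>v. (g v)\<^sup>2 \<partial>lborel)"
    using ph1 by simp
  thus ?thesis
    by (rule LIMSEQ_le_const2) (intro exI[of _ 0] allI impI main, simp)
qed

section \<open>The zeta function on and near the line of real part one\<close>

text \<open>The term at n = 0 vanishes because 0 powr (- s) = 0, so the series can be summed over
  all natural numbers.\<close>

definition dser :: "(nat \<Rightarrow> real) \<Rightarrow> complex \<Rightarrow> complex" where
  "dser a s = (\<Sum>n. of_real (a n) * of_nat n powr (- s))"

lemma norm_dser_term: "norm (of_real (a n) * of_nat n powr (- s) :: complex) = \<bar>a n\<bar> * real n powr (- Re s)"
  by (simp add: norm_mult norm_powr_real_powr)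

text \<open>One majorant serves the coefficients 1, ln n and Lambda(n) alike.\<close>

lemma summable_ln_powr:
  assumes "c > 1"
  shows "summable (\<lambda>n. (1 + ln (real n)) * real n powr (- c))"
proof (rule summable_comparison_test)
  \<comment> \<open>Half of the excess over 1 pays for the logarithm, the other half keeps the
    series convergent.\<close>
  define e where "e = (c - 1) / 2"
  have e: "e > 0" using assms by (simp add: e_def)
  have "norm ((1 + ln (real n)) * real n powr (- c)) \<le> (1 + 1 / e) * real n powr (- (1 + e))" if n: "n \<ge> 1" for n
  proof -
    have l: "ln (real n) \<ge> 0" "ln (real n) \<le> real n powr e / e" using n e by (auto intro: ln_powr_bound)
    have p: "1 \<le> real n powr e" using n e by (auto intro: ge_one_powr_ge_zero)
    have "1 + ln (real n) \<le> real n powr e + real n powr e / e" using l p by linarith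
    also have "\<dots> = (1 + 1 / e) * real n powr e" by (simp add: algebra_simps)
    finally have "(1 + ln (real n)) * real n powr (- c) \<le> (1 + 1 / e) * real n powr e * real n powr (- c)"
      by (rule mult_right_mono) simp
    also have "\<dots> = (1 + 1 / e) * real n powr (- (1 + e))"
    proof -
      have "e + - c = - (1 + e)" by (simp add: e_def field_simps)
      thus ?thesis by (simp only: mult.assoc powr_add[symmetric])
    qed
    finally show ?thesis using l by (simp add: abs_mult)
  qed
  thus "\<exists>N. \<forall>n\<ge>N. norm ((1 + ln (real n)) * real n powr (- c)) \<le> (1 + 1 / e) * real n powr (- (1 + e))" by blast
  show "summable (\<lambda>n. (1 + 1 / e) * real n powr (- (1 + e)))"
    using e by (intro summable_mult) (simp add: summable_real_powr_iff)
qed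

lemma norm_dser_term_le:
  assumes "\<And>n. n \<ge> 1 \<Longrightarrow> \<bar>a n\<bar> \<le> 1 + ln (real n)" "c \<le> Re s"
  shows "norm (of_real (a n) * of_nat n powr (- s) :: complex) \<le> (1 + ln (real n)) * real n powr (- c)"
proof (cases "n = 0")
  case False
  thus ?thesis unfolding norm_dser_term using assms
    by (intro mult_mono assms powr_mono) auto
qed auto

lemma dser_abs_summable:
  assumes "\<And>n. n \<ge> 1 \<Longrightarrow> \<bar>a n\<bar> \<le> 1 + ln (real n)" "Re s > 1"
  shows "summable (\<lambda>n. norm (of_real (a n) * of_nat n powr (- s) :: complex))"
  by (rule summable_comparison_test[OF _ summable_ln_powr[OF assms(2)]])
     (use norm_dser_term_le[OF assms(1) order_refl] in auto)

text \<open>Termwise differentiation, on a closed half-plane whose edge lies strictly between 1 and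
  \<open>Re s\<close>; there the majorant of \<open>summable_ln_powr\<close> gives uniform
  convergence.\<close>

lemma dser_deriv:
  assumes a: "\<And>n. \<bar>a n\<bar> \<le> 1" and s: "Re s > 1"
  shows "(dser a has_field_derivative - dser (\<lambda>n. a n * ln (real n)) s) (at s)"
proof -
  define c where "c = (1 + Re s) / 2"
  have c: "1 < c" "c < Re s" using s by (auto simp: c_def)
  have la: "\<bar>a n * ln (real n)\<bar> \<le> 1 + ln (real n)" if "n \<ge> 1" for n
    using mult_mono[OF a[of n] order_refl, of "ln (real n)"] that by (simp add: abs_mult)
  have la1: "\<bar>a n\<bar> \<le> 1 + ln (real n)" if "n \<ge> 1" for n
    using a[of n] that by (smt (verit) ln_ge_zero of_nat_1 of_nat_le_iff)
  have "((\<lambda>s. \<Sum>n. of_real (a n) * of_nat n powr (- s)) has_field_derivative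
      (\<Sum>n. - (of_real (a n * ln (real n)) * of_nat n powr (- s)))) (at s)"
  proof (rule has_field_derivative_series'(2)[where S = "{z. Re z \<ge> c}" and ?x0.0 = s])
    show "convex {z. Re z \<ge> c}" by (rule convex_halfspace_Re_ge)
    show "((\<lambda>s. of_real (a n) * of_nat n powr (- s)) has_field_derivative
        - (of_real (a n * ln (real n)) * of_nat n powr (- z))) (at z within {z. Re z \<ge> c})" for n z
    proof (cases "n = 0")
      case False
      hence eq: "of_nat n powr (- w) = exp (- w * of_real (ln (real n)))" for w :: complex
        by (simp add: powr_def Ln_of_nat)
      show ?thesis unfolding eq by (auto intro!: derivative_eq_intros)
    qed auto
    show "uniformly_convergent_on {z. Re z \<ge> c} (\<lambda>n z. \<Sum>i<n. - (of_real (a i * ln (real i)) * of_nat i powr (- z)))"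
      by (rule Weierstrass_m_test'[OF _ summable_ln_powr[OF c(1)]])
         (use norm_dser_term_le[OF la] in auto)
    show "s \<in> {z. Re z \<ge> c}" using c by simp
    show "summable (\<lambda>n. of_real (a n) * of_nat n powr (- s) :: complex)"
      by (rule summable_norm_cancel, rule dser_abs_summable) (use la1 s in auto)
    have "s \<in> {z. Re z > c}" using c by simp
    thus "s \<in> interior {z. Re z \<ge> c}"
      by (rule interiorI[OF open_halfspace_Re_gt]) auto
  qed
  moreover have "summable (\<lambda>n. of_real (a n * ln (real n)) * of_nat n powr (- s) :: complex)"
    by (rule summable_norm_cancel, rule dser_abs_summable) (use la s in auto)
  ultimately show ?thesis unfolding dser_def[abs_def] by (simp add: suminf_minus)
qed

text \<open>Absolute summability over pairs permits regrouping them by their product. Pairs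
  containing 0 belong to no product n >= 1, whence the conditions at 0.\<close>

lemma suminf_divisor_conv:
  fixes f g :: "nat \<Rightarrow> complex"
  assumes f: "summable (\<lambda>n. norm (f n))" and g: "summable (\<lambda>n. norm (g n))" and 0: "f 0 = 0" "g 0 = 0"
  shows "(\<Sum>n. \<Sum>d | d dvd n. f d * g (n div d)) = suminf f * suminf g"
proof -
  have hf: "(f has_sum suminf f) UNIV" and hg: "(g has_sum suminf g) UNIV"
    using f g by (auto intro!: norm_summable_imp_has_sum summable_sums summable_norm_cancel)
  have nf: "((\<lambda>n. norm (f n)) has_sum (\<Sum>n. norm (f n))) UNIV" and ng: "((\<lambda>n. norm (g n)) has_sum (\<Sum>n. norm (g n))) UNIV"
    using f g by (auto intro!: norm_summable_imp_has_sum summable_sums)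
  have "(\<lambda>(x,y). norm (f x) * norm (g y)) summable_on (UNIV \<times> UNIV)"
  proof (rule summable_on_SigmaI)
    show "((\<lambda>y. case (x, y) of (x, y) \<Rightarrow> norm (f x) * norm (g y)) has_sum norm (f x) * (\<Sum>n. norm (g n))) UNIV" for x
      using has_sum_cmult_right[OF ng, of "norm (f x)"] by simp
    show "(\<lambda>x. norm (f x) * (\<Sum>n. norm (g n))) summable_on UNIV"
      using has_sum_cmult_left[OF nf, of "\<Sum>n. norm (g n)"] by (auto simp: summable_on_def)
  qed auto
  hence "(\<lambda>p. norm (case p of (x,y) \<Rightarrow> f x * g y)) summable_on (UNIV \<times> UNIV)"
    by (simp add: case_prod_unfold norm_mult)
  hence sm: "(\<lambda>(x,y). f x * g y) summable_on (UNIV \<times> UNIV)"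
    by (rule abs_summable_summable)
  have "((\<lambda>(x,y). f x * g y) has_sum (suminf f * suminf g)) (UNIV \<times> UNIV)"
  proof (rule has_sum_SigmaI[OF _ _ sm])
    show "((\<lambda>y. case (x, y) of (x, y) \<Rightarrow> f x * g y) has_sum f x * suminf g) UNIV" for x
      using has_sum_cmult_right[OF hg, of "f x"] by simp
    show "((\<lambda>x. f x * suminf g) has_sum suminf f * suminf g) UNIV"
      by (rule has_sum_cmult_left[OF hf])
  qed
  hence "((\<lambda>(x,y). f x * g y) has_sum (suminf f * suminf g)) ({1..} \<times> {1..})"
  proof (rule has_sum_cong_neutral[THEN iffD1, rotated -1])
    fix p :: "nat \<times> nat" assume "p \<in> UNIV \<times> UNIV - {1..} \<times> {1..}"
    hence "fst p = 0 \<or> snd p = 0" by (cases p) auto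
    thus "(case p of (x, y) \<Rightarrow> f x * g y) = 0" using 0 by (cases p) auto
  qed auto
  also have "?this \<longleftrightarrow> ((\<lambda>p. case (case p of (n, d) \<Rightarrow> (d, n div d)) of (x,y) \<Rightarrow> f x * g y) has_sum (suminf f * suminf g))
      (SIGMA n:{1..}. {d. d dvd n})"
  proof (rule has_sum_reindex_bij_betw[symmetric])
    show "bij_betw (\<lambda>(n, d). (d, n div d)) (SIGMA n:{1..}. {d. d dvd n}) ({1..} \<times> {1::nat..})"
      by (rule bij_betwI[of _ _ _ "\<lambda>(x,y). (x * y, x)"]) (auto simp: Suc_le_eq div_greater_zero_iff dvd_imp_le intro!: Nat.gr0I)
  qed
  finally have "((\<lambda>n. \<Sum>d | d dvd n. f d * g (n div d)) has_sum (suminf f * suminf g)) {1..}"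
    by (rule has_sum_SigmaD) (auto intro!: has_sum_finiteI)
  \<comment> \<open>At n = 0 the set of divisors is infinite, and the sum over it is 0 by
    convention.\<close>
  hence "((\<lambda>n. \<Sum>d | d dvd n. f d * g (n div d)) has_sum (suminf f * suminf g)) UNIV"
    by (rule has_sum_cong_neutral[THEN iffD1, rotated -1]) (auto simp: not_le)
  from has_sum_imp_sums[OF this] show ?thesis by (simp add: sums_iff)
qed

text \<open>These are \<open>\<zeta>\<close>, \<open>-\<zeta>'\<close> and \<open>-\<zeta>'/\<zeta>\<close> on \<open>Re s > 1\<close>; outside that half-plane the values are junk.\<close>

definition zt :: "complex \<Rightarrow> complex" where "zt = dser (\<lambda>_. 1)"
definition dz :: "complex \<Rightarrow> complex" where "dz = dser (\<lambda>n. ln (real n))"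
definition mz :: "complex \<Rightarrow> complex" where "mz = dser mangoldt"

lemma zt_deriv: "Re s > 1 \<Longrightarrow> (zt has_field_derivative - dz s) (at s)"
  unfolding zt_def dz_def using dser_deriv[of "\<lambda>_. 1" s] by simp

lemma mangoldt_le_1_ln: "n \<ge> 1 \<Longrightarrow> \<bar>mangoldt n\<bar> \<le> 1 + ln (real n)"
  using mangoldt_le[of n] by simp

text \<open>The convolution identity Lambda * 1 = ln in summed form. As a product it is available
  before \<open>zt s\<close> is known to be nonzero.\<close>

lemma dz_eq_zt_mz:
  assumes s: "Re s > 1"
  shows "dz s = zt s * mz s"
proof -
  define f where "f = (\<lambda>n. of_real (mangoldt n) * of_nat n powr (- s) :: complex)"
  define g where "g = (\<lambda>n. of_real 1 * of_nat n powr (- s) :: complex)"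
  have "(\<Sum>n. \<Sum>d | d dvd n. f d * g (n div d)) = suminf f * suminf g"
  proof (rule suminf_divisor_conv)
    show "summable (\<lambda>n. norm (f n))" unfolding f_def
      by (rule dser_abs_summable[OF _ s]) (rule mangoldt_le_1_ln)
    show "summable (\<lambda>n. norm (g n))" unfolding g_def
      by (rule dser_abs_summable[OF _ s]) auto
  qed (auto simp: f_def g_def)
  moreover have "(\<lambda>n. \<Sum>d | d dvd n. f d * g (n div d)) = (\<lambda>n. of_real (ln (real n)) * of_nat n powr (- s))"
  proof
    fix n :: nat
    show "(\<Sum>d | d dvd n. f d * g (n div d)) = of_real (ln (real n)) * of_nat n powr (- s)"
    proof (cases "n = 0")
      case False
      have "(\<Sum>d | d dvd n. f d * g (n div d)) = (\<Sum>d | d dvd n. of_real (mangoldt d) * of_nat n powr (- s))"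
      proof (rule sum.cong[OF refl])
        fix d assume "d \<in> {d. d dvd n}"
        then obtain e where e: "n = d * e" by auto
        with False have "d > 0" by auto
        thus "f d * g (n div d) = of_real (mangoldt d) * of_nat n powr (- s)"
          unfolding f_def g_def e by (simp add: powr_times_real)
      qed
      thus ?thesis using False mangoldt_sum[of n, where 'a = complex] by (simp add: sum_distrib_right[symmetric])
    qed simp
  qed
  ultimately show ?thesis unfolding dz_def zt_def mz_def dser_def f_def g_def by (simp add: mult.commute)
qed

text \<open>Sum against integral for complex functions: on each unit interval the error is at most
  the supremum of |f'|, and n powr (-3/2) is dominated by a telescoping difference of inverse square
  roots. It is meant for n powr (- s) and for ln n * n powr (- s); the second one determines the
  exponent 3/2.\<close>

lemma tail_compare:
  fixes f f' F :: "complex \<Rightarrow> complex"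
  assumes F: "\<And>y. y \<ge> 1 \<Longrightarrow> (F has_field_derivative f (of_real y)) (at (of_real y))"
    and f: "\<And>y. y \<ge> 1 \<Longrightarrow> (f has_field_derivative f' (of_real y)) (at (of_real y))"
    and B: "\<And>y. y \<ge> 1 \<Longrightarrow> norm (f' (of_real y)) \<le> B * y powr (- 3 / 2)" "B \<ge> 0"
    and lim: "(\<lambda>n. F (of_nat n)) \<longlonglongrightarrow> 0"
    and sm: "summable (\<lambda>n. f (of_nat n))" and N: "N \<ge> 1"
  shows "norm ((\<Sum>n. f (of_nat (n + Suc N))) + F (of_nat N)) \<le> 6 * B / sqrt (real N)"
proof -
  define e where "e n = f (of_nat (Suc n)) - (F (of_nat (Suc n)) - F (of_nat n))" for n
  have e: "norm (e n) \<le> 6 * B * (1 / sqrt (real n) - 1 / sqrt (real (Suc n)))" if n: "n \<ge> 1" for n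
  proof -
    let ?S = "closed_segment (of_nat n :: complex) (of_nat (Suc n))"
    have S: "\<exists>y. z = of_real y \<and> real n \<le> y \<and> y \<le> real n + 1" if "z \<in> ?S" for z
    proof -
      obtain u where u: "0 \<le> u" "u \<le> 1" "z = (1 - u) *\<^sub>R of_nat n + u *\<^sub>R of_nat (Suc n)"
        using \<open>z \<in> ?S\<close> by (auto simp: in_segment)
      show ?thesis
        by (rule exI[of _ "real n + u"]) (use u in \<open>auto simp: scaleR_conv_of_real algebra_simps\<close>)
    qed
    have fd: "norm (f z - f (of_nat (Suc n))) \<le> B * real n powr (- 3 / 2)" if z: "z \<in> ?S" for z
    proof -
      have "norm (f z - f (of_nat (Suc n))) \<le> (B * real n powr (- 3 / 2)) * norm (z - of_nat (Suc n))"
      proof (rule field_differentiable_bound[where S = ?S and f' = f'])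
        fix w assume "w \<in> ?S"
        then obtain y where y: "w = of_real y" "real n \<le> y" using S by blast
        have y1: "y \<ge> 1" using y n by linarith
        show "(f has_field_derivative f' w) (at w within ?S)"
          using f[OF y1] y by (simp add: has_field_derivative_at_within)
        have "norm (f' w) \<le> B * y powr (- 3 / 2)" using B(1)[OF y1] y by simp
        also have "\<dots> \<le> B * real n powr (- 3 / 2)"
          using y n B(2) by (intro mult_left_mono powr_mono2') auto
        finally show "norm (f' w) \<le> B * real n powr (- 3 / 2)" .
      qed (use z in auto)
      also have "\<dots> \<le> (B * real n powr (- 3 / 2)) * 1"
      proof (rule mult_left_mono)
        obtain y where y: "z = of_real y" "real n \<le> y" "y \<le> real n + 1" using S[OF z] by blast
        have "z - of_nat (Suc n) = of_real (y - (real n + 1))" using y by simp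
        hence "norm (z - of_nat (Suc n)) = \<bar>y - (real n + 1)\<bar>" by (simp only: norm_of_real)
        thus "norm (z - of_nat (Suc n)) \<le> 1" using y by simp
      qed (use B in simp)
      finally show ?thesis by simp
    qed
    \<comment> \<open>The derivative of D is f z - f (n + 1), already known to be small, so the mean
      value bound for D over the interval bounds e n.\<close>
    define D where "D z = F z - z * f (of_nat (Suc n))" for z
    have "norm (D (of_nat (Suc n)) - D (of_nat n)) \<le> (B * real n powr (- 3 / 2)) * norm (of_nat (Suc n) - of_nat n :: complex)"
    proof (rule field_differentiable_bound[where S = ?S and f' = "\<lambda>z. f z - f (of_nat (Suc n))"])
      fix w assume w: "w \<in> ?S"
      then obtain y where y: "w = of_real y" "real n \<le> y" using S by blast
      have y1: "y \<ge> 1" using y n by linarith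
      have "(F has_field_derivative f w) (at w)" using F[OF y1] y(1) by simp
      hence "((\<lambda>z. F z - z * f (of_nat (Suc n))) has_field_derivative f w - 1 * f (of_nat (Suc n))) (at w)"
        by (intro DERIV_diff DERIV_cmult_right DERIV_ident)
      thus "(D has_field_derivative f w - f (of_nat (Suc n))) (at w within ?S)"
        unfolding D_def[abs_def] by (simp add: has_field_derivative_at_within)
      show "norm (f w - f (of_nat (Suc n))) \<le> B * real n powr (- 3 / 2)" by (rule fd[OF w])
    qed auto
    also have "D (of_nat (Suc n)) - D (of_nat n) = - e n" unfolding D_def e_def by (simp add: algebra_simps)
    finally have 1: "norm (e n) \<le> B * real n powr (- 3 / 2)" by simp
    \<comment> \<open>With a = sqrt n and b = sqrt (n + 1) one has b <= 3/2 * a, so a b (a + b) <=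
      15/4 a^3. Hence a^(-3) is at most 6 times the telescoping difference 1/a - 1/b.\<close>
    define a b where "a = sqrt (real n)" and "b = sqrt (real (Suc n))"
    have ab: "a \<ge> 1" "a \<le> b" "a * a = real n" "b * b = real n + 1" using n unfolding a_def b_def by auto
    have b32: "b \<le> 3 / 2 * a"
    proof (rule power2_le_imp_le)
      have "real n \<ge> 1" using n by simp
      thus "b\<^sup>2 \<le> (3 / 2 * a)\<^sup>2" using ab by (simp add: power2_eq_square)
    qed (use ab in auto)
    have "(b - a) * (a + b) = 1" using ab by (simp add: algebra_simps)
    hence ba: "b - a = 1 / (a + b)" using ab by (simp add: field_simps)
    have "a * b * (a + b) \<le> a * (3 / 2 * a) * (a + 3 / 2 * a)" using ab b32 by (intro mult_mono) auto
    also have "\<dots> \<le> 6 * (a * a * a)" using ab by (simp add: algebra_simps)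
    finally have le: "a * b * (a + b) \<le> 6 * (a * a * a)" .
    have "1 / P \<le> 6 / Q" if "0 < P" "0 < Q" "Q \<le> 6 * P" for P Q :: real using that by (simp add: field_simps)
    hence "1 / (a * a * a) \<le> 6 / (a * b * (a + b))" using ab le by auto
    also have "\<dots> = 6 * ((1 / (a + b)) / (a * b))" by simp
    also have "\<dots> = 6 * (1 / a - 1 / b)" unfolding ba[symmetric] using ab by (simp add: diff_divide_distrib)
    finally have "1 / (a * a * a) \<le> 6 * (1 / a - 1 / b)" .
    moreover have "real n powr (- 3 / 2) = 1 / (a * a * a)"
    proof -
      have "real n powr (3 / 2) = real n powr (1 + 1 / 2)" by simp
      also have "\<dots> = real n * sqrt (real n)" using n by (simp only: powr_add powr_half_sqrt) simp
      also have "\<dots> = a * a * a" using ab unfolding a_def by simp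
      finally show ?thesis using powr_minus_divide[of "real n" "3/2"] by simp
    qed
    ultimately have "B * real n powr (- 3 / 2) \<le> B * (6 * (1 / a - 1 / b))" using B by (intro mult_left_mono) auto
    thus ?thesis using 1 unfolding a_def b_def by (simp add: mult_ac)
  qed
  have part: "norm ((\<Sum>i<m. f (of_nat (i + Suc N))) + F (of_nat N)) \<le> norm (F (of_nat (N + m))) + 6 * B / sqrt (real N)" for m
  proof -
    have "(\<Sum>i<m. f (of_nat (i + Suc N))) + F (of_nat N) = F (of_nat (N + m)) + (\<Sum>i<m. e (N + i))"
      by (induction m) (simp_all add: e_def add_ac)
    also have "norm \<dots> \<le> norm (F (of_nat (N + m))) + norm (\<Sum>i<m. e (N + i))" by (rule norm_triangle_ineq)
    also have "norm (\<Sum>i<m. e (N + i)) \<le> (\<Sum>i<m. 6 * B * (1 / sqrt (real (N + i)) - 1 / sqrt (real (Suc (N + i)))))"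
      by (intro sum_norm_le e) (use N in auto)
    also have "\<dots> = 6 * B * (1 / sqrt (real N) - 1 / sqrt (real (N + m)))"
      unfolding sum_distrib_left[symmetric] by (induction m) (auto simp: algebra_simps)
    also have "\<dots> \<le> 6 * B * (1 / sqrt (real N))" using B by (intro mult_left_mono) auto
    finally show ?thesis by simp
  qed
  have lim1: "(\<lambda>m. norm (F (of_nat (N + m))) + 6 * B / sqrt (real N)) \<longlonglongrightarrow> norm (0::complex) + 6 * B / sqrt (real N)"
    using LIMSEQ_ignore_initial_segment[OF lim, of N] by (intro tendsto_intros) (simp add: add.commute)
  have lim2: "(\<lambda>m. norm ((\<Sum>i<m. f (of_nat (i + Suc N))) + F (of_nat N))) \<longlonglongrightarrow>
      norm ((\<Sum>n. f (of_nat (n + Suc N))) + F (of_nat N))"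
    using summable_ignore_initial_segment[OF sm, of "Suc N"]
    by (intro tendsto_intros summable_LIMSEQ) auto
  have "norm ((\<Sum>n. f (of_nat (n + Suc N))) + F (of_nat N)) \<le> norm (0::complex) + 6 * B / sqrt (real N)"
    by (rule LIMSEQ_le[OF lim2 lim1]) (use part in auto)
  thus ?thesis by simp
qed

text \<open>For N of order |s|^2 the error is bounded, and it does not depend on how close
  \<open>Re s\<close> is to 1.\<close>

lemma zt_tail:
  assumes s: "Re s > 1" and N: "N \<ge> 1"
  shows "norm (zt s - (\<Sum>n\<le>N. of_nat n powr (- s)) - of_nat N powr (1 - s) / (s - 1)) \<le> 6 * norm s / sqrt (real N)"
proof -
  define f where "f = (\<lambda>z::complex. z powr (- s))"
  define F where "F = (\<lambda>z::complex. z powr (1 - s) / (1 - s))"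
  have s1: "s \<noteq> 1" using s by auto
  have sm: "summable (\<lambda>n. f (of_nat n))"
  proof (rule summable_norm_cancel)
    have "summable (\<lambda>n. norm (of_real 1 * of_nat n powr (- s) :: complex))"
      by (rule dser_abs_summable[OF _ s]) simp
    thus "summable (\<lambda>n. norm (f (of_nat n)))" by (simp add: f_def)
  qed
  have "norm ((\<Sum>n. f (of_nat (n + Suc N))) + F (of_nat N)) \<le> 6 * norm s / sqrt (real N)"
  proof (rule tail_compare[where f' = "\<lambda>z. - s * z powr (- s - 1)", OF _ _ _ _ _ sm N])
    fix y :: real assume y: "y \<ge> 1"
    have nr: "complex_of_real y \<notin> \<real>\<^sub>\<le>\<^sub>0" using y by auto
    have s1': "1 - s \<noteq> 0" using s1 by simp
    show "(F has_field_derivative f (of_real y)) (at (of_real y))"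
      unfolding F_def f_def
      using DERIV_cdivide[OF has_field_derivative_powr[OF nr, of "1 - s"], of "1 - s"] s1' by simp
    show "(f has_field_derivative - s * of_real y powr (- s - 1)) (at (of_real y))"
      unfolding f_def using has_field_derivative_powr[OF nr, of "- s"] by simp
    have "norm (- s * of_real y powr (- s - 1)) = norm s * y powr (- Re s - 1)"
      using y by (simp add: norm_mult norm_powr_real_powr)
    also have "\<dots> \<le> norm s * y powr (- 3 / 2)" using s y by (intro mult_left_mono powr_mono) auto
    finally show "norm (- s * of_real y powr (- s - 1)) \<le> norm s * y powr (- 3 / 2)" .
  next
    have "(\<lambda>n. real n powr (- (Re s - 1)) / norm (1 - s)) \<longlonglongrightarrow> 0 / norm (1 - s)"
      using s s1 by (intro tendsto_intros tendsto_neg_powr filterlim_real_sequentially) auto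
    thus "(\<lambda>n. F (of_nat n)) \<longlonglongrightarrow> 0"
      by (subst tendsto_norm_zero_iff[symmetric]) (simp add: F_def norm_divide norm_powr_real_powr)
  qed auto
  moreover have "zt s = (\<Sum>n. f (of_nat (n + Suc N))) + (\<Sum>n<Suc N. f (of_nat n))"
    using suminf_split_initial_segment[OF sm, of "Suc N"] by (simp add: zt_def dser_def f_def)
  moreover have "F (of_nat N) = - (of_nat N powr (1 - s) / (s - 1))"
    unfolding F_def using s1 by (simp add: field_simps minus_divide_right[symmetric])
  ultimately show ?thesis by (simp add: f_def lessThan_Suc_atMost algebra_simps)
qed

text \<open>The comparison is applied to ln n * n powr (- s) directly, so no error term has to be
  differentiated. The constant doubles because of |1 - s ln y| <= 2 |s| sqrt y.\<close>

lemma dz_tail: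
  assumes s: "Re s > 1" and N: "N \<ge> 1"
  shows "norm (dz s - (\<Sum>n\<le>N. of_real (ln (real n)) * of_nat n powr (- s))
     + of_nat N powr (1 - s) * (of_real (ln (real N)) / (1 - s) - 1 / (1 - s)\<^sup>2)) \<le> 12 * norm s / sqrt (real N)"
proof -
  define f where "f = (\<lambda>z::complex. Ln z * z powr (- s))"
  define F where "F = (\<lambda>z::complex. z powr (1 - s) * (Ln z / (1 - s) - 1 / (1 - s)\<^sup>2))"
  have s1: "1 - s \<noteq> 0" using s by auto
  have ns: "norm s \<ge> 1" using s complex_Re_le_cmod[of s] by linarith
  have f_eq: "f (of_nat n) = of_real (ln (real n)) * of_nat n powr (- s)" for n
    by (cases "n = 0") (auto simp: f_def Ln_of_nat)
  have sm: "summable (\<lambda>n. f (of_nat n))"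
    unfolding f_eq by (rule summable_norm_cancel, rule dser_abs_summable[OF _ s]) simp
  have "norm ((\<Sum>n. f (of_nat (n + Suc N))) + F (of_nat N)) \<le> 6 * (2 * norm s) / sqrt (real N)"
  proof (rule tail_compare[where f' = "\<lambda>z. (1 - s * Ln z) * z powr (- s - 1)", OF _ _ _ _ _ sm N])
    fix y :: real assume y: "y \<ge> 1"
    have nr: "complex_of_real y \<notin> \<real>\<^sub>\<le>\<^sub>0" and y0: "complex_of_real y \<noteq> 0" using y by auto
    have pw: "complex_of_real y powr (w + 1) = of_real y * of_real y powr w" for w
      using y0 by (simp add: powr_add)
    have D: "(F has_field_derivative ((1 - s) * of_real y powr (1 - s - 1)) * (Ln (of_real y) / (1 - s) - 1 / (1 - s)\<^sup>2) +
        (1 / of_real y / (1 - s)) * of_real y powr (1 - s)) (at (of_real y))"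
    proof -
      have "((\<lambda>z. Ln z / (1 - s) - 1 / (1 - s)\<^sup>2) has_field_derivative inverse (of_real y) / (1 - s) - 0) (at (of_real y))"
        by (intro DERIV_diff DERIV_cdivide has_field_derivative_Ln nr DERIV_const)
      from DERIV_mult[OF has_field_derivative_powr[OF nr, of "1 - s"] this]
      show ?thesis unfolding F_def by (simp add: inverse_eq_divide mult.commute add.commute)
    qed
    have "((1 - s) * of_real y powr (1 - s - 1)) * (Ln (of_real y) / (1 - s) - 1 / (1 - s)\<^sup>2) +
        (1 / of_real y / (1 - s)) * of_real y powr (1 - s) = f (of_real y)"
    proof -
      have e: "complex_of_real y powr (1 - s) = of_real y * of_real y powr (- s)"
        using pw[of "- s"] by (simp add: add.commute)
      have e2: "1 - s - 1 = - s" by simp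
      have "(r * P) * (L / r - 1 / r\<^sup>2) + (1 / Y / r) * (Y * P) = L * P"
        if "Y \<noteq> 0" "r \<noteq> 0" for P L Y r :: complex
        using that by (simp add: field_simps power2_eq_square)
      from this[OF y0 s1] show ?thesis unfolding e e2 f_def .
    qed
    thus "(F has_field_derivative f (of_real y)) (at (of_real y))" using D by simp
    have D2: "(f has_field_derivative (1 / of_real y) * of_real y powr (- s) +
        (- s * of_real y powr (- s - 1)) * Ln (of_real y)) (at (of_real y))"
      unfolding f_def using DERIV_mult[OF has_field_derivative_Ln[OF nr] has_field_derivative_powr[OF nr, of "- s"]]
      by (simp add: inverse_eq_divide mult.commute add.commute)
    have "(1 / of_real y) * of_real y powr (- s) + (- s * of_real y powr (- s - 1)) * Ln (of_real y) =
        (1 - s * Ln (of_real y)) * of_real y powr (- s - 1)"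
      using pw[of "- s - 1"] y0 by (simp add: field_simps)
    thus "(f has_field_derivative (1 - s * Ln (of_real y)) * of_real y powr (- s - 1)) (at (of_real y))"
      using D2 by simp
    \<comment> \<open>The logarithm is absorbed by sqrt y, since 2 / e <= 1; this turns the decay y
      powr (-2) into y powr (-3/2).\<close>
    have ly: "ln y \<le> sqrt y" "ln y \<ge> 0"
    proof -
      have "ln y = 2 * ln (sqrt y)" using y by (simp add: ln_sqrt)
      also have "ln (sqrt y) \<le> sqrt y / exp 1"
      proof -
        have "ln (sqrt y / exp 1) \<le> sqrt y / exp 1 - 1" using y by (intro ln_le_minus_one) auto
        thus ?thesis using y by (simp add: ln_div)
      qed
      finally have "ln y \<le> 2 * (sqrt y / exp 1)" by simp
      also have "\<dots> \<le> sqrt y" using exp_ge_add_one_self[of 1] y by (simp add: field_simps mult_left_mono)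
      finally show "ln y \<le> sqrt y" .
    qed (use y in auto)
    have sq: "sqrt y \<ge> 1" using y by simp
    have "norm (1 - s * Ln (of_real y)) \<le> 1 + norm s * ln y"
      using norm_triangle_ineq4[of 1 "s * Ln (of_real y)"] y ly by (simp add: norm_mult Ln_of_real)
    also have "\<dots> \<le> norm s * sqrt y + norm s * sqrt y"
      using mult_mono[OF ns sq] ly ns by (intro add_mono mult_left_mono) auto
    finally have n1: "norm (1 - s * Ln (of_real y)) \<le> 2 * norm s * sqrt y" by (simp add: mult_ac)
    have "norm ((1 - s * Ln (of_real y)) * of_real y powr (- s - 1)) = norm (1 - s * Ln (of_real y)) * y powr (- Re s - 1)"
      using y by (simp add: norm_mult norm_powr_real_powr)
    also have "\<dots> \<le> (2 * norm s * sqrt y) * y powr (- 2)"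
      using s y by (intro mult_mono n1 powr_mono) auto
    also have "\<dots> = 2 * norm s * y powr (- 3 / 2)"
    proof -
      have "sqrt y * y powr (- 2) = y powr (1 / 2 + - 2)"
        using y by (simp only: powr_add powr_half_sqrt)
      thus ?thesis by simp
    qed
    finally show "norm ((1 - s * Ln (of_real y)) * of_real y powr (- s - 1)) \<le> 2 * norm s * y powr (- 3 / 2)" .
  next
    define r where "r = Re s - 1"
    have r: "r > 0" using s by (simp add: r_def)
    have l1: "(\<lambda>n. real n powr (- r)) \<longlonglongrightarrow> 0" using r by real_asymp
    have l2: "(\<lambda>n. real n powr (- r) * ln (real n)) \<longlonglongrightarrow> 0" using r by real_asymp
    have "(\<lambda>n. (real n powr (- r) * ln (real n)) / norm (1 - s) + real n powr (- r) / norm ((1 - s)\<^sup>2)) \<longlonglongrightarrow>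
        0 / norm (1 - s) + 0 / norm ((1 - s)\<^sup>2)"
      using s1 by (intro tendsto_intros l1 l2) auto
    hence lim: "(\<lambda>n. (real n powr (- r) * ln (real n)) / norm (1 - s) + real n powr (- r) / norm ((1 - s)\<^sup>2)) \<longlonglongrightarrow> 0"
      by simp
    show "(\<lambda>n. F (of_nat n)) \<longlonglongrightarrow> 0"
    proof (rule Lim_null_comparison[OF _ lim], rule eventually_sequentiallyI[of 1])
      fix n :: nat assume n: "1 \<le> n"
      have "norm (F (of_nat n)) = real n powr (- r) * norm (of_real (ln (real n)) / (1 - s) - 1 / (1 - s)\<^sup>2)"
        using n by (simp add: F_def norm_mult norm_powr_real_powr r_def Ln_of_nat)
      also have "\<dots> \<le> real n powr (- r) * (ln (real n) / norm (1 - s) + 1 / norm ((1 - s)\<^sup>2))"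
        using n norm_triangle_ineq4[of "of_real (ln (real n)) / (1 - s)" "1 / (1 - s)\<^sup>2"]
        by (intro mult_left_mono) (auto simp: norm_divide)
      finally show "norm (F (of_nat n)) \<le> (real n powr (- r) * ln (real n)) / norm (1 - s) + real n powr (- r) / norm ((1 - s)\<^sup>2)"
        by (simp add: algebra_simps)
    qed
  qed auto
  moreover have "dz s = (\<Sum>n. f (of_nat (n + Suc N))) + (\<Sum>n<Suc N. f (of_nat n))"
    using suminf_split_initial_segment[OF sm, of "Suc N"] by (simp add: dz_def dser_def f_eq)
  moreover have "F (of_nat N) = of_nat N powr (1 - s) * (of_real (ln (real N)) / (1 - s) - 1 / (1 - s)\<^sup>2)"
    unfolding F_def using N by (simp add: Ln_of_nat)
  ultimately show ?thesis by (simp add: f_eq lessThan_Suc_atMost algebra_simps)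
qed

text \<open>N = 1 leaves only the term 1 and the pole.\<close>

lemma zt_near: "Re s > 1 \<Longrightarrow> norm (zt s - 1 / (s - 1)) \<le> 1 + 6 * norm s"
  using zt_tail[of s 1] norm_triangle_ineq[of "zt s - 1 - 1 / (s - 1)" 1]
  by (simp add: atMost_Suc algebra_simps)

lemma dz_near: "Re s > 1 \<Longrightarrow> norm (dz s - 1 / (s - 1)\<^sup>2) \<le> 12 * norm s"
  using dz_tail[of s 1] by (simp add: atMost_Suc power2_commute)

text \<open>With N of order |s|^2 the tails are bounded and there remain sums of size ln N and (ln
  N)^2. These are traded for small powers of |s|, so that later estimates merely add exponents; 40
  is the bound for 1 / |s - 1|.\<close>

lemma zt_dz_far:
  assumes s: "Re s > 1" and far: "norm (s - 1) \<ge> 1 / 40"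
  shows "norm (zt s) \<le> 12000 * norm s powr (1 / 20)" and "norm (dz s) \<le> 12000 * norm s powr (1 / 20)"
proof -
  define S where "S = norm s"
  have S1: "S \<ge> 1" using s complex_Re_le_cmod[of s] unfolding S_def by linarith
  define N where "N = nat \<lceil>S\<^sup>2\<rceil>"
  have S2: "S\<^sup>2 \<ge> 1" using S1 by simp
  have N: "real N \<ge> S\<^sup>2" "real N \<le> S\<^sup>2 + 1" unfolding N_def using S2 by linarith+
  have N1: "N \<ge> 1" using N(1) S2 by (cases N) auto
  have sqN: "sqrt (real N) \<ge> S" using N(1) S1 by (intro real_le_rsqrt) auto
  \<comment> \<open>\<open>dz\<close> carries two logarithms, each at most 82 * w; hence the product
    w * w, which is |s| powr (1/20).\<close>
  define w where "w = S powr (1 / 40)"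
  have w1: "w \<ge> 1" unfolding w_def using S1 by (intro ge_one_powr_ge_zero) auto
  have ww: "w * w = S powr (1 / 20)" unfolding w_def by (simp add: powr_add[symmetric])
  have lnN: "1 + ln (real N) \<le> 82 * w"
  proof -
    have "ln (real N) \<le> ln (2 * S\<^sup>2)" using N N1 S2 by (intro ln_mono) (linarith | simp)+
    also have "\<dots> = ln 2 + 2 * ln S" using S1 by (simp add: ln_mult ln_realpow)
    also have "\<dots> \<le> 1 + 2 * (w / (1 / 40))"
      using ln_2_less_1 ln_powr_bound[of S "1/40"] S1 unfolding w_def by (intro add_mono mult_left_mono) auto
    finally show ?thesis using w1 by simp
  qed
  have lnN0: "ln (real N) \<ge> 0" using N1 by simp
  have harm: "(\<Sum>n\<in>{1..M}. 1 / real n) \<le> 1 + ln (real M)" if "M \<ge> 1" for M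
    using that
  proof (induction M rule: dec_induct)
    case (step n)
    have "ln (real n / real (Suc n)) \<le> real n / real (Suc n) - 1" using step by (intro ln_le_minus_one) auto
    hence "1 / real (Suc n) \<le> ln (real (Suc n)) - ln (real n)" using step by (simp add: ln_div field_simps)
    thus ?case using step by simp
  qed simp
  have pn: "norm (of_nat n powr (- s) :: complex) \<le> 1 / real n" if "n \<ge> 1" for n
  proof -
    have "norm (of_nat n powr (- s) :: complex) = real n powr (- Re s)" by (simp add: norm_powr_real_powr)
    also have "\<dots> \<le> real n powr (- 1)" using that s by (intro powr_mono) auto
    finally show ?thesis using that by (simp add: powr_minus field_simps)
  qed
  have rng: "{..N} = insert 0 {1..N}" by auto
  have pN: "norm (of_nat N powr (1 - s) :: complex) \<le> 1"
  proof -
    have "norm (of_nat N powr (1 - s) :: complex) = real N powr (1 - Re s)" by (simp add: norm_powr_real_powr)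
    also have "\<dots> \<le> real N powr 0" using N1 s by (intro powr_mono) auto
    finally show ?thesis using N1 by simp
  qed
  have "1 / r \<le> 40" if "r \<ge> 1 / 40" for r :: real using that by (simp add: field_simps)
  hence i1: "1 / norm (s - 1) \<le> 40" using far by blast
  have SN: "S / sqrt (real N) \<le> 1" using sqN S1 N1 by (simp add: divide_le_eq_1)
  have a1: "norm (\<Sum>n\<le>N. of_nat n powr (- s) :: complex) \<le> 1 + ln (real N)"
  proof -
    have "norm (\<Sum>n\<le>N. of_nat n powr (- s) :: complex) = norm (\<Sum>n\<in>{1..N}. of_nat n powr (- s) :: complex)"
      unfolding rng by simp
    also have "\<dots> \<le> (\<Sum>n\<in>{1..N}. 1 / real n)" by (intro sum_norm_le pn) auto
    also have "\<dots> \<le> 1 + ln (real N)" by (rule harm[OF N1])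
    finally show ?thesis .
  qed
  have a2: "norm (of_nat N powr (1 - s) / (s - 1)) \<le> 40"
  proof -
    have "norm (of_nat N powr (1 - s) / (s - 1)) \<le> 1 / norm (s - 1)"
      unfolding norm_divide by (intro divide_right_mono pN) auto
    thus ?thesis using i1 by simp
  qed
  have "norm (zt s) \<le> 6 * (S / sqrt (real N)) + (1 + ln (real N)) + 40"
    using zt_tail[OF s N1] a1 a2
      norm_triangle_ineq[of "zt s - (\<Sum>n\<le>N. of_nat n powr (- s)) - of_nat N powr (1 - s) / (s - 1)"
        "(\<Sum>n\<le>N. of_nat n powr (- s)) + of_nat N powr (1 - s) / (s - 1)"]
      norm_triangle_ineq[of "(\<Sum>n\<le>N. of_nat n powr (- s))" "of_nat N powr (1 - s) / (s - 1)"]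
    unfolding S_def by (simp add: algebra_simps)
  also have "\<dots> \<le> 6 * 1 + 82 * w + 40" using SN lnN by simp
  also have "\<dots> \<le> 128 * w" using w1 by simp
  also have "\<dots> \<le> 12000 * (w * w)" using w1 by (intro mult_mono) auto
  finally show "norm (zt s) \<le> 12000 * norm s powr (1 / 20)" unfolding ww S_def .
  have b1: "norm (\<Sum>n\<le>N. of_real (ln (real n)) * of_nat n powr (- s) :: complex) \<le> (82 * w) * (82 * w)"
  proof -
    have "norm (\<Sum>n\<le>N. of_real (ln (real n)) * of_nat n powr (- s) :: complex) =
        norm (\<Sum>n\<in>{1..N}. of_real (ln (real n)) * of_nat n powr (- s) :: complex)"
      unfolding rng by simp
    also have "\<dots> \<le> (\<Sum>n\<in>{1..N}. ln (real N) * (1 / real n))"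
    proof (intro sum_norm_le)
      fix n assume n: "n \<in> {1..N}"
      have "norm (of_real (ln (real n)) * of_nat n powr (- s) :: complex) = ln (real n) * norm (of_nat n powr (- s) :: complex)"
        using n by (simp add: norm_mult)
      also have "\<dots> \<le> ln (real N) * (1 / real n)" using n by (intro mult_mono pn) auto
      finally show "norm (of_real (ln (real n)) * of_nat n powr (- s) :: complex) \<le> ln (real N) * (1 / real n)" .
    qed
    also have "\<dots> \<le> ln (real N) * (1 + ln (real N))" unfolding sum_distrib_left[symmetric]
      using lnN0 by (intro mult_left_mono harm N1) auto
    also have "\<dots> \<le> (82 * w) * (82 * w)" using lnN lnN0 by (intro mult_mono) auto
    finally show ?thesis .
  qed
  have b2: "norm (of_nat N powr (1 - s) * (of_real (ln (real N)) / (1 - s) - 1 / (1 - s)\<^sup>2)) \<le> 40 * (82 * w) + 1600"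
  proof -
    have "norm (of_real (ln (real N)) / (1 - s) - 1 / (1 - s)\<^sup>2) \<le> ln (real N) / norm (1 - s) + 1 / (norm (1 - s))\<^sup>2"
      using norm_triangle_ineq4[of "of_real (ln (real N)) / (1 - s)" "1 / (1 - s)\<^sup>2"] lnN0
      by (simp add: norm_divide norm_power)
    also have "\<dots> = ln (real N) * (1 / norm (s - 1)) + (1 / norm (s - 1))\<^sup>2"
      by (simp add: norm_minus_commute power_divide)
    also have "\<dots> \<le> (82 * w) * 40 + 40\<^sup>2"
      using i1 lnN lnN0 by (intro add_mono mult_mono power_mono) auto
    finally have "norm (of_real (ln (real N)) / (1 - s) - 1 / (1 - s)\<^sup>2) \<le> 40 * (82 * w) + 1600" by simp
    thus ?thesis unfolding norm_mult using pN mult_mono[OF pN] by fastforce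
  qed
  have "norm (dz s) \<le> 12 * (S / sqrt (real N)) + (82 * w) * (82 * w) + (40 * (82 * w) + 1600)"
    using dz_tail[OF s N1] b1 b2
      norm_triangle_ineq[of "dz s - (\<Sum>n\<le>N. of_real (ln (real n)) * of_nat n powr (- s)) +
          of_nat N powr (1 - s) * (of_real (ln (real N)) / (1 - s) - 1 / (1 - s)\<^sup>2)"
        "(\<Sum>n\<le>N. of_real (ln (real n)) * of_nat n powr (- s)) -
          of_nat N powr (1 - s) * (of_real (ln (real N)) / (1 - s) - 1 / (1 - s)\<^sup>2)"]
      norm_triangle_ineq4[of "(\<Sum>n\<le>N. of_real (ln (real n)) * of_nat n powr (- s))"
         "of_nat N powr (1 - s) * (of_real (ln (real N)) / (1 - s) - 1 / (1 - s)\<^sup>2)"]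
    unfolding S_def by (simp add: algebra_simps)
  also have "\<dots> \<le> 12 * 1 + 6724 * (w * w) + (3280 * w + 1600)" using SN by simp
  also have "\<dots> \<le> 12000 * (w * w)"
  proof -
    have "1 * 1 \<le> w * w" using w1 by (intro mult_mono) auto
    moreover have "1 * w \<le> w * w" using w1 by (intro mult_right_mono) auto
    ultimately show ?thesis by simp
  qed
  finally show "norm (dz s) \<le> 12000 * norm s powr (1 / 20)" unfolding ww S_def .
qed

section \<open>The logarithm of zeta and a lower bound for zeta\<close>

definition lz :: "complex \<Rightarrow> complex" where "lz = dser (\<lambda>n. mangoldt n / ln (real n))"

text \<open>At a prime power p^j the quotient is 1/j, the coefficient of log zeta; at n = 0 and n =
  1 it is 0 by the conventions for ln and division.\<close>

lemma mangoldt_div_ln: "\<bar>mangoldt n / ln (real n)\<bar> \<le> 1" "0 \<le> mangoldt n / ln (real n)"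
proof -
  consider "n = 0" | "n = 1" | "n \<ge> 2" by linarith
  hence "\<bar>mangoldt n / ln (real n)\<bar> \<le> 1 \<and> 0 \<le> mangoldt n / ln (real n)"
  proof cases
    case 3
    thus ?thesis using mangoldt_le[of n] mangoldt_nonneg[of n] by (simp add: divide_le_eq_1)
  qed auto
  thus "\<bar>mangoldt n / ln (real n)\<bar> \<le> 1" "0 \<le> mangoldt n / ln (real n)" by auto
qed

lemma lz_deriv:
  assumes "Re s > 1"
  shows "(lz has_field_derivative - mz s) (at s)"
proof -
  have "(\<lambda>n. mangoldt n / ln (real n) * ln (real n)) = (mangoldt :: nat \<Rightarrow> real)"
  proof
    fix n :: nat
    consider "n = 0" | "n = 1" | "n \<ge> 2" by linarith
    thus "mangoldt n / ln (real n) * ln (real n) = (mangoldt n :: real)" by cases auto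
  qed
  thus ?thesis unfolding lz_def mz_def
    using dser_deriv[of "\<lambda>n. mangoldt n / ln (real n)", OF mangoldt_div_ln(1) assms] by simp
qed

lemma Re_zt_2: "Re (zt 2) \<ge> 1"
proof -
  have sm: "summable (\<lambda>n. of_real 1 * of_nat n powr (- 2) :: complex)"
    by (rule summable_norm_cancel, rule dser_abs_summable) auto
  have t: "of_real 1 * of_nat n powr (- 2) = complex_of_real (real n powr (- 2))" for n
    using powr_of_real[of "real n" "-2"] by simp
  have "Re (zt 2) = (\<Sum>n. real n powr (- 2))"
    unfolding zt_def dser_def using Re_suminf[OF sm] by (simp only: t Re_complex_of_real)
  also have "\<dots> \<ge> (\<Sum>n\<in>{1}. real n powr (- 2))"
    by (rule sum_le_suminf) (auto simp: summable_real_powr_iff)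
  finally show ?thesis by simp
qed

text \<open>Both sides have logarithmic derivative - \<open>mz\<close>, so their quotient is
  constant on the convex half-plane. This stands in for the Euler product; the value of zeta at 2
  excludes the constant 0.\<close>

lemma zt_exp_lz: "\<exists>c. c \<noteq> 0 \<and> (\<forall>s. Re s > 1 \<longrightarrow> zt s = c * exp (lz s))"
proof -
  have "\<exists>c. \<forall>s\<in>{s. Re s > 1}. zt s * exp (- lz s) = c"
  proof (rule has_field_derivative_zero_constant)
    show "convex {s. Re s > 1}" by (rule convex_halfspace_Re_gt)
    fix s assume s: "s \<in> {s. Re s > 1}"
    have "((\<lambda>s. zt s * exp (- lz s)) has_field_derivative zt s * (exp (- lz s) * (- (- mz s))) + (- dz s) * exp (- lz s)) (at s)"
      using s by (intro DERIV_mult' DERIV_chain2[OF DERIV_exp] DERIV_minus lz_deriv zt_deriv) auto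
    moreover have "zt s * (exp (- lz s) * (- (- mz s))) + (- dz s) * exp (- lz s) = 0"
      using dz_eq_zt_mz[of s] s by simp
    ultimately show "((\<lambda>s. zt s * exp (- lz s)) has_field_derivative 0) (at s within {s. Re s > 1})"
      by (metis has_field_derivative_at_within)
  qed
  then obtain c where c: "\<And>s. Re s > 1 \<Longrightarrow> zt s * exp (- lz s) = c" by auto
  have "zt s = c * exp (lz s)" if "Re s > 1" for s
    using c[OF that] by (simp add: exp_minus field_simps)
  moreover have "c \<noteq> 0"
  proof
    assume "c = 0"
    hence "zt 2 = 0" using c[of 2] by simp
    thus False using Re_zt_2 by simp
  qed
  ultimately show ?thesis by blast
qed

lemma Re_lz:
  assumes "Re s > 1"
  shows "summable (\<lambda>n. mangoldt n / ln (real n) * (real n powr (- Re s) * cos (Im s * ln (real n))))"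
    and "Re (lz s) = (\<Sum>n. mangoldt n / ln (real n) * (real n powr (- Re s) * cos (Im s * ln (real n))))"
proof -
  have "\<bar>mangoldt n / ln (real n)\<bar> \<le> 1 + ln (real n)" if "n \<ge> 1" for n
  proof -
    have "0 \<le> ln (real n)" using that by simp
    thus ?thesis using mangoldt_div_ln(1)[of n] by linarith
  qed
  hence sm: "summable (\<lambda>n. of_real (mangoldt n / ln (real n)) * of_nat n powr (- s) :: complex)"
    by (rule summable_norm_cancel[OF dser_abs_summable[OF _ assms]])
  have t: "Re (of_real (mangoldt n / ln (real n)) * of_nat n powr (- s)) =
      mangoldt n / ln (real n) * (real n powr (- Re s) * cos (Im s * ln (real n)))" for n
  proof (cases "n = 0")
    case False
    hence "of_nat n powr (- s) = exp (- s * of_real (ln (real n)))" by (simp add: powr_def Ln_of_nat)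
    hence "Re (of_nat n powr (- s)) = exp (- Re s * ln (real n)) * cos (Im s * ln (real n))" by (simp add: Re_exp)
    also have "exp (- Re s * ln (real n)) = real n powr (- Re s)" using False by (simp add: powr_def)
    finally show ?thesis by (simp only: Re_complex_of_real Im_complex_of_real times_complex.simps)
  qed simp
  show "summable (\<lambda>n. mangoldt n / ln (real n) * (real n powr (- Re s) * cos (Im s * ln (real n))))"
    using summable_Re[OF sm] by (simp only: t)
  show "Re (lz s) = (\<Sum>n. mangoldt n / ln (real n) * (real n powr (- Re s) * cos (Im s * ln (real n))))"
    unfolding lz_def dser_def using Re_suminf[OF sm] by (simp only: t)
qed

text \<open>The constant is |c|^8 with c from \<open>zt_exp_lz\<close>, as zeta enters 3 + 4 + 1
  times. Termwise, 3 + 4 cos y + cos 2y = 2 (1 + cos y)^2 is nonnegative.\<close>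

lemma three_four_one:
  "\<exists>c>0. \<forall>x t. x > 1 \<longrightarrow> c \<le> norm (zt (Complex x 0)) ^ 3 * norm (zt (Complex x t)) ^ 4 * norm (zt (Complex x (2 * t)))"
proof -
  obtain c where c: "c \<noteq> 0" "\<And>s. Re s > 1 \<Longrightarrow> zt s = c * exp (lz s)" using zt_exp_lz by auto
  have "norm c ^ 8 \<le> norm (zt (Complex x 0)) ^ 3 * norm (zt (Complex x t)) ^ 4 * norm (zt (Complex x (2 * t)))"
    if x: "x > 1" for x t
  proof -
    have n: "norm (zt (Complex x u)) = norm c * exp (Re (lz (Complex x u)))" for u
      using c(2)[of "Complex x u"] x by (simp add: norm_mult)
    define a where "a = (\<lambda>u n. mangoldt n / ln (real n) * (real n powr (- x) * cos (u * ln (real n))))"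
    have sm: "summable (a u)" and L: "Re (lz (Complex x u)) = suminf (a u)" for u
      using Re_lz[of "Complex x u"] x unfolding a_def by simp_all
    have "0 \<le> (\<Sum>n. 3 * a 0 n + 4 * a t n + a (2 * t) n)"
    proof (rule suminf_nonneg)
      show "summable (\<lambda>n. 3 * a 0 n + 4 * a t n + a (2 * t) n)" by (intro summable_add summable_mult sm)
      fix n
      define y where "y = t * ln (real n)"
      have "cos (2 * y) = 2 * (cos y)\<^sup>2 - 1" by (rule cos_double_cos)
      hence "3 + 4 * cos y + cos (2 * y) = 2 * (1 + cos y)\<^sup>2" by (simp add: power2_eq_square algebra_simps)
      hence "0 \<le> 3 + 4 * cos y + cos (2 * y)" by simp
      hence "0 \<le> mangoldt n / ln (real n) * (real n powr (- x) * (3 + 4 * cos y + cos (2 * y)))"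
        using mangoldt_div_ln(2)[of n] by (intro mult_nonneg_nonneg) auto
      thus "0 \<le> 3 * a 0 n + 4 * a t n + a (2 * t) n"
        unfolding a_def y_def by (simp add: algebra_simps)
    qed
    also have "\<dots> = 3 * suminf (a 0) + 4 * suminf (a t) + suminf (a (2 * t))"
      by (simp add: suminf_add[symmetric] summable_add summable_mult sm suminf_mult)
    finally have ge: "0 \<le> 3 * Re (lz (Complex x 0)) + 4 * Re (lz (Complex x t)) + Re (lz (Complex x (2 * t)))"
      unfolding L .
    have "norm (zt (Complex x 0)) ^ 3 * norm (zt (Complex x t)) ^ 4 * norm (zt (Complex x (2 * t))) =
        norm c ^ 8 * exp (3 * Re (lz (Complex x 0)) + 4 * Re (lz (Complex x t)) + Re (lz (Complex x (2 * t))))"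
      unfolding n exp_add power_mult_distrib
      by (simp add: exp_of_nat_mult[symmetric] eval_nat_numeral mult_ac exp_add[symmetric])
    also have "\<dots> \<ge> norm c ^ 8 * 1" using ge by (intro mult_left_mono) auto
    finally show ?thesis by simp
  qed
  moreover have "norm c ^ 8 > 0" using c by simp
  ultimately show ?thesis by blast
qed

text \<open>At distance x from the line, \<open>three_four_one\<close> gives a bound of order x powr
  (3/4), which degenerates as x tends to 0. Below a threshold y the bound at 1 + y is used instead,
  and moving horizontally to 1 + x costs at most y times the bound for \<open>dz\<close>. The
  quantity T = 3 + 2 |t| dominates |s| at both heights t and 2t.\<close>

lemma zt_lower_bound:
  "\<exists>c>0. \<forall>x t. 0 < x \<longrightarrow> x \<le> 1 / 40 \<longrightarrow> \<bar>t\<bar> \<ge> 1 / 40 \<longrightarrow> norm (zt (Complex (1 + x) t)) \<ge> c * (3 + 2 * \<bar>t\<bar>) powr (- 1 / 5)"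
proof -
  obtain c1 where c1: "c1 > 0" "\<And>x t. x > 1 \<Longrightarrow>
      c1 \<le> norm (zt (Complex x 0)) ^ 3 * norm (zt (Complex x t)) ^ 4 * norm (zt (Complex x (2 * t)))"
    using three_four_one by auto
  define K :: real where "K = 12000"
  define c2 where "c2 = (c1 / (8 * K)) powr (1 / 4)"
  have c2: "c2 > 0" using c1 by (simp add: c2_def K_def)
  have nrm: "norm (Complex (1 + x) u) \<le> 3 + 2 * \<bar>t\<bar>" "norm (Complex (1 + x) u - 1) \<ge> \<bar>u\<bar>"
    if "0 < x" "x \<le> 1 / 40" "\<bar>u\<bar> \<le> 2 * \<bar>t\<bar>" for x u t
  proof -
    have "norm (Complex (1 + x) u) \<le> \<bar>1 + x\<bar> + \<bar>u\<bar>" using cmod_le[of "Complex (1 + x) u"] by simp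
    thus "norm (Complex (1 + x) u) \<le> 3 + 2 * \<bar>t\<bar>" using that by simp
    show "norm (Complex (1 + x) u - 1) \<ge> \<bar>u\<bar>" using abs_Im_le_cmod[of "Complex (1 + x) u - 1"] by simp
  qed
  have lb1: "norm (zt (Complex (1 + x) t)) \<ge> c2 * x powr (3 / 4) * (3 + 2 * \<bar>t\<bar>) powr (- 1 / 80)"
    if x: "0 < x" "x \<le> 1 / 40" and t: "\<bar>t\<bar> \<ge> 1 / 40" for x t
  proof -
    define T where "T = 3 + 2 * \<bar>t\<bar>"
    define Z where "Z = norm (zt (Complex (1 + x) t))"
    have T: "T > 0" using t by (simp add: T_def)
    have z0: "norm (zt (Complex (1 + x) 0)) \<le> 2 / x"
    proof -
      have e: "Complex (1 + x) 0 = of_real (1 + x)" by (simp add: complex_of_real_def)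
      have "norm (zt (Complex (1 + x) 0) - 1 / (Complex (1 + x) 0 - 1)) \<le> 1 + 6 * norm (Complex (1 + x) 0)"
        using x by (intro zt_near) simp
      also have "Complex (1 + x) 0 - 1 = of_real x" unfolding e by simp
      also have "norm (Complex (1 + x) 0) = 1 + x" unfolding e norm_of_real using x by simp
      finally have "norm (zt (Complex (1 + x) 0)) \<le> 1 + 6 * (1 + x) + norm (1 / complex_of_real x)"
        using norm_triangle_ineq[of "zt (Complex (1 + x) 0) - 1 / of_real x" "1 / of_real x"] by simp
      also have "norm (1 / complex_of_real x) = 1 / x" using x by (simp add: norm_divide)
      also have "1 + 6 * (1 + x) \<le> 1 / x"
      proof -
        have "40 \<le> 1 / x" using x by (simp add: field_simps)
        moreover have "1 + 6 * (1 + x) \<le> 40" using x by simp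
        ultimately show ?thesis by (rule order_trans[rotated])
      qed
      finally show ?thesis by simp
    qed
    have z2: "norm (zt (Complex (1 + x) (2 * t))) \<le> K * T powr (1 / 20)"
    proof -
      have "norm (zt (Complex (1 + x) (2 * t))) \<le> K * norm (Complex (1 + x) (2 * t)) powr (1 / 20)"
      proof -
        have "\<bar>2 * t\<bar> \<le> norm (Complex (1 + x) (2 * t) - 1)" by (rule nrm(2)[OF x, of "2 * t" t]) (simp add: abs_mult)
        moreover have "\<bar>2 * t\<bar> \<ge> 1 / 40" using t by (simp add: abs_mult)
        ultimately have "norm (Complex (1 + x) (2 * t) - 1) \<ge> 1 / 40" by linarith
        thus ?thesis unfolding K_def using x by (intro zt_dz_far) auto
      qed
      also have "\<dots> \<le> K * T powr (1 / 20)"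
        unfolding T_def K_def using nrm(1)[OF x, of "2 * t" t] by (intro mult_left_mono powr_mono2) (auto simp: abs_mult)
      finally show ?thesis .
    qed
    have "c1 \<le> norm (zt (Complex (1 + x) 0)) ^ 3 * Z ^ 4 * norm (zt (Complex (1 + x) (2 * t)))"
      unfolding Z_def using x by (intro c1) simp
    also have "\<dots> \<le> (2 / x) ^ 3 * Z ^ 4 * (K * T powr (1 / 20))"
      using z0 z2 x by (intro mult_mono power_mono) (auto simp: Z_def K_def)
    also have "\<dots> = Z ^ 4 * (8 * K * T powr (1 / 20) / x ^ 3)" by (simp add: power_divide)
    finally have "c1 \<le> Z ^ 4 * (8 * K * T powr (1 / 20) / x ^ 3)" .
    hence "c1 / (8 * K) * x ^ 3 * T powr (- 1 / 20) \<le> Z ^ 4"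
      using x T by (simp add: field_simps K_def powr_minus)
    moreover have "c1 / (8 * K) * x ^ 3 * T powr (- 1 / 20) = (c2 * x powr (3 / 4) * T powr (- 1 / 80)) ^ 4"
    proof -
      have "c2 ^ 4 = c1 / (8 * K)" using c1(1) unfolding c2_def by (simp add: powr_power K_def)
      moreover have "(x powr (3 / 4)) ^ 4 = x ^ 3" using x by (simp add: powr_power powr_numeral)
      moreover have "(T powr (- 1 / 80)) ^ 4 = T powr (- 1 / 20)" using T by (simp add: powr_power)
      ultimately show ?thesis by (simp add: power_mult_distrib)
    qed
    ultimately have "(c2 * x powr (3 / 4) * T powr (- 1 / 80)) ^ 4 \<le> Z ^ 4" by simp
    thus ?thesis unfolding Z_def T_def by (rule power_le_imp_le_base[of _ 3, simplified]) simp
  qed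
  \<comment> \<open>c0 powr (1/4) <= c2 / (2 * K) makes the loss c0 * K at most half of the lower
    bound c2 * c0 powr (3/4).\<close>
  define c0 where "c0 = min (1 / 40) ((c2 / (2 * K)) ^ 4)"
  have c0: "c0 > 0" "c0 \<le> 1 / 40" "c0 \<le> (c2 / (2 * K)) ^ 4" using c2 by (auto simp: c0_def K_def)
  have c0K: "c0 * K \<le> c2 * c0 powr (3 / 4) / 2"
  proof -
    have "c0 powr (1 / 4) \<le> ((c2 / (2 * K)) ^ 4) powr (1 / 4)" using c0 by (intro powr_mono2) auto
    also have "\<dots> = c2 / (2 * K)"
    proof -
      have q: "c2 / (2 * K) > 0" using c2 by (simp add: K_def)
      have "(r powr real 4) powr (1 / 4) = r" if "r > 0" for r :: real unfolding powr_powr using that by simp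
      from this[OF q] have "((c2 / (2 * K)) powr real 4) powr (1 / 4) = c2 / (2 * K)" .
      thus ?thesis by (simp only: powr_realpow[OF q])
    qed
    finally have "c0 powr (1 / 4) * c0 powr (3 / 4) * K \<le> c2 / (2 * K) * c0 powr (3 / 4) * K"
      by (intro mult_right_mono) (auto simp: K_def)
    also have "c0 powr (1 / 4) * c0 powr (3 / 4) = c0" using c0 by (simp add: powr_add[symmetric])
    finally show ?thesis by (simp add: K_def)
  qed
  define c3 where "c3 = c2 * c0 powr (3 / 4) / 2"
  have c3: "c3 > 0" using c2 c0 by (simp add: c3_def)
  have "norm (zt (Complex (1 + x) t)) \<ge> c3 * (3 + 2 * \<bar>t\<bar>) powr (- 1 / 5)"
    if x: "0 < x" "x \<le> 1 / 40" and t: "\<bar>t\<bar> \<ge> 1 / 40" for x t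
  proof -
    define T where "T = 3 + 2 * \<bar>t\<bar>"
    have T: "T \<ge> 1" by (simp add: T_def)
    \<comment> \<open>The exponent 1/4 balances the two sides: the lower bound at y has exponent 3/4
      * 1/4 + 1/80 = 1/5, the loss 1/4 - 1/20 = 1/5.\<close>
    define y where "y = c0 * T powr (- 1 / 4)"
    have y: "y > 0" "y \<le> 1 / 40"
    proof -
      show "y > 0" using c0 T by (simp add: y_def)
      have "T powr (- 1 / 4) \<le> T powr 0" using T by (intro powr_mono) auto
      hence "y \<le> c0 * 1" unfolding y_def using c0 T by (intro mult_left_mono) auto
      thus "y \<le> 1 / 40" using c0 by simp
    qed
    have y34: "y powr (3 / 4) * T powr (- 1 / 80) = c0 powr (3 / 4) * T powr (- 1 / 5)"
      using c0 T unfolding y_def by (simp add: powr_mult powr_powr powr_add[symmetric])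
    have main: "norm (zt (Complex (1 + max x y) t)) \<ge> 2 * c3 * T powr (- 1 / 5)"
    proof -
      have "2 * c3 * T powr (- 1 / 5) = c2 * (y powr (3 / 4) * T powr (- 1 / 80))"
        unfolding y34 c3_def by simp
      also have "\<dots> \<le> c2 * ((max x y) powr (3 / 4) * T powr (- 1 / 80))"
        using y x c2 by (intro mult_left_mono mult_right_mono powr_mono2) auto
      also have "\<dots> \<le> norm (zt (Complex (1 + max x y) t))"
        using lb1[of "max x y" t] x y t unfolding T_def by (simp add: mult.assoc)
      finally show ?thesis .
    qed
    show ?thesis
    proof (cases "x \<ge> y")
      case True
      hence "2 * c3 * T powr (- 1 / 5) \<le> norm (zt (Complex (1 + x) t))" using main by (simp add: max_def split: if_splits)
      moreover have "c3 * T powr (- 1 / 5) \<le> 2 * c3 * T powr (- 1 / 5)" using c3 by simp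
      ultimately show ?thesis unfolding T_def by linarith
    next
      case False
      let ?a = "Complex (1 + x) t" and ?b = "Complex (1 + y) t"
      have "norm (zt ?b - zt ?a) \<le> (K * T powr (1 / 20)) * norm (?b - ?a)"
      proof (rule field_differentiable_bound[where S = "closed_segment ?a ?b" and f' = "\<lambda>s. - dz s"])
        fix s assume "s \<in> closed_segment ?a ?b"
        then obtain v where v: "0 \<le> v" "v \<le> 1" "s = (1 - v) *\<^sub>R ?a + v *\<^sub>R ?b" by (auto simp: in_segment)
        define r where "r = (1 - v) * x + v * y"
        have s: "s = Complex (1 + r) t" unfolding v r_def by (simp add: complex_eq_iff algebra_simps)
        have "(1 - v) * x \<ge> (1 - v) * x" "v * y \<ge> v * x" using v False by (auto intro!: mult_left_mono)
        hence "r \<ge> x" unfolding r_def by (simp add: algebra_simps)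
        moreover have "(1 - v) * x \<le> (1 - v) * y" using v False by (intro mult_left_mono) auto
        hence "r \<le> y" unfolding r_def by (simp add: algebra_simps)
        ultimately have r: "0 < r" "r \<le> 1 / 40" using x y by auto
        show "(zt has_field_derivative - dz s) (at s within closed_segment ?a ?b)"
          unfolding s using r by (intro has_field_derivative_at_within[OF zt_deriv]) simp
        have "norm (dz s) \<le> K * norm s powr (1 / 20)"
        proof -
          have "\<bar>t\<bar> \<le> norm (Complex (1 + r) t - 1)" by (rule nrm(2)[OF r, of t t]) simp
          hence "norm (Complex (1 + r) t - 1) \<ge> 1 / 40" using t by linarith
          thus ?thesis unfolding s K_def using r by (intro zt_dz_far) auto
        qed
        also have "\<dots> \<le> K * T powr (1 / 20)"
          unfolding s T_def K_def using nrm(1)[OF r, of t t] by (intro mult_left_mono powr_mono2) auto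
        finally show "norm (- dz s) \<le> K * T powr (1 / 20)" by simp
      qed auto
      also have "norm (?b - ?a) = y - x"
      proof -
        have "?b - ?a = of_real (y - x)" by (simp add: complex_eq_iff)
        hence "norm (?b - ?a) = \<bar>y - x\<bar>" by (simp only: norm_of_real)
        thus ?thesis using False by simp
      qed
      also have "(K * T powr (1 / 20)) * (y - x) \<le> (K * T powr (1 / 20)) * y"
        using x by (intro mult_left_mono) (auto simp: K_def)
      also have "\<dots> = c0 * K * T powr (- 1 / 5)"
      proof -
        have "T powr (1 / 20) * T powr (- 1 / 4) = T powr (- 1 / 5)" by (simp add: powr_add[symmetric])
        thus ?thesis unfolding y_def by (simp add: mult_ac)
      qed
      also have "\<dots> \<le> c3 * T powr (- 1 / 5)" using c0K unfolding c3_def by (intro mult_right_mono) auto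
      finally have "norm (zt ?b - zt ?a) \<le> c3 * T powr (- 1 / 5)" .
      moreover have "norm (zt ?b) \<ge> 2 * c3 * T powr (- 1 / 5)" using main False by (simp add: max_def)
      ultimately have "norm (zt ?a) \<ge> c3 * T powr (- 1 / 5)"
        using norm_triangle_ineq2[of "zt ?b" "zt ?b - zt ?a"] by simp
      thus ?thesis unfolding T_def .
    qed
  qed
  thus ?thesis using c3 by blast
qed

text \<open>Away from 1 the quotient \<open>dz\<close> / \<open>zt\<close> is of order T powr (1/20
  + 1/5) = T powr (1/4); dividing by s leaves |t| powr (-3/4), whose square is integrable. Near 1
  the poles cancel. The constant is uniform in x, which will tend to 0.\<close>

lemma transform_bound:
  "\<exists>C. \<forall>x t. 0 < x \<longrightarrow> x \<le> 1 / 40 \<longrightarrow>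
     (norm (mz (Complex (1 + x) t) / Complex (1 + x) t - 1 / (Complex (1 + x) t - 1)))\<^sup>2 \<le> C * (1 + \<bar>t\<bar>) powr (- 3 / 2)"
proof -
  obtain c where c: "c > 0" "\<And>x t. 0 < x \<Longrightarrow> x \<le> 1 / 40 \<Longrightarrow> \<bar>t\<bar> \<ge> 1 / 40 \<Longrightarrow>
      norm (zt (Complex (1 + x) t)) \<ge> c * (3 + 2 * \<bar>t\<bar>) powr (- 1 / 5)"
    using zt_lower_bound by auto
  define K :: real where "K = 12000"
  define A where "A = 6 * K / c + 41"
  have A0: "A \<ge> 0" using c by (simp add: A_def K_def)
  have near: "(norm (mz s / s - 1 / (s - 1)))\<^sup>2 \<le> 1000 * (1 + \<bar>t\<bar>) powr (- 3 / 2)"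
    if x: "0 < x" "x \<le> 1 / 40" and t: "\<bar>t\<bar> < 1 / 40" and s: "s = Complex (1 + x) t" for x t s
  proof -
    define w where "w = s - 1"
    have Res: "Re s > 1" using x s by simp
    have w0: "w \<noteq> 0" "s \<noteq> 0" using Res unfolding w_def by auto
    have wn: "norm w \<le> 1 / 20" using cmod_le[of w] x t unfolding w_def s by simp
    have sn: "norm s \<le> 21 / 20" "norm s \<ge> 1"
      using wn norm_triangle_ineq[of w 1] complex_Re_le_cmod[of s] Res unfolding w_def by auto
    define H where "H = zt s - 1 / w"
    define D where "D = dz s - 1 / w\<^sup>2"
    have H: "norm H \<le> 8" using zt_near[OF Res] sn unfolding H_def w_def by linarith
    have D: "norm D \<le> 13" using dz_near[OF Res] sn unfolding D_def w_def by linarith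
    have z: "zt s * w = 1 + w * H" "dz s * w\<^sup>2 = 1 + w\<^sup>2 * D"
      using w0 by (simp_all add: H_def D_def field_simps)
    have wH: "norm (w * H) \<le> 2 / 5" unfolding norm_mult using mult_mono[OF wn H] by simp
    have wD: "norm (w * D) \<le> 13 / 20" unfolding norm_mult using mult_mono[OF wn D] by simp
    have den: "norm (1 + w * H) \<ge> 1 / 2" using wH norm_triangle_ineq2[of 1 "- (w * H)"] by simp
    hence d0: "1 + w * H \<noteq> 0" by auto
    hence "zt s \<noteq> 0" using z by auto
    hence mz: "mz s = dz s / zt s" using dz_eq_zt_mz[OF Res] by (simp add: field_simps)
    have "mz s * (w * (1 + w * H)) = (dz s * w\<^sup>2)"
      unfolding mz z(1)[symmetric] using \<open>zt s \<noteq> 0\<close> by (simp add: power2_eq_square)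
    hence m2: "mz s * (w * (1 + w * H)) = 1 + w\<^sup>2 * D" unfolding z .
    \<comment> \<open>Clearing denominators turns the cancellation of the poles into an identity
      between bounded quantities.\<close>
    have "(mz s / s - 1 / w) * (s * (1 + w * H)) * w = mz s * (w * (1 + w * H)) - s * (1 + w * H)"
      using w0 by (simp add: field_simps)
    also have "\<dots> = (w * D - 1 - H - w * H) * w" unfolding m2 by (simp add: w_def algebra_simps power2_eq_square)
    finally have "(mz s / s - 1 / w) * (s * (1 + w * H)) = w * D - 1 - H - w * H" using w0 by simp
    hence "norm (mz s / s - 1 / w) * (norm s * norm (1 + w * H)) = norm (w * D - 1 - H - w * H)"
      by (metis norm_mult)
    also have "\<dots> \<le> norm (w * D) + 1 + norm H + norm (w * H)"
      using norm_triangle_ineq4[of "w * D - 1 - H" "w * H"] norm_triangle_ineq4[of "w * D - 1" H]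
        norm_triangle_ineq4[of "w * D" 1] by simp
    also have "\<dots> \<le> 11" using wD wH H by simp
    finally have le: "norm (mz s / s - 1 / w) * (norm s * norm (1 + w * H)) \<le> 11" .
    have "norm (mz s / s - 1 / w) * (1 * (1 / 2)) \<le> norm (mz s / s - 1 / w) * (norm s * norm (1 + w * H))"
      using sn den by (intro mult_left_mono mult_mono) auto
    hence "norm (mz s / s - 1 / w) \<le> 22" using le by simp
    hence "(norm (mz s / s - 1 / w))\<^sup>2 \<le> 22\<^sup>2" by (intro power_mono) auto
    also have "\<dots> \<le> 1000 * (1 / 2)" by simp
    also have "\<dots> \<le> 1000 * (1 + \<bar>t\<bar>) powr (- 3 / 2)"
    proof (rule mult_left_mono)
      have "(1 / 2 :: real) \<le> 1 / (41 / 40)\<^sup>2" by (simp add: power2_eq_square)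
      also have "\<dots> \<le> 1 / (1 + \<bar>t\<bar>)\<^sup>2" using t by (intro divide_left_mono power_mono) auto
      also have "\<dots> = (1 + \<bar>t\<bar>) powr (- 2)" by (simp add: powr_minus_divide powr_numeral)
      also have "\<dots> \<le> (1 + \<bar>t\<bar>) powr (- 3 / 2)" by (intro powr_mono) auto
      finally show "1 / 2 \<le> (1 + \<bar>t\<bar>) powr (- 3 / 2)" .
    qed simp
    finally show ?thesis unfolding w_def .
  qed
  have far: "(norm (mz s / s - 1 / (s - 1)))\<^sup>2 \<le> A\<^sup>2 * (1 + \<bar>t\<bar>) powr (- 3 / 2)"
    if x: "0 < x" "x \<le> 1 / 40" and t: "\<bar>t\<bar> \<ge> 1 / 40" and s: "s = Complex (1 + x) t" for x t s
  proof -
    define Y where "Y = 1 + \<bar>t\<bar>"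
    define T where "T = 3 + 2 * \<bar>t\<bar>"
    have Res: "Re s > 1" using x s by simp
    have Y: "Y \<ge> 1" by (simp add: Y_def)
    have sT: "norm s \<le> T" using cmod_le[of s] x unfolding s T_def by simp
    have s1: "norm (s - 1) \<ge> \<bar>t\<bar>" using abs_Im_le_cmod[of "s - 1"] unfolding s by simp
    have sY: "norm s \<ge> Y / 2"
      using complex_Re_le_cmod[of s] abs_Im_le_cmod[of s] Res unfolding Y_def s by simp
    have "norm (dz s) \<le> K * norm s powr (1 / 20)" unfolding K_def using Res s1 t by (intro zt_dz_far) auto
    also have "\<dots> \<le> K * T powr (1 / 20)" using sT unfolding K_def by (intro mult_left_mono powr_mono2) auto
    finally have d: "norm (dz s) \<le> K * T powr (1 / 20)" .
    have z: "norm (zt s) \<ge> c * T powr (- 1 / 5)" unfolding s T_def by (rule c(2)[OF x t])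
    have T0: "T > 0" by (simp add: T_def)
    have zp: "c * T powr (- 1 / 5) > 0" using c T0 by simp
    hence "zt s \<noteq> 0" using z by auto
    hence "mz s = dz s / zt s" using dz_eq_zt_mz[OF Res] by (simp add: field_simps)
    hence "norm (mz s) \<le> (K * T powr (1 / 20)) / (c * T powr (- 1 / 5))"
      by (simp only: norm_divide) (intro frac_le d z zp mult_nonneg_nonneg, auto simp: K_def)
    also have "\<dots> = K / c * T powr (1 / 4)"
    proof -
      have "T powr (1 / 20) / T powr (- 1 / 5) = T powr (1 / 20 - (- 1 / 5))" by (rule powr_diff[symmetric])
      hence "T powr (1 / 20) / T powr (- 1 / 5) = T powr (1 / 4)" by simp
      thus ?thesis by (simp only: times_divide_times_eq[symmetric])
    qed
    also have "\<dots> \<le> K / c * (3 * Y powr (1 / 4))"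
    proof (rule mult_left_mono)
      have "T powr (1 / 4) \<le> (3 * Y) powr (1 / 4)" using T0 unfolding T_def Y_def by (intro powr_mono2) auto
      also have "\<dots> = 3 powr (1 / 4) * Y powr (1 / 4)" using Y by (simp add: powr_mult)
      also have "\<dots> \<le> 3 * Y powr (1 / 4)"
        using powr_mono[of "1/4" 1 "3::real"] by (intro mult_right_mono) auto
      finally show "T powr (1 / 4) \<le> 3 * Y powr (1 / 4)" .
    qed (use c in \<open>auto simp: K_def\<close>)
    finally have m: "norm (mz s) \<le> K / c * (3 * Y powr (1 / 4))" .
    have p1: "Y powr (1 / 4) / Y = Y powr (- 3 / 4)"
    proof -
      have "Y powr (1 / 4) / Y powr 1 = Y powr (1 / 4 - 1)" by (rule powr_diff[symmetric])
      thus ?thesis using Y by simp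
    qed
    have "norm (mz s / s) \<le> K / c * (3 * Y powr (1 / 4)) / (Y / 2)"
      unfolding norm_divide using m sY Y c by (intro frac_le) (auto simp: K_def)
    also have "\<dots> = 6 * K / c * (Y powr (1 / 4) / Y)" by (simp add: field_simps)
    finally have a1: "norm (mz s / s) \<le> 6 * K / c * Y powr (- 3 / 4)" unfolding p1 .
    have "norm (1 / (s - 1)) \<le> 1 / \<bar>t\<bar>" unfolding norm_divide using s1 t by (simp add: frac_le)
    also have "\<dots> \<le> 41 * (1 / Y)" using t unfolding Y_def by (simp add: field_simps)
    also have "1 / Y = Y powr (- 1)" using Y by (simp add: powr_minus_divide)
    also have "41 * Y powr (- 1) \<le> 41 * Y powr (- 3 / 4)" using Y by (intro mult_left_mono powr_mono) auto
    finally have a2: "norm (1 / (s - 1)) \<le> 41 * Y powr (- 3 / 4)" .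
    have "norm (mz s / s - 1 / (s - 1)) \<le> norm (mz s / s) + norm (1 / (s - 1))" by (rule norm_triangle_ineq4)
    also have "\<dots> \<le> A * Y powr (- 3 / 4)" using a1 a2 unfolding A_def by (simp add: distrib_right)
    finally have "(norm (mz s / s - 1 / (s - 1)))\<^sup>2 \<le> (A * Y powr (- 3 / 4))\<^sup>2" by (intro power_mono) auto
    also have "\<dots> = A\<^sup>2 * Y powr (- 3 / 2)"
      using Y by (simp add: power_mult_distrib powr_power)
    finally show ?thesis unfolding Y_def .
  qed
  have "(norm (mz (Complex (1 + x) t) / Complex (1 + x) t - 1 / (Complex (1 + x) t - 1)))\<^sup>2 \<le> (1000 + A\<^sup>2) * (1 + \<bar>t\<bar>) powr (- 3 / 2)"
    if x: "0 < x" "x \<le> 1 / 40" for x t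
  proof -
    have p: "(1 + \<bar>t\<bar>) powr (- 3 / 2) \<ge> 0" by simp
    show ?thesis
    proof (cases "\<bar>t\<bar> < 1 / 40")
      case True
      have "1000 * (1 + \<bar>t\<bar>) powr (- 3 / 2) \<le> (1000 + A\<^sup>2) * (1 + \<bar>t\<bar>) powr (- 3 / 2)" by (intro mult_right_mono) auto
      thus ?thesis using near[OF x True refl] by linarith
    next
      case False
      have "A\<^sup>2 * (1 + \<bar>t\<bar>) powr (- 3 / 2) \<le> (1000 + A\<^sup>2) * (1 + \<bar>t\<bar>) powr (- 3 / 2)" by (intro mult_right_mono) auto
      thus ?thesis using far[OF x _ refl, of t] False by linarith
    qed
  qed
  thus ?thesis by blast
qed

section \<open>The mean square of the relative error of \<open>psi\<close>\<close>

lemma integrable_powr_three_half: "integrable lborel (\<lambda>t::real. (1 + \<bar>t\<bar>) powr (- 3 / 2))"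
proof -
  define p where "p = (\<lambda>t::real. indicator {0..} t * (1 + \<bar>t\<bar>) powr (- 3 / 2))"
  have pm [measurable]: "p \<in> borel_measurable borel" unfolding p_def by measurable
  have "(\<integral>\<^sup>+t. ennreal ((1 + \<bar>t\<bar>) powr (- 3 / 2)) * indicator {0..} t \<partial>lborel) = ennreal (0 - (- 2 * (1 + 0) powr (- 1 / 2)))"
  proof (rule nn_integral_FTC_atLeast)
    show "((\<lambda>t. - 2 * (1 + t) powr (- 1 / 2)) has_real_derivative (1 + \<bar>t\<bar>) powr (- 3 / 2)) (at t)" if "0 \<le> t" for t :: real
      using that by (auto intro!: derivative_eq_intros)
    show "((\<lambda>t::real. - 2 * (1 + t) powr (- 1 / 2)) \<longlongrightarrow> 0) at_top" by real_asymp
  qed auto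
  hence "integrable lborel p"
    unfolding p_def by (intro integrableI_nonneg) (auto simp: ennreal_mult' ennreal_indicator mult.commute)
  moreover from this have "integrable lborel (\<lambda>t. p (0 + (-1) * t))" by (rule lborel_integrable_real_affine) simp
  ultimately have "integrable lborel (\<lambda>t. p t + p (0 + (-1) * t))" by simp
  thus ?thesis
    by (rule Bochner_Integration.integrable_bound) (auto simp: p_def indicator_def)
qed

text \<open>The real version dominates the complex one and makes it integrable; its value is then a
  limit of integrals over bounded intervals.\<close>

lemma exp_integral_atLeast:
  fixes w :: complex
  assumes w: "Re w > 0"
  shows "has_bochner_integral lborel (\<lambda>v. indicator {a..} v *\<^sub>R exp (- w * of_real v)) (exp (- w * of_real a) / w)"
    and "has_bochner_integral lborel (\<lambda>v. indicator {a..} v * exp (- Re w * v)) (exp (- Re w * a) / Re w)"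
proof -
  have w0: "w \<noteq> 0" using w by auto
  have "(\<integral>\<^sup>+v. ennreal (exp (- Re w * v)) * indicator {a..} v \<partial>lborel) = ennreal (0 - (- exp (- Re w * a) / Re w))"
  proof (rule nn_integral_FTC_atLeast)
    show "((\<lambda>v. - exp (- Re w * v) / Re w) has_real_derivative exp (- Re w * v)) (at v)" for v
      using w by (auto intro!: derivative_eq_intros)
    show "((\<lambda>v. - exp (- Re w * v) / Re w) \<longlongrightarrow> 0) at_top" using w by real_asymp
  qed auto
  hence "(\<integral>\<^sup>+v. ennreal (indicator {a..} v * exp (- Re w * v)) \<partial>lborel) = ennreal (exp (- Re w * a) / Re w)"
    by (simp add: ennreal_mult' ennreal_indicator mult.commute)
  thus real: "has_bochner_integral lborel (\<lambda>v. indicator {a..} v * exp (- Re w * v)) (exp (- Re w * a) / Re w)"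
    using w by (intro has_bochner_integral_nn_integral) auto
  hence ri: "integrable lborel (\<lambda>v. indicator {a..} v * exp (- Re w * v))" by (simp add: has_bochner_integral_iff)
  have int: "set_integrable lborel {a..} (\<lambda>v. exp (- w * of_real v))"
    unfolding set_integrable_def
    by (rule Bochner_Integration.integrable_bound[OF ri]) (auto simp: norm_exp_eq_Re indicator_def)
  have "((\<lambda>b. set_lebesgue_integral lborel {a..b} (\<lambda>v. exp (- w * of_real v))) \<longlongrightarrow>
      set_lebesgue_integral lborel {a..} (\<lambda>v. exp (- w * of_real v))) at_top"
    by (rule tendsto_set_lebesgue_integral_at_top[OF _ int]) simp
  moreover have "\<forall>\<^sub>F b in at_top. (exp (- w * of_real a) - exp (- w * of_real b)) / w =
      set_lebesgue_integral lborel {a..b} (\<lambda>v. exp (- w * of_real v))"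
  proof (rule eventually_at_top_linorderI[of a])
    fix b assume "a \<le> b"
    have "has_bochner_integral lborel (\<lambda>v. indicator {a..b} v *\<^sub>R exp (- w * of_real v))
        (- exp (- w * of_real b) / w - (- exp (- w * of_real a) / w))"
    proof (rule has_bochner_integral_FTC_Icc[OF \<open>a \<le> b\<close>])
      fix v
      have "((\<lambda>z. - exp (- w * z) / w) has_field_derivative - (exp (- w * of_real v) * (- w)) / w) (at (of_real v))"
        using w0 by (auto intro!: derivative_eq_intros)
      hence "((\<lambda>z. - exp (- w * z) / w) has_field_derivative exp (- w * of_real v)) (at (of_real v))"
        using w0 by simp
      thus "((\<lambda>v. - exp (- w * complex_of_real v) / w) has_vector_derivative exp (- w * of_real v)) (at v within {a..b})"
        by (rule has_vector_derivative_at_within[OF has_vector_derivative_real_field])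
    qed (auto intro!: continuous_intros)
    thus "(exp (- w * of_real a) - exp (- w * of_real b)) / w =
        set_lebesgue_integral lborel {a..b} (\<lambda>v. exp (- w * of_real v))"
      unfolding set_lebesgue_integral_def by (simp add: has_bochner_integral_iff diff_divide_distrib)
  qed
  ultimately have "((\<lambda>b. (exp (- w * of_real a) - exp (- w * of_real b)) / w) \<longlongrightarrow>
      set_lebesgue_integral lborel {a..} (\<lambda>v. exp (- w * of_real v))) at_top"
    by (smt (verit) Lim_transform_eventually eventually_mono)
  moreover have "((\<lambda>b. (exp (- w * of_real a) - exp (- w * of_real b)) / w) \<longlongrightarrow> (exp (- w * of_real a) - 0) / w) at_top"
  proof (intro tendsto_intros w0)
    have "((\<lambda>b. exp (- Re w * b)) \<longlongrightarrow> 0) at_top" using w by real_asymp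
    thus "((\<lambda>b. exp (- w * of_real b)) \<longlongrightarrow> 0) at_top"
      by (subst tendsto_norm_zero_iff[symmetric]) (simp add: norm_exp_eq_Re)
  qed
  ultimately have "set_lebesgue_integral lborel {a..} (\<lambda>v. exp (- w * of_real v)) = exp (- w * of_real a) / w"
    using tendsto_unique[OF trivial_limit_at_top_linorder] by fastforce
  thus "has_bochner_integral lborel (\<lambda>v. indicator {a..} v *\<^sub>R exp (- w * of_real v)) (exp (- w * of_real a) / w)"
    using int unfolding set_integrable_def set_lebesgue_integral_def by (simp add: has_bochner_integral_iff)
qed

text \<open>psi (exp v) is a sum of jumps Lambda(n) at v = ln n, and each jump contributes n powr (-
  s) / s. Absolute convergence of the Dirichlet series justifies the exchange. Since
  \<open>psi\<close> vanishes below 1, the integral over the line is the usual one over v >=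
  0.\<close>

lemma psi_exp_transform:
  assumes s: "Re s > 1"
  shows "has_bochner_integral lborel (\<lambda>v. of_real (psi (exp v)) * exp (- s * of_real v)) (mz s / s)"
proof -
  define f where "f n v = of_real (mangoldt n) * (indicator {ln (real n)..} v *\<^sub>R exp (- s * of_real v))" for n v
  have s0: "Re s > 0" "s \<noteq> 0" using s by auto
  have fi: "has_bochner_integral lborel (f n) (of_real (mangoldt n) * (exp (- s * of_real (ln (real n))) / s))" for n
    unfolding f_def by (intro has_bochner_integral_mult_right exp_integral_atLeast(1) s0)
  have nf: "norm (f n v) = mangoldt n * (indicator {ln (real n)..} v * exp (- Re s * v))" for n v
    unfolding f_def by (auto simp: norm_mult norm_exp_eq_Re indicator_def mangoldt_nonneg)
  have nfi: "(\<integral>v. norm (f n v) \<partial>lborel) = mangoldt n * (exp (- Re s * ln (real n)) / Re s)" for n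
    unfolding nf using exp_integral_atLeast(2)[OF s0(1), of "ln (real n)"]
    by (simp only: Bochner_Integration.integral_mult_right_zero has_bochner_integral_iff)
  have fin: "f n v = 0" if "n \<notin> {1..nat \<lfloor>exp v\<rfloor>}" for n v
  proof (cases "n = 0")
    case False
    hence "real n > exp v" using that unfolding in_upto_iff by auto
    hence "ln (real n) > v" using False by (metis exp_less_cancel_iff exp_ln of_nat_0_less_iff neq0_conv)
    thus ?thesis by (simp add: f_def)
  qed (simp add: f_def)
  have sumf: "(\<Sum>n. f n v) = of_real (psi (exp v)) * exp (- s * of_real v)" for v
  proof -
    have "(\<Sum>n. f n v) = (\<Sum>n\<in>{1..nat \<lfloor>exp v\<rfloor>}. f n v)"
      by (rule suminf_finite) (use fin in auto)
    also have "\<dots> = (\<Sum>n\<in>{1..nat \<lfloor>exp v\<rfloor>}. of_real (mangoldt n) * exp (- s * of_real v))"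
    proof (rule sum.cong[OF refl])
      fix n assume n: "n \<in> {1..nat \<lfloor>exp v\<rfloor>}"
      hence "real n \<le> exp v" "n \<ge> 1" unfolding in_upto_iff by auto
      hence "ln (real n) \<le> v" by (metis ln_mono ln_exp of_nat_0_less_iff less_le_trans zero_less_one)
      thus "f n v = of_real (mangoldt n) * exp (- s * of_real v)" by (simp add: f_def)
    qed
    finally show ?thesis by (simp add: psi_def sum_distrib_right)
  qed
  have ex: "exp (- s * of_real (ln (real n))) = of_nat n powr (- s)" if "n > 0" for n
    using that by (simp add: powr_def Ln_of_nat)
  have "integrable lborel (f n)" for n using fi by (simp add: has_bochner_integral_iff)
  moreover have "AE v in lborel. summable (\<lambda>n. norm (f n v))"
  proof (rule AE_I2)
    fix v show "summable (\<lambda>n. norm (f n v))"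
      by (rule summable_finite[of "{1..nat \<lfloor>exp v\<rfloor>}"]) (use fin in auto)
  qed
  moreover have "summable (\<lambda>n. \<integral>v. norm (f n v) \<partial>lborel)"
  proof -
    have sm: "summable (\<lambda>n. norm (of_real (mangoldt n) * of_nat n powr (- s) :: complex) / Re s)"
      by (intro summable_divide dser_abs_summable[OF _ s] mangoldt_le_1_ln)
    have eq: "norm (of_real (mangoldt n) * of_nat n powr (- s) :: complex) / Re s = (\<integral>v. norm (f n v) \<partial>lborel)" for n
      unfolding nfi norm_dser_term by (cases "n = 0") (auto simp: powr_def)
    show ?thesis using sm unfolding eq .
  qed
  ultimately have "integrable lborel (\<lambda>v. \<Sum>n. f n v)" "(\<integral>v. (\<Sum>n. f n v) \<partial>lborel) = (\<Sum>n. integral\<^sup>L lborel (f n))"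
    by (auto intro: integrable_suminf integral_suminf)
  moreover have "(\<Sum>n. integral\<^sup>L lborel (f n)) = mz s / s"
  proof -
    have "integral\<^sup>L lborel (f n) = of_real (mangoldt n) * of_nat n powr (- s) / s" for n
      using fi[of n] ex[of n] by (cases "n = 0") (auto simp: has_bochner_integral_iff)
    moreover have "summable (\<lambda>n. of_real (mangoldt n) * of_nat n powr (- s) :: complex)"
      by (rule summable_norm_cancel[OF dser_abs_summable[OF _ s]]) (rule mangoldt_le_1_ln)
    ultimately show ?thesis unfolding mz_def dser_def by (simp add: suminf_divide)
  qed
  ultimately show ?thesis unfolding sumf by (simp add: has_bochner_integral_iff)
qed

text \<open>\<open>psi\<close> is a step function with jumps only at integers; the excluded v are
  countably many, which supplies the continuity almost everywhere asked for in
  \<open>plancherel_le\<close>.\<close>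

lemma psi_exp_isCont:
  assumes "\<And>n::nat. exp v \<noteq> real n"
  shows "isCont (\<lambda>v. psi (exp v)) v"
proof -
  have "exp v \<notin> \<int>"
  proof
    assume "exp v \<in> \<int>"
    then obtain i where "exp v = of_int i" by (elim Ints_cases)
    moreover from this have "i \<ge> 0" by (metis exp_ge_zero of_int_0_le_iff)
    ultimately have "exp v = real (nat i)" by simp
    thus False using assms by blast
  qed
  have lt: "of_int \<lfloor>exp v\<rfloor> < exp v" "exp v < of_int \<lfloor>exp v\<rfloor> + 1"
    using \<open>exp v \<notin> \<int>\<close> floor_less_iff[of "exp v"] by (metis Ints_of_int floor_correct less_eq_real_def, linarith)
  have "\<forall>\<^sub>F y in nhds v. exp y \<in> {of_int \<lfloor>exp v\<rfloor> <..< of_int \<lfloor>exp v\<rfloor> + 1}"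
  proof -
    have "open (exp -` {of_int \<lfloor>exp v\<rfloor> <..< of_int \<lfloor>exp v\<rfloor> + 1} :: real set)"
      by (intro open_vimage continuous_intros)
    from eventually_nhds_in_open[OF this, of v] lt show ?thesis by (auto elim!: eventually_mono)
  qed
  hence "\<forall>\<^sub>F y in nhds v. psi (exp y) = psi (exp v)"
  proof eventually_elim
    case (elim y)
    hence "\<lfloor>exp y\<rfloor> = \<lfloor>exp v\<rfloor>" by (intro floor_unique) auto
    thus ?case by (simp add: psi_def)
  qed
  thus ?thesis by (rule isCont_cong[THEN iffD2]) simp
qed

lemma psi_exp_measurable [measurable]: "(\<lambda>v. psi (exp v)) \<in> borel_measurable borel"
  by (intro borel_measurable_mono monoI psi_mono) simp

text \<open>The relative error in the prime number theorem on the logarithmic scale. It equals -1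
  for v < 0, hence the indicators of the half-line below.\<close>

definition dl :: "real \<Rightarrow> real" where "dl v = psi (exp v) * exp (- v) - 1"

lemma dl_measurable [measurable]: "dl \<in> borel_measurable borel"
  unfolding dl_def[abs_def] by measurable

lemma dl_bound: "\<bar>dl v\<bar> \<le> 3"
proof -
  have "psi (exp v) * exp (- v) \<le> 4 * exp v * exp (- v)" using psi_bound[of "exp v"] by (intro mult_right_mono) auto
  moreover have "0 \<le> psi (exp v) * exp (- v)" using psi_nonneg by simp
  moreover have "4 * exp v * exp (- v) = 4" by (simp add: exp_minus)
  ultimately show ?thesis unfolding dl_def by linarith
qed

text \<open>Damping by exp (- v / L) makes the error square integrable without presupposing that it
  tends to 0, and costs at most the factor exp 2 on {0..L}. The transform of the damped error is the
  function of \<open>transform_bound\<close> at distance 1 / L from the line; L >= 40 is its range x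
  <= 1/40.\<close>

lemma dl_L2_bound: "\<exists>C. \<forall>L\<ge>40. (\<integral>v. indicator {0..L} v * (dl v)\<^sup>2 \<partial>lborel) \<le> C"
proof -
  obtain C where C: "\<And>x t. 0 < x \<Longrightarrow> x \<le> 1 / 40 \<Longrightarrow>
     (norm (mz (Complex (1 + x) t) / Complex (1 + x) t - 1 / (Complex (1 + x) t - 1)))\<^sup>2 \<le> C * (1 + \<bar>t\<bar>) powr (- 3 / 2)"
    using transform_bound by auto
  define I where "I = (\<integral>t. C * (1 + \<bar>t\<bar>) powr (- 3 / 2) \<partial>lborel)"
  have "(\<integral>v. indicator {0..L} v * (dl v)\<^sup>2 \<partial>lborel) \<le> exp 2 * (I / (2 * pi))" if L: "L \<ge> 40" for L
  proof -
    define x where "x = 1 / L"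
    have x: "0 < x" "x \<le> 1 / 40" using L by (auto simp: x_def field_simps)
    define g where "g v = indicator {0..} v * (dl v * exp (- x * v))" for v
    have gm [measurable]: "g \<in> borel_measurable borel" unfolding g_def[abs_def] by measurable
    have e1: "has_bochner_integral lborel (\<lambda>v. indicator {0..} v * exp (- x * v)) (exp (- x * 0) / x)"
      using exp_integral_atLeast(2)[of "of_real x" 0] x by simp
    hence e1i: "integrable lborel (\<lambda>v. 3 * (indicator {0..} v * exp (- x * v)))"
      by (simp add: has_bochner_integral_iff)
    have gle: "\<bar>g v\<bar> \<le> 3 * (indicator {0..} v * exp (- x * v))" for v
      unfolding g_def using dl_bound[of v] by (auto simp: abs_mult indicator_def)
    have gi: "integrable lborel g"
      by (rule Bochner_Integration.integrable_bound[OF e1i]) (use gle in \<open>auto simp: abs_mult\<close>)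
    have g3: "\<bar>g v\<bar> \<le> 3" for v
    proof -
      have "indicator {0..} v * exp (- x * v) \<le> 1" using x by (auto simp: indicator_def)
      thus ?thesis using gle[of v] by linarith
    qed
    have "(\<integral>v. (g v)\<^sup>2 \<partial>lborel) \<le> I / (2 * pi)"
      unfolding I_def
    proof (rule plancherel_le[OF gi g3])
      show "integrable lborel (\<lambda>t. C * (1 + \<bar>t\<bar>) powr (- 3 / 2))" using integrable_powr_three_half by simp
      have "countable (insert 0 (range (\<lambda>n::nat. ln (real n))))" by simp
      hence "insert 0 (range (\<lambda>n::nat. ln (real n))) \<in> null_sets lborel" by (rule countable_imp_null_set_lborel)
      hence "AE v in lborel. v \<notin> insert 0 (range (\<lambda>n::nat. ln (real n)))" by (rule AE_not_in)
      thus "AE v in lborel. isCont g v"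
      proof eventually_elim
        case (elim v)
        have "exp v \<noteq> real n" for n :: nat
        proof
          assume "exp v = real n"
          hence "v = ln (real n)" by (metis ln_exp)
          thus False using elim by auto
        qed
        hence c1: "isCont dl v" unfolding dl_def[abs_def]
          by (intro continuous_intros psi_exp_isCont) auto
        have "isCont (\<lambda>v. indicator {0::real..} v :: real) v"
        proof (cases "v > 0")
          case True
          have "\<forall>\<^sub>F y in nhds v. (indicator {0::real..} y :: real) = 1"
            using eventually_nhds_in_open[of "{0<..}" v] True by (auto elim!: eventually_mono)
          thus ?thesis by (rule isCont_cong[THEN iffD2]) simp
        next
          case False
          have "\<forall>\<^sub>F y in nhds v. (indicator {0::real..} y :: real) = 0"
            using eventually_nhds_in_open[of "{..<0}" v] False elim by (auto elim!: eventually_mono)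
          thus ?thesis by (rule isCont_cong[THEN iffD2]) simp
        qed
        with c1 show "isCont g v" unfolding g_def[abs_def] by (intro continuous_intros)
      qed
      fix u :: real
      \<comment> \<open>The sign of the imaginary part matches \<open>iexp (u * v)\<close>. The 1
        subtracted in \<open>dl\<close> contributes the term 1 / (s - 1) that removes the
        pole.\<close>
      define s where "s = Complex (1 + x) (- u)"
      have s: "Re s > 1" "Re (s - 1) > 0" using x by (auto simp: s_def)
      have "has_bochner_integral lborel (\<lambda>v. of_real (psi (exp v)) * exp (- s * of_real v) -
          indicator {0..} v *\<^sub>R exp (- (s - 1) * of_real v)) (mz s / s - exp (- (s - 1) * of_real 0) / (s - 1))"
        by (intro has_bochner_integral_diff psi_exp_transform exp_integral_atLeast(1) s)
      moreover have "of_real (psi (exp v)) * exp (- s * of_real v) -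
          indicator {0..} v *\<^sub>R exp (- (s - 1) * of_real v) = of_real (g v) * iexp (u * v)" for v
      proof (cases "v \<ge> 0")
        case True
        have "of_real (g v) * iexp (u * v) =
            (of_real (psi (exp v)) * of_real (exp (- v)) - 1) * (of_real (exp (- x * v)) * iexp (u * v))"
          using True by (simp add: g_def dl_def)
        also have "of_real (exp (- x * v)) * iexp (u * v) = exp (- (s - 1) * of_real v)"
        proof -
          have "- (s - 1) * of_real v = of_real (- x * v) + \<i> * of_real (u * v)"
            by (simp add: s_def complex_eq_iff)
          thus ?thesis by (simp only: exp_add exp_of_real)
        qed
        also have "(of_real (psi (exp v)) * of_real (exp (- v)) - 1) * exp (- (s - 1) * of_real v) =
            of_real (psi (exp v)) * exp (- s * of_real v) - exp (- (s - 1) * of_real v)"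
        proof -
          have "complex_of_real (exp (- v)) * exp (- (s - 1) * of_real v) = exp (- s * of_real v)"
            unfolding exp_of_real[symmetric] exp_add[symmetric] by (simp add: algebra_simps)
          thus ?thesis by (simp add: left_diff_distrib mult.assoc)
        qed
        finally show ?thesis using True by simp
      next
        case False
        hence "exp v < 1" by simp
        hence "psi (exp v) = 0" unfolding psi_def by simp
        thus ?thesis using False by (simp add: g_def)
      qed
      ultimately have "(CLINT v|lborel. g v * iexp (u * v)) = mz s / s - 1 / (s - 1)"
        by (simp add: has_bochner_integral_iff)
      thus "(norm (CLINT v|lborel. g v * iexp (u * v)))\<^sup>2 \<le> C * (1 + \<bar>u\<bar>) powr (- 3 / 2)"
        using C[OF x, of "- u"] unfolding s_def by simp
    qed
    moreover have "(\<integral>v. indicator {0..L} v * (dl v)\<^sup>2 \<partial>lborel) \<le> (\<integral>v. exp 2 * (g v)\<^sup>2 \<partial>lborel)"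
    proof (rule Bochner_Integration.integral_mono')
      have "integrable lborel (\<lambda>v. 3 * \<bar>g v\<bar>)" using gi by simp
      hence "integrable lborel (\<lambda>v. (g v)\<^sup>2)"
      proof (rule Bochner_Integration.integrable_bound)
        have "(g v)\<^sup>2 \<le> 3 * \<bar>g v\<bar>" for v
          using mult_right_mono[OF g3[of v], of "\<bar>g v\<bar>"] by (simp add: power2_eq_square)
        thus "AE v in lborel. norm ((g v)\<^sup>2) \<le> norm (3 * \<bar>g v\<bar>)" by simp
      qed simp
      thus "integrable lborel (\<lambda>v. exp 2 * (g v)\<^sup>2)" by simp
      fix v
      show "indicator {0..L} v * (dl v)\<^sup>2 \<le> exp 2 * (g v)\<^sup>2"
      proof (cases "v \<in> {0..L}")
        case True
        have "x * v \<le> 1" using True L by (simp add: x_def field_simps)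
        hence "exp (- 2) \<le> exp (2 * (- x * v))" by simp
        also have "\<dots> = (exp (- x * v))\<^sup>2" by (rule exp_double)
        finally have "exp 2 * exp (- 2) \<le> exp 2 * (exp (- x * v))\<^sup>2" by (intro mult_left_mono) auto
        hence "1 \<le> exp 2 * (exp (- x * v))\<^sup>2" by (simp add: exp_minus)
        hence "1 * (dl v)\<^sup>2 \<le> exp 2 * (exp (- x * v))\<^sup>2 * (dl v)\<^sup>2" by (intro mult_right_mono) auto
        thus ?thesis using True by (simp add: g_def power_mult_distrib mult_ac)
      qed simp
    qed simp
    ultimately show ?thesis using mult_left_mono[of _ "I / (2 * pi)" "exp 2"] by fastforce
  qed
  thus ?thesis by blast
qed

text \<open>Cauchy-Schwarz in the pointwise form r <= 1 / (2 q) + q r^2 / 2 with q = sqrt L.\<close>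

lemma dl_L1_bound: "\<exists>C. \<forall>L\<ge>40. integral {0..L} (\<lambda>v. \<bar>dl v\<bar>) \<le> C * sqrt L"
proof -
  obtain C where C: "\<And>L. L \<ge> 40 \<Longrightarrow> (\<integral>v. indicator {0..L} v * (dl v)\<^sup>2 \<partial>lborel) \<le> C" using dl_L2_bound by auto
  have "integral {0..L} (\<lambda>v. \<bar>dl v\<bar>) \<le> ((1 + C) / 2) * sqrt L" if L: "L \<ge> 40" for L
  proof -
    have ind: "integrable lborel (indicator {0..L} :: real \<Rightarrow> real)"
      by (rule integrable_real_indicator) (auto simp: emeasure_lborel_Icc_eq)
    have i1: "set_integrable lborel {0..L} (\<lambda>v. \<bar>dl v\<bar>)" "set_integrable lborel {0..L} (\<lambda>v. (dl v)\<^sup>2)"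
      unfolding set_integrable_def
    proof -
      from ind have b: "integrable lborel (\<lambda>v. indicator {0..L} v *\<^sub>R (9 :: real))" by simp
      have "(dl v)\<^sup>2 \<le> 9" for v using power_mono[OF dl_bound[of v], of 2] by simp
      thus "integrable lborel (\<lambda>v. indicator {0..L} v *\<^sub>R (dl v)\<^sup>2)"
        by (intro Bochner_Integration.integrable_bound[OF b]) (auto simp: indicator_def)
      have "\<bar>dl v\<bar> \<le> 9" for v using dl_bound[of v] by simp
      thus "integrable lborel (\<lambda>v. indicator {0..L} v *\<^sub>R \<bar>dl v\<bar>)"
        by (intro Bochner_Integration.integrable_bound[OF b]) (auto simp: indicator_def)
    qed
    have "integral {0..L} (\<lambda>v. \<bar>dl v\<bar>) = (\<integral>v. indicator {0..L} v * \<bar>dl v\<bar> \<partial>lborel)"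
      using set_borel_integral_eq_integral(2)[OF i1(1)] by (simp add: set_lebesgue_integral_def)
    also have "\<dots> \<le> (\<integral>v. 1 / (2 * sqrt L) * indicator {0..L} v + sqrt L / 2 * (indicator {0..L} v * (dl v)\<^sup>2) \<partial>lborel)"
    proof (rule Bochner_Integration.integral_mono')
      have "integrable lborel (\<lambda>v. indicator {0..L} v * (dl v)\<^sup>2)" using i1(2) by (simp add: set_integrable_def)
      thus "integrable lborel (\<lambda>v. 1 / (2 * sqrt L) * indicator {0..L} v + sqrt L / 2 * (indicator {0..L} v * (dl v)\<^sup>2))"
        by (intro Bochner_Integration.integrable_add integrable_mult_right ind)
      fix v
      have q: "q > 0 \<Longrightarrow> a \<le> 1 / (2 * q) + q / 2 * a\<^sup>2" for q a :: real
      proof -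
        assume q: "q > 0"
        have "0 \<le> (q * a - 1)\<^sup>2 / (2 * q)" using q by simp
        also have "\<dots> = 1 / (2 * q) + q / 2 * a\<^sup>2 - a" using q by (simp add: field_simps power2_eq_square)
        finally show ?thesis by simp
      qed
      show "indicator {0..L} v * \<bar>dl v\<bar> \<le> 1 / (2 * sqrt L) * indicator {0..L} v + sqrt L / 2 * (indicator {0..L} v * (dl v)\<^sup>2)"
        using q[of "sqrt L" "\<bar>dl v\<bar>"] L by (auto simp: indicator_def)
      show "0 \<le> 1 / (2 * sqrt L) * indicator {0..L} v + sqrt L / 2 * (indicator {0..L} v * (dl v)\<^sup>2)" using L by simp
    qed
    also have "\<dots> = 1 / (2 * sqrt L) * L + sqrt L / 2 * (\<integral>v. indicator {0..L} v * (dl v)\<^sup>2 \<partial>lborel)"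
    proof -
      have "integrable lborel (\<lambda>v. indicator {0..L} v * (dl v)\<^sup>2)" using i1(2) by (simp add: set_integrable_def)
      thus ?thesis using L
        by (subst Bochner_Integration.integral_add) (auto intro!: integrable_mult_right ind simp del: times_divide_eq_left times_divide_eq_right)
    qed
    also have "\<dots> \<le> 1 / (2 * sqrt L) * L + sqrt L / 2 * C" using C[OF L] L by (intro add_mono mult_left_mono) auto
    also have "1 / (2 * sqrt L) * L = sqrt L / 2" using L by (simp add: field_simps)
    finally show ?thesis by (simp add: algebra_simps add_divide_distrib)
  qed
  thus ?thesis by blast
qed

text \<open>On the interval from ln (x / (m + 1)) to ln (x / m), of length at least 1 / (2 m),
  monotonicity of \<open>psi\<close> bounds the m-th summand by x / m * |dl| at any point plus the
  variation of \<open>psi\<close> and of the identity. Averaging over the interval produces the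
  integral of |dl|, and the variations telescope to at most psi x + x <= 5 x.\<close>

theorem psi_error_average:
  "\<exists>C\<ge>0. \<forall>x\<ge>2. (\<Sum>m\<in>{1..nat \<lfloor>x\<rfloor>}. \<bar>psi (x / real m) - x / real m\<bar>) \<le> C * x * sqrt (ln x)"
proof -
  obtain C where C: "\<And>L. L \<ge> 40 \<Longrightarrow> integral {0..L} (\<lambda>v. \<bar>dl v\<bar>) \<le> C * sqrt L" using dl_L1_bound by auto
  have triv: "\<bar>psi y - y\<bar> \<le> 4 * y" if "y \<ge> 0" for y
    using psi_bound[OF that] psi_nonneg[of y] that by (auto simp: abs_le_iff)
  have small: "(\<Sum>m\<in>{1..nat \<lfloor>x\<rfloor>}. \<bar>psi (x / real m) - x / real m\<bar>) \<le> 4 * x * exp 40" if x: "x \<ge> 2" "ln x < 40" for x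
  proof -
    have "\<bar>psi (x / real m) - x / real m\<bar> \<le> 4 * x" if m: "m \<in> {1..nat \<lfloor>x\<rfloor>}" for m
    proof -
      have "x / real m \<le> x / 1" using m x by (intro divide_left_mono) auto
      thus ?thesis using triv[of "x / real m"] x by simp
    qed
    hence "(\<Sum>m\<in>{1..nat \<lfloor>x\<rfloor>}. \<bar>psi (x / real m) - x / real m\<bar>) \<le> real (nat \<lfloor>x\<rfloor>) * (4 * x)"
      using sum_bounded_above[of "{1..nat \<lfloor>x\<rfloor>}" "\<lambda>m. \<bar>psi (x / real m) - x / real m\<bar>" "4 * x"] by simp
    also have "\<dots> \<le> exp 40 * (4 * x)"
    proof (rule mult_right_mono)
      have "x < exp 40" using x by (metis exp_less_cancel_iff exp_ln less_le_trans zero_less_numeral)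
      thus "real (nat \<lfloor>x\<rfloor>) \<le> exp 40" using x by linarith
    qed (use x in simp)
    finally show ?thesis by (simp add: mult_ac)
  qed
  have large: "(\<Sum>m\<in>{1..nat \<lfloor>x\<rfloor>}. \<bar>psi (x / real m) - x / real m\<bar>) \<le> (2 * \<bar>C\<bar> + 13) * x * sqrt (ln x)"
    if x: "x \<ge> 2" "ln x \<ge> 40" for x
  proof -
    define f where "f = (\<lambda>v. \<bar>dl v\<bar>)"
    define N where "N = nat \<lfloor>x\<rfloor>"
    have N: "N \<ge> 1" "real N \<le> x" "x < real N + 1" using x unfolding N_def by linarith+
    have fint: "f integrable_on {a..b}" for a b
    proof -
      have "set_integrable lborel {a..b} f" unfolding set_integrable_def
      proof (rule Bochner_Integration.integrable_bound)
        have "integrable lborel (indicator {a..b} :: real \<Rightarrow> real)"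
          by (rule integrable_real_indicator) (auto simp: emeasure_lborel_Icc_eq)
        thus "integrable lborel (\<lambda>v. indicator {a..b} v *\<^sub>R (3 :: real))" by simp
        show "AE v in lborel. norm (indicator {a..b} v *\<^sub>R f v) \<le> norm (indicator {a..b} v *\<^sub>R (3 :: real))"
          using dl_bound by (auto simp: f_def indicator_def)
      qed (simp add: f_def)
      thus ?thesis by (rule set_borel_integral_eq_integral(1))
    qed
    have step: "\<bar>psi (x / real m) - x / real m\<bar> \<le> 2 * x * integral {ln (x / real (Suc m))..ln (x / real m)} f +
        (psi (x / real m) - psi (x / real (Suc m)) + (x / real m - x / real (Suc m)))" if m: "m \<ge> 1" for m
    proof -
      define a b where "a = ln (x / real (Suc m))" and "b = ln (x / real m)"
      define V where "V = psi (x / real m) - psi (x / real (Suc m)) + (x / real m - x / real (Suc m))"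
      define D where "D = \<bar>psi (x / real m) - x / real m\<bar>"
      have lt: "x / real (Suc m) \<le> x / real m" using m x by (intro divide_left_mono) auto
      have ab: "b - a \<ge> 1 / (2 * real m)"
      proof -
        have "b - a = ln (real (Suc m)) - ln (real m)" unfolding a_def b_def using m x by (simp add: ln_div del: of_nat_Suc)
        also have "\<dots> = - ln (real m / real (Suc m))" using m by (simp add: ln_div del: of_nat_Suc)
        also have "\<dots> \<ge> 1 - real m / real (Suc m)" using ln_le_minus_one[of "real m / real (Suc m)"] m by simp
        also have "1 - real m / real (Suc m) = 1 / real (Suc m)" by (simp add: field_simps)
        also have "1 / real (Suc m) \<ge> 1 / (2 * real m)" using m by (intro divide_left_mono) auto
        finally show ?thesis .
      qed
      have "integral {a..b} (\<lambda>v. D - V) \<le> integral {a..b} (\<lambda>v. x / real m * f v)"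
      proof (rule integral_le)
        fix v assume v: "v \<in> {a..b}"
        define y where "y = exp v"
        have y: "x / real (Suc m) \<le> y" "y \<le> x / real m" "y > 0"
        proof -
          have "exp a = x / real (Suc m)" "exp b = x / real m" unfolding a_def b_def using x m by (simp_all add: exp_ln)
          thus "x / real (Suc m) \<le> y" "y \<le> x / real m" "y > 0" using v unfolding y_def
            by (metis atLeastAtMost_iff exp_le_cancel_iff, metis atLeastAtMost_iff exp_le_cancel_iff, simp)
        qed
        have "D \<le> \<bar>psi y - y\<bar> + V"
        proof -
          have "\<bar>P - A\<bar> \<le> \<bar>q - y\<bar> + (P - p + (A - B))" if "p \<le> q" "q \<le> P" "B \<le> y" "y \<le> A" for P A p B q y :: real
            using that by linarith
          from this[OF psi_mono[OF y(1)] psi_mono[OF y(2)] y(1,2)] show ?thesis unfolding D_def V_def .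
        qed
        also have "\<bar>psi y - y\<bar> = y * f v"
        proof -
          have "psi y - y = y * dl v" unfolding dl_def y_def by (simp add: exp_minus field_simps)
          thus ?thesis using y by (simp add: f_def abs_mult)
        qed
        also have "\<dots> \<le> x / real m * f v" using y by (intro mult_right_mono) (auto simp: f_def)
        finally show "D - V \<le> x / real m * f v" by simp
      next
        show "(\<lambda>v. x / real m * f v) integrable_on {a..b}" using integrable_cmul[OF fint, of "x / real m"] by simp
      qed (rule integrable_const_ivl)
      also have "\<dots> = x / real m * integral {a..b} f" by simp
      also have "integral {a..b} (\<lambda>v. D - V) = (b - a) * (D - V)"
      proof -
        have "a \<le> b" using ab m by (smt (verit) divide_nonneg_nonneg of_nat_0_le_iff)
        thus ?thesis by simp
      qed
      finally have le: "(b - a) * (D - V) \<le> x / real m * integral {a..b} f" .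
      have nn: "integral {a..b} f \<ge> 0" by (intro integral_nonneg fint) (simp add: f_def)
      have "D - V \<le> 2 * x * integral {a..b} f"
      proof (cases "D - V \<le> 0")
        case True
        moreover have "2 * x * integral {a..b} f \<ge> 0" using nn x by simp
        ultimately show ?thesis by linarith
      next
        case False
        have "1 / (2 * real m) * (D - V) \<le> (b - a) * (D - V)" using ab False by (intro mult_right_mono) auto
        also note le
        finally have l1: "1 / (2 * real m) * (D - V) \<le> x / real m * integral {a..b} f" .
        have m0: "real m > 0" using m by simp
        have "(2 * real m) * (1 / (2 * real m) * (D - V)) \<le> (2 * real m) * (x / real m * integral {a..b} f)"
          using l1 m0 by (intro mult_left_mono) auto
        thus ?thesis using m0 by simp
      qed
      thus ?thesis unfolding D_def V_def a_def b_def by simp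
    qed
    have part: "(\<Sum>m\<in>{1..M}. \<bar>psi (x / real m) - x / real m\<bar>) \<le> 2 * x * integral {ln (x / real (Suc M))..ln x} f +
        (psi x - psi (x / real (Suc M)) + (x - x / real (Suc M)))" for M
    proof (induction M)
      case 0
      show ?case by simp
    next
      case (Suc M)
      have "integral {ln (x / real (Suc (Suc M)))..ln (x / real (Suc M))} f + integral {ln (x / real (Suc M))..ln x} f =
          integral {ln (x / real (Suc (Suc M)))..ln x} f"
      proof (rule Henstock_Kurzweil_Integration.integral_combine[OF _ _ fint])
        have "x / real (Suc (Suc M)) \<le> x / real (Suc M)" using x by (intro divide_left_mono) auto
        thus "ln (x / real (Suc (Suc M))) \<le> ln (x / real (Suc M))" using x by (subst ln_le_cancel_iff) auto
        have "x / real (Suc M) \<le> x / 1" using x by (intro divide_left_mono) auto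
        thus "ln (x / real (Suc M)) \<le> ln x" using x by (subst ln_le_cancel_iff) auto
      qed
      hence I: "2 * x * integral {ln (x / real (Suc (Suc M)))..ln (x / real (Suc M))} f + 2 * x * integral {ln (x / real (Suc M))..ln x} f =
          2 * x * integral {ln (x / real (Suc (Suc M)))..ln x} f"
        by (simp only: distrib_left[symmetric])
      have "(\<Sum>m\<in>{1..Suc M}. \<bar>psi (x / real m) - x / real m\<bar>) =
          (\<Sum>m\<in>{1..M}. \<bar>psi (x / real m) - x / real m\<bar>) + \<bar>psi (x / real (Suc M)) - x / real (Suc M)\<bar>" by simp
      thus ?case using Suc step[of "Suc M"] I by simp
    qed
    \<comment> \<open>The last summand m = N is estimated trivially, by 4 * (x / N) <= 8, because
      its interval would reach below v = 0.\<close>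
    obtain M where M: "N = Suc M" using N(1) by (cases N) auto
    have f1: "(\<Sum>m\<in>{1..N}. \<bar>psi (x / real m) - x / real m\<bar>) =
        (\<Sum>m\<in>{1..M}. \<bar>psi (x / real m) - x / real m\<bar>) + \<bar>psi (x / real N) - x / real N\<bar>" unfolding M by simp
    have f2: "\<bar>psi (x / real N) - x / real N\<bar> \<le> 4 * (x / real N)" using x by (intro triv) auto
    have f3: "x / real N \<le> 2" using N x by (simp add: field_simps)
    have f4: "(\<Sum>m\<in>{1..M}. \<bar>psi (x / real m) - x / real m\<bar>) \<le> 2 * x * integral {ln (x / real N)..ln x} f +
        (psi x - psi (x / real N) + (x - x / real N))" unfolding M by (rule part)
    have "integral {ln (x / real N)..ln x} f \<le> integral {0..ln x} f"
    proof (rule integral_subset_le)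
      have "x / real N \<ge> 1" using N by (simp add: field_simps)
      thus "{ln (x / real N)..ln x} \<subseteq> {0..ln x}" by auto
    qed (use fint in \<open>auto simp: f_def\<close>)
    also have "integral {0..ln x} f \<le> C * sqrt (ln x)" unfolding f_def by (rule C[OF x(2)])
    also have "C * sqrt (ln x) \<le> \<bar>C\<bar> * sqrt (ln x)" using x by (intro mult_right_mono) auto
    finally have "2 * x * integral {ln (x / real N)..ln x} f \<le> 2 * x * (\<bar>C\<bar> * sqrt (ln x))"
      using x by (intro mult_left_mono) auto
    moreover have "x / real N \<ge> 0" using x by simp
    ultimately have "(\<Sum>m\<in>{1..N}. \<bar>psi (x / real m) - x / real m\<bar>) \<le> 2 * x * (\<bar>C\<bar> * sqrt (ln x)) + 5 * x + 4 * 2"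
      using f1 f2 f3 f4 psi_bound[of x] psi_nonneg[of "x / real N"] x by linarith
    also have "\<dots> \<le> 2 * x * (\<bar>C\<bar> * sqrt (ln x)) + 13 * x * 1" using x by simp
    also have "\<dots> \<le> 2 * x * (\<bar>C\<bar> * sqrt (ln x)) + 13 * x * sqrt (ln x)"
      using x by (intro add_left_mono mult_left_mono) auto
    finally show ?thesis unfolding N_def by (simp add: algebra_simps)
  qed
  define C' where "C' = 2 * \<bar>C\<bar> + 13 + 4 * exp 40 / sqrt (ln 2)"
  have C'0: "C' \<ge> 0" by (simp add: C'_def)
  have "(\<Sum>m\<in>{1..nat \<lfloor>x\<rfloor>}. \<bar>psi (x / real m) - x / real m\<bar>) \<le> C' * x * sqrt (ln x)" if x: "x \<ge> 2" for x
  proof (cases "ln x < 40")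
    case True
    have "4 * x * exp 40 = 4 * exp 40 / sqrt (ln 2) * x * sqrt (ln 2)" by simp
    also have "\<dots> \<le> 4 * exp 40 / sqrt (ln 2) * x * sqrt (ln x)" using x by (intro mult_left_mono) auto
    also have "\<dots> \<le> C' * x * sqrt (ln x)" using x unfolding C'_def by (intro mult_right_mono) auto
    finally show ?thesis using small[OF x True] by linarith
  next
    case False
    have "(2 * \<bar>C\<bar> + 13) * x * sqrt (ln x) \<le> C' * x * sqrt (ln x)"
      using x unfolding C'_def by (intro mult_right_mono) auto
    thus ?thesis using large[OF x] False by linarith
  qed
  thus ?thesis using C'0 by blast
qed

section \<open>Dirichlet integrals\<close>

text \<open>The Riemann-Liouville kernel. The normalization by Gamma makes the kernels a semigroup
  under convolution, so no Beta constants appear later.\<close>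

definition ker :: "real \<Rightarrow> real \<Rightarrow> real" where
  "ker a v = indicator {0<..} v * (v powr (a - 1) / Gamma a)"

definition kerU :: "real \<Rightarrow> real \<Rightarrow> real \<Rightarrow> real" where
  "kerU a U v = indicator {..U} v * ker a v"

text \<open>The convolution of g with the cut-off kernels indexed by J. Here g stands for the
  coordinate determined by the others, and values in \<open>ennreal\<close> let Tonelli apply
  without integrability conditions.\<close>

definition Qn :: "real \<Rightarrow> nat set \<Rightarrow> (nat \<Rightarrow> real) \<Rightarrow> (real \<Rightarrow> ennreal) \<Rightarrow> real \<Rightarrow> ennreal" where
  "Qn a J U g w = (\<integral>\<^sup>+v. (\<Prod>i\<in>J. ennreal (kerU a (U i) (v i))) * g (w - (\<Sum>i\<in>J. v i)) \<partial>(\<Pi>\<^sub>M i\<in>J. lborel))"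

interpretation lb: product_sigma_finite "\<lambda>_::nat. lborel :: real measure" ..

lemma ker_measurable [measurable]: "ker a \<in> borel_measurable borel"
  unfolding ker_def[abs_def] by measurable

lemma kerU_measurable [measurable]: "kerU a U \<in> borel_measurable borel"
  unfolding kerU_def[abs_def] by measurable

lemma ker_nonneg: "a > 0 \<Longrightarrow> ker a v \<ge> 0"
  unfolding ker_def by (simp add: Gamma_real_pos less_imp_le)

lemma kerU_nonneg: "a > 0 \<Longrightarrow> kerU a U v \<ge> 0"
  unfolding kerU_def by (simp add: ker_nonneg)

lemma kerU_le_ker: "a > 0 \<Longrightarrow> kerU a U v \<le> ker a v"
  unfolding kerU_def using ker_nonneg[of a v] by (auto simp: indicator_def)

lemma Qn_integrand_measurable [measurable]:
  assumes [measurable]: "g \<in> borel_measurable borel"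
  shows "(\<lambda>v. (\<Prod>i\<in>J. ennreal (kerU a (U i) (v i))) * g (w - (\<Sum>i\<in>J. v i))) \<in> borel_measurable (\<Pi>\<^sub>M i\<in>J. lborel)"
  by measurable

lemma Qn_empty [simp]: "Qn a {} U g w = g w"
  unfolding Qn_def by (simp add: PiM_empty nn_integral_count_space_finite)

lemma Qn_insert:
  assumes J: "finite J" "j \<notin> J" and [measurable]: "g \<in> borel_measurable borel"
  shows "Qn a (insert j J) U g w = (\<integral>\<^sup>+y. ennreal (kerU a (U j) y) * Qn a J U g (w - y) \<partial>lborel)"
proof -
  have "Qn a (insert j J) U g w = (\<integral>\<^sup>+y. \<integral>\<^sup>+v. (\<Prod>i\<in>insert j J. ennreal (kerU a (U i) ((v(j := y)) i))) *
      g (w - (\<Sum>i\<in>insert j J. (v(j := y)) i)) \<partial>(\<Pi>\<^sub>M i\<in>J. lborel) \<partial>lborel)"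
    unfolding Qn_def by (rule lb.product_nn_integral_insert_rev[OF J]) measurable
  also have "\<dots> = (\<integral>\<^sup>+y. ennreal (kerU a (U j) y) * Qn a J U g (w - y) \<partial>lborel)"
  proof (rule nn_integral_cong)
    fix y :: real
    have "(\<Prod>i\<in>J. ennreal (kerU a (U i) ((v(j := y)) i))) = (\<Prod>i\<in>J. ennreal (kerU a (U i) (v i)))"
      "(\<Sum>i\<in>J. (v(j := y)) i) = (\<Sum>i\<in>J. v i)" for v
      using J by (auto intro!: prod.cong sum.cong)
    hence "(\<integral>\<^sup>+v. (\<Prod>i\<in>insert j J. ennreal (kerU a (U i) ((v(j := y)) i))) *
        g (w - (\<Sum>i\<in>insert j J. (v(j := y)) i)) \<partial>(\<Pi>\<^sub>M i\<in>J. lborel)) =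
        (\<integral>\<^sup>+v. ennreal (kerU a (U j) y) * ((\<Prod>i\<in>J. ennreal (kerU a (U i) (v i))) * g (w - y - (\<Sum>i\<in>J. v i))) \<partial>(\<Pi>\<^sub>M i\<in>J. lborel))"
      using J by (simp add: mult.assoc diff_diff_eq)
    also have "\<dots> = ennreal (kerU a (U j) y) * Qn a J U g (w - y)"
      unfolding Qn_def by (rule nn_integral_cmult) measurable
    finally show "(\<integral>\<^sup>+v. (\<Prod>i\<in>insert j J. ennreal (kerU a (U i) ((v(j := y)) i))) *
        g (w - (\<Sum>i\<in>insert j J. (v(j := y)) i)) \<partial>(\<Pi>\<^sub>M i\<in>J. lborel)) = ennreal (kerU a (U j) y) * Qn a J U g (w - y)" .
  qed
  finally show ?thesis .
qed

lemma Qn_measurable [measurable]: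
  assumes J: "finite J" and [measurable]: "g \<in> borel_measurable borel"
  shows "Qn a J U g \<in> borel_measurable borel"
  using J
proof (induction J rule: finite_induct)
  case empty
  thus ?case by (simp add: Qn_empty[abs_def])
next
  case (insert j J)
  note [measurable] = insert.IH
  have "Qn a (insert j J) U g = (\<lambda>w. \<integral>\<^sup>+y. ennreal (kerU a (U j) y) * Qn a J U g (w - y) \<partial>lborel)"
    by (rule ext) (rule Qn_insert[OF insert.hyps assms(2)])
  thus ?case by simp
qed

text \<open>The kernels vanish off the positive axis, so g contributes only at arguments up to
  w.\<close>

lemma Qn_cong_le:
  assumes "finite J" "\<And>y. y \<le> w \<Longrightarrow> g y = h y" "a > 0"
  shows "Qn a J U g w = Qn a J U h w"
  unfolding Qn_def
proof (rule nn_integral_cong)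
  fix v :: "nat \<Rightarrow> real"
  show "(\<Prod>i\<in>J. ennreal (kerU a (U i) (v i))) * g (w - (\<Sum>i\<in>J. v i)) =
      (\<Prod>i\<in>J. ennreal (kerU a (U i) (v i))) * h (w - (\<Sum>i\<in>J. v i))"
  proof (cases "\<forall>i\<in>J. v i > 0")
    case True
    hence "(\<Sum>i\<in>J. v i) \<ge> 0" by (intro sum_nonneg) auto
    thus ?thesis using assms(2) by simp
  next
    case False
    then obtain i where "i \<in> J" "\<not> v i > 0" by auto
    hence "ennreal (kerU a (U i) (v i)) = 0" by (simp add: kerU_def ker_def)
    hence "(\<Prod>i\<in>J. ennreal (kerU a (U i) (v i))) = 0" using assms(1) \<open>i \<in> J\<close> by (intro prod_zero) blast+
    thus ?thesis by (simp only: mult_zero_left)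
  qed
qed

text \<open>\<open>ker a\<close> is homogeneous of degree a - 1 and the measure adds 1, so every
  coordinate contributes c powr a.\<close>

lemma Qn_scale:
  assumes J: "finite J" and [measurable]: "g \<in> borel_measurable borel" and c: "c > 0" and a: "a > 0"
  shows "Qn a J (\<lambda>i. c * U i) g (c * w) = ennreal (c powr (real (card J) * a)) * Qn a J U (\<lambda>w. g (c * w)) w"
  using J
proof (induction J arbitrary: w rule: finite_induct)
  case empty
  thus ?case using c by simp
next
  case (insert j J)
  have ks: "c * kerU a (c * U j) (c * z) = c powr a * kerU a (U j) z" for z
  proof (cases "z > 0")
    case True
    have "c * (c * z) powr (a - 1) = c powr a * z powr (a - 1)"
    proof -
      have "c * (c powr (a - 1) * z powr (a - 1)) = (c powr 1 * c powr (a - 1)) * z powr (a - 1)" using c by simp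
      thus ?thesis using True c by (simp only: powr_mult powr_add[symmetric]) simp
    qed
    thus ?thesis using c True unfolding kerU_def ker_def
      by (auto simp: indicator_def divide_simps split: if_splits)
  next
    case False
    hence "\<not> c * z > 0" using c by (simp add: zero_less_mult_iff)
    thus ?thesis using False by (simp add: kerU_def ker_def)
  qed
  have [measurable]: "(\<lambda>w. g (c * w)) \<in> borel_measurable borel" by measurable
  note [measurable] = Qn_measurable[OF insert.hyps(1)]
  have "Qn a (insert j J) (\<lambda>i. c * U i) g (c * w) =
      (\<integral>\<^sup>+y. ennreal (kerU a (c * U j) y) * Qn a J (\<lambda>i. c * U i) g (c * w - y) \<partial>lborel)"
    by (rule Qn_insert[OF insert.hyps]) measurable
  also have "\<dots> = ennreal \<bar>c\<bar> * (\<integral>\<^sup>+z. ennreal (kerU a (c * U j) (0 + c * z)) * Qn a J (\<lambda>i. c * U i) g (c * w - (0 + c * z)) \<partial>lborel)"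
    by (rule nn_integral_real_affine) (use c in auto)
  also have "\<dots> = (\<integral>\<^sup>+z. ennreal c * (ennreal (kerU a (c * U j) (c * z)) * Qn a J (\<lambda>i. c * U i) g (c * (w - z))) \<partial>lborel)"
    using c by (subst nn_integral_cmult[symmetric]) (auto simp: right_diff_distrib)
  also have "\<dots> = (\<integral>\<^sup>+z. ennreal (c powr (real (card (insert j J)) * a)) * (ennreal (kerU a (U j) z) * Qn a J U (\<lambda>w. g (c * w)) (w - z)) \<partial>lborel)"
  proof (rule nn_integral_cong)
    fix z
    have "ennreal c * (ennreal (kerU a (c * U j) (c * z)) * Qn a J (\<lambda>i. c * U i) g (c * (w - z))) =
        ennreal (c * kerU a (c * U j) (c * z)) * Qn a J (\<lambda>i. c * U i) g (c * (w - z))"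
      using c by (simp add: ennreal_mult' mult.assoc)
    also have "\<dots> = ennreal (c powr a * kerU a (U j) z) * (ennreal (c powr (real (card J) * a)) * Qn a J U (\<lambda>w. g (c * w)) (w - z))"
      unfolding ks insert.IH ..
    also have "\<dots> = ennreal (c powr a) * ennreal (c powr (real (card J) * a)) * (ennreal (kerU a (U j) z) * Qn a J U (\<lambda>w. g (c * w)) (w - z))"
      by (simp add: ennreal_mult' mult_ac)
    also have "ennreal (c powr a) * ennreal (c powr (real (card J) * a)) = ennreal (c powr (real (card (insert j J)) * a))"
      using insert.hyps by (simp add: ennreal_mult'[symmetric] powr_add[symmetric] algebra_simps)
    finally show "ennreal c * (ennreal (kerU a (c * U j) (c * z)) * Qn a J (\<lambda>i. c * U i) g (c * (w - z))) =
        ennreal (c powr (real (card (insert j J)) * a)) * (ennreal (kerU a (U j) z) * Qn a J U (\<lambda>w. g (c * w)) (w - z))" .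
  qed
  also have "\<dots> = ennreal (c powr (real (card (insert j J)) * a)) * Qn a (insert j J) U (\<lambda>w. g (c * w)) w"
    by (subst Qn_insert[OF insert.hyps]) (auto intro!: nn_integral_cmult)
  finally show ?case .
qed

text \<open>Half-open on the left, to fit the tiling of the positive axis by the intervals from ln d
  to ln (d + 1).\<close>

lemma nn_integral_ker_Ioc:
  assumes a: "a > 0" and p: "0 \<le> p" "p \<le> q"
  shows "(\<integral>\<^sup>+y. ennreal (indicator {p<..q} y * ker a y) \<partial>lborel) = ennreal (q powr a / Gamma (a + 1) - p powr a / Gamma (a + 1))"
proof -
  have G: "Gamma (a + 1) = a * Gamma a" using a by (intro Gamma_plus1) (auto elim!: nonpos_Ints_cases)
  have G0: "Gamma a > 0" using a by (rule Gamma_real_pos)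
  have base: "(\<integral>\<^sup>+y. ennreal (indicator {0<..q} y * ker a y) \<partial>lborel) = ennreal (q powr a / Gamma (a + 1))" if "q \<ge> 0" for q
  proof -
    have "((\<lambda>x. x powr (a - 1)) has_integral (q powr (a - 1 + 1) / (a - 1 + 1))) {0..q}"
      using a that by (intro has_integral_powr_from_0) auto
    hence "((\<lambda>x. x powr (a - 1) / Gamma a) has_integral (q powr a / a / Gamma a)) {0..q}"
      by (intro has_integral_divide) simp
    moreover have "q powr a / a / Gamma a = q powr a / Gamma (a + 1)" unfolding G by simp
    ultimately have hi: "((\<lambda>x. x powr (a - 1) / Gamma a) has_integral (q powr a / Gamma (a + 1))) {0..q}" by (simp only:)
    have "(\<integral>\<^sup>+x. ennreal (x powr (a - 1) / Gamma a) * indicator {0..q} x \<partial>lborel) = ennreal (q powr a / Gamma (a + 1))"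
    proof -
      have "(\<integral>\<^sup>+x. ennreal (x powr (a - 1) / Gamma a) * indicator {0..q} x \<partial>lborel) =
          (\<integral>\<^sup>+x. ennreal (indicator {0..q} x * (x powr (a - 1) / Gamma a)) \<partial>lborel)"
        by (intro nn_integral_cong) (auto simp: indicator_def)
      also have "\<dots> = ennreal (q powr a / Gamma (a + 1))"
        by (rule nn_integral_has_integral_lebesgue[OF _ hi]) (use G0 in auto)
      finally show ?thesis .
    qed
    also have "(\<integral>\<^sup>+x. ennreal (x powr (a - 1) / Gamma a) * indicator {0..q} x \<partial>lborel) =
        (\<integral>\<^sup>+y. ennreal (indicator {0<..q} y * ker a y) \<partial>lborel)"
    proof (rule nn_integral_cong)
      fix x :: real
      show "ennreal (x powr (a - 1) / Gamma a) * indicator {0..q} x = ennreal (indicator {0<..q} x * ker a x)"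
        by (cases "x = 0") (auto simp: ker_def indicator_def)
    qed
    finally show ?thesis .
  qed
  have q0: "q \<ge> 0" using p by simp
  have le: "p powr a / Gamma (a + 1) \<le> q powr a / Gamma (a + 1)"
    using a p by (intro divide_right_mono powr_mono2 Gamma_real_nonneg) auto
  have pn: "p powr a / Gamma (a + 1) \<ge> 0" using a by (intro divide_nonneg_nonneg Gamma_real_nonneg) auto
  have "ennreal (q powr a / Gamma (a + 1)) = (\<integral>\<^sup>+y. ennreal (indicator {0<..p} y * ker a y) + ennreal (indicator {p<..q} y * ker a y) \<partial>lborel)"
    unfolding base[OF q0, symmetric]
  proof (rule nn_integral_cong)
    fix y :: real
    have "indicator {0<..q} y * ker a y = indicator {0<..p} y * ker a y + indicator {p<..q} y * ker a y"
      using p by (auto simp: indicator_def)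
    thus "ennreal (indicator {0<..q} y * ker a y) = ennreal (indicator {0<..p} y * ker a y) + ennreal (indicator {p<..q} y * ker a y)"
      using ker_nonneg[OF a] by (simp add: ennreal_plus[symmetric] del: ennreal_plus)
  qed
  also have "\<dots> = ennreal (p powr a / Gamma (a + 1)) + (\<integral>\<^sup>+y. ennreal (indicator {p<..q} y * ker a y) \<partial>lborel)"
    unfolding base[OF p(1), symmetric] by (rule nn_integral_add) auto
  finally have "ennreal (p powr a / Gamma (a + 1)) + (\<integral>\<^sup>+y. ennreal (indicator {p<..q} y * ker a y) \<partial>lborel) =
      ennreal (p powr a / Gamma (a + 1)) + ennreal (q powr a / Gamma (a + 1) - p powr a / Gamma (a + 1))"
    using le pn by (simp add: ennreal_plus[symmetric] del: ennreal_plus)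
  thus ?thesis by (simp only: ennreal_add_left_cancel) auto
qed

text \<open>After y = w * t this is the Beta integral.\<close>

lemma ker_convolution:
  assumes a: "a > 0" and b: "b > 0"
  shows "(\<integral>\<^sup>+y. ennreal (ker a y) * ennreal (ker b (w - y)) \<partial>lborel) = ennreal (ker (a + b) w)"
proof (cases "w > 0")
  case False
  have "ennreal (ker a y) * ennreal (ker b (w - y)) = 0" for y
    using False by (auto simp: ker_def indicator_def)
  hence "(\<integral>\<^sup>+y. ennreal (ker a y) * ennreal (ker b (w - y)) \<partial>lborel) = 0" by (simp only: nn_integral_const mult_zero_left)
  thus ?thesis using False by (simp add: ker_def)
next
  case True
  have pos: "Gamma a > 0" "Gamma b > 0" "Gamma (a + b) > 0" using a b by (auto intro!: Gamma_real_pos)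
  have "((\<lambda>t. t powr (a - 1) * (1 - t) powr (b - 1)) has_integral Beta a b) {0..1}"
    by (rule has_integral_Beta_real) (use a b in auto)
  hence B: "(\<integral>\<^sup>+t. ennreal (t powr (a - 1) * (1 - t) powr (b - 1)) * indicator {0..1} t \<partial>lborel) = ennreal (Beta a b)"
    using nn_integral_has_integral_lebesgue[of "{0..1}" "\<lambda>t. t powr (a - 1) * (1 - t) powr (b - 1)"]
    by (simp add: ennreal_mult'' ennreal_indicator mult.commute)
  define W where "W = w powr (a + b - 1) / (Gamma a * Gamma b)"
  have "(\<integral>\<^sup>+y. ennreal (ker a y) * ennreal (ker b (w - y)) \<partial>lborel) =
      ennreal \<bar>w\<bar> * (\<integral>\<^sup>+t. ennreal (ker a (0 + w * t)) * ennreal (ker b (w - (0 + w * t))) \<partial>lborel)"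
    by (rule nn_integral_real_affine) (use True in auto)
  also have "\<dots> = (\<integral>\<^sup>+t. ennreal w * (ennreal (ker a (w * t)) * ennreal (ker b (w - w * t))) \<partial>lborel)"
    using True by (subst nn_integral_cmult[symmetric]) auto
  also have "\<dots> = (\<integral>\<^sup>+t. ennreal W * (ennreal (t powr (a - 1) * (1 - t) powr (b - 1)) * indicator {0..1} t) \<partial>lborel)"
  proof (rule nn_integral_cong)
    fix t :: real
    consider "t \<le> 0" "t \<noteq> 0" | "t = 0" | "t > 0" "t < 1" | "t \<ge> 1" "t \<noteq> 1" | "t = 1" by linarith
    thus "ennreal w * (ennreal (ker a (w * t)) * ennreal (ker b (w - w * t))) =
        ennreal W * (ennreal (t powr (a - 1) * (1 - t) powr (b - 1)) * indicator {0..1} t)"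
    proof cases
      case 3
      have e: "w - w * t = w * (1 - t)" by (simp add: algebra_simps)
      have p: "w * t > 0" "w * (1 - t) > 0" using True 3 by auto
      have "w * (ker a (w * t) * ker b (w - w * t)) = W * (t powr (a - 1) * (1 - t) powr (b - 1))"
      proof -
        have ww: "w powr (a + b - 1) = w powr 1 * w powr (a - 1) * w powr (b - 1)"
          unfolding powr_add[symmetric] by (simp add: algebra_simps)
        show ?thesis unfolding e W_def ww using p 3 True by (simp add: ker_def powr_mult)
      qed
      thus ?thesis using True 3 pos
        by (simp add: ennreal_mult'[symmetric] W_def ker_nonneg a b less_imp_le)
    qed (use True in \<open>auto simp: ker_def zero_less_mult_iff mult_less_cancel_left\<close>)
  qed
  also have "\<dots> = ennreal W * ennreal (Beta a b)" unfolding B[symmetric] by (rule nn_integral_cmult) measurable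
  also have "\<dots> = ennreal (ker (a + b) w)"
  proof -
    have "W * Beta a b = ker (a + b) w" using True pos unfolding W_def Beta_def ker_def by simp
    thus ?thesis using pos unfolding W_def by (subst ennreal_mult'[symmetric]) (auto simp: less_imp_le)
  qed
  finally show ?thesis .
qed

text \<open>Cut-offs only decrease the integral, and without them it is an iterated
  \<open>ker_convolution\<close>.\<close>

lemma Qn_ker_le:
  assumes "finite J" "a > 0" "b > 0"
  shows "Qn a J U (\<lambda>w. ennreal (ker b w)) w \<le> ennreal (ker (real (card J) * a + b) w)"
  using assms(1)
proof (induction J arbitrary: w rule: finite_induct)
  case (insert j J)
  have "Qn a (insert j J) U (\<lambda>w. ennreal (ker b w)) w =
      (\<integral>\<^sup>+y. ennreal (kerU a (U j) y) * Qn a J U (\<lambda>w. ennreal (ker b w)) (w - y) \<partial>lborel)"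
    by (rule Qn_insert[OF insert.hyps]) measurable
  also have "\<dots> \<le> (\<integral>\<^sup>+y. ennreal (ker a y) * ennreal (ker (real (card J) * a + b) (w - y)) \<partial>lborel)"
    using assms by (intro nn_integral_mono mult_mono insert.IH ennreal_leI kerU_le_ker) auto
  also have "\<dots> = ennreal (ker (a + (real (card J) * a + b)) w)"
    using assms by (intro ker_convolution add_nonneg_pos) auto
  finally show ?case using insert.hyps by (simp add: algebra_simps)
qed simp

text \<open>All coordinates that contribute are at most w, where these cut-offs are not
  felt.\<close>

lemma Qn_ker_eq:
  assumes "finite J" "a > 0" "b > 0" "\<And>i. i \<in> J \<Longrightarrow> U i \<ge> w"
  shows "Qn a J U (\<lambda>w. ennreal (ker b w)) w = ennreal (ker (real (card J) * a + b) w)"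
  using assms(1,4)
proof (induction J arbitrary: w rule: finite_induct)
  case (insert j J)
  have "Qn a (insert j J) U (\<lambda>w. ennreal (ker b w)) w =
      (\<integral>\<^sup>+y. ennreal (kerU a (U j) y) * Qn a J U (\<lambda>w. ennreal (ker b w)) (w - y) \<partial>lborel)"
    by (rule Qn_insert[OF insert.hyps]) measurable
  also have "\<dots> = (\<integral>\<^sup>+y. ennreal (ker a y) * ennreal (ker (real (card J) * a + b) (w - y)) \<partial>lborel)"
  proof (rule nn_integral_cong)
    fix y :: real
    consider "y \<le> 0" | "y > 0" "y \<le> w" | "y > w" by linarith
    thus "ennreal (kerU a (U j) y) * Qn a J U (\<lambda>w. ennreal (ker b w)) (w - y) =
        ennreal (ker a y) * ennreal (ker (real (card J) * a + b) (w - y))"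
    proof cases
      case 2
      have "Qn a J U (\<lambda>w. ennreal (ker b w)) (w - y) = ennreal (ker (real (card J) * a + b) (w - y))"
        by (rule insert.IH) (use insert.prems 2 in force)
      moreover have "kerU a (U j) y = ker a y" using insert.prems[of j] 2 by (simp add: kerU_def)
      ultimately show ?thesis by simp
    next
      case 3
      have "Qn a J U (\<lambda>w. ennreal (ker b w)) (w - y) \<le> ennreal (ker (real (card J) * a + b) (w - y))"
        using insert.hyps assms by (intro Qn_ker_le) auto
      also have "ker (real (card J) * a + b) (w - y) = 0" using 3 by (simp add: ker_def)
      finally show ?thesis using 3 by (simp add: ker_def)
    qed (simp add: kerU_def ker_def)
  qed
  also have "\<dots> = ennreal (ker (a + (real (card J) * a + b)) w)"
    using assms by (intro ker_convolution add_nonneg_pos) auto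
  finally show ?case using insert.hyps by (simp add: algebra_simps)
qed simp

text \<open>w powr a / Gamma (a + 1) is the primitive of \<open>ker a\<close>, the continuous
  counterpart of \<open>Lf a\<close>. It drops to 0 beyond U: a logarithmically weighted sum over
  one coordinate is carried by values near the largest one the product allows, and a smaller cut-off
  excludes these.\<close>

definition gcut :: "real \<Rightarrow> real \<Rightarrow> real \<Rightarrow> real" where
  "gcut a U w = indicator {0<..U} w * (w powr a / Gamma (a + 1))"

lemma gcut_measurable [measurable]: "gcut a U \<in> borel_measurable borel"
  unfolding gcut_def[abs_def] by measurable

lemma gcut_nonneg: "a > 0 \<Longrightarrow> gcut a U w \<ge> 0"
  unfolding gcut_def by (intro mult_nonneg_nonneg divide_nonneg_nonneg Gamma_real_nonneg) auto

text \<open>The continuous counterpart of \<open>tz_rec\<close>: multiplying the kernel by its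
  argument is a times convolution with the density 1, which stands for Lambda on the logarithmic
  scale.\<close>

lemma gcut_eq_ker:
  assumes "a > 0"
  shows "a * gcut a U w = w * kerU a U w"
proof -
  have G: "Gamma (a + 1) = a * Gamma a" using assms by (intro Gamma_plus1) (auto elim!: nonpos_Ints_cases)
  have "Gamma a > 0" using assms by (rule Gamma_real_pos)
  moreover have "w powr a = w * w powr (a - 1)" if "w > 0"
    using powr_add[of w 1 "a - 1"] that by simp
  ultimately show ?thesis unfolding gcut_def kerU_def ker_def G using assms
    by (auto simp: indicator_def)
qed

lemma prod_kerU_eq_0:
  assumes "finite J" "i \<in> J" "\<not> v i > 0"
  shows "(\<Prod>i\<in>J. ennreal (kerU a (U i) (v i))) = 0"
proof -
  have "ennreal (kerU a (U i) (v i)) = 0" using assms by (simp add: kerU_def ker_def)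
  thus ?thesis using assms by (intro prod_zero) blast+
qed

text \<open>L is the sum of all v j and of the determined coordinate L - sum. By
  \<open>gcut_eq_ker\<close> the latter turns its own kernel into \<open>gcut\<close>; each v j does
  the same for coordinate j, which then changes places with k. The exchange is legitimate because U
  k >= L leaves k without an effective cut-off.\<close>

lemma Qn_derivation:
  assumes J: "finite J" "k \<notin> J" and a: "a > 0" and L: "L > 0" "U k \<ge> L"
  shows "ennreal L * Qn a J U (\<lambda>w. ennreal (ker a w)) L =
         (\<Sum>j\<in>insert k J. ennreal a * Qn a (insert k J - {j}) U (\<lambda>w. ennreal (gcut a (U j) w)) L)"
proof -
  let ?PJ = "\<lambda>J v. (\<Prod>i\<in>J. ennreal (kerU a (U i) (v i)))"
  have split: "ennreal L * (?PJ J v * ennreal (ker a (L - (\<Sum>i\<in>J. v i)))) =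
      ennreal a * (?PJ J v * ennreal (gcut a (U k) (L - (\<Sum>i\<in>J. v i)))) +
      (\<Sum>j\<in>J. ennreal (v j) * (?PJ J v * ennreal (ker a (L - (\<Sum>i\<in>J. v i)))))" for v
  proof (cases "\<forall>i\<in>J. v i > 0")
    case False
    then obtain i where "i \<in> J" "\<not> v i > 0" by auto
    hence "?PJ J v = 0" using prod_kerU_eq_0[OF J(1)] by blast
    thus ?thesis by (simp only: mult_zero_left mult_zero_right sum.neutral_const add_0)
  next
    case True
    define S where "S = (\<Sum>i\<in>J. v i)"
    have S: "S \<ge> 0" unfolding S_def using True by (intro sum_nonneg) auto
    show ?thesis
    proof (cases "L - S > 0")
      case False
      thus ?thesis unfolding S_def[symmetric] by (simp add: ker_def gcut_def)
    next
      case LS: True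
      have g: "a * gcut a (U k) (L - S) = (L - S) * ker a (L - S)"
        using gcut_eq_ker[OF a, of "U k" "L - S"] L S by (simp add: kerU_def)
      have "ennreal L = ennreal (L - S) + (\<Sum>j\<in>J. ennreal (v j))"
        using LS S True by (simp add: sum_ennreal[symmetric] S_def[symmetric] ennreal_plus[symmetric] less_imp_le del: ennreal_plus)
      hence "ennreal L * (?PJ J v * ennreal (ker a (L - S))) =
          ennreal (L - S) * (?PJ J v * ennreal (ker a (L - S))) + (\<Sum>j\<in>J. ennreal (v j)) * (?PJ J v * ennreal (ker a (L - S)))"
        by (simp only: distrib_right)
      also have "ennreal (L - S) * (?PJ J v * ennreal (ker a (L - S))) = ?PJ J v * ennreal ((L - S) * ker a (L - S))"
        using LS by (simp add: ennreal_mult' mult_ac)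
      also have "\<dots> = ennreal a * (?PJ J v * ennreal (gcut a (U k) (L - S)))"
        unfolding g[symmetric] using a by (simp add: ennreal_mult' mult_ac)
      finally show ?thesis unfolding S_def by (simp only: sum_distrib_right)
    qed
  qed
  have jterm: "(\<integral>\<^sup>+v. ennreal (v j) * (?PJ J v * ennreal (ker a (L - (\<Sum>i\<in>J. v i)))) \<partial>(\<Pi>\<^sub>M i\<in>J. lborel)) =
      ennreal a * Qn a (insert k J - {j}) U (\<lambda>w. ennreal (gcut a (U j) w)) L" if j: "j \<in> J" for j
  proof -
    define J' where "J' = J - {j}"
    have J': "finite J'" "j \<notin> J'" "k \<notin> J'" "J = insert j J'" "insert k J - {j} = insert k J'"
      using J j by (auto simp: J'_def)
    have upd: "?PJ J' (x(m := y)) = ?PJ J' x" "(\<Sum>i\<in>J'. (x(m := y)) i) = (\<Sum>i\<in>J'. x i)" if "m \<notin> J'" for x m and y :: real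
      using that by (auto intro!: prod.cong sum.cong)
    have "(\<integral>\<^sup>+v. ennreal (v j) * (?PJ J v * ennreal (ker a (L - (\<Sum>i\<in>J. v i)))) \<partial>(\<Pi>\<^sub>M i\<in>J. lborel)) =
        (\<integral>\<^sup>+x. \<integral>\<^sup>+y. ennreal ((x(j := y)) j) * (?PJ J (x(j := y)) * ennreal (ker a (L - (\<Sum>i\<in>J. (x(j := y)) i)))) \<partial>lborel \<partial>(\<Pi>\<^sub>M i\<in>J'. lborel))"
      unfolding J'(4) by (rule lb.product_nn_integral_insert[OF J'(1,2)]) measurable
    also have "\<dots> = (\<integral>\<^sup>+x. \<integral>\<^sup>+y. ennreal a * (?PJ (insert k J') (x(k := y)) * ennreal (gcut a (U j) (L - (\<Sum>i\<in>insert k J'. (x(k := y)) i)))) \<partial>lborel \<partial>(\<Pi>\<^sub>M i\<in>J'. lborel))"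
    proof (rule nn_integral_cong)
      fix x :: "nat \<Rightarrow> real"
      define S where "S = L - (\<Sum>i\<in>J'. x i)"
      have l: "(\<integral>\<^sup>+y. ennreal ((x(j := y)) j) * (?PJ J (x(j := y)) * ennreal (ker a (L - (\<Sum>i\<in>J. (x(j := y)) i)))) \<partial>lborel) =
          (\<integral>\<^sup>+y. ?PJ J' x * ennreal (y * kerU a (U j) y * ker a (S - y)) \<partial>lborel)"
      proof (rule nn_integral_cong)
        fix y :: real
        have "(\<Sum>i\<in>J. (x(j := y)) i) = y + (\<Sum>i\<in>J'. x i)" unfolding J'(4) using J' upd(2)[of j] by simp
        moreover have "?PJ J (x(j := y)) = ennreal (kerU a (U j) y) * ?PJ J' x" unfolding J'(4) using J' upd(1)[of j] by simp
        moreover have "ennreal y * ennreal (kerU a (U j) y) = ennreal (y * kerU a (U j) y)"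
        proof (cases "y \<ge> 0")
          case True
          thus ?thesis by (simp only: ennreal_mult')
        qed (simp add: kerU_def ker_def)
        moreover have "y * kerU a (U j) y \<ge> 0" unfolding gcut_eq_ker[OF a, symmetric] using a gcut_nonneg[OF a] by simp
        moreover have "L - (y + (\<Sum>i\<in>J'. x i)) = S - y" by (simp add: S_def)
        ultimately show "ennreal ((x(j := y)) j) * (?PJ J (x(j := y)) * ennreal (ker a (L - (\<Sum>i\<in>J. (x(j := y)) i)))) =
            ?PJ J' x * ennreal (y * kerU a (U j) y * ker a (S - y))"
          by (simp only: fun_upd_same ennreal_mult' mult.assoc[symmetric]) (simp only: mult_ac)
      qed
      have r: "(\<integral>\<^sup>+y. ennreal a * (?PJ (insert k J') (x(k := y)) * ennreal (gcut a (U j) (L - (\<Sum>i\<in>insert k J'. (x(k := y)) i)))) \<partial>lborel) =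
          (\<integral>\<^sup>+y. ?PJ J' x * ennreal (kerU a (U k) y * (a * gcut a (U j) (S - y))) \<partial>lborel)"
      proof (rule nn_integral_cong)
        fix y :: real
        have "(\<Sum>i\<in>insert k J'. (x(k := y)) i) = y + (\<Sum>i\<in>J'. x i)" using J' upd(2)[of k] by simp
        moreover have "?PJ (insert k J') (x(k := y)) = ennreal (kerU a (U k) y) * ?PJ J' x" using J' upd(1)[of k] by simp
        ultimately show "ennreal a * (?PJ (insert k J') (x(k := y)) * ennreal (gcut a (U j) (L - (\<Sum>i\<in>insert k J'. (x(k := y)) i)))) =
            ?PJ J' x * ennreal (kerU a (U k) y * (a * gcut a (U j) (S - y)))"
          using a by (simp add: S_def ennreal_mult' diff_diff_eq algebra_simps gcut_nonneg kerU_nonneg)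
      qed
      \<comment> \<open>The reflection of y to S - y exchanges coordinate j with the determined
        one.\<close>
      have "(\<integral>\<^sup>+y. ?PJ J' x * ennreal (y * kerU a (U j) y * ker a (S - y)) \<partial>lborel) =
          ennreal \<bar>-1\<bar> * (\<integral>\<^sup>+y. ?PJ J' x * ennreal ((S + (-1) * y) * kerU a (U j) (S + (-1) * y) * ker a (S - (S + (-1) * y))) \<partial>lborel)"
        by (rule nn_integral_real_affine) auto
      also have "\<dots> = (\<integral>\<^sup>+y. ?PJ J' x * ennreal (kerU a (U k) y * (a * gcut a (U j) (S - y))) \<partial>lborel)"
      proof -
        have "?PJ J' x * ennreal ((S + (-1) * y) * kerU a (U j) (S + (-1) * y) * ker a (S - (S + (-1) * y))) =
            ?PJ J' x * ennreal (kerU a (U k) y * (a * gcut a (U j) (S - y)))" for y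
        proof (cases "\<forall>i\<in>J'. x i > 0")
          case False
          then obtain i where "i \<in> J'" "\<not> x i > 0" by auto
          hence "?PJ J' x = 0" using prod_kerU_eq_0[OF J'(1)] by blast
          thus ?thesis by (simp only: mult_zero_left)
        next
          case True
          have "S \<le> L" unfolding S_def using True by (auto intro!: sum_nonneg)
          have eq: "ker a y * ((S - y) * kerU a (U j) (S - y)) = kerU a (U k) y * ((S - y) * kerU a (U j) (S - y))"
          proof (cases "S - y > 0")
            case True
            hence "y \<le> U k" using \<open>S \<le> L\<close> L by linarith
            thus ?thesis by (simp add: kerU_def)
          qed (simp add: kerU_def ker_def)
          have e: "S + (-1) * y = S - y" "S - (S - y) = y" by auto
          have "(S - y) * kerU a (U j) (S - y) * ker a y = kerU a (U k) y * ((S - y) * kerU a (U j) (S - y))"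
            by (subst mult.commute) (rule eq)
          thus ?thesis unfolding gcut_eq_ker[OF a] e by (simp only:)
        qed
        thus ?thesis by simp
      qed
      finally show "(\<integral>\<^sup>+y. ennreal ((x(j := y)) j) * (?PJ J (x(j := y)) * ennreal (ker a (L - (\<Sum>i\<in>J. (x(j := y)) i)))) \<partial>lborel) =
          (\<integral>\<^sup>+y. ennreal a * (?PJ (insert k J') (x(k := y)) * ennreal (gcut a (U j) (L - (\<Sum>i\<in>insert k J'. (x(k := y)) i)))) \<partial>lborel)"
        unfolding l r .
    qed
    also have "\<dots> = (\<integral>\<^sup>+v. ennreal a * (?PJ (insert k J') v * ennreal (gcut a (U j) (L - (\<Sum>i\<in>insert k J'. v i)))) \<partial>(\<Pi>\<^sub>M i\<in>insert k J'. lborel))"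
      by (rule lb.product_nn_integral_insert[OF J'(1,3), symmetric]) measurable
    also have "\<dots> = ennreal a * Qn a (insert k J - {j}) U (\<lambda>w. ennreal (gcut a (U j) w)) L"
      unfolding Qn_def J'(5) by (rule nn_integral_cmult) measurable
    finally show ?thesis .
  qed
  have "ennreal L * Qn a J U (\<lambda>w. ennreal (ker a w)) L =
      (\<integral>\<^sup>+v. ennreal L * (?PJ J v * ennreal (ker a (L - (\<Sum>i\<in>J. v i)))) \<partial>(\<Pi>\<^sub>M i\<in>J. lborel))"
    unfolding Qn_def by (rule nn_integral_cmult[symmetric]) measurable
  also have "\<dots> = (\<integral>\<^sup>+v. ennreal a * (?PJ J v * ennreal (gcut a (U k) (L - (\<Sum>i\<in>J. v i)))) \<partial>(\<Pi>\<^sub>M i\<in>J. lborel)) +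
      (\<integral>\<^sup>+v. (\<Sum>j\<in>J. ennreal (v j) * (?PJ J v * ennreal (ker a (L - (\<Sum>i\<in>J. v i))))) \<partial>(\<Pi>\<^sub>M i\<in>J. lborel))"
    unfolding split by (rule nn_integral_add) measurable
  also have "(\<integral>\<^sup>+v. ennreal a * (?PJ J v * ennreal (gcut a (U k) (L - (\<Sum>i\<in>J. v i)))) \<partial>(\<Pi>\<^sub>M i\<in>J. lborel)) =
      ennreal a * Qn a (insert k J - {k}) U (\<lambda>w. ennreal (gcut a (U k) w)) L"
    using J unfolding Qn_def by (subst nn_integral_cmult[symmetric]) auto
  also have "(\<integral>\<^sup>+v. (\<Sum>j\<in>J. ennreal (v j) * (?PJ J v * ennreal (ker a (L - (\<Sum>i\<in>J. v i))))) \<partial>(\<Pi>\<^sub>M i\<in>J. lborel)) =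
      (\<Sum>j\<in>J. ennreal a * Qn a (insert k J - {j}) U (\<lambda>w. ennreal (gcut a (U j) w)) L)"
    by (subst nn_integral_sum) (auto simp: jterm)
  finally show ?thesis using J by simp
qed

text \<open>The product is singular at both ends of {0..L}. Splitting at L / 2 leaves one
  singularity at a time: the other factor is bounded by its value at L / 2, and the singular one
  only grows when the window is pushed to its end. The resulting (D / L) powr (1 - a) is absorbed by
  (D / L) powr a since a <= 1/2 and D <= L.\<close>

lemma interval_kernel_bound:
  assumes a: "0 < a" "a \<le> 1 / 2" and L: "L > 0" and pq: "p \<le> q"
  shows "(\<integral>\<^sup>+y. ennreal (indicator {p<..q} y * ker a y) * ennreal (ker (1 - a) (L - y)) \<partial>lborel)
    \<le> ennreal (4 / (Gamma (a + 1) * Gamma (1 - a)) + 4 / (Gamma a * Gamma (2 - a))) * ennreal (((q - p) / L) powr a)"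
proof -
  define p' q' where "p' = max p 0" and "q' = min q L"
  have G: "Gamma a > 0" "Gamma (1 - a) > 0" "Gamma (a + 1) > 0" "Gamma (2 - a) > 0"
    using a by (auto intro!: Gamma_real_pos)
  let ?f = "\<lambda>y. ennreal (indicator {p<..q} y * ker a y) * ennreal (ker (1 - a) (L - y))"
  show ?thesis
  proof (cases "p' \<le> q'")
    case False
    have z: "?f y = 0" for y
      using False unfolding p'_def q'_def ker_def by (auto simp: indicator_def)
    show ?thesis unfolding z by simp
  next
    case True
    define D where "D = q' - p'"
    have D: "D \<ge> 0" "D \<le> q - p" "D \<le> L" using True pq L unfolding D_def p'_def q'_def by auto
    define K1 where "K1 = (L / 2) powr (- a) / Gamma (1 - a)"
    define K2 where "K2 = (L / 2) powr (a - 1) / Gamma a"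
    have K: "K1 \<ge> 0" "K2 \<ge> 0" using G by (auto simp: K1_def K2_def)
    \<comment> \<open>The single point y = q' is left out because the shifted kernel on the right is
      0 there; it is a null set.\<close>
    have pw: "?f y \<le> ennreal K1 * ennreal (indicator {0<..D} (y - p') * ker a (y - p')) +
        ennreal K2 * ennreal (indicator {0<..D} (q' - y) * ker (1 - a) (q' - y))" if ne: "y \<noteq> q'" for y
    proof (cases "p' < y \<and> y < q'")
      case False
      have "?f y = 0" using False ne unfolding p'_def q'_def ker_def by (auto simp: indicator_def)
      thus ?thesis by (simp only: zero_le)
    next
      case y: True
      have y0: "0 < y" "y < L" "p < y" "y \<le> q" using y unfolding p'_def q'_def by auto
      have kk: "?f y = ennreal (ker a y * ker (1 - a) (L - y))"
        using y0 a by (simp add: ennreal_mult' ker_nonneg)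
      have i1: "indicator {0<..D} (y - p') = (1::real)" "indicator {0<..D} (q' - y) = (1::real)"
        using y unfolding D_def by auto
      show ?thesis
      proof (cases "y \<le> L / 2")
        case True
        have "ker (1 - a) (L - y) \<le> K1"
          using True y0 a L G unfolding ker_def K1_def by (simp, intro divide_right_mono powr_mono2') auto
        moreover have "ker a y \<le> ker a (y - p')"
          using y y0 a G unfolding ker_def by (simp, intro divide_right_mono powr_mono2') (auto simp: p'_def)
        ultimately have "ker a y * ker (1 - a) (L - y) \<le> ker a (y - p') * K1"
          using a by (intro mult_mono ker_nonneg) auto
        hence "?f y \<le> ennreal K1 * ennreal (ker a (y - p'))"
          unfolding kk using K by (simp add: ennreal_mult'[symmetric] mult.commute ennreal_leI)
        thus ?thesis unfolding i1 by (simp add: add_increasing2)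
      next
        case False
        have "ker a y \<le> K2"
          using False y0 a L G unfolding ker_def K2_def by (simp, intro divide_right_mono powr_mono2') auto
        moreover have "ker (1 - a) (L - y) \<le> ker (1 - a) (q' - y)"
          using y y0 a G unfolding ker_def by (simp, intro divide_right_mono powr_mono2') (auto simp: q'_def)
        ultimately have "ker a y * ker (1 - a) (L - y) \<le> K2 * ker (1 - a) (q' - y)"
          using a K by (intro mult_mono ker_nonneg) auto
        hence "?f y \<le> ennreal K2 * ennreal (ker (1 - a) (q' - y))"
          unfolding kk using K by (simp add: ennreal_mult'[symmetric] ennreal_leI)
        thus ?thesis unfolding i1 by (simp add: add_increasing)
      qed
    qed
    have s1: "(\<integral>\<^sup>+y. ennreal (indicator {0<..D} (y - p') * ker a (y - p')) \<partial>lborel) = ennreal (D powr a / Gamma (a + 1))"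
    proof -
      have "(\<integral>\<^sup>+y. ennreal (indicator {0<..D} (y - p') * ker a (y - p')) \<partial>lborel) =
          ennreal \<bar>1\<bar> * (\<integral>\<^sup>+y. ennreal (indicator {0<..D} ((p' + 1 * y) - p') * ker a ((p' + 1 * y) - p')) \<partial>lborel)"
        by (rule nn_integral_real_affine) auto
      thus ?thesis using nn_integral_ker_Ioc[of a 0 D] a D by simp
    qed
    have s2: "(\<integral>\<^sup>+y. ennreal (indicator {0<..D} (q' - y) * ker (1 - a) (q' - y)) \<partial>lborel) = ennreal (D powr (1 - a) / Gamma (2 - a))"
    proof -
      have "(\<integral>\<^sup>+y. ennreal (indicator {0<..D} (q' - y) * ker (1 - a) (q' - y)) \<partial>lborel) =
          ennreal \<bar>-1\<bar> * (\<integral>\<^sup>+y. ennreal (indicator {0<..D} (q' - (q' + (-1) * y)) * ker (1 - a) (q' - (q' + (-1) * y))) \<partial>lborel)"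
        by (rule nn_integral_real_affine) auto
      thus ?thesis using nn_integral_ker_Ioc[of "1 - a" 0 D] a D by simp
    qed
    have "(\<integral>\<^sup>+y. ?f y \<partial>lborel) \<le> (\<integral>\<^sup>+y. ennreal K1 * ennreal (indicator {0<..D} (y - p') * ker a (y - p')) +
        ennreal K2 * ennreal (indicator {0<..D} (q' - y) * ker (1 - a) (q' - y)) \<partial>lborel)"
    proof (rule nn_integral_mono_AE)
      have "AE y in lborel. y \<noteq> q'" by (rule AE_lborel_singleton)
      thus "AE y in lborel. ?f y \<le> ennreal K1 * ennreal (indicator {0<..D} (y - p') * ker a (y - p')) +
        ennreal K2 * ennreal (indicator {0<..D} (q' - y) * ker (1 - a) (q' - y))"
        by eventually_elim (rule pw)
    qed
    also have "\<dots> = ennreal K1 * ennreal (D powr a / Gamma (a + 1)) + ennreal K2 * ennreal (D powr (1 - a) / Gamma (2 - a))"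
      unfolding s1[symmetric] s2[symmetric] by (subst nn_integral_add) (auto simp: nn_integral_cmult)
    also have "\<dots> = ennreal (K1 * (D powr a / Gamma (a + 1)) + K2 * (D powr (1 - a) / Gamma (2 - a)))"
    proof -
      have "D powr a / Gamma (a + 1) \<ge> 0" "D powr (1 - a) / Gamma (2 - a) \<ge> 0" using G by auto
      thus ?thesis using K by (simp only: ennreal_mult' ennreal_plus mult_nonneg_nonneg)
    qed
    also have "\<dots> \<le> ennreal ((4 / (Gamma (a + 1) * Gamma (1 - a)) + 4 / (Gamma a * Gamma (2 - a))) * ((q - p) / L) powr a)"
    proof (rule ennreal_leI)
      define R where "R = (q - p) / L"
      have DR: "D / L \<le> R" "D / L \<le> 1" "D / L \<ge> 0" using D L unfolding R_def by (auto intro: divide_right_mono)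
      have h: "(L / 2) powr (- b) = 2 powr b * L powr (- b)" for b
        using L by (simp add: powr_divide powr_minus field_simps)
      have two: "2 powr b \<le> 4" if "b \<le> 1" for b :: real
        using powr_mono[of b 2 "2::real"] that by (simp add: powr_numeral)
      have e: "L powr (- b) * D powr b = (D / L) powr b" for b
        using D L by (simp add: powr_divide powr_minus field_simps)
      have t1: "K1 * (D powr a / Gamma (a + 1)) = 2 powr a * (D / L) powr a / (Gamma (a + 1) * Gamma (1 - a))"
        unfolding K1_def h e[symmetric] by (simp add: mult_ac)
      have t2: "K2 * (D powr (1 - a) / Gamma (2 - a)) = 2 powr (1 - a) * (D / L) powr (1 - a) / (Gamma a * Gamma (2 - a))"
        unfolding K2_def using h[of "1 - a"] e[of "1 - a", symmetric] by (simp add: mult_ac)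
      have m1: "(D / L) powr a \<le> R powr a" using DR a by (intro powr_mono2) auto
      have m2: "(D / L) powr (1 - a) \<le> R powr a"
      proof -
        have "(D / L) powr (1 - a) \<le> (D / L) powr a" using DR a by (intro powr_mono') auto
        thus ?thesis using m1 by linarith
      qed
      have "K1 * (D powr a / Gamma (a + 1)) \<le> 4 * R powr a / (Gamma (a + 1) * Gamma (1 - a))"
        unfolding t1 using G a m1 two[of a] by (intro divide_right_mono mult_mono) auto
      moreover have "K2 * (D powr (1 - a) / Gamma (2 - a)) \<le> 4 * R powr a / (Gamma a * Gamma (2 - a))"
        unfolding t2 using G a m2 two[of "1 - a"] by (intro divide_right_mono mult_mono) auto
      ultimately show "K1 * (D powr a / Gamma (a + 1)) + K2 * (D powr (1 - a) / Gamma (2 - a)) \<le>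
          (4 / (Gamma (a + 1) * Gamma (1 - a)) + 4 / (Gamma a * Gamma (2 - a))) * ((q - p) / L) powr a"
        unfolding R_def by (simp add: distrib_right)
    qed
    finally show ?thesis using G by (simp add: ennreal_mult')
  qed
qed

text \<open>When (card J + 1) * a = 1 this is the distribution function of the Dirichlet law at the
  points U i / L, the last coordinate being L minus the sum of the others.\<close>

definition Phi :: "real \<Rightarrow> nat set \<Rightarrow> (nat \<Rightarrow> real) \<Rightarrow> real \<Rightarrow> real" where
  "Phi a J U L = enn2real (Qn a J U (\<lambda>w. ennreal (ker a w)) L)"

lemma Qn_cong_U: "(\<And>i. i \<in> J \<Longrightarrow> U i = U' i) \<Longrightarrow> Qn a J U g w = Qn a J U' g w"
  unfolding Qn_def by simp

lemma Qn_ker_le_1: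
  assumes "finite J" "a > 0" "real (card J + 1) * a = 1" "L > 0"
  shows "Qn a J U (\<lambda>w. ennreal (ker a w)) L \<le> 1"
proof -
  have "real (card J) * a + a = 1" using assms(3) by (simp add: algebra_simps)
  thus ?thesis using Qn_ker_le[of J a a U L] assms by (simp add: ker_def)
qed

lemma Qn_eq_Phi:
  assumes "finite J" "a > 0" "real (card J + 1) * a = 1" "L > 0"
  shows "Qn a J U (\<lambda>w. ennreal (ker a w)) L = ennreal (Phi a J U L)"
proof -
  have "Qn a J U (\<lambda>w. ennreal (ker a w)) L < top" using Qn_ker_le_1[OF assms] by (rule le_less_trans) simp
  thus ?thesis unfolding Phi_def by simp
qed

lemma Phi_bounds:
  assumes "finite J" "a > 0" "real (card J + 1) * a = 1" "L > 0"
  shows "0 \<le> Phi a J U L" "Phi a J U L \<le> 1"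
  using Qn_ker_le_1[OF assms] unfolding Qn_eq_Phi[OF assms] by (auto simp: Phi_def)

lemma Phi_eq_1:
  assumes "finite J" "a > 0" "real (card J + 1) * a = 1" "L > 0" "\<And>i. i \<in> J \<Longrightarrow> U i \<ge> L"
  shows "Phi a J U L = 1"
proof -
  have "real (card J) * a + a = 1" using assms(3) by (simp add: algebra_simps)
  thus ?thesis using Qn_ker_eq[of J a a L U] assms unfolding Phi_def by (simp add: ker_def)
qed

lemma Phi_scale:
  assumes "finite J" "a > 0" "real (card J + 1) * a = 1" "L > 0"
  shows "Phi a J (\<lambda>i. L * u i) L = Phi a J u 1"
proof -
  have s: "ker a (L * w) = L powr (a - 1) * ker a w" for w
    using assms(4) by (cases "w > 0") (auto simp: ker_def powr_mult zero_less_mult_iff)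
  have "Qn a J (\<lambda>i. L * u i) (\<lambda>w. ennreal (ker a w)) (L * 1) =
      ennreal (L powr (real (card J) * a)) * Qn a J u (\<lambda>w. ennreal (ker a (L * w))) 1"
    by (rule Qn_scale) (use assms in auto)
  also have "Qn a J u (\<lambda>w. ennreal (ker a (L * w))) 1 = ennreal (L powr (a - 1)) * Qn a J u (\<lambda>w. ennreal (ker a w)) 1"
    unfolding s Qn_def by (subst nn_integral_cmult[symmetric]) (auto simp: ennreal_mult' mult_ac)
  also have "ennreal (L powr (real (card J) * a)) * (ennreal (L powr (a - 1)) * Qn a J u (\<lambda>w. ennreal (ker a w)) 1) =
      ennreal (L powr (real (card J) * a + (a - 1))) * Qn a J u (\<lambda>w. ennreal (ker a w)) 1"
    by (simp add: powr_add ennreal_mult' mult.assoc)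
  also have "real (card J) * a + (a - 1) = 0" using assms(3) by (simp add: algebra_simps)
  finally show ?thesis using assms(4) unfolding Phi_def by simp
qed

text \<open>Only points whose coordinate j lies between p and U j are lost. Dropping the other
  cut-offs there leaves the kernel \<open>ker (1 - a)\<close>, and
  \<open>interval_kernel_bound\<close> applies.\<close>

lemma Qn_change_cut:
  assumes J: "finite J" "j \<in> J" and a: "0 < a" "a \<le> 1 / 2" and card: "real (card J + 1) * a = 1" and L: "L > 0"
    and C: "C \<ge> 4 / (Gamma (a + 1) * Gamma (1 - a)) + 4 / (Gamma a * Gamma (2 - a))"
  shows "Qn a J U (\<lambda>w. ennreal (ker a w)) L \<le>
    Qn a J (U(j := p)) (\<lambda>w. ennreal (ker a w)) L + ennreal (C * (\<bar>U j - p\<bar> / L) powr a)"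
proof -
  define J' where "J' = J - {j}"
  have J': "finite J'" "j \<notin> J'" "J = insert j J'" using J by (auto simp: J'_def)
  have c: "real (card J') * a + a = 1 - a" using J' card by (simp add: algebra_simps)
  define f where "f = (\<lambda>w. ennreal (ker a w))"
  have fm [measurable]: "f \<in> borel_measurable borel" unfolding f_def by measurable
  note [measurable] = Qn_measurable[OF J'(1)]
  let ?D = "\<lambda>y. ennreal (indicator {p<..U j} y * ker a y) * ennreal (ker (1 - a) (L - y))"
  have "Qn a J U f L = (\<integral>\<^sup>+y. ennreal (kerU a (U j) y) * Qn a J' U f (L - y) \<partial>lborel)"
    unfolding J'(3) by (rule Qn_insert[OF J'(1,2) fm])
  also have "\<dots> \<le> (\<integral>\<^sup>+y. ennreal (kerU a p y) * Qn a J' (U(j := p)) f (L - y) + ?D y \<partial>lborel)"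
  proof (rule nn_integral_mono)
    fix y :: real
    have "kerU a (U j) y \<le> kerU a p y + indicator {p<..U j} y * ker a y"
      using ker_nonneg[OF a(1), of y] by (auto simp: kerU_def indicator_def)
    hence "ennreal (kerU a (U j) y) \<le> ennreal (kerU a p y) + ennreal (indicator {p<..U j} y * ker a y)"
      using ker_nonneg[OF a(1), of y] kerU_nonneg[OF a(1), of p y]
      by (simp add: ennreal_plus[symmetric] ennreal_leI del: ennreal_plus)
    hence "ennreal (kerU a (U j) y) * Qn a J' U f (L - y) \<le>
        (ennreal (kerU a p y) + ennreal (indicator {p<..U j} y * ker a y)) * Qn a J' U f (L - y)"
      by (rule mult_right_mono) simp
    also have "\<dots> = ennreal (kerU a p y) * Qn a J' (U(j := p)) f (L - y) + ennreal (indicator {p<..U j} y * ker a y) * Qn a J' U f (L - y)"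
      unfolding distrib_right using J' by (subst Qn_cong_U[of J' U "U(j := p)"]) auto
    also have "\<dots> \<le> ennreal (kerU a p y) * Qn a J' (U(j := p)) f (L - y) + ?D y"
    proof (intro add_left_mono mult_left_mono)
      show "Qn a J' U f (L - y) \<le> ennreal (ker (1 - a) (L - y))"
        using Qn_ker_le[OF J'(1) a(1) a(1), of U "L - y"] unfolding c f_def .
    qed simp
    finally show "ennreal (kerU a (U j) y) * Qn a J' U f (L - y) \<le> ennreal (kerU a p y) * Qn a J' (U(j := p)) f (L - y) + ?D y" .
  qed
  also have "\<dots> = (\<integral>\<^sup>+y. ennreal (kerU a p y) * Qn a J' (U(j := p)) f (L - y) \<partial>lborel) + (\<integral>\<^sup>+y. ?D y \<partial>lborel)"
    by (rule nn_integral_add) measurable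
  also have "(\<integral>\<^sup>+y. ennreal (kerU a p y) * Qn a J' (U(j := p)) f (L - y) \<partial>lborel) = Qn a J (U(j := p)) f L"
    unfolding J'(3) by (subst Qn_insert[OF J'(1,2) fm]) simp
  also have "(\<integral>\<^sup>+y. ?D y \<partial>lborel) \<le> ennreal (C * (\<bar>U j - p\<bar> / L) powr a)"
  proof (cases "p \<le> U j")
    case True
    have "(\<integral>\<^sup>+y. ?D y \<partial>lborel) \<le> ennreal (4 / (Gamma (a + 1) * Gamma (1 - a)) + 4 / (Gamma a * Gamma (2 - a))) * ennreal (((U j - p) / L) powr a)"
      by (rule interval_kernel_bound[OF a L True])
    also have "\<dots> \<le> ennreal C * ennreal (((U j - p) / L) powr a)"
      using C by (intro mult_right_mono ennreal_leI) auto
    finally show ?thesis using True by (simp add: ennreal_mult'')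
  next
    case False
    thus ?thesis by simp
  qed
  finally show ?thesis unfolding f_def by (simp only: add_left_mono)
qed

text \<open>The cut-offs are changed one at a time by \<open>Qn_change_cut\<close>. The
  \<open>obtains\<close> form fixes C from a alone, before J, U, U' and L.\<close>

lemma Phi_Holder:
  assumes a: "0 < a" "a \<le> 1 / 2"
  obtains C where "C \<ge> 0" "\<And>(J :: nat set) U U' (L :: real). finite J \<Longrightarrow> real (card J + 1) * a = 1 \<Longrightarrow> L > 0 \<Longrightarrow>
    \<bar>Phi a J U L - Phi a J U' L\<bar> \<le> C * (\<Sum>i\<in>J. (\<bar>U i - U' i\<bar> / L) powr a)"
proof -
  define C where "C = 4 / (Gamma (a + 1) * Gamma (1 - a)) + 4 / (Gamma a * Gamma (2 - a))"
  have G: "Gamma a > 0" "Gamma (1 - a) > 0" "Gamma (a + 1) > 0" "Gamma (2 - a) > 0"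
    using a by (auto intro!: Gamma_real_pos)
  hence C0: "C \<ge> 0" unfolding C_def by simp
  have one: "Phi a J U L \<le> Phi a J U' L + C * (\<Sum>i\<in>J. (\<bar>U i - U' i\<bar> / L) powr a)"
    if J: "finite J" "real (card J + 1) * a = 1" and L: "L > 0" for J :: "nat set" and U U' L
  proof -
    have "Qn a J U (\<lambda>w. ennreal (ker a w)) L \<le>
        Qn a J (\<lambda>i. if i \<in> S then U' i else U i) (\<lambda>w. ennreal (ker a w)) L + ennreal (C * (\<Sum>i\<in>S. (\<bar>U i - U' i\<bar> / L) powr a))"
      if "finite S" "S \<subseteq> J" for S
      using that
    proof (induction S rule: finite_induct)
      case empty
      show ?case by simp
    next
      case (insert j S)
      define V where "V = (\<lambda>i. if i \<in> S then U' i else U i)"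
      have V: "V(j := U' j) = (\<lambda>i. if i \<in> insert j S then U' i else U i)" "V j = U j"
        using insert.hyps by (auto simp: V_def)
      have nn: "C * (\<bar>U j - U' j\<bar> / L) powr a \<ge> 0" "C * (\<Sum>i\<in>S. (\<bar>U i - U' i\<bar> / L) powr a) \<ge> 0"
        using C0 by (auto intro!: mult_nonneg_nonneg sum_nonneg)
      have "Qn a J U (\<lambda>w. ennreal (ker a w)) L \<le>
          Qn a J V (\<lambda>w. ennreal (ker a w)) L + ennreal (C * (\<Sum>i\<in>S. (\<bar>U i - U' i\<bar> / L) powr a))"
        using insert unfolding V_def by auto
      also have "\<dots> \<le> (Qn a J (V(j := U' j)) (\<lambda>w. ennreal (ker a w)) L + ennreal (C * (\<bar>V j - U' j\<bar> / L) powr a)) +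
          ennreal (C * (\<Sum>i\<in>S. (\<bar>U i - U' i\<bar> / L) powr a))"
        using insert.prems J a L by (intro add_right_mono Qn_change_cut) (auto simp: C_def)
      also have "\<dots> = Qn a J (V(j := U' j)) (\<lambda>w. ennreal (ker a w)) L + ennreal (C * (\<Sum>i\<in>insert j S. (\<bar>U i - U' i\<bar> / L) powr a))"
        using insert.hyps nn V(2) by (simp add: add.assoc distrib_left ennreal_plus[symmetric] del: ennreal_plus)
      finally show ?case unfolding V(1) .
    qed
    from this[OF J(1) order_refl]
    have "Qn a J U (\<lambda>w. ennreal (ker a w)) L \<le> Qn a J (\<lambda>i. if i \<in> J then U' i else U i) (\<lambda>w. ennreal (ker a w)) L +
        ennreal (C * (\<Sum>i\<in>J. (\<bar>U i - U' i\<bar> / L) powr a))" .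
    also have "Qn a J (\<lambda>i. if i \<in> J then U' i else U i) (\<lambda>w. ennreal (ker a w)) L = Qn a J U' (\<lambda>w. ennreal (ker a w)) L"
      by (rule Qn_cong_U) simp
    finally have "ennreal (Phi a J U L) \<le> ennreal (Phi a J U' L) + ennreal (C * (\<Sum>i\<in>J. (\<bar>U i - U' i\<bar> / L) powr a))"
      unfolding Qn_eq_Phi[OF J(1) a(1) J(2) L] .
    moreover have nn: "C * (\<Sum>i\<in>J. (\<bar>U i - U' i\<bar> / L) powr a) \<ge> 0" using C0 by (auto intro!: mult_nonneg_nonneg sum_nonneg)
    moreover have "Phi a J U' L \<ge> 0" by (rule Phi_bounds[OF J(1) a(1) J(2) L])
    ultimately show ?thesis by (simp add: ennreal_plus[symmetric] ennreal_le_iff del: ennreal_plus)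
  qed
  show thesis
  proof (rule that[OF C0])
    fix J :: "nat set" and U U' :: "nat \<Rightarrow> real" and L :: real
    assume J: "finite J" "real (card J + 1) * a = 1" and L: "L > 0"
    show "\<bar>Phi a J U L - Phi a J U' L\<bar> \<le> C * (\<Sum>i\<in>J. (\<bar>U i - U' i\<bar> / L) powr a)"
      using one[OF J L, of U U'] one[OF J L, of U' U] by (simp add: abs_minus_commute)
  qed
qed

section \<open>Logarithmic sums of generalized divisor functions\<close>

definition Lf :: "real \<Rightarrow> real \<Rightarrow> real" where
  "Lf z v = (\<Sum>d\<in>{1..nat \<lfloor>exp v\<rfloor>}. tz z d / real d)"

text \<open>For v >= 0 this is the integral of \<open>Lf z\<close> over {0..v}.\<close>

definition Lf_int :: "real \<Rightarrow> real \<Rightarrow> real" where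
  "Lf_int z v = (\<Sum>d\<in>{1..nat \<lfloor>exp v\<rfloor>}. tz z d / real d * (v - ln (real d)))"

lemma sum_inverse_le: "(\<Sum>n\<in>{1..M}. 1 / real n) \<le> 1 + ln (real M)" if "M \<ge> 1" for M
  using that
proof (induction M rule: dec_induct)
  case (step n)
  have "ln (real n / real (Suc n)) \<le> real n / real (Suc n) - 1" using step by (intro ln_le_minus_one) auto
  hence "1 / real (Suc n) \<le> ln (real (Suc n)) - ln (real n)" using step by (simp add: ln_div field_simps)
  thus ?case using step by simp
qed simp

lemma exp_ge_iff_ln_le: "n \<ge> 1 \<Longrightarrow> real n \<le> exp v \<longleftrightarrow> ln (real n) \<le> v"
  using ln_le_cancel_iff[of "real n" "exp v"] by simp

lemma Lf_bounds:
  assumes "0 \<le> z" "z \<le> 1" "v \<ge> 0"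
  shows "1 \<le> Lf z v" "Lf z v \<le> 1 + v"
proof -
  have e1: "exp v \<ge> 1" using assms by simp
  define M where "M = nat \<lfloor>exp v\<rfloor>"
  have M: "M \<ge> 1" "real M \<le> exp v" using e1 unfolding M_def by linarith+
  have "Lf z v \<le> (\<Sum>n\<in>{1..M}. 1 / real n)"
    unfolding Lf_def M_def using assms by (intro sum_mono divide_right_mono tz_le_1) auto
  also have "\<dots> \<le> 1 + ln (real M)" by (rule sum_inverse_le[OF M(1)])
  also have "ln (real M) \<le> v" using M exp_ge_iff_ln_le by blast
  finally show "Lf z v \<le> 1 + v" by simp
  have "(\<Sum>d\<in>{1}. tz z d / real d) \<le> Lf z v"
    unfolding Lf_def using assms M by (intro sum_mono2) (auto intro!: divide_nonneg_nonneg tz_nonneg simp: M_def[symmetric])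
  thus "1 \<le> Lf z v" by simp
qed

lemma Lf_mono:
  assumes "0 \<le> z" "v \<le> w"
  shows "Lf z v \<le> Lf z w"
proof -
  have "nat \<lfloor>exp v\<rfloor> \<le> nat \<lfloor>exp w\<rfloor>" using assms by (intro nat_mono floor_mono) simp
  thus ?thesis unfolding Lf_def using assms
    by (intro sum_mono2) (auto intro!: divide_nonneg_nonneg tz_nonneg)
qed

lemma Lf_int_nonneg: "0 \<le> z \<Longrightarrow> Lf_int z v \<ge> 0"
  unfolding Lf_int_def
  by (intro sum_nonneg mult_nonneg_nonneg divide_nonneg_nonneg tz_nonneg)
     (use exp_ge_iff_ln_le in \<open>auto simp: in_upto_iff in_upto_iff[unfolded One_nat_def] simp del: atLeastAtMost_iff\<close>)

text \<open>The Levin-Fainleib argument: expanding tz z d * ln d by \<open>tz_rec\<close> and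
  summing the mangoldt factor by Mertens gives z * \<open>Lf_int\<close> up to 5 *
  \<open>Lf\<close>. Reading \<open>Lf\<close> as the derivative of I = \<open>Lf_int\<close>, this
  is the approximate Euler equation v I' = (1 + z) I.\<close>

lemma levin_identity:
  assumes z: "0 \<le> z" "z \<le> 1" and v: "v \<ge> 0"
  shows "\<bar>v * Lf z v - (1 + z) * Lf_int z v\<bar> \<le> 5 * Lf z v"
proof -
  define x where "x = exp v"
  have x: "x \<ge> 1" using v by (simp add: x_def)
  define S where "S = (\<Sum>n\<in>{1..nat \<lfloor>x\<rfloor>}. tz z n / real n * ln (real n))"
  have I: "Lf_int z v = v * Lf z v - S"
    unfolding Lf_int_def Lf_def S_def x_def sum_distrib_left sum_subtractf[symmetric]
    by (intro sum.cong refl) (simp add: right_diff_distrib diff_divide_distrib mult_ac)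
  have "S = (\<Sum>n\<in>{1..nat \<lfloor>x\<rfloor>}. \<Sum>d | d dvd n. z * (tz z d / real d * (mangoldt (n div d) / real (n div d))))"
    unfolding S_def
  proof (rule sum.cong[OF refl])
    fix n assume "n \<in> {1..nat \<lfloor>x\<rfloor>}"
    hence n: "n > 0" by auto
    have "tz z n * ln (real n) = z * (\<Sum>r | r dvd n. tz z r * mangoldt (n div r))"
      using tz_rec[OF n, of z] sum_divisors_flip[OF n, of "\<lambda>d e. mangoldt d * tz z e"] by (simp add: mult.commute)
    hence "tz z n / real n * ln (real n) = (\<Sum>d | d dvd n. z * (tz z d * mangoldt (n div d) / real n))"
      by (simp add: sum_distrib_left sum_divide_distrib)
    also have "\<dots> = (\<Sum>d | d dvd n. z * (tz z d / real d * (mangoldt (n div d) / real (n div d))))"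
    proof (rule sum.cong[OF refl])
      fix d assume "d \<in> {d. d dvd n}"
      then obtain e where e: "n = d * e" by auto
      hence "d > 0" using n by auto
      thus "z * (tz z d * mangoldt (n div d) / real n) = z * (tz z d / real d * (mangoldt (n div d) / real (n div d)))"
        unfolding e by simp
    qed
    finally show "tz z n / real n * ln (real n) = (\<Sum>d | d dvd n. z * (tz z d / real d * (mangoldt (n div d) / real (n div d))))" .
  qed
  also have "\<dots> = (\<Sum>d\<in>{1..nat \<lfloor>x\<rfloor>}. \<Sum>m\<in>{1..nat \<lfloor>x / real d\<rfloor>}. z * (tz z d / real d * (mangoldt m / real m)))"
    by (rule sum_divisors_upto)
  also have "\<dots> = z * (\<Sum>d\<in>{1..nat \<lfloor>x\<rfloor>}. tz z d / real d * (\<Sum>m\<in>{1..nat \<lfloor>x / real d\<rfloor>}. mangoldt m / real m))"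
    by (simp add: sum_distrib_left mult_ac)
  finally have S: "S = z * (\<Sum>d\<in>{1..nat \<lfloor>x\<rfloor>}. tz z d / real d * (\<Sum>m\<in>{1..nat \<lfloor>x / real d\<rfloor>}. mangoldt m / real m))" .
  have "S - z * Lf_int z v = z * (\<Sum>d\<in>{1..nat \<lfloor>x\<rfloor>}. tz z d / real d * ((\<Sum>m\<in>{1..nat \<lfloor>x / real d\<rfloor>}. mangoldt m / real m) - (v - ln (real d))))" (is "_ = z * ?T")
    unfolding S Lf_int_def x_def by (simp only: right_diff_distrib[symmetric] sum_subtractf[symmetric])
  hence "\<bar>S - z * Lf_int z v\<bar> = \<bar>z * ?T\<bar>" by (simp only:)
  also have "\<dots> \<le> 1 * (\<Sum>d\<in>{1..nat \<lfloor>x\<rfloor>}. tz z d / real d * 5)"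
    unfolding abs_mult
  proof (intro mult_mono order_trans[OF sum_abs] sum_mono)
    fix d assume d: "d \<in> {1..nat \<lfloor>x\<rfloor>}"
    hence d1: "d \<ge> 1" "real d \<le> x" unfolding in_upto_iff by auto
    have "v - ln (real d) = ln (x / real d)" using d1 by (simp add: ln_div x_def)
    moreover have "x / real d \<ge> 1" using d1 by simp
    ultimately have "\<bar>(\<Sum>m\<in>{1..nat \<lfloor>x / real d\<rfloor>}. mangoldt m / real m) - (v - ln (real d))\<bar> \<le> 5"
      using mertens_mangoldt by simp
    thus "\<bar>tz z d / real d * ((\<Sum>m\<in>{1..nat \<lfloor>x / real d\<rfloor>}. mangoldt m / real m) - (v - ln (real d)))\<bar> \<le> tz z d / real d * 5"
      unfolding abs_mult using z by (intro mult_mono) (auto simp: tz_nonneg)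
  qed (use z in auto)
  also have "\<dots> = 5 * Lf z v" unfolding Lf_def x_def sum_distrib_right[symmetric] by simp
  finally have "\<bar>S - z * Lf_int z v\<bar> \<le> 5 * Lf z v" .
  moreover have "S - z * Lf_int z v = v * Lf z v - (1 + z) * Lf_int z v" unfolding I by (simp add: algebra_simps)
  ultimately show ?thesis by simp
qed

text \<open>By \<open>levin_identity\<close> the derivative of Lf_int z w * w powr (-1 - z) is
  bounded by the left side of B, and the right side of B is minus the derivative of B * w powr (-p).
  So adding this term makes the quotient decreasing, and subtracting it makes it increasing.\<close>

lemma Lf_int_ratio_mono:
  assumes z: "0 \<le> z" "z \<le> 1" and ab: "1 \<le> a" "a \<le> b" and p: "p > 0"
    and B: "\<And>w. a \<le> w \<Longrightarrow> w \<le> b \<Longrightarrow> 5 * Lf z w * w powr (- 2 - z) \<le> B * p * w powr (- p - 1)"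
  shows "Lf_int z b * b powr (- 1 - z) + B * b powr (- p) \<le> Lf_int z a * a powr (- 1 - z) + B * a powr (- p)"
    and "Lf_int z b * b powr (- 1 - z) - B * b powr (- p) \<ge> Lf_int z a * a powr (- 1 - z) - B * a powr (- p)"
proof -
  define M where "M = nat \<lfloor>exp b\<rfloor>"
  \<comment> \<open>A version of \<open>Lf_int\<close> with a fixed index set: continuous, and
    differentiable off the finitely many kinks ln d.\<close>
  define G where "G = (\<lambda>w. \<Sum>d\<in>{1..M}. tz z d / real d * max 0 (w - ln (real d)))"
  have sub: "{1..nat \<lfloor>exp w\<rfloor>} \<subseteq> {1..M}" if "w \<le> b" for w
  proof -
    have "nat \<lfloor>exp w\<rfloor> \<le> M" unfolding M_def using that by (intro nat_mono floor_mono) simp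
    thus ?thesis by auto
  qed
  have out: "ln (real d) > w" if "d \<in> {1..M} - {1..nat \<lfloor>exp w\<rfloor>}" for d w
    using that exp_ge_iff_ln_le[of d w] in_upto_iff[of d "exp w"] by auto
  have inn: "ln (real d) \<le> w" if "d \<in> {1..nat \<lfloor>exp w\<rfloor>}" for d w
    using that exp_ge_iff_ln_le[of d w] in_upto_iff[of d "exp w"] by auto
  have GI: "G w = Lf_int z w" if "w \<le> b" for w
  proof -
    have "G w = (\<Sum>d\<in>{1..nat \<lfloor>exp w\<rfloor>}. tz z d / real d * max 0 (w - ln (real d)))"
      unfolding G_def by (rule sum.mono_neutral_right) (use sub[OF that] out[of _ w] in force)+
    also have "\<dots> = Lf_int z w" unfolding Lf_int_def using inn[of _ w] by (intro sum.cong) (auto simp: max_def)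
    finally show ?thesis .
  qed
  define S where "S = (\<lambda>d. ln (real d)) ` {1..M}"
  have GD: "(G has_real_derivative Lf z w) (at w)" if w: "w \<le> b" "w \<notin> S" for w
  proof -
    have "(G has_real_derivative (\<Sum>d\<in>{1..M}. tz z d / real d * (if ln (real d) < w then 1 else 0))) (at w)"
      unfolding G_def
    proof (intro DERIV_sum DERIV_cmult)
      fix d assume d: "d \<in> {1..M}"
      show "((\<lambda>w. max 0 (w - ln (real d))) has_real_derivative (if ln (real d) < w then 1 else 0)) (at w)"
      proof (cases "ln (real d) < w")
        case True
        have "((\<lambda>w. w - ln (real d)) has_real_derivative 1) (at w)" by (auto intro!: derivative_eq_intros)
        moreover have "\<forall>\<^sub>F y in nhds w. max 0 (y - ln (real d)) = y - ln (real d)"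
          using eventually_nhds_in_open[of "{ln (real d)<..}" w] True by (auto elim!: eventually_mono)
        ultimately show ?thesis using True by (subst DERIV_cong_ev[OF refl _ refl]) auto
      next
        case False
        hence "w < ln (real d)" using w d unfolding S_def by force
        hence "\<forall>\<^sub>F y in nhds w. max 0 (y - ln (real d)) = 0"
          using eventually_nhds_in_open[of "{..<ln (real d)}" w] by (auto elim!: eventually_mono)
        thus ?thesis using False by (subst DERIV_cong_ev[OF refl _ refl]) auto
      qed
    qed
    also have "(\<Sum>d\<in>{1..M}. tz z d / real d * (if ln (real d) < w then 1 else 0)) = Lf z w"
    proof -
      have "(\<Sum>d\<in>{1..M}. tz z d / real d * (if ln (real d) < w then 1 else 0)) =
          (\<Sum>d\<in>{1..nat \<lfloor>exp w\<rfloor>}. tz z d / real d * (if ln (real d) < w then 1 else 0))"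
      proof (rule sum.mono_neutral_right)
        show "\<forall>d\<in>{1..M} - {1..nat \<lfloor>exp w\<rfloor>}. tz z d / real d * (if ln (real d) < w then 1 else 0) = 0"
        proof
          fix d assume "d \<in> {1..M} - {1..nat \<lfloor>exp w\<rfloor>}"
          hence "ln (real d) > w" by (rule out)
          thus "tz z d / real d * (if ln (real d) < w then 1 else 0) = 0" by simp
        qed
      qed (use sub[OF w(1)] in auto)
      also have "\<dots> = Lf z w" unfolding Lf_def
      proof (rule sum.cong[OF refl])
        fix d assume d: "d \<in> {1..nat \<lfloor>exp w\<rfloor>}"
        have "ln (real d) \<noteq> w" using w(2) sub[OF w(1)] d unfolding S_def by blast
        hence "ln (real d) < w" using inn[OF d] by simp
        thus "tz z d / real d * (if ln (real d) < w then 1 else 0) = tz z d / real d" by simp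
      qed
      finally show ?thesis .
    qed
    finally show ?thesis .
  qed
  have Gc: "continuous_on X G" for X unfolding G_def by (intro continuous_intros)
  \<comment> \<open>The signs e = 1 and e = -1 give the two claims.\<close>
  have mono: "e * (G a * a powr (- 1 - z)) - B * a powr (- p) \<le> e * (G b * b powr (- 1 - z)) - B * b powr (- p)"
    if e: "\<bar>e\<bar> = 1" for e :: real
  proof -
    have "((\<lambda>w. e * ((w * Lf z w - (1 + z) * G w) * w powr (- 2 - z)) + B * p * w powr (- p - 1)) has_integral
      ((e * (G b * b powr (- 1 - z)) - B * b powr (- p)) - (e * (G a * a powr (- 1 - z)) - B * a powr (- p)))) {a..b}"
    proof (rule fundamental_theorem_of_calculus_interior_strong[where S = S])
      show "finite S" unfolding S_def by simp
      show "a \<le> b" by fact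
      fix w assume w: "w \<in> {a<..<b} - S"
      have w1: "w \<ge> 1" "w > 0" using w ab by auto
      have D1: "((\<lambda>w. w powr r) has_real_derivative r * w powr (r - 1)) (at w)" for r
        by (rule has_real_derivative_powr[OF w1(2)])
      have "((\<lambda>w. e * (G w * w powr (- 1 - z)) - B * w powr (- p)) has_real_derivative
         e * (Lf z w * w powr (- 1 - z) + ((- 1 - z) * w powr (- 1 - z - 1)) * G w) - B * (- p * w powr (- p - 1))) (at w)"
        using w by (intro DERIV_diff DERIV_cmult DERIV_mult GD D1) auto
      moreover have "e * (Lf z w * w powr (- 1 - z) + ((- 1 - z) * w powr (- 1 - z - 1)) * G w) - B * (- p * w powr (- p - 1)) =
          e * ((w * Lf z w - (1 + z) * G w) * w powr (- 2 - z)) + B * p * w powr (- p - 1)"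
      proof -
        have "w powr (- 1 - z) = w * w powr (- 2 - z)" using powr_add[of w 1 "- 2 - z"] w1 by simp
        moreover have "- 1 - z - 1 = - 2 - z" by simp
        ultimately show ?thesis by (simp only:) (simp add: algebra_simps)
      qed
      ultimately show "((\<lambda>w. e * (G w * w powr (- 1 - z)) - B * w powr (- p)) has_vector_derivative
          e * ((w * Lf z w - (1 + z) * G w) * w powr (- 2 - z)) + B * p * w powr (- p - 1)) (at w)"
        by (simp only: has_real_derivative_iff_has_vector_derivative)
    next
      show "continuous_on {a..b} (\<lambda>w. e * (G w * w powr (- 1 - z)) - B * w powr (- p))"
        using ab by (intro continuous_intros Gc) auto
    qed
    hence "0 \<le> (e * (G b * b powr (- 1 - z)) - B * b powr (- p)) - (e * (G a * a powr (- 1 - z)) - B * a powr (- p))"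
    proof (rule has_integral_nonneg)
      fix w assume w: "w \<in> {a..b}"
      have "\<bar>w * Lf z w - (1 + z) * G w\<bar> \<le> 5 * Lf z w"
        using levin_identity[OF z, of w] GI[of w] w ab by simp
      hence "\<bar>w * Lf z w - (1 + z) * G w\<bar> * w powr (- 2 - z) \<le> 5 * Lf z w * w powr (- 2 - z)"
        by (rule mult_right_mono) simp
      also have "\<dots> \<le> B * p * w powr (- p - 1)" using B w by auto
      finally have "\<bar>e * ((w * Lf z w - (1 + z) * G w) * w powr (- 2 - z))\<bar> \<le> B * p * w powr (- p - 1)"
        by (simp add: abs_mult e)
      thus "0 \<le> e * ((w * Lf z w - (1 + z) * G w) * w powr (- 2 - z)) + B * p * w powr (- p - 1)"
        by linarith
    qed
    thus ?thesis by simp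
  qed
  show "Lf_int z b * b powr (- 1 - z) + B * b powr (- p) \<le> Lf_int z a * a powr (- 1 - z) + B * a powr (- p)"
    using mono[of "- 1"] GI[of a] GI[of b] ab by simp
  show "Lf_int z b * b powr (- 1 - z) - B * b powr (- p) \<ge> Lf_int z a * a powr (- 1 - z) - B * a powr (- p)"
    using mono[of 1] GI[of a] GI[of b] ab by simp
qed


text \<open>Two passes through \<open>Lf_int_ratio_mono\<close>. The trivial bound 1 + w for
  \<open>Lf\<close> with p = z shows that the quotient q is bounded, and
  \<open>levin_identity\<close> turns this into a bound of order v powr z for \<open>Lf\<close>.
  With it, p = 1 makes q converge at rate 1 / v, and \<open>levin_identity\<close> carries the
  result back to \<open>Lf\<close>.\<close>

theorem Lf_asymptotics:
  assumes z: "0 < z" "z \<le> 1"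
  shows "\<exists>c\<ge>0. \<exists>C. \<forall>v\<ge>0. \<bar>Lf z v - c * v powr z\<bar> \<le> C"
proof -
  have z0: "0 \<le> z" using z by simp
  define q where "q v = Lf_int z v * v powr (- 1 - z)" for v
  define Q where "Q = q 1 + 10 / z"
  have q0: "q v \<ge> 0" for v unfolding q_def using Lf_int_nonneg[OF z0] by simp
  have Q0: "Q \<ge> 0" unfolding Q_def using q0[of 1] z by simp
  have qb: "q v \<le> Q" if v: "v \<ge> 1" for v
  proof -
    have "q v + 10 / z * v powr (- z) \<le> q 1 + 10 / z * 1 powr (- z)"
      unfolding q_def
    proof (rule Lf_int_ratio_mono(1)[OF z0 z(2) order_refl v z(1)])
      fix w assume w: "1 \<le> w" "w \<le> v"
      have "5 * Lf z w * w powr (- 2 - z) \<le> 5 * (w + w) * w powr (- 2 - z)"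
        using Lf_bounds(2)[OF z0 z(2), of w] w by (intro mult_right_mono) auto
      also have "\<dots> = 10 * (w * w powr (- 2 - z))" by simp
      also have "w * w powr (- 2 - z) = w powr (- z - 1)"
      proof -
        have "- z - 1 = 1 + (- 2 - z)" by simp
        thus ?thesis using w by (simp only: powr_add) simp
      qed
      finally show "5 * Lf z w * w powr (- 2 - z) \<le> 10 / z * z * w powr (- z - 1)" using z by simp
    qed
    moreover have "10 / z * v powr (- z) \<ge> 0" using z by simp
    ultimately show ?thesis unfolding Q_def by simp
  qed
  have Ib: "Lf_int z v = q v * (v * v powr z)" if v: "v \<ge> 1" for v
  proof -
    have "v powr (- 1 - z) * (v powr 1 * v powr z) = v powr 0" unfolding powr_add[symmetric] by simp
    thus ?thesis unfolding q_def using v by (simp add: mult.assoc)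
  qed
  \<comment> \<open>For v >= 10 the error 5 * Lf z v is at most half of v * Lf z v and can be
    absorbed.\<close>
  have Lb: "Lf z v \<le> 4 * Q * v powr z" if v: "v \<ge> 10" for v
  proof -
    have "v * Lf z v \<le> (1 + z) * Lf_int z v + 5 * Lf z v" using levin_identity[OF z0 z(2), of v] v by (simp add: abs_le_iff)
    moreover have "5 * Lf z v \<le> v / 2 * Lf z v" using Lf_bounds(1)[OF z0 z(2), of v] v by (intro mult_right_mono) auto
    moreover have "(1 + z) * Lf_int z v \<le> 2 * (Q * (v * v powr z))"
      unfolding Ib[OF order_trans[OF _ v], simplified] using z v qb[of v] q0[of v] by (intro mult_mono) auto
    ultimately have "v / 2 * Lf z v \<le> v / 2 * (4 * Q * v powr z)" by (simp add: algebra_simps)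
    thus ?thesis using v by (simp only: mult_le_cancel_left_pos[of "v/2"])
  qed
  have mono: "q b + 20 * Q / b \<le> q a + 20 * Q / a" "q a - 20 * Q / a \<le> q b - 20 * Q / b" if ab: "10 \<le> a" "a \<le> b" for a b
  proof -
    have B: "5 * Lf z w * w powr (- 2 - z) \<le> 20 * Q * 1 * w powr (- 1 - 1)" if w: "a \<le> w" "w \<le> b" for w
    proof -
      have "5 * Lf z w * w powr (- 2 - z) \<le> 5 * (4 * Q * w powr z) * w powr (- 2 - z)"
        using Lb[of w] w ab by (intro mult_right_mono) auto
      also have "\<dots> = 20 * Q * (w powr z * w powr (- 2 - z))" by simp
      also have "w powr z * w powr (- 2 - z) = w powr (- 1 - 1)" unfolding powr_add[symmetric] by simp
      finally show ?thesis by simp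
    qed
    have m: "b powr (- 1) = 1 / b" "a powr (- 1) = 1 / a" using ab by (auto simp: powr_minus_divide)
    show "q b + 20 * Q / b \<le> q a + 20 * Q / a" "q a - 20 * Q / a \<le> q b - 20 * Q / b"
      using Lf_int_ratio_mono[OF z0 z(2) _ ab(2) zero_less_one B] ab unfolding q_def m by auto
  qed
  \<comment> \<open>The supremum of the increasing minorants plays the part of the limit of q; the
    decreasing majorants bound it from above.\<close>
  define X where "X = (\<lambda>v. q v - 20 * Q / v) ` {10..}"
  define c where "c = Sup X"
  have ub: "y \<le> q v + 20 * Q / v" if y: "y \<in> X" and v: "v \<ge> 10" for y v
  proof -
    obtain w where w: "w \<ge> 10" "y = q w - 20 * Q / w" using y by (auto simp: X_def)
    define m where "m = max v w"
    have "y \<le> q m - 20 * Q / m" unfolding w(2) by (rule mono(2)) (use w in \<open>auto simp: m_def\<close>)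
    also have "\<dots> \<le> q m + 20 * Q / m" using Q0 w by (auto simp: m_def)
    also have "\<dots> \<le> q v + 20 * Q / v" by (rule mono(1)) (use v in \<open>auto simp: m_def\<close>)
    finally show ?thesis .
  qed
  have ne: "X \<noteq> {}" unfolding X_def by auto
  have bdd: "bdd_above X" using ub[of _ 10] by (auto simp: bdd_above_def)
  have c1: "q v - 20 * Q / v \<le> c" if "v \<ge> 10" for v
    unfolding c_def using that by (intro cSup_upper bdd) (auto simp: X_def)
  have c2: "c \<le> q v + 20 * Q / v" if "v \<ge> 10" for v
    unfolding c_def using ub that ne by (intro cSup_least) auto
  have c0: "c \<ge> 0"
  proof (rule ccontr)
    assume neg: "\<not> c \<ge> 0"
    define v where "v = max 10 (40 * Q / (- c))"
    have v: "v \<ge> 10" "v \<ge> 40 * Q / (- c)" by (auto simp: v_def)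
    have "40 * Q \<le> v * (- c)" using v(2) neg by (simp add: field_simps)
    hence "20 * Q / v \<le> - c / 2" using v(1) by (simp add: field_simps)
    thus False using c1[OF v(1)] q0[of v] neg by linarith
  qed
  define d where "d = (1 + z) * c"
  have d0: "d \<ge> 0" unfolding d_def using c0 z by simp
  have large: "\<bar>Lf z v - d * v powr z\<bar> \<le> 60 * Q" if v: "v \<ge> 10" for v
  proof -
    define E where "E = v * Lf z v - (1 + z) * Lf_int z v"
    have E: "\<bar>E\<bar> \<le> 20 * Q * v powr z"
      using levin_identity[OF z0 z(2), of v] Lb[OF v] v unfolding E_def by simp
    have "v * (Lf z v - d * v powr z) = E + (1 + z) * (q v - c) * (v * v powr z)"
      unfolding E_def d_def using Ib[of v] v by (simp add: algebra_simps)
    hence "\<bar>v * (Lf z v - d * v powr z)\<bar> \<le> \<bar>E\<bar> + \<bar>(1 + z) * (q v - c) * (v * v powr z)\<bar>"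
      by (simp only: abs_triangle_ineq)
    also have "\<bar>(1 + z) * (q v - c) * (v * v powr z)\<bar> = (1 + z) * \<bar>q v - c\<bar> * (v * v powr z)"
      using z v by (simp add: abs_mult)
    also have "\<dots> \<le> 2 * (20 * Q / v) * (v * v powr z)"
      using c1[OF v] c2[OF v] z v by (intro mult_right_mono mult_mono) (auto simp: abs_le_iff)
    also have "\<dots> = 40 * Q * v powr z" using v by simp
    finally have "\<bar>v * (Lf z v - d * v powr z)\<bar> \<le> 60 * Q * v powr z" using E by simp
    also have "\<dots> \<le> 60 * Q * v powr 1" using Q0 v z by (intro mult_left_mono powr_mono) auto
    finally have "v * \<bar>Lf z v - d * v powr z\<bar> \<le> v * (60 * Q)" using v by (simp add: abs_mult mult.commute)
    thus ?thesis using v by (simp only: mult_le_cancel_left_pos)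
  qed
  have small: "\<bar>Lf z v - d * v powr z\<bar> \<le> 11 + 10 * d" if v: "v \<ge> 0" "v < 10" for v
  proof -
    have "0 \<le> Lf z v" "Lf z v \<le> 11" using Lf_bounds[OF z0 z(2) v(1)] v by auto
    moreover have "d * v powr z \<le> d * 10"
    proof (rule mult_left_mono[OF _ d0])
      have "v powr z \<le> 10 powr z" using v z by (intro powr_mono2) auto
      also have "\<dots> \<le> 10 powr 1" using z by (intro powr_mono) auto
      finally show "v powr z \<le> 10" by simp
    qed
    moreover have "0 \<le> d * v powr z" using d0 by simp
    ultimately show ?thesis by (simp add: abs_le_iff)
  qed
  have "\<bar>Lf z v - d * v powr z\<bar> \<le> 60 * Q + (11 + 10 * d)" if v: "v \<ge> 0" for v
    using large[of v] small[of v] v Q0 d0 by (cases "v < 10") auto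
  thus ?thesis using d0 by blast
qed

section \<open>Comparing weighted tuple sums with Dirichlet integrals\<close>

lemma Abel_sum1:
  fixes T A :: "nat \<Rightarrow> real"
  shows "(\<Sum>d\<in>{1..N}. (T d - T (d - 1)) * A d) = T N * A (Suc N) - T 0 * A 1 + (\<Sum>d\<in>{1..N}. T d * (A d - A (Suc d)))"
  by (induction N) (auto simp: algebra_simps)

text \<open>For decreasing A and increasing M, sampling A at the left end of each interval gives an
  upper Riemann-Stieltjes sum, and sampling at the right end, as in \<open>Abel_sum3\<close>, a
  lower one.\<close>

lemma Abel_sum2:
  fixes M A :: "nat \<Rightarrow> real"
  shows "(\<Sum>d\<in>{1..N}. (M (Suc d) - M d) * A d) = M (Suc N) * A (Suc N) - M 1 * A 1 + (\<Sum>d\<in>{1..N}. M (Suc d) * (A d - A (Suc d)))"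
  by (induction N) (auto simp: algebra_simps)

lemma Abel_sum3:
  fixes M A :: "nat \<Rightarrow> real"
  shows "(\<Sum>d\<in>{1..N}. (M (Suc d) - M d) * A (Suc d)) = M (Suc N) * A (Suc N) - M 1 * A 1 + (\<Sum>d\<in>{1..N}. M d * (A d - A (Suc d)))"
  by (induction N) (auto simp: algebra_simps)

text \<open>Being open on the left and closed on the right, these intervals cover the positive axis
  exactly once; hence the ceiling minus 1.\<close>

lemma ln_interval_iff:
  assumes "d \<ge> 1" "y > 0"
  shows "ln (real d) < y \<and> y \<le> ln (real (Suc d)) \<longleftrightarrow> d = nat (\<lceil>exp y\<rceil> - 1)"
proof -
  have "ln (real d) < y \<longleftrightarrow> real d < exp y" using assms ln_less_cancel_iff[of "real d" "exp y"] by simp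
  moreover have "y \<le> ln (real (Suc d)) \<longleftrightarrow> exp y \<le> real (Suc d)"
    using ln_le_cancel_iff[of "exp y" "real (Suc d)"] by simp
  moreover have "real d < exp y \<and> exp y \<le> real (Suc d) \<longleftrightarrow> \<lceil>exp y\<rceil> = int d + 1"
    by (subst ceiling_eq_iff) auto
  moreover have "\<lceil>exp y\<rceil> = int d + 1 \<longleftrightarrow> d = nat (\<lceil>exp y\<rceil> - 1)" using assms by auto
  ultimately show ?thesis by blast
qed

text \<open>The cut-off values A d of G decrease to 0, so Abel summation bounds the exchange of the
  two summatory functions by their distance times A 1 <= G w. The integral against the kernel lies
  between the Riemann-Stieltjes sums \<open>Lo\<close> and \<open>Up\<close>. Only monotonicity and
  vanishing on the negative axis are asked of G, so the step can be iterated.\<close>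

lemma replace_one:
  fixes t g :: "nat \<Rightarrow> real" and G :: "real \<Rightarrow> real"
  assumes a: "a > 0" and t: "\<And>d. 0 \<le> t d" "\<And>d. t d \<le> 1" and c: "c \<ge> 0"
    and T: "\<And>D. D \<ge> 1 \<Longrightarrow> \<bar>(\<Sum>d\<in>{1..D}. t d / real d) - c * (ln (real D) powr a / Gamma (a + 1))\<bar> \<le> C0"
    and G: "mono G" "\<And>y. y < 0 \<Longrightarrow> G y = 0" and w: "exp w < real (Suc N)"
  shows "\<bar>(\<Sum>d\<in>{1..N}. (if ln (real d) \<le> U then t d / real d else 0) * G (w - ln (real d))) -
      c * enn2real (\<integral>\<^sup>+y. ennreal (kerU a U y) * ennreal (G (w - y)) \<partial>lborel)\<bar> \<le> (C0 + 1) * G w"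
proof -
  have G0: "G y \<ge> 0" for y
    using monoD[OF G(1), of "min y (-1)" y] G(2)[of "min y (-1)"] by simp
  have wN: "w < ln (real (Suc N))" using w ln_less_cancel_iff[of "exp w" "real (Suc N)"] by simp
  define M where "M d = ln (real d) powr a / Gamma (a + 1)" for d :: nat
  define Ts where "Ts D = (\<Sum>d\<in>{1..D}. t d / real d)" for D
  define A where "A d = (if ln (real d) \<le> U then G (w - ln (real d)) else 0)" for d :: nat
  have A0: "A d \<ge> 0" for d using G0 by (simp add: A_def)
  have Amono: "A (Suc d) \<le> A d" if "d \<ge> 1" for d
  proof -
    have "ln (real d) \<le> ln (real (Suc d))" using that by (subst ln_le_cancel_iff) auto
    thus ?thesis using G0 monoD[OF G(1), of "w - ln (real (Suc d))" "w - ln (real d)"] by (auto simp: A_def)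
  qed
  have AN: "A (Suc N) = 0" using wN G(2) by (simp add: A_def)
  have A1: "A 1 \<le> G w" using G0[of w] by (simp add: A_def)
  have M1: "M 1 = 0" using a by (simp add: M_def)
  define S where "S = (\<Sum>d\<in>{1..N}. (if ln (real d) \<le> U then t d / real d else 0) * G (w - ln (real d)))"
  have S: "S = (\<Sum>d\<in>{1..N}. Ts d * (A d - A (Suc d)))"
  proof -
    have "S = (\<Sum>d\<in>{1..N}. (Ts d - Ts (d - 1)) * A d)"
      unfolding S_def
    proof (rule sum.cong[OF refl])
      fix d assume "d \<in> {1..N}"
      then obtain e where "d = Suc e" by (cases d) auto
      hence "Ts d - Ts (d - 1) = t d / real d" by (simp add: Ts_def)
      thus "(if ln (real d) \<le> U then t d / real d else 0) * G (w - ln (real d)) = (Ts d - Ts (d - 1)) * A d"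
        by (simp add: A_def)
    qed
    thus ?thesis using Abel_sum1[of Ts A N] AN by (simp add: Ts_def)
  qed
  define Lo where "Lo = (\<Sum>d\<in>{1..N}. (M (Suc d) - M d) * A (Suc d))"
  define Up where "Up = (\<Sum>d\<in>{1..N}. (M (Suc d) - M d) * A d)"
  have Lo: "Lo = (\<Sum>d\<in>{1..N}. M d * (A d - A (Suc d)))" unfolding Lo_def using Abel_sum3[of M A N] AN M1 by simp
  have Up: "Up = (\<Sum>d\<in>{1..N}. M (Suc d) * (A d - A (Suc d)))" unfolding Up_def using Abel_sum2[of M A N] AN M1 by simp
  have Mmono: "M d \<le> M (Suc d)" if "d \<ge> 1" for d
    unfolding M_def using a that by (intro divide_right_mono powr_mono2 Gamma_real_nonneg) auto
  have tel: "(\<Sum>d\<in>{1..N}. A d - A (Suc d)) = A 1"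
    using Abel_sum2[of "\<lambda>_. 1" A N] AN by simp
  have C0: "C0 \<ge> 0" using T[of 1] by linarith
  have b1: "Ts d - c * M d \<le> C0" if "d \<ge> 1" for d using T[OF that] unfolding Ts_def M_def by linarith
  \<comment> \<open>The upper sum compares Ts d with the mass up to d + 1. The additional summand is
    at most 1, which is the + 1 in the bound.\<close>
  have b2: "Ts d - c * M (Suc d) \<ge> - (C0 + 1)" if "d \<ge> 1" for d
  proof -
    have "Ts (Suc d) - c * M (Suc d) \<ge> - C0" using T[of "Suc d"] unfolding Ts_def M_def by linarith
    moreover have "Ts (Suc d) = Ts d + t (Suc d) / real (Suc d)" by (simp add: Ts_def)
    moreover have "t (Suc d) / real (Suc d) \<le> 1" using t(2)[of "Suc d"] by (simp add: divide_le_eq)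
    ultimately show ?thesis by linarith
  qed
  have up: "S - c * Lo \<le> C0 * G w"
  proof -
    have "S - c * Lo = (\<Sum>d\<in>{1..N}. (Ts d - c * M d) * (A d - A (Suc d)))"
      unfolding S Lo by (simp add: sum_distrib_left sum_subtractf[symmetric] left_diff_distrib mult.assoc)
    also have "\<dots> \<le> (\<Sum>d\<in>{1..N}. C0 * (A d - A (Suc d)))"
      using b1 Amono by (intro sum_mono mult_right_mono) auto
    also have "\<dots> = C0 * A 1" by (simp only: sum_distrib_left[symmetric] tel)
    also have "\<dots> \<le> C0 * G w" using C0 A1 by (intro mult_left_mono)
    finally show ?thesis .
  qed
  have lo: "S - c * Up \<ge> - ((C0 + 1) * G w)"
  proof -
    have eq: "S - c * Up = (\<Sum>d\<in>{1..N}. (Ts d - c * M (Suc d)) * (A d - A (Suc d)))"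
      unfolding S Up by (simp add: sum_distrib_left sum_subtractf[symmetric] left_diff_distrib mult.assoc)
    have "(\<Sum>d\<in>{1..N}. - (C0 + 1) * (A d - A (Suc d))) \<le> S - c * Up"
      unfolding eq
    proof (intro sum_mono mult_right_mono)
      fix d assume "d \<in> {1..N}"
      thus "- (C0 + 1) \<le> Ts d - c * M (Suc d)" "0 \<le> A d - A (Suc d)" using b2 Amono by auto
    qed
    moreover have "(\<Sum>d\<in>{1..N}. - (C0 + 1) * (A d - A (Suc d))) = - ((C0 + 1) * A 1)"
      by (simp only: sum_distrib_left[symmetric] tel minus_mult_left)
    moreover have "(C0 + 1) * A 1 \<le> (C0 + 1) * G w" using C0 by (intro mult_left_mono A1) auto
    ultimately show ?thesis by linarith
  qed
  have Gm [measurable]: "G \<in> borel_measurable borel" using G(1) by (rule borel_measurable_mono)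
  define h where "h F y = (\<Sum>d\<in>{1..N}. ennreal (F d) * ennreal (indicator {ln (real d)<..ln (real (Suc d))} y * ker a y))" for F :: "nat \<Rightarrow> real" and y
  have hint: "(\<integral>\<^sup>+y. h F y \<partial>lborel) = ennreal (\<Sum>d\<in>{1..N}. (M (Suc d) - M d) * F d)" if F: "\<And>d. F d \<ge> 0" for F
  proof -
    have "(\<integral>\<^sup>+y. h F y \<partial>lborel) = (\<Sum>d\<in>{1..N}. ennreal (F d) * (\<integral>\<^sup>+y. ennreal (indicator {ln (real d)<..ln (real (Suc d))} y * ker a y) \<partial>lborel))"
      unfolding h_def by (subst nn_integral_sum) (auto simp: nn_integral_cmult)
    also have "\<dots> = (\<Sum>d\<in>{1..N}. ennreal ((M (Suc d) - M d) * F d))"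
    proof (rule sum.cong[OF refl])
      fix d assume d: "d \<in> {1..N}"
      have "(\<integral>\<^sup>+y. ennreal (indicator {ln (real d)<..ln (real (Suc d))} y * ker a y) \<partial>lborel) = ennreal (M (Suc d) - M d)"
        unfolding M_def using d by (intro nn_integral_ker_Ioc a) auto
      thus "ennreal (F d) * (\<integral>\<^sup>+y. ennreal (indicator {ln (real d)<..ln (real (Suc d))} y * ker a y) \<partial>lborel) =
          ennreal ((M (Suc d) - M d) * F d)"
        using Mmono d F by (simp add: ennreal_mult' mult.commute)
    qed
    also have "\<dots> = ennreal (\<Sum>d\<in>{1..N}. (M (Suc d) - M d) * F d)"
      using Mmono F by (intro sum_ennreal) auto
    finally show ?thesis .
  qed
  define \<delta> where "\<delta> y = nat (\<lceil>exp y\<rceil> - 1)" for y :: real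
  have hdelta: "h F y = (if \<delta> y \<in> {1..N} then ennreal (F (\<delta> y)) * ennreal (ker a y) else 0)" if y: "y > 0" for F y
  proof -
    have "h F y = (\<Sum>d\<in>{1..N}. if d = \<delta> y then ennreal (F d) * ennreal (ker a y) else 0)"
      unfolding h_def
    proof (rule sum.cong[OF refl])
      fix d assume "d \<in> {1..N}"
      hence "ln (real d) < y \<and> y \<le> ln (real (Suc d)) \<longleftrightarrow> d = \<delta> y"
        unfolding \<delta>_def using y by (intro ln_interval_iff) auto
      thus "ennreal (F d) * ennreal (indicator {ln (real d)<..ln (real (Suc d))} y * ker a y) =
          (if d = \<delta> y then ennreal (F d) * ennreal (ker a y) else 0)"
        by (auto simp: indicator_def)
    qed
    thus ?thesis by (simp add: sum.delta')
  qed
  have \<delta>: "\<delta> y \<ge> 1" "ln (real (\<delta> y)) < y" "y \<le> ln (real (Suc (\<delta> y)))" if y: "y > 0" for y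
  proof -
    have "exp y > 1" using y by simp
    hence "\<lceil>exp y\<rceil> \<ge> 2" by linarith
    thus d1: "\<delta> y \<ge> 1" unfolding \<delta>_def by linarith
    show "ln (real (\<delta> y)) < y" "y \<le> ln (real (Suc (\<delta> y)))"
      using ln_interval_iff[OF d1 y] unfolding \<delta>_def by auto
  qed
  let ?I = "\<integral>\<^sup>+y. ennreal (kerU a U y) * ennreal (G (w - y)) \<partial>lborel"
  have lnSuc: "ln (real d) \<le> ln (real e)" if "1 \<le> d" "d \<le> e" for d e
    using that by (subst ln_le_cancel_iff) auto
  have Iup: "?I \<le> ennreal Up"
    unfolding Up_def hint[OF A0, symmetric]
  proof (rule nn_integral_mono)
    fix y :: real
    show "ennreal (kerU a U y) * ennreal (G (w - y)) \<le> h A y"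
    proof (cases "y > 0 \<and> y \<le> U \<and> w - y \<ge> 0")
      case False
      hence "ennreal (kerU a U y) * ennreal (G (w - y)) = 0"
        using G(2)[of "w - y"] by (auto simp: kerU_def ker_def not_le)
      thus ?thesis by (simp only: zero_le)
    next
      case True
      hence y: "y > 0" by simp
      have "\<delta> y \<le> N"
      proof (rule ccontr)
        assume "\<not> \<delta> y \<le> N"
        hence "ln (real (Suc N)) \<le> ln (real (\<delta> y))" by (intro lnSuc) auto
        thus False using \<delta>(2)[OF y] True wN by linarith
      qed
      hence "h A y = ennreal (A (\<delta> y)) * ennreal (ker a y)" using hdelta[OF y] \<delta>(1)[OF y] by simp
      moreover have "G (w - y) \<le> A (\<delta> y)"
        using \<delta>(2)[OF y] True monoD[OF G(1), of "w - y" "w - ln (real (\<delta> y))"] by (simp add: A_def)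
      moreover have "kerU a U y = ker a y" using True by (simp add: kerU_def)
      ultimately show ?thesis
        by (simp only:) (subst mult.commute, intro mult_right_mono ennreal_leI, auto)
    qed
  qed
  have Ilo: "ennreal Lo \<le> ?I"
    unfolding Lo_def hint[of "\<lambda>d. A (Suc d)", OF A0, symmetric]
  proof (rule nn_integral_mono)
    fix y :: real
    show "h (\<lambda>d. A (Suc d)) y \<le> ennreal (kerU a U y) * ennreal (G (w - y))"
    proof (cases "y > 0")
      case False
      hence "h (\<lambda>d. A (Suc d)) y = 0" by (simp add: h_def ker_def)
      thus ?thesis by (simp only: zero_le)
    next
      case y: True
      show ?thesis
      proof (cases "y \<le> U")
        case True
        hence "A (Suc (\<delta> y)) \<le> G (w - y)"
          using \<delta>(3)[OF y] G0 monoD[OF G(1), of "w - ln (real (Suc (\<delta> y)))" "w - y"] by (auto simp: A_def)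
        hence "ennreal (A (Suc (\<delta> y))) * ennreal (ker a y) \<le> ennreal (ker a y) * ennreal (G (w - y))"
          by (subst mult.commute) (intro mult_left_mono ennreal_leI, auto)
        thus ?thesis using hdelta[OF y] True by (auto simp: kerU_def)
      next
        case False
        hence "A (Suc (\<delta> y)) = 0" using \<delta>(3)[OF y] by (simp add: A_def)
        thus ?thesis using hdelta[OF y] by simp
      qed
    qed
  qed
  have Lo0: "Lo \<ge> 0" unfolding Lo_def using Mmono A0 by (intro sum_nonneg mult_nonneg_nonneg) auto
  have Up0: "Up \<ge> 0" unfolding Up_def using Mmono A0 by (intro sum_nonneg mult_nonneg_nonneg) auto
  have fin: "?I < top" using Iup by (rule le_less_trans) simp
  hence Ie: "?I = ennreal (enn2real ?I)" by simp
  have "enn2real ?I \<le> Up" using Iup Up0 by (subst (asm) Ie) (simp add: ennreal_le_iff)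
  moreover have "Lo \<le> enn2real ?I" using Ilo by (subst (asm) Ie) (simp add: ennreal_le_iff)
  ultimately have "c * Lo \<le> c * enn2real ?I" "c * enn2real ?I \<le> c * Up" using c by (auto intro: mult_left_mono)
  moreover have "C0 * G w \<le> (C0 + 1) * G w" using G0 by (simp add: distrib_right)
  ultimately have "\<bar>S - c * enn2real ?I\<bar> \<le> (C0 + 1) * G w" using up lo by (simp add: abs_le_iff)
  thus ?thesis unfolding S_def .
qed


text \<open>The discrete counterpart of \<open>Qn\<close>; G sees a tuple only through its product.
  The box {1..N} keeps the sum finite, and in the counting sums G vanishes for products beyond
  N.\<close>

definition TS :: "nat \<Rightarrow> nat set \<Rightarrow> (nat \<Rightarrow> nat \<Rightarrow> real) \<Rightarrow> (nat \<Rightarrow> real) \<Rightarrow> real" where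
  "TS N J f G = (\<Sum>d\<in>J \<rightarrow>\<^sub>E {1..N}. (\<Prod>i\<in>J. f i (d i)) * G (\<Prod>i\<in>J. d i))"

lemma TS_empty [simp]: "TS N {} f G = G 1"
  by (simp add: TS_def)

lemma TS_cong:
  assumes "finite J" "\<And>i d. i \<in> J \<Longrightarrow> d \<in> {1..N} \<Longrightarrow> f i d = f' i d" "\<And>p. p \<ge> 1 \<Longrightarrow> G p = G' p"
  shows "TS N J f G = TS N J f' G'"
  unfolding TS_def
proof (intro sum.cong refl arg_cong2[of _ _ _ _ times] prod.cong)
  fix d assume d: "d \<in> J \<rightarrow>\<^sub>E {1..N}"
  show "f i (d i) = f' i (d i)" if "i \<in> J" for i using that d assms(2) by (auto simp: PiE_iff)
  have "(\<Prod>i\<in>J. d i) \<ge> (\<Prod>i\<in>J. 1)" using d by (intro prod_mono) (auto simp: PiE_iff)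
  thus "G (\<Prod>i\<in>J. d i) = G' (\<Prod>i\<in>J. d i)" using assms(3) by simp
qed

lemma sum_PiE_insert:
  fixes f :: "('a \<Rightarrow> 'b) \<Rightarrow> 'c :: comm_monoid_add"
  assumes "finite J" "j \<notin> J" "finite S"
  shows "(\<Sum>d\<in>insert j J \<rightarrow>\<^sub>E S. f d) = (\<Sum>y\<in>S. \<Sum>d\<in>J \<rightarrow>\<^sub>E S. f (d(j := y)))"
proof -
  have "inj_on (\<lambda>(y, g). g(j := y)) (S \<times> (J \<rightarrow>\<^sub>E S))" using assms by (intro inj_combinator)
  hence "(\<Sum>d\<in>insert j J \<rightarrow>\<^sub>E S. f d) = (\<Sum>p\<in>S \<times> (J \<rightarrow>\<^sub>E S). f (case p of (y, g) \<Rightarrow> g(j := y)))"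
    unfolding PiE_insert_eq by (subst sum.reindex) (auto simp: o_def)
  also have "\<dots> = (\<Sum>y\<in>S. \<Sum>d\<in>J \<rightarrow>\<^sub>E S. f (d(j := y)))"
    by (subst sum.cartesian_product) (auto intro!: sum.cong)
  finally show ?thesis .
qed

lemma TS_insert:
  assumes "finite J" "j \<notin> J"
  shows "TS N (insert j J) f G = (\<Sum>y\<in>{1..N}. f j y * TS N J f (\<lambda>p. G (y * p)))"
proof -
  have "TS N (insert j J) f G = (\<Sum>y\<in>{1..N}. \<Sum>d\<in>J \<rightarrow>\<^sub>E {1..N}.
      (\<Prod>i\<in>insert j J. f i ((d(j := y)) i)) * G (\<Prod>i\<in>insert j J. (d(j := y)) i))"
    unfolding TS_def by (rule sum_PiE_insert) (use assms in auto)
  also have "\<dots> = (\<Sum>y\<in>{1..N}. f j y * TS N J f (\<lambda>p. G (y * p)))"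
    unfolding TS_def sum_distrib_left
  proof (intro sum.cong refl)
    fix y d
    have "(\<Prod>i\<in>J. f i ((d(j := y)) i)) = (\<Prod>i\<in>J. f i (d i))" "(\<Prod>i\<in>J. (d(j := y)) i) = (\<Prod>i\<in>J. d i)"
      using assms by (auto intro!: prod.cong)
    thus "(\<Prod>i\<in>insert j J. f i ((d(j := y)) i)) * G (\<Prod>i\<in>insert j J. (d(j := y)) i) =
        f j y * ((\<Prod>i\<in>J. f i (d i)) * G (y * (\<Prod>i\<in>J. d i)))"
      using assms by (simp add: mult.assoc)
  qed
  finally show ?thesis .
qed

lemma TS_mono:
  assumes "finite J" "\<And>i d. i \<in> J \<Longrightarrow> d \<in> {1..N} \<Longrightarrow> 0 \<le> f i d" "\<And>i d. i \<in> J \<Longrightarrow> d \<in> {1..N} \<Longrightarrow> f i d \<le> f' i d"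
    and "\<And>p. p \<ge> 1 \<Longrightarrow> G p \<le> G' p" "\<And>p. p \<ge> 1 \<Longrightarrow> 0 \<le> G' p"
  shows "TS N J f G \<le> TS N J f' G'"
  unfolding TS_def
proof (rule sum_mono)
  fix d assume d: "d \<in> J \<rightarrow>\<^sub>E {1..N}"
  have "(\<Prod>i\<in>J. 1) \<le> (\<Prod>i\<in>J. d i)" using d by (intro prod_mono) (auto simp: PiE_iff)
  hence p: "(\<Prod>i\<in>J. d i) \<ge> 1" by simp
  have f0: "0 \<le> (\<Prod>i\<in>J. f i (d i))" using d assms(2) by (intro prod_nonneg) (auto simp: PiE_iff)
  have "(\<Prod>i\<in>J. f i (d i)) * G (\<Prod>i\<in>J. d i) \<le> (\<Prod>i\<in>J. f i (d i)) * G' (\<Prod>i\<in>J. d i)"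
    using assms(4)[OF p] f0 by (intro mult_left_mono)
  also have "\<dots> \<le> (\<Prod>i\<in>J. f' i (d i)) * G' (\<Prod>i\<in>J. d i)"
    using d assms(2,3) assms(5)[OF p] by (intro mult_right_mono prod_mono) (auto simp: PiE_iff)
  finally show "(\<Prod>i\<in>J. f i (d i)) * G (\<Prod>i\<in>J. d i) \<le> (\<Prod>i\<in>J. f' i (d i)) * G' (\<Prod>i\<in>J. d i)" .
qed

lemma TS_nonneg:
  assumes "\<And>i d. i \<in> J \<Longrightarrow> d \<in> {1..N} \<Longrightarrow> 0 \<le> f i d" "\<And>p. 0 \<le> G p"
  shows "0 \<le> TS N J f G"
  unfolding TS_def using assms by (intro sum_nonneg mult_nonneg_nonneg prod_nonneg) (auto simp: PiE_iff)

lemma Qn_neg: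
  assumes "finite J" "a > 0" "\<And>y. y < 0 \<Longrightarrow> g y = 0" "w < 0"
  shows "Qn a J U (\<lambda>y. ennreal (g y)) w = 0"
proof -
  have "Qn a J U (\<lambda>y. ennreal (g y)) w = Qn a J U (\<lambda>y. 0) w"
    by (rule Qn_cong_le) (use assms in auto)
  thus ?thesis by (simp add: Qn_def)
qed

lemma Qn_mono_arg: "mono g \<Longrightarrow> w \<le> w' \<Longrightarrow> Qn a J U (\<lambda>y. ennreal (g y)) w \<le> Qn a J U (\<lambda>y. ennreal (g y)) w'"
  unfolding Qn_def by (intro nn_integral_mono mult_left_mono ennreal_leI) (auto simp: mono_def)

text \<open>As g vanishes on the negative axis, only coordinates up to w count, each with mass at
  most w powr a / Gamma (a + 1). This provides both finiteness and the size of
  \<open>Qn\<close>.\<close>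

lemma Qn_le_power:
  assumes J: "finite J" and a: "a > 0" and g: "mono g" "\<And>y. y < 0 \<Longrightarrow> g y = 0" "\<And>y. g y \<ge> 0" and w: "w \<ge> 0"
  shows "Qn a J U (\<lambda>y. ennreal (g y)) w \<le> ennreal (g w * (w powr a / Gamma (a + 1)) ^ card J)"
  using J w
proof (induction J arbitrary: w rule: finite_induct)
  case empty
  thus ?case by simp
next
  case (insert j J)
  have gm [measurable]: "g \<in> borel_measurable borel" using g(1) by (rule borel_measurable_mono)
  have G0: "Gamma (a + 1) \<ge> 0" using a by (intro Gamma_real_nonneg) auto
  define m where "m = w powr a / Gamma (a + 1)"
  have m0: "m \<ge> 0" unfolding m_def using G0 by simp
  have "Qn a (insert j J) U (\<lambda>y. ennreal (g y)) w = (\<integral>\<^sup>+y. ennreal (kerU a (U j) y) * Qn a J U (\<lambda>y. ennreal (g y)) (w - y) \<partial>lborel)"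
    by (rule Qn_insert[OF insert.hyps]) measurable
  also have "\<dots> \<le> (\<integral>\<^sup>+y. ennreal (g w * m ^ card J) * ennreal (indicator {0<..w} y * ker a y) \<partial>lborel)"
  proof (rule nn_integral_mono)
    fix y :: real
    consider "y \<le> 0" | "0 < y" "y \<le> w" | "y > w" by linarith
    thus "ennreal (kerU a (U j) y) * Qn a J U (\<lambda>y. ennreal (g y)) (w - y) \<le> ennreal (g w * m ^ card J) * ennreal (indicator {0<..w} y * ker a y)"
    proof cases
      case 1
      thus ?thesis by (simp add: kerU_def ker_def)
    next
      case 2
      have "Qn a J U (\<lambda>y. ennreal (g y)) (w - y) \<le> ennreal (g (w - y) * ((w - y) powr a / Gamma (a + 1)) ^ card J)"
        by (rule insert.IH) (use 2 in auto)
      also have "\<dots> \<le> ennreal (g w * m ^ card J)"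
        unfolding m_def using 2 a G0 g
        by (intro ennreal_leI mult_mono power_mono divide_right_mono powr_mono2 monoD[OF g(1)]) auto
      finally have "Qn a J U (\<lambda>y. ennreal (g y)) (w - y) \<le> ennreal (g w * m ^ card J)" .
      moreover have "ennreal (kerU a (U j) y) \<le> ennreal (ker a y)" by (intro ennreal_leI kerU_le_ker a)
      ultimately have "ennreal (kerU a (U j) y) * Qn a J U (\<lambda>y. ennreal (g y)) (w - y) \<le> ennreal (ker a y) * ennreal (g w * m ^ card J)"
        by (intro mult_mono) auto
      thus ?thesis using 2 by (simp add: mult.commute)
    next
      case 3
      hence "Qn a J U (\<lambda>y. ennreal (g y)) (w - y) = 0" using insert.hyps a g by (intro Qn_neg) auto
      thus ?thesis by simp
    qed
  qed
  also have "\<dots> = ennreal (g w * m ^ card J) * ennreal m"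
    using nn_integral_ker_Ioc[of a 0 w] a insert.prems by (subst nn_integral_cmult) (auto simp: m_def)
  also have "\<dots> = ennreal (g w * m ^ card (insert j J))"
    using insert.hyps m0 g(3)[of w] by (simp add: ennreal_mult'[symmetric] mult_ac)
  finally show ?case unfolding m_def .
qed

definition fw :: "real \<Rightarrow> (nat \<Rightarrow> real) \<Rightarrow> nat \<Rightarrow> nat \<Rightarrow> real" where
  "fw a U i d = (if ln (real d) \<le> U i then tz a d / real d else 0)"

text \<open>Induction on the coordinates: those already replaced form Q, which is again monotone and
  0 on the negative axis, so \<open>replace_one\<close> handles the next. A replacement trades the
  mass Lf a w of one coordinate for a constant, whence the power card J - 1.\<close>

lemma replace_multi:
  assumes a: "0 < a" "a \<le> 1" and c: "c \<ge> 0"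
    and T: "\<And>v. v \<ge> 0 \<Longrightarrow> \<bar>Lf a v - c * (v powr a / Gamma (a + 1))\<bar> \<le> C0"
    and J: "finite J" and g: "mono g" "\<And>y. y < 0 \<Longrightarrow> g y = 0" and w: "w \<ge> 0" "exp w < real (Suc N)"
  shows "\<bar>TS N J (fw a U) (\<lambda>p. g (w - ln (real p))) - c ^ card J * enn2real (Qn a J U (\<lambda>y. ennreal (g y)) w)\<bar>
     \<le> (C0 + 1) ^ card J * real (card J) * g w * Lf a w ^ (card J - 1)"
  using J w
proof (induction J arbitrary: w rule: finite_induct)
  case empty
  have "g w \<ge> 0" using monoD[OF g(1), of "-1" w] g(2)[of "-1"] empty by simp
  thus ?case by simp
next
  case (insert j J)
  have g0: "g y \<ge> 0" for y using monoD[OF g(1), of "min y (-1)" y] g(2)[of "min y (-1)"] by simp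
  have gm [measurable]: "g \<in> borel_measurable borel" using g(1) by (rule borel_measurable_mono)
  define n where "n = card J"
  define X where "X = Lf a w"
  have X1: "X \<ge> 1" unfolding X_def using a insert.prems by (intro Lf_bounds) auto
  have C0: "C0 \<ge> 0" using T[of 0] by linarith
  define Q where "Q v = enn2real (Qn a J U (\<lambda>y. ennreal (g y)) v)" for v
  have Qfin: "Qn a J U (\<lambda>y. ennreal (g y)) v = ennreal (Q v)" for v
  proof (cases "v \<ge> 0")
    case True
    have "Qn a J U (\<lambda>y. ennreal (g y)) v < top"
      using Qn_le_power[OF insert.hyps(1) a(1) g g0 True] by (rule le_less_trans) simp_all
    thus ?thesis unfolding Q_def by simp
  next
    case False
    hence "Qn a J U (\<lambda>y. ennreal (g y)) v = 0" using insert.hyps a g by (intro Qn_neg) auto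
    thus ?thesis unfolding Q_def by simp
  qed
  have Qmono: "mono Q"
    unfolding Q_def mono_def using Qn_mono_arg[OF g(1)] Qfin
    by (metis Q_def enn2real_mono ennreal_less_top)
  have Qneg: "Q v = 0" if "v < 0" for v
  proof -
    have "Qn a J U (\<lambda>y. ennreal (g y)) v = 0" using insert.hyps a g that by (intro Qn_neg) auto
    thus ?thesis unfolding Q_def by simp
  qed
  define TJ where "TJ v = TS N J (fw a U) (\<lambda>p. g (v - ln (real p)))" for v
  have TJneg: "TJ v = 0" if "v < 0" for v
  proof -
    have "TJ v = TS N J (fw a U) (\<lambda>_. 0)"
      unfolding TJ_def
    proof (intro TS_cong insert.hyps refl)
      fix p :: nat assume "p \<ge> 1"
      hence "v - ln (real p) < 0" using that by (smt (verit) ln_ge_zero of_nat_1 of_nat_mono)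
      thus "g (v - ln (real p)) = 0" by (rule g(2))
    qed
    thus ?thesis by (simp add: TS_def)
  qed
  have fw0: "fw a U i d \<ge> 0" for i d unfolding fw_def using a by (auto intro!: divide_nonneg_nonneg tz_nonneg)
  have TI: "TS N (insert j J) (fw a U) (\<lambda>p. g (w - ln (real p))) = (\<Sum>y\<in>{1..N}. fw a U j y * TJ (w - ln (real y)))"
    unfolding TS_insert[OF insert.hyps] TJ_def
  proof (intro sum.cong refl arg_cong2[of _ _ _ _ times] TS_cong insert.hyps)
    fix y p :: nat assume "y \<in> {1..N}" "p \<ge> 1"
    hence "ln (real (y * p)) = ln (real y) + ln (real p)" by (simp add: ln_mult)
    thus "g (w - ln (real (y * p))) = g (w - ln (real y) - ln (real p))" by (simp add: diff_diff_eq)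
  qed
  have step: "\<bar>TJ (w - ln (real y)) - c ^ n * Q (w - ln (real y))\<bar> \<le>
      (if ln (real y) \<le> w then (C0 + 1) ^ n * real n * g w * X ^ (n - 1) else 0)" if y: "y \<in> {1..N}" for y
  proof (cases "ln (real y) \<le> w")
    case True
    define v where "v = w - ln (real y)"
    have v: "0 \<le> v" "v \<le> w" using True y unfolding v_def by auto
    have "exp v \<le> exp w" using v by simp
    hence "exp v < real (Suc N)" using insert.prems(2) by linarith
    hence "\<bar>TJ v - c ^ n * Q v\<bar> \<le> (C0 + 1) ^ n * real n * g v * Lf a v ^ (n - 1)"
      unfolding TJ_def Q_def n_def using v by (intro insert.IH)
    also have "\<dots> \<le> (C0 + 1) ^ n * real n * g w * X ^ (n - 1)"
    proof (intro mult_mono power_mono)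
      show "g v \<le> g w" using monoD[OF g(1) v(2)] .
      show "Lf a v \<le> X" unfolding X_def using a v by (intro Lf_mono) auto
      show "0 \<le> Lf a v" using Lf_bounds(1)[of a v] a v by simp
    qed (use C0 g0 Lf_bounds(1)[of a v] a v in auto)
    finally show ?thesis using True unfolding v_def by simp
  next
    case False
    thus ?thesis using TJneg[of "w - ln (real y)"] Qneg[of "w - ln (real y)"] by simp
  qed
  have sumle: "(\<Sum>y\<in>{1..N}. fw a U j y * (if ln (real y) \<le> w then K else 0)) \<le> K * X" if K: "K \<ge> 0" for K
  proof -
    have "(\<Sum>y\<in>{1..N}. fw a U j y * (if ln (real y) \<le> w then K else 0)) \<le> (\<Sum>y\<in>{1..N}. (if ln (real y) \<le> w then K * (tz a y / real y) else 0))"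
      using K a by (intro sum_mono) (auto simp: fw_def tz_nonneg mult.commute)
    also have "\<dots> = (\<Sum>y\<in>{y\<in>{1..N}. ln (real y) \<le> w}. K * (tz a y / real y))"
      by (rule sum.inter_filter[symmetric]) simp
    also have "{y\<in>{1..N}. ln (real y) \<le> w} \<subseteq> {1..nat \<lfloor>exp w\<rfloor>}"
    proof
      fix y assume "y \<in> {y\<in>{1..N}. ln (real y) \<le> w}"
      thus "y \<in> {1..nat \<lfloor>exp w\<rfloor>}" unfolding in_upto_iff using exp_ge_iff_ln_le[of y w] by simp
    qed
    hence "(\<Sum>y\<in>{y\<in>{1..N}. ln (real y) \<le> w}. K * (tz a y / real y)) \<le> (\<Sum>y\<in>{1..nat \<lfloor>exp w\<rfloor>}. K * (tz a y / real y))"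
      using K a by (intro sum_mono2) (auto intro!: mult_nonneg_nonneg divide_nonneg_nonneg tz_nonneg)
    also have "\<dots> = K * X" unfolding X_def Lf_def by (simp only: sum_distrib_left)
    finally show ?thesis .
  qed
  have E1: "\<bar>(\<Sum>y\<in>{1..N}. fw a U j y * TJ (w - ln (real y))) - c ^ n * (\<Sum>y\<in>{1..N}. fw a U j y * Q (w - ln (real y)))\<bar> \<le>
      (C0 + 1) ^ n * real n * g w * X ^ n"
  proof -
    have eq: "(\<Sum>y\<in>{1..N}. fw a U j y * TJ (w - ln (real y))) - c ^ n * (\<Sum>y\<in>{1..N}. fw a U j y * Q (w - ln (real y))) =
        (\<Sum>y\<in>{1..N}. fw a U j y * (TJ (w - ln (real y)) - c ^ n * Q (w - ln (real y))))"
      by (simp add: sum_distrib_left sum_subtractf[symmetric] right_diff_distrib mult_ac)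
    have "\<bar>(\<Sum>y\<in>{1..N}. fw a U j y * TJ (w - ln (real y))) - c ^ n * (\<Sum>y\<in>{1..N}. fw a U j y * Q (w - ln (real y)))\<bar> \<le>
        (\<Sum>y\<in>{1..N}. fw a U j y * (if ln (real y) \<le> w then (C0 + 1) ^ n * real n * g w * X ^ (n - 1) else 0))"
      unfolding eq
    proof (intro order_trans[OF sum_abs] sum_mono)
      fix y assume "y \<in> {1..N}"
      from mult_left_mono[OF step[OF this] fw0[of j y]]
      show "\<bar>fw a U j y * (TJ (w - ln (real y)) - c ^ n * Q (w - ln (real y)))\<bar> \<le>
          fw a U j y * (if ln (real y) \<le> w then (C0 + 1) ^ n * real n * g w * X ^ (n - 1) else 0)"
        using fw0[of j y] by (simp add: abs_mult)
    qed
    also have "\<dots> \<le> (C0 + 1) ^ n * real n * g w * X ^ (n - 1) * X"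
      by (rule sumle) (use C0 g0 X1 in auto)
    also have "\<dots> = (C0 + 1) ^ n * real n * g w * X ^ n"
      by (cases n) auto
    finally show ?thesis .
  qed
  have T': "\<bar>(\<Sum>d\<in>{1..D}. tz a d / real d) - c * (ln (real D) powr a / Gamma (a + 1))\<bar> \<le> C0" if "D \<ge> 1" for D
    using T[of "ln (real D)"] that unfolding Lf_def by simp
  have QI: "Qn a (insert j J) U (\<lambda>y. ennreal (g y)) w = (\<integral>\<^sup>+y. ennreal (kerU a (U j) y) * ennreal (Q (w - y)) \<partial>lborel)"
    unfolding Qfin[symmetric] by (rule Qn_insert[OF insert.hyps]) measurable
  have E2: "\<bar>(\<Sum>y\<in>{1..N}. fw a U j y * Q (w - ln (real y))) - c * enn2real (Qn a (insert j J) U (\<lambda>y. ennreal (g y)) w)\<bar> \<le> (C0 + 1) * Q w"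
    unfolding QI fw_def
    using a T' insert.prems(2) Qmono Qneg c by (intro replace_one) (auto intro: tz_nonneg tz_le_1)
  \<comment> \<open>c * m is the main term of Lf a w, so the continuous mass is at most a multiple
    of the discrete one.\<close>
  have Qb: "c ^ n * Q w \<le> g w * ((C0 + 1) * X) ^ n"
  proof -
    define m where "m = w powr a / Gamma (a + 1)"
    have m0: "m \<ge> 0" unfolding m_def using a by (intro divide_nonneg_nonneg Gamma_real_nonneg) auto
    have "ennreal (Q w) \<le> ennreal (g w * m ^ n)"
      unfolding Qfin[symmetric] m_def n_def by (rule Qn_le_power[OF insert.hyps(1) a(1) g g0 insert.prems(1)])
    hence "Q w \<le> g w * m ^ n" using g0[of w] m0 by (simp add: ennreal_le_iff)
    hence "c ^ n * Q w \<le> c ^ n * (g w * m ^ n)" using c by (intro mult_left_mono) auto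
    also have "\<dots> = g w * (c * m) ^ n" by (simp add: power_mult_distrib)
    also have "\<dots> \<le> g w * ((C0 + 1) * X) ^ n"
    proof (intro mult_left_mono power_mono g0)
      have "c * m \<le> X + C0" using T[OF insert.prems(1)] unfolding m_def X_def by linarith
      also have "\<dots> \<le> (C0 + 1) * X" using X1 C0 mult_left_mono[OF X1 C0] by (simp add: algebra_simps)
      finally show "c * m \<le> (C0 + 1) * X" .
    qed (use c m0 in auto)
    finally show ?thesis .
  qed
  have card: "card (insert j J) = Suc n" using insert.hyps by (simp add: n_def)
  have "\<bar>c ^ n * (\<Sum>y\<in>{1..N}. fw a U j y * Q (w - ln (real y))) - c ^ Suc n * enn2real (Qn a (insert j J) U (\<lambda>y. ennreal (g y)) w)\<bar> \<le>
      (C0 + 1) * (g w * ((C0 + 1) * X) ^ n)"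
  proof -
    have "c ^ n * (\<Sum>y\<in>{1..N}. fw a U j y * Q (w - ln (real y))) - c ^ Suc n * enn2real (Qn a (insert j J) U (\<lambda>y. ennreal (g y)) w) =
        c ^ n * ((\<Sum>y\<in>{1..N}. fw a U j y * Q (w - ln (real y))) - c * enn2real (Qn a (insert j J) U (\<lambda>y. ennreal (g y)) w))"
      by (simp add: right_diff_distrib mult_ac)
    hence "\<bar>c ^ n * (\<Sum>y\<in>{1..N}. fw a U j y * Q (w - ln (real y))) - c ^ Suc n * enn2real (Qn a (insert j J) U (\<lambda>y. ennreal (g y)) w)\<bar> =
        c ^ n * \<bar>(\<Sum>y\<in>{1..N}. fw a U j y * Q (w - ln (real y))) - c * enn2real (Qn a (insert j J) U (\<lambda>y. ennreal (g y)) w)\<bar>"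
      using c by (simp only: abs_mult) simp
    also have "\<dots> \<le> c ^ n * ((C0 + 1) * Q w)" using c by (intro mult_left_mono E2) auto
    also have "\<dots> = (C0 + 1) * (c ^ n * Q w)" by simp
    also have "\<dots> \<le> (C0 + 1) * (g w * ((C0 + 1) * X) ^ n)" using C0 by (intro mult_left_mono Qb) auto
    finally show ?thesis .
  qed
  hence "\<bar>TS N (insert j J) (fw a U) (\<lambda>p. g (w - ln (real p))) - c ^ Suc n * enn2real (Qn a (insert j J) U (\<lambda>y. ennreal (g y)) w)\<bar> \<le>
      (C0 + 1) ^ n * real n * g w * X ^ n + (C0 + 1) * (g w * ((C0 + 1) * X) ^ n)"
    using E1 unfolding TI by linarith
  also have "(C0 + 1) * (g w * ((C0 + 1) * X) ^ n) = (C0 + 1) ^ Suc n * g w * X ^ n"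
    by (simp add: power_mult_distrib mult_ac)
  also have "(C0 + 1) ^ n * real n * g w * X ^ n + (C0 + 1) ^ Suc n * g w * X ^ n \<le> (C0 + 1) ^ Suc n * real (Suc n) * g w * X ^ n"
  proof -
    have "(C0 + 1) ^ n \<le> (C0 + 1) ^ Suc n" using C0 by (intro power_increasing) auto
    hence "(C0 + 1) ^ n * (real n * g w * X ^ n) \<le> (C0 + 1) ^ Suc n * (real n * g w * X ^ n)"
      using g0 X1 by (intro mult_right_mono) auto
    thus ?thesis by (simp add: algebra_simps)
  qed
  finally show ?case unfolding card X_def by simp
qed

lemma TS_group_tup:
  assumes "finite J"
  shows "TS N J f (\<lambda>p. if p \<le> N then G p else 0) = (\<Sum>n\<in>{1..N}. (\<Sum>d\<in>tup J n. \<Prod>i\<in>J. f i (d i)) * G n)"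
proof -
  let ?P = "\<lambda>d. \<Prod>i\<in>J. d i"
  have fin: "finite (J \<rightarrow>\<^sub>E {1..N})" using assms by (intro finite_PiE) auto
  have P1: "?P d \<ge> 1" if "d \<in> J \<rightarrow>\<^sub>E {1..N}" for d
  proof -
    have "(\<Prod>i\<in>J. 1) \<le> ?P d" using that by (intro prod_mono) (auto simp: PiE_iff)
    thus ?thesis by simp
  qed
  have "TS N J f (\<lambda>p. if p \<le> N then G p else 0) =
      (\<Sum>d\<in>J \<rightarrow>\<^sub>E {1..N}. if ?P d \<le> N then (\<Prod>i\<in>J. f i (d i)) * G (?P d) else 0)"
    unfolding TS_def by (intro sum.cong) auto
  also have "\<dots> = (\<Sum>d\<in>{d \<in> J \<rightarrow>\<^sub>E {1..N}. ?P d \<le> N}. (\<Prod>i\<in>J. f i (d i)) * G (?P d))"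
    by (rule sum.inter_filter[symmetric]) (rule fin)
  also have "\<dots> = (\<Sum>n\<in>{1..N}. \<Sum>d\<in>{d\<in>{d \<in> J \<rightarrow>\<^sub>E {1..N}. ?P d \<le> N}. ?P d = n}. (\<Prod>i\<in>J. f i (d i)) * G (?P d))"
    by (rule sum.group[symmetric]) (use fin P1 in auto)
  also have "\<dots> = (\<Sum>n\<in>{1..N}. (\<Sum>d\<in>tup J n. \<Prod>i\<in>J. f i (d i)) * G n)"
  proof (rule sum.cong[OF refl])
    fix n assume n: "n \<in> {1..N}"
    have "tup J n \<subseteq> J \<rightarrow>\<^sub>E {1..n}" using assms n by (intro tup_subset) auto
    also have "\<dots> \<subseteq> J \<rightarrow>\<^sub>E {1..N}" using n by (intro PiE_mono) auto
    finally have "{d\<in>{d \<in> J \<rightarrow>\<^sub>E {1..N}. ?P d \<le> N}. ?P d = n} = tup J n"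
      using n by (auto simp: tup_def PiE_iff)
    hence "(\<Sum>d\<in>{d\<in>{d \<in> J \<rightarrow>\<^sub>E {1..N}. ?P d \<le> N}. ?P d = n}. (\<Prod>i\<in>J. f i (d i)) * G (?P d)) =
        (\<Sum>d\<in>tup J n. (\<Prod>i\<in>J. f i (d i)) * G n)"
      by (intro sum.cong) (auto simp: tup_def)
    thus "(\<Sum>d\<in>{d\<in>{d \<in> J \<rightarrow>\<^sub>E {1..N}. ?P d \<le> N}. ?P d = n}. (\<Prod>i\<in>J. f i (d i)) * G (?P d)) =
        (\<Sum>d\<in>tup J n. \<Prod>i\<in>J. f i (d i)) * G n"
      by (simp add: sum_distrib_right[symmetric])
  qed
  finally show ?thesis .
qed

lemma TS_group:
  assumes "finite J"
  shows "TS N J (\<lambda>_. tz z) (\<lambda>p. if p \<le> N then G p else 0) = (\<Sum>n\<in>{1..N}. tz (real (card J) * z) n * G n)"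
  unfolding TS_group_tup[OF assms] using sum_tup_tz[OF assms] by (intro sum.cong) auto

section \<open>Counting weighted tuples with product at most x\<close>

definition cw :: "real \<Rightarrow> (nat \<Rightarrow> real) \<Rightarrow> nat \<Rightarrow> nat \<Rightarrow> real" where
  "cw a U i d = (if ln (real d) \<le> U i then tz a d else 0)"

definition NN :: "real \<Rightarrow> nat set \<Rightarrow> (nat \<Rightarrow> real) \<Rightarrow> real \<Rightarrow> real" where
  "NN a I U x = TS (nat \<lfloor>x\<rfloor>) I (cw a U) (\<lambda>p. if real p \<le> x then 1 else 0)"

definition Bz :: "real \<Rightarrow> real \<Rightarrow> real" where
  "Bz a Y = (\<Sum>n\<in>{1..nat \<lfloor>Y\<rfloor>}. tz a n * ln (real n))"

lemma Bz_eq: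
  assumes "Y \<ge> 0"
  shows "Bz a Y = a * (\<Sum>m\<in>{1..nat \<lfloor>Y\<rfloor>}. tz a m * psi (Y / real m))"
proof -
  have "Bz a Y = (\<Sum>n\<in>{1..nat \<lfloor>Y\<rfloor>}. \<Sum>d | d dvd n. a * (tz a d * mangoldt (n div d)))"
    unfolding Bz_def
  proof (rule sum.cong[OF refl])
    fix n assume "n \<in> {1..nat \<lfloor>Y\<rfloor>}"
    hence n: "n > 0" by auto
    show "tz a n * ln (real n) = (\<Sum>d | d dvd n. a * (tz a d * mangoldt (n div d)))"
      using tz_rec[OF n, of a] sum_divisors_flip[OF n, of "\<lambda>d e. mangoldt d * tz a e"]
      by (simp add: mult.commute sum_distrib_left)
  qed
  also have "\<dots> = (\<Sum>d\<in>{1..nat \<lfloor>Y\<rfloor>}. \<Sum>m\<in>{1..nat \<lfloor>Y / real d\<rfloor>}. a * (tz a d * mangoldt m))"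
    by (rule sum_divisors_upto)
  also have "\<dots> = a * (\<Sum>m\<in>{1..nat \<lfloor>Y\<rfloor>}. tz a m * psi (Y / real m))"
    unfolding psi_def by (simp add: sum_distrib_left)
  finally show ?thesis .
qed

text \<open>Chebyshev's bound for \<open>psi\<close> suffices here: it will be applied where the
  cut-off of the coordinate is effective, and that part belongs to the error.\<close>

lemma Bz_upper:
  assumes a: "0 \<le> a" "a \<le> 1" and Y: "Y \<ge> 1"
  shows "0 \<le> Bz a Y" "Bz a Y \<le> 4 * Y * Lf a (ln Y)"
proof -
  show "0 \<le> Bz a Y" unfolding Bz_def using a by (intro sum_nonneg mult_nonneg_nonneg tz_nonneg) auto
  have L: "Lf a (ln Y) = (\<Sum>d\<in>{1..nat \<lfloor>Y\<rfloor>}. tz a d / real d)" unfolding Lf_def using Y by simp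
  have "Bz a Y \<le> 1 * (\<Sum>m\<in>{1..nat \<lfloor>Y\<rfloor>}. tz a m * (4 * (Y / real m)))"
  proof -
    have "(\<Sum>m\<in>{1..nat \<lfloor>Y\<rfloor>}. tz a m * psi (Y / real m)) \<le> (\<Sum>m\<in>{1..nat \<lfloor>Y\<rfloor>}. tz a m * (4 * (Y / real m)))"
      using a Y by (intro sum_mono mult_left_mono psi_bound tz_nonneg) auto
    moreover have "0 \<le> (\<Sum>m\<in>{1..nat \<lfloor>Y\<rfloor>}. tz a m * psi (Y / real m))"
      using a by (intro sum_nonneg mult_nonneg_nonneg tz_nonneg psi_nonneg) auto
    moreover have "Bz a Y = a * (\<Sum>m\<in>{1..nat \<lfloor>Y\<rfloor>}. tz a m * psi (Y / real m))" using Y by (intro Bz_eq) auto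
    ultimately show ?thesis using a by (simp only:) (rule mult_mono, auto)
  qed
  also have "\<dots> = 4 * Y * Lf a (ln Y)" unfolding L by (simp add: sum_distrib_left mult_ac)
  finally show "Bz a Y \<le> 4 * Y * Lf a (ln Y)" .
qed

lemma Bz_main:
  assumes a: "0 \<le> a" "a \<le> 1" and Y: "Y \<ge> 1"
  shows "\<bar>Bz a Y - a * (Y * Lf a (ln Y))\<bar> \<le> (\<Sum>m\<in>{1..nat \<lfloor>Y\<rfloor>}. tz a m * \<bar>psi (Y / real m) - Y / real m\<bar>)"
proof -
  have L: "Lf a (ln Y) = (\<Sum>d\<in>{1..nat \<lfloor>Y\<rfloor>}. tz a d / real d)" unfolding Lf_def using Y by simp
  have "Bz a Y - a * (Y * Lf a (ln Y)) = a * (\<Sum>m\<in>{1..nat \<lfloor>Y\<rfloor>}. tz a m * (psi (Y / real m) - Y / real m))"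
    using Y by (subst Bz_eq) (auto simp: L sum_distrib_left right_diff_distrib sum_subtractf mult_ac)
  also have "\<bar>\<dots>\<bar> \<le> 1 * (\<Sum>m\<in>{1..nat \<lfloor>Y\<rfloor>}. tz a m * \<bar>psi (Y / real m) - Y / real m\<bar>)"
    unfolding abs_mult using a
    by (intro mult_mono order_trans[OF sum_abs] sum_mono) (auto simp: abs_mult tz_nonneg)
  finally show ?thesis by simp
qed

lemma TS_add: "TS N J f (\<lambda>p. G p + H p) = TS N J f G + TS N J f H"
  unfolding TS_def by (simp add: distrib_left sum.distrib)

lemma TS_cmult: "TS N J f (\<lambda>p. c * G p) = c * TS N J f G"
  unfolding TS_def by (simp add: sum_distrib_left mult_ac)

lemma TS_abs_le:
  assumes "finite J" "\<And>i d. i \<in> J \<Longrightarrow> d \<in> {1..N} \<Longrightarrow> 0 \<le> f i d" "\<And>i d. i \<in> J \<Longrightarrow> d \<in> {1..N} \<Longrightarrow> f i d \<le> f' i d"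
    and "\<And>p. p \<ge> 1 \<Longrightarrow> \<bar>G p\<bar> \<le> G' p"
  shows "\<bar>TS N J f G\<bar> \<le> TS N J f' G'"
proof -
  have 1: "TS N J f G \<le> TS N J f' G'"
    using assms(4) by (intro TS_mono assms) (force intro: order_trans abs_ge_zero)+
  have "TS N J f (\<lambda>p. - 1 * G p) \<le> TS N J f' G'"
    using assms(4) by (intro TS_mono assms) (force intro: order_trans abs_ge_zero)+
  hence "- TS N J f G \<le> TS N J f' G'" unfolding TS_cmult by simp
  thus ?thesis using 1 by (simp add: abs_le_iff)
qed

lemma TS_Lf_power:
  assumes "finite J" "0 \<le> a" "a \<le> 1" "x \<ge> 1"
  shows "TS (nat \<lfloor>x\<rfloor>) J (fw a U) (\<lambda>_. 1) \<le> Lf a (ln x) ^ card J"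
proof -
  have L: "Lf a (ln x) = (\<Sum>d\<in>{1..nat \<lfloor>x\<rfloor>}. tz a d / real d)" unfolding Lf_def using assms by simp
  have L0: "Lf a (ln x) \<ge> 0" using Lf_bounds(1)[of a "ln x"] assms by simp
  show ?thesis using assms(1)
  proof (induction J rule: finite_induct)
    case (insert j J)
    have "TS (nat \<lfloor>x\<rfloor>) (insert j J) (fw a U) (\<lambda>_. 1) = (\<Sum>y\<in>{1..nat \<lfloor>x\<rfloor>}. fw a U j y) * TS (nat \<lfloor>x\<rfloor>) J (fw a U) (\<lambda>_. 1)"
      unfolding TS_insert[OF insert.hyps] sum_distrib_right ..
    also have "\<dots> \<le> Lf a (ln x) * Lf a (ln x) ^ card J"
    proof (intro mult_mono insert.IH L0)
      show "(\<Sum>y\<in>{1..nat \<lfloor>x\<rfloor>}. fw a U j y) \<le> Lf a (ln x)"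
        unfolding L using assms by (intro sum_mono) (auto simp: fw_def tz_nonneg)
      show "0 \<le> TS (nat \<lfloor>x\<rfloor>) J (fw a U) (\<lambda>_. 1)"
        using assms by (intro TS_nonneg) (auto simp: fw_def tz_nonneg)
    qed
    finally show ?case using insert.hyps by simp
  qed simp
qed


text \<open>The base 1 + v absorbs the additive constant of \<open>Lf_asymptotics\<close>, so that
  powers of the bound can be taken.\<close>

lemma Lf_upper:
  assumes a: "0 < a" "a \<le> 1"
  shows "\<exists>K\<ge>1. \<forall>v\<ge>0. Lf a v \<le> K * (1 + v) powr a"
proof -
  obtain c C where c: "c \<ge> 0" "\<And>v. v \<ge> 0 \<Longrightarrow> \<bar>Lf a v - c * v powr a\<bar> \<le> C" using Lf_asymptotics[OF a] by auto
  have "Lf a v \<le> (\<bar>C\<bar> + c + 1) * (1 + v) powr a" if v: "v \<ge> 0" for v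
  proof -
    have p: "v powr a \<le> (1 + v) powr a" "1 \<le> (1 + v) powr a"
      using v a by (auto intro!: powr_mono2 ge_one_powr_ge_zero)
    have "Lf a v \<le> \<bar>C\<bar> * 1 + c * v powr a" using c(2)[OF v] by linarith
    also have "\<dots> \<le> \<bar>C\<bar> * (1 + v) powr a + c * (1 + v) powr a" using p c(1) by (intro add_mono mult_left_mono) auto
    also have "\<dots> \<le> (\<bar>C\<bar> + c + 1) * (1 + v) powr a" by (simp add: distrib_right)
    finally show ?thesis .
  qed
  moreover have "\<bar>C\<bar> + c + 1 \<ge> 1" using c by simp
  ultimately show ?thesis by blast
qed

text \<open>The error \<open>(1 + L)\<^bsup>1 - a\<^esup>\<close> is what a single coordinate costs: replacing one of the \<open>1 / a\<close>
  coordinates by its continuous counterpart loses \<open>O(1)\<close>, and each of the others has mass \<open>O((1 + L)\<^sup>a)\<close>.\<close>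

lemma log_weighted_term:
  fixes I :: "nat set"
  assumes a: "0 < a" "a \<le> 1 / 2" and I: "finite I" "real (card I) * a = 1"
    and c: "c \<ge> 0" and T: "\<And>v. v \<ge> 0 \<Longrightarrow> \<bar>Lf a v - c * (v powr a / Gamma (a + 1))\<bar> \<le> C0"
  shows "\<exists>C. \<forall>x\<ge>2. \<forall>U. \<forall>j\<in>I.
    \<bar>TS (nat \<lfloor>x\<rfloor>) (I - {j}) (cw a U) (\<lambda>p. \<Sum>y\<in>{1..nat \<lfloor>x\<rfloor>}. cw a U j y * (if real (y * p) \<le> x then ln (real y) else 0)) -
      x * c ^ card I * (a * enn2real (Qn a (I - {j}) U (\<lambda>w. ennreal (gcut a (U j) w)) (ln x)))\<bar> \<le> C * x * (1 + ln x) powr (1 - a)"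
proof -
  have a1: "a \<le> 1" using a by simp
  obtain K where K: "K \<ge> 1" "\<And>v. v \<ge> 0 \<Longrightarrow> Lf a v \<le> K * (1 + v) powr a" using Lf_upper[OF a(1) a1] by auto
  obtain Cp where Cp: "Cp \<ge> 0" "\<And>x. x \<ge> 2 \<Longrightarrow> (\<Sum>m\<in>{1..nat \<lfloor>x\<rfloor>}. \<bar>psi (x / real m) - x / real m\<bar>) \<le> Cp * x * sqrt (ln x)"
    using psi_error_average by auto
  define n where "n = card I - 1"
  have cI: "card I \<ge> 2"
  proof (rule ccontr)
    assume "\<not> card I \<ge> 2"
    hence "real (card I) * a \<le> 1 * a" using a by (intro mult_right_mono) auto
    thus False using I a by simp
  qed
  have n: "card I = Suc n" "n \<ge> 1" using cI by (auto simp: n_def)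
  have na: "real n * a = 1 - a" using I(2) n by (simp add: algebra_simps)
  have C00: "C0 \<ge> 0" using T[of 0] by linarith
  have G0: "Gamma (a + 1) > 0" using a by (intro Gamma_real_pos) auto
  define C where "C = Cp + 4 * K + C0 * K ^ n + c * (2 * ((C0 + 1) ^ n * real n * (1 / Gamma (a + 1)) * K ^ (n - 1)))"
  have "\<bar>TS (nat \<lfloor>x\<rfloor>) (I - {j}) (cw a U) (\<lambda>p. \<Sum>y\<in>{1..nat \<lfloor>x\<rfloor>}. cw a U j y * (if real (y * p) \<le> x then ln (real y) else 0)) -
      x * c ^ card I * (a * enn2real (Qn a (I - {j}) U (\<lambda>w. ennreal (gcut a (U j) w)) (ln x)))\<bar> \<le> C * x * (1 + ln x) powr (1 - a)"
    if x: "x \<ge> 2" and j: "j \<in> I" for x U j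
  proof -
    define N where "N = nat \<lfloor>x\<rfloor>"
    define L where "L = ln x"
    define J where "J = I - {j}"
    have J: "finite J" "card J = n" "j \<notin> J" "I = insert j J" using I j n by (auto simp: J_def)
    have L0: "L > 0" unfolding L_def using x by simp
    have N: "real N \<le> x" "x < real (Suc N)" unfolding N_def using x by linarith+
    have pN: "real p \<le> x \<longleftrightarrow> p \<le> N" for p :: nat unfolding N_def using x by linarith
    define E where "E = (1 + L) powr (1 - a)"
    have LfL: "Lf a L \<le> K * (1 + L) powr a" using K(2) L0 by simp
    have Lf1: "1 \<le> Lf a L" using Lf_bounds(1)[of a L] a a1 L0 by simp
    have aE: "(1 + L) powr a \<le> E" unfolding E_def using L0 a by (intro powr_mono) auto
    have powE: "Lf a L ^ n \<le> K ^ n * E"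
    proof -
      have "Lf a L ^ n \<le> (K * (1 + L) powr a) ^ n" using LfL Lf1 by (intro power_mono) auto
      also have "\<dots> = K ^ n * E"
      proof -
        have "((1 + L) powr a) ^ n = (1 + L) powr (real n * a)" using L0 by (simp add: powr_power mult.commute)
        thus ?thesis unfolding na E_def by (simp add: power_mult_distrib)
      qed
      finally show ?thesis .
    qed
    define inner where "inner p = (\<Sum>y\<in>{1..N}. cw a U j y * (if real (y * p) \<le> x then ln (real y) else 0))" for p
    define \<Delta> where "\<Delta> y = \<bar>psi y - y\<bar>" for y
    \<comment> \<open>The main term for coordinate j when the others have product p: inner p is
      close to a * (x / p) * gh (L - ln p), with nothing from those p for which the cut-off exp (U
      j) lies below x / p.\<close>
    define gh where "gh w = (if 0 \<le> w \<and> w \<le> U j then Lf a w else 0)" for w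
    have cw0: "0 \<le> cw a U i d" "cw a U i d \<le> tz a d" for i d using a by (auto simp: cw_def tz_nonneg)
    \<comment> \<open>Two errors: replacing psi y by y when the cut-off is not felt, and the entire
      inner sum when it is.\<close>
    have innerle: "\<bar>inner p - a * (x / real p * gh (L - ln (real p)))\<bar> \<le>
        (if p \<le> N then (\<Sum>m\<in>{1..nat \<lfloor>x / real p\<rfloor>}. tz a m * \<Delta> (x / real p / real m)) else 0) +
        (if real p \<le> x / exp (U j) \<and> 0 \<le> U j \<and> U j \<le> L then 4 * exp (U j) * Lf a L else 0)" if p: "p \<ge> 1" for p
    proof -
      have lp: "L - ln (real p) = ln (x / real p)" unfolding L_def using p x by (simp add: ln_div)
      have rng: "y \<in> {1..N} \<and> real (y * p) \<le> x \<longleftrightarrow> y \<in> {1..nat \<lfloor>x / real p\<rfloor>}" for y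
      proof -
        have "real (y * p) \<le> x \<longleftrightarrow> real y \<le> x / real p" using p by (simp add: field_simps)
        moreover have "real y \<le> x" if "real y \<le> x / real p"
        proof -
          have "x / real p \<le> x / 1" using p x by (intro divide_left_mono) auto
          thus ?thesis using that by simp
        qed
        ultimately show ?thesis unfolding N_def in_upto_iff by auto
      qed
      have inner1: "inner p = (\<Sum>y\<in>{1..nat \<lfloor>x / real p\<rfloor>}. cw a U j y * ln (real y))"
      proof -
        have "inner p = (\<Sum>y\<in>{1..N}. if real (y * p) \<le> x then cw a U j y * ln (real y) else 0)"
          unfolding inner_def by (intro sum.cong) auto
        also have "\<dots> = (\<Sum>y\<in>{y\<in>{1..N}. real (y * p) \<le> x}. cw a U j y * ln (real y))"
          by (rule sum.inter_filter[symmetric]) simp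
        also have "{y\<in>{1..N}. real (y * p) \<le> x} = {1..nat \<lfloor>x / real p\<rfloor>}" using rng by blast
        finally show ?thesis .
      qed
      show ?thesis
      proof (cases "p \<le> N")
        case False
        hence "x / real p < 1" using pN[of p] p by (simp add: field_simps)
        moreover from this have "ln (x / real p) < 0" using x p by (subst ln_less_zero_iff) auto
        ultimately have "inner p = 0" "gh (L - ln (real p)) = 0" unfolding inner1 gh_def lp by auto
        thus ?thesis using False Lf1 by simp
      next
        case True
        define Y where "Y = x / real p"
        have Y1: "Y \<ge> 1" unfolding Y_def using True pN[of p] p by (simp add: field_simps)
        have YL: "ln Y \<ge> 0" "ln Y \<le> L"
        proof -
          show "ln Y \<ge> 0" using Y1 by simp
          have "ln (real p) \<ge> 0" using p by simp
          thus "ln Y \<le> L" using lp unfolding Y_def by linarith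
        qed
        have S0: "0 \<le> (\<Sum>m\<in>{1..nat \<lfloor>Y\<rfloor>}. tz a m * \<Delta> (Y / real m))"
          unfolding \<Delta>_def using a by (intro sum_nonneg mult_nonneg_nonneg tz_nonneg) auto
        show ?thesis
        proof (cases "ln Y \<le> U j")
          case le: True
          have "inner p = Bz a Y" unfolding inner1 Bz_def Y_def[symmetric]
          proof (rule sum.cong[OF refl])
            fix y assume "y \<in> {1..nat \<lfloor>Y\<rfloor>}"
            hence "y \<ge> 1" "real y \<le> Y" unfolding in_upto_iff by auto
            hence "ln (real y) \<le> ln Y" by (intro ln_mono) auto
            thus "cw a U j y * ln (real y) = tz a y * ln (real y)" using le by (simp add: cw_def)
          qed
          moreover have "gh (L - ln (real p)) = Lf a (ln Y)" unfolding lp gh_def Y_def[symmetric] using le YL by simp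
          moreover have "0 \<le> (if real p \<le> x / exp (U j) \<and> 0 \<le> U j \<and> U j \<le> L then 4 * exp (U j) * Lf a L else 0)"
            using Lf1 by simp
          ultimately show ?thesis using Bz_main[of a Y] a a1 Y1 True unfolding Y_def[symmetric] \<Delta>_def by simp
        next
          case gt: False
          have gh: "gh (L - ln (real p)) = 0" unfolding lp gh_def Y_def[symmetric] using gt by simp
          show ?thesis
          proof (cases "U j \<ge> 0")
            case False
            have "inner p = 0" unfolding inner1
            proof (rule sum.neutral, rule ballI)
              fix y assume "y \<in> {1..nat \<lfloor>x / real p\<rfloor>}"
              hence "ln (real y) \<ge> 0" by auto
              thus "cw a U j y * ln (real y) = 0" using False by (simp add: cw_def)
            qed
            thus ?thesis using gh S0 True False unfolding Y_def by simp
          next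
            case U0: True
            have eY: "exp (U j) \<le> Y" using gt Y1 by (metis exp_le_cancel_iff exp_ln less_le_trans linear zero_less_one)
            have "inner p = Bz a (exp (U j))"
            proof -
              have "inner p = (\<Sum>y\<in>{1..nat \<lfloor>exp (U j)\<rfloor>}. cw a U j y * ln (real y))"
                unfolding inner1 Y_def[symmetric]
              proof (rule sum.mono_neutral_right)
                show "{1..nat \<lfloor>exp (U j)\<rfloor>} \<subseteq> {1..nat \<lfloor>Y\<rfloor>}"
                  using nat_mono[OF floor_mono[OF eY]] by auto
                show "\<forall>y\<in>{1..nat \<lfloor>Y\<rfloor>} - {1..nat \<lfloor>exp (U j)\<rfloor>}. cw a U j y * ln (real y) = 0"
                proof
                  fix y assume y: "y \<in> {1..nat \<lfloor>Y\<rfloor>} - {1..nat \<lfloor>exp (U j)\<rfloor>}"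
                  hence "\<not> ln (real y) \<le> U j" using exp_ge_iff_ln_le[of y "U j"] in_upto_iff[of y "exp (U j)"] by auto
                  thus "cw a U j y * ln (real y) = 0" by (simp add: cw_def)
                qed
              qed simp
              also have "\<dots> = Bz a (exp (U j))" unfolding Bz_def
              proof (rule sum.cong[OF refl])
                fix y assume y: "y \<in> {1..nat \<lfloor>exp (U j)\<rfloor>}"
                hence "ln (real y) \<le> U j" using exp_ge_iff_ln_le[of y "U j"] in_upto_iff[of y "exp (U j)"] by auto
                thus "cw a U j y * ln (real y) = tz a y * ln (real y)" by (simp add: cw_def)
              qed
              finally show ?thesis .
            qed
            moreover have "0 \<le> Bz a (exp (U j))" "Bz a (exp (U j)) \<le> 4 * exp (U j) * Lf a (U j)"
              using Bz_upper[of a "exp (U j)"] a a1 U0 by auto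
            moreover have UL: "U j \<le> L" using gt YL by simp
            moreover have "4 * exp (U j) * Lf a (U j) \<le> 4 * exp (U j) * Lf a L"
              using UL a by (intro mult_left_mono Lf_mono) auto
            moreover have c1: "real p \<le> x / exp (U j) \<and> 0 \<le> U j \<and> U j \<le> L"
              using eY p UL U0 unfolding Y_def by (simp add: field_simps)
            ultimately show ?thesis using S0 unfolding Y_def if_P[OF True] if_P[OF c1] gh by linarith
          qed
        qed
      qed
    qed
    \<comment> \<open>Regrouping by q = p * m, the weights convolve to tz 1, so the errors of
      \<open>psi\<close> are summed without weights.\<close>
    have E1: "TS N J (\<lambda>_. tz a) (\<lambda>p. if p \<le> N then (\<Sum>m\<in>{1..nat \<lfloor>x / real p\<rfloor>}. tz a m * \<Delta> (x / real p / real m)) else 0) \<le> Cp * x * E"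
    proof -
      have "TS N J (\<lambda>_. tz a) (\<lambda>p. if p \<le> N then (\<Sum>m\<in>{1..nat \<lfloor>x / real p\<rfloor>}. tz a m * \<Delta> (x / real p / real m)) else 0) =
          (\<Sum>p\<in>{1..N}. tz (real (card J) * a) p * (\<Sum>m\<in>{1..nat \<lfloor>x / real p\<rfloor>}. tz a m * \<Delta> (x / real p / real m)))"
        by (rule TS_group[OF J(1)])
      also have "\<dots> = (\<Sum>p\<in>{1..N}. \<Sum>m\<in>{1..nat \<lfloor>x / real p\<rfloor>}. tz (1 - a) p * tz a m * \<Delta> (x / real (p * m)))"
        unfolding J(2) na by (simp add: sum_distrib_left mult_ac)
      also have "\<dots> = (\<Sum>q\<in>{1..N}. \<Sum>p | p dvd q. tz (1 - a) p * tz a (q div p) * \<Delta> (x / real (p * (q div p))))"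
        unfolding N_def by (rule sum_divisors_upto[symmetric])
      also have "\<dots> = (\<Sum>q\<in>{1..N}. \<Delta> (x / real q))"
      proof (rule sum.cong[OF refl])
        fix q assume "q \<in> {1..N}"
        hence q: "q > 0" by auto
        have "(\<Sum>p | p dvd q. tz (1 - a) p * tz a (q div p) * \<Delta> (x / real (p * (q div p)))) =
            (\<Sum>p | p dvd q. tz (1 - a) p * tz a (q div p)) * \<Delta> (x / real q)"
          unfolding sum_distrib_right by (intro sum.cong) auto
        also have "(\<Sum>p | p dvd q. tz (1 - a) p * tz a (q div p)) = 1"
          using tz_conv[OF q, of "1 - a" a] tz_one[OF q] by simp
        finally show "(\<Sum>p | p dvd q. tz (1 - a) p * tz a (q div p) * \<Delta> (x / real (p * (q div p)))) = \<Delta> (x / real q)" by simp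
      qed
      also have "\<dots> \<le> Cp * x * sqrt L" unfolding \<Delta>_def N_def L_def by (rule Cp(2)[OF x])
      also have "\<dots> \<le> Cp * x * E"
      proof (rule mult_left_mono)
        have "sqrt L \<le> sqrt (1 + L)" by simp
        also have "\<dots> = (1 + L) powr (1 / 2)" using L0 by (simp add: powr_half_sqrt)
        also have "\<dots> \<le> E" unfolding E_def using L0 a by (intro powr_mono) auto
        finally show "sqrt L \<le> E" .
      qed (use Cp x in simp)
      finally show ?thesis .
    qed
    \<comment> \<open>Every p has weight tz (1 - a) p <= 1, and there are at most x / exp (U j) of
      them, which cancels the factor exp (U j).\<close>
    have E2: "TS N J (\<lambda>_. tz a) (\<lambda>p. if real p \<le> x / exp (U j) \<and> 0 \<le> U j \<and> U j \<le> L then 4 * exp (U j) * Lf a L else 0) \<le> 4 * K * x * E"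
    proof (cases "0 \<le> U j \<and> U j \<le> L")
      case False
      hence "TS N J (\<lambda>_. tz a) (\<lambda>p. if real p \<le> x / exp (U j) \<and> 0 \<le> U j \<and> U j \<le> L then 4 * exp (U j) * Lf a L else 0) = 0"
        by (auto simp: TS_def)
      thus ?thesis using K x by (simp add: E_def)
    next
      case True
      define y where "y = x / exp (U j)"
      have y: "0 \<le> y" "y \<le> x"
      proof -
        show "0 \<le> y" unfolding y_def using x by simp
        have "x / exp (U j) \<le> x / 1" using True x by (intro divide_left_mono) auto
        thus "y \<le> x" unfolding y_def by simp
      qed
      define H where "H p = (if real p \<le> y then 4 * exp (U j) * Lf a L else 0)" for p :: nat
      have H0: "H p \<ge> 0" for p unfolding H_def using Lf1 by simp
      have "TS N J (\<lambda>_. tz a) (\<lambda>p. if real p \<le> x / exp (U j) \<and> 0 \<le> U j \<and> U j \<le> L then 4 * exp (U j) * Lf a L else 0) =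
          TS N J (\<lambda>_. tz a) (\<lambda>p. if p \<le> N then H p else 0)"
      proof (rule TS_cong[OF J(1) refl])
        fix p :: nat
        show "(if real p \<le> x / exp (U j) \<and> 0 \<le> U j \<and> U j \<le> L then 4 * exp (U j) * Lf a L else 0) = (if p \<le> N then H p else 0)"
          using pN[of p] y True unfolding H_def y_def[symmetric] by auto
      qed
      also have "\<dots> = (\<Sum>p\<in>{1..N}. tz (1 - a) p * H p)" using TS_group[OF J(1), of N a H] unfolding J(2) na .
      also have "\<dots> \<le> (\<Sum>p\<in>{1..N}. 1 * H p)" using a H0 by (intro sum_mono mult_right_mono tz_le_1) auto
      also have "\<dots> = (\<Sum>p\<in>{p\<in>{1..N}. real p \<le> y}. 4 * exp (U j) * Lf a L)"
        unfolding H_def mult_1 by (rule sum.inter_filter[symmetric]) simp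
      also have "\<dots> = real (card {p\<in>{1..N}. real p \<le> y}) * (4 * exp (U j) * Lf a L)" by simp
      also have "\<dots> \<le> y * (4 * exp (U j) * Lf a L)"
      proof (rule mult_right_mono)
        have "card {p\<in>{1..N}. real p \<le> y} \<le> card {1..nat \<lfloor>y\<rfloor>}" by (intro card_mono) (auto simp: le_nat_floor)
        hence "real (card {p\<in>{1..N}. real p \<le> y}) \<le> real (nat \<lfloor>y\<rfloor>)" by simp
        thus "real (card {p\<in>{1..N}. real p \<le> y}) \<le> y" using y by linarith
      qed (use Lf1 in simp)
      also have "\<dots> = 4 * x * Lf a L" unfolding y_def by simp
      also have "\<dots> \<le> 4 * x * (K * E)"
        using LfL aE K(1) x by (intro mult_left_mono order_trans[OF LfL]) auto
      finally show ?thesis by (simp add: mult_ac)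
    qed
    define fwJ where "fwJ = TS N J (fw a U)"
    \<comment> \<open>The factor 1 / p is distributed over the coordinates and turns the weights
      \<open>cw\<close> into \<open>fw\<close>.\<close>
    have main1: "TS N J (cw a U) (\<lambda>p. a * (x / real p * gh (L - ln (real p)))) = a * x * fwJ (\<lambda>p. gh (L - ln (real p)))"
    proof -
      have "TS N J (cw a U) (\<lambda>p. a * (x / real p * gh (L - ln (real p)))) = TS N J (fw a U) (\<lambda>p. a * x * gh (L - ln (real p)))"
        unfolding TS_def
      proof (rule sum.cong[OF refl])
        fix d assume d: "d \<in> J \<rightarrow>\<^sub>E {1..N}"
        have d1: "d i \<ge> 1" if "i \<in> J" for i using d that by (auto simp: PiE_iff)
        have "(\<Prod>i\<in>J. fw a U i (d i)) = (\<Prod>i\<in>J. cw a U i (d i) / real (d i))"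
          by (intro prod.cong) (auto simp: fw_def cw_def)
        also have "\<dots> = (\<Prod>i\<in>J. cw a U i (d i)) / real (\<Prod>i\<in>J. d i)" by (simp add: prod_dividef)
        finally have "(\<Prod>i\<in>J. fw a U i (d i)) = (\<Prod>i\<in>J. cw a U i (d i)) / real (\<Prod>i\<in>J. d i)" .
        thus "(\<Prod>i\<in>J. cw a U i (d i)) * (a * (x / real (\<Prod>i\<in>J. d i) * gh (L - ln (real (\<Prod>i\<in>J. d i))))) =
            (\<Prod>i\<in>J. fw a U i (d i)) * (a * x * gh (L - ln (real (\<Prod>i\<in>J. d i))))"
          by simp
      qed
      thus ?thesis unfolding fwJ_def TS_cmult .
    qed
    have fw0: "0 \<le> fw a U i d" for i d using a by (auto simp: fw_def tz_nonneg)
    have main2: "\<bar>fwJ (\<lambda>p. gh (L - ln (real p))) - fwJ (\<lambda>p. c * gcut a (U j) (L - ln (real p)))\<bar> \<le> C0 * K ^ n * E"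
    proof -
      have "fwJ (\<lambda>p. gh (L - ln (real p))) - fwJ (\<lambda>p. c * gcut a (U j) (L - ln (real p))) =
          fwJ (\<lambda>p. gh (L - ln (real p)) + (-1) * (c * gcut a (U j) (L - ln (real p))))"
        unfolding fwJ_def TS_add TS_cmult by simp
      also have "\<bar>\<dots>\<bar> \<le> fwJ (\<lambda>_. C0 * 1)"
        unfolding fwJ_def
      proof (intro TS_abs_le J fw0 order_refl)
        fix p :: nat
        define w where "w = L - ln (real p)"
        have "\<bar>gh w + (-1) * (c * gcut a (U j) w)\<bar> \<le> C0"
        proof (cases "0 \<le> w \<and> w \<le> U j")
          case True
          have "gcut a (U j) w = w powr a / Gamma (a + 1)" using True a by (cases "w = 0") (auto simp: gcut_def)
          thus ?thesis using T[of w] True by (simp add: gh_def)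
        next
          case False
          thus ?thesis using C00 by (auto simp: gh_def gcut_def indicator_def)
        qed
        thus "\<bar>gh (L - ln (real p)) + (-1) * (c * gcut a (U j) (L - ln (real p)))\<bar> \<le> C0 * 1" by (simp add: w_def)
      qed
      also have "\<dots> = C0 * fwJ (\<lambda>_. 1)" unfolding fwJ_def by (rule TS_cmult)
      also have "fwJ (\<lambda>_. 1) \<le> Lf a L ^ n"
        unfolding fwJ_def N_def L_def J(2)[symmetric] using a a1 x J by (intro TS_Lf_power) auto
      hence "C0 * fwJ (\<lambda>_. 1) \<le> C0 * (K ^ n * E)" using powE C00 by (intro mult_left_mono) auto
      finally show ?thesis by (simp add: mult.assoc)
    qed
    \<comment> \<open>\<open>gcut\<close> drops to 0 at U j and is not monotone; as the difference
      of the increasing functions g1 and g2 it becomes accessible to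
      \<open>replace_multi\<close>.\<close>
    define g1 where "g1 w = (if w > 0 then w powr a / Gamma (a + 1) else 0)" for w
    define g2 where "g2 w = (if w > U j then g1 w else 0)" for w
    have g10: "g1 w \<ge> 0" for w unfolding g1_def using G0 by simp
    have g1m: "mono g1" unfolding g1_def mono_def using G0 a by (auto intro!: divide_right_mono powr_mono2)
    have g2m: "mono g2" unfolding g2_def mono_def using g10 monoD[OF g1m] by auto
    have gz: "g1 w = 0" "g2 w = 0" if "w < 0" for w using that by (auto simp: g1_def g2_def)
    have [measurable]: "g1 \<in> borel_measurable borel" "g2 \<in> borel_measurable borel"
      using g1m g2m by (auto intro: borel_measurable_mono)
    have gg: "gcut a (U j) w = g1 w - g2 w" for w by (auto simp: gcut_def g1_def g2_def indicator_def)
    define Q where "Q g = enn2real (Qn a J U (\<lambda>w. ennreal (g w)) L)" for g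
    have Qfin: "Qn a J U (\<lambda>w. ennreal (g w)) L = ennreal (Q g)" if "mono g" "\<And>y. y < 0 \<Longrightarrow> g y = 0" "\<And>y. g y \<ge> 0" for g
    proof -
      have "Qn a J U (\<lambda>w. ennreal (g w)) L < top"
        using Qn_le_power[OF J(1) a(1) that, of L U] L0 by (auto elim!: le_less_trans)
      thus ?thesis unfolding Q_def by simp
    qed
    have g20: "g2 w \<ge> 0" for w unfolding g2_def using g10 by simp
    have QQ: "Q (gcut a (U j)) = Q g1 - Q g2"
    proof -
      have "Qn a J U (\<lambda>w. ennreal (g1 w)) L = Qn a J U (\<lambda>w. ennreal (gcut a (U j) w) + ennreal (g2 w)) L"
      proof -
        have "ennreal (g1 w) = ennreal (gcut a (U j) w) + ennreal (g2 w)" for w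
          using gg[of w] g20[of w] gcut_nonneg[OF a(1), of "U j" w] by (simp add: ennreal_plus[symmetric] del: ennreal_plus)
        thus ?thesis by simp
      qed
      also have "\<dots> = Qn a J U (\<lambda>w. ennreal (gcut a (U j) w)) L + Qn a J U (\<lambda>w. ennreal (g2 w)) L"
        unfolding Qn_def distrib_left by (rule nn_integral_add) measurable
      finally have eq: "ennreal (Q g1) = Qn a J U (\<lambda>w. ennreal (gcut a (U j) w)) L + ennreal (Q g2)"
        using Qfin[OF g1m gz(1) g10] Qfin[OF g2m gz(2) g20] by simp
      hence "Qn a J U (\<lambda>w. ennreal (gcut a (U j) w)) L \<le> ennreal (Q g1)" by simp
      hence "Qn a J U (\<lambda>w. ennreal (gcut a (U j) w)) L < top" by (rule le_less_trans) simp
      hence "Qn a J U (\<lambda>w. ennreal (gcut a (U j) w)) L = ennreal (Q (gcut a (U j)))" unfolding Q_def by simp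
      hence "ennreal (Q g1) = ennreal (Q (gcut a (U j)) + Q g2)" using eq by (simp add: Q_def)
      hence "Q g1 = Q (gcut a (U j)) + Q g2" by (subst (asm) ennreal_inj) (auto simp: Q_def)
      thus ?thesis by simp
    qed
    have eL: "exp L < real (Suc N)" unfolding L_def using x N by simp
    define Er where "Er = (C0 + 1) ^ n * real n * (1 / Gamma (a + 1)) * K ^ (n - 1) * E"
    have rep: "\<bar>fwJ (\<lambda>p. g (L - ln (real p))) - c ^ n * Q g\<bar> \<le> Er"
      if g: "mono g" "\<And>y. y < 0 \<Longrightarrow> g y = 0" "\<And>y. 0 \<le> g y" "g L \<le> g1 L" for g
    proof -
      have "\<bar>fwJ (\<lambda>p. g (L - ln (real p))) - c ^ n * Q g\<bar> \<le> (C0 + 1) ^ n * real n * g L * Lf a L ^ (n - 1)"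
        unfolding fwJ_def Q_def J(2)[symmetric]
        by (rule replace_multi[OF a(1) a1 c T J(1) g(1,2) _ eL]) (use L0 in auto)
      also have "\<dots> \<le> (C0 + 1) ^ n * real n * ((1 / Gamma (a + 1)) * (1 + L) powr a) * (K * (1 + L) powr a) ^ (n - 1)"
      proof -
        have "g L \<le> (1 / Gamma (a + 1)) * (1 + L) powr a"
        proof -
          have "g1 L \<le> (1 + L) powr a / Gamma (a + 1)" unfolding g1_def using L0 G0 a
            by (auto intro!: divide_right_mono powr_mono2)
          thus ?thesis using g(4) by simp
        qed
        thus ?thesis using C00 G0 LfL Lf1 g(3) by (intro mult_mono power_mono) auto
      qed
      also have "\<dots> = (C0 + 1) ^ n * real n * (1 / Gamma (a + 1)) * K ^ (n - 1) * ((1 + L) powr a * ((1 + L) powr a) ^ (n - 1))"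
        by (simp add: power_mult_distrib mult_ac)
      also have "(1 + L) powr a * ((1 + L) powr a) ^ (n - 1) = E"
      proof -
        have "(1 + L) powr a * ((1 + L) powr a) ^ (n - 1) = ((1 + L) powr a) ^ n" using n by (cases n) auto
        also have "\<dots> = (1 + L) powr (real n * a)" using L0 by (simp add: powr_power mult.commute)
        finally show ?thesis unfolding na E_def .
      qed
      finally show ?thesis unfolding Er_def .
    qed
    have main3: "\<bar>fwJ (\<lambda>p. c * gcut a (U j) (L - ln (real p))) - c * (c ^ n * Q (gcut a (U j)))\<bar> \<le> c * (2 * Er)"
    proof -
      have "fwJ (\<lambda>p. gcut a (U j) (L - ln (real p))) = fwJ (\<lambda>p. g1 (L - ln (real p))) - fwJ (\<lambda>p. g2 (L - ln (real p)))"
      proof -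
        have "fwJ (\<lambda>p. gcut a (U j) (L - ln (real p))) = fwJ (\<lambda>p. g1 (L - ln (real p)) + (-1) * g2 (L - ln (real p)))"
          unfolding gg by simp
        thus ?thesis unfolding fwJ_def TS_add TS_cmult by simp
      qed
      moreover have "g2 L \<le> g1 L" unfolding g2_def using g10 by simp
      ultimately have "\<bar>fwJ (\<lambda>p. gcut a (U j) (L - ln (real p))) - c ^ n * Q (gcut a (U j))\<bar> \<le> 2 * Er"
        using rep[OF g1m gz(1) g10 order_refl] rep[OF g2m gz(2) g20] unfolding QQ right_diff_distrib by linarith
      hence "c * \<bar>fwJ (\<lambda>p. gcut a (U j) (L - ln (real p))) - c ^ n * Q (gcut a (U j))\<bar> \<le> c * (2 * Er)" using c by (rule mult_left_mono)
      moreover have "fwJ (\<lambda>p. c * gcut a (U j) (L - ln (real p))) = c * fwJ (\<lambda>p. gcut a (U j) (L - ln (real p)))"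
        unfolding fwJ_def by (rule TS_cmult)
      ultimately show ?thesis using c by (simp add: right_diff_distrib[symmetric] abs_mult del: mult_le_cancel_left)
    qed
    have eq: "TS N J (cw a U) inner - TS N J (cw a U) (\<lambda>p. a * (x / real p * gh (L - ln (real p)))) =
        TS N J (cw a U) (\<lambda>p. inner p + (-1) * (a * (x / real p * gh (L - ln (real p)))))"
      unfolding TS_add TS_cmult by simp
    have "\<bar>TS N J (cw a U) inner - TS N J (cw a U) (\<lambda>p. a * (x / real p * gh (L - ln (real p))))\<bar> \<le>
        TS N J (\<lambda>_. tz a) (\<lambda>p. (if p \<le> N then (\<Sum>m\<in>{1..nat \<lfloor>x / real p\<rfloor>}. tz a m * \<Delta> (x / real p / real m)) else 0) +
        (if real p \<le> x / exp (U j) \<and> 0 \<le> U j \<and> U j \<le> L then 4 * exp (U j) * Lf a L else 0))"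
      unfolding eq
    proof (rule TS_abs_le[OF J(1) cw0(1) cw0(2)])
      fix p :: nat assume p: "p \<ge> 1"
      have "inner p + (-1) * (a * (x / real p * gh (L - ln (real p)))) = inner p - a * (x / real p * gh (L - ln (real p)))"
        by (simp only: minus_mult_left[symmetric] mult_1 diff_conv_add_uminus)
      thus "\<bar>inner p + (-1) * (a * (x / real p * gh (L - ln (real p))))\<bar> \<le>
        (if p \<le> N then (\<Sum>m\<in>{1..nat \<lfloor>x / real p\<rfloor>}. tz a m * \<Delta> (x / real p / real m)) else 0) +
        (if real p \<le> x / exp (U j) \<and> 0 \<le> U j \<and> U j \<le> L then 4 * exp (U j) * Lf a L else 0)"
        using innerle[OF p] by (simp only:)
    qed
    hence part1: "\<bar>TS N J (cw a U) inner - a * x * fwJ (\<lambda>p. gh (L - ln (real p)))\<bar> \<le> Cp * x * E + 4 * K * x * E"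
      unfolding main1 TS_add using add_mono[OF E1 E2] by (rule order_trans)
    have part2: "\<bar>a * x * fwJ (\<lambda>p. gh (L - ln (real p))) - a * x * (c * (c ^ n * Q (gcut a (U j))))\<bar> \<le> x * (C0 * K ^ n * E + c * (2 * Er))"
    proof -
      have "\<bar>fwJ (\<lambda>p. gh (L - ln (real p))) - c * (c ^ n * Q (gcut a (U j)))\<bar> \<le> C0 * K ^ n * E + c * (2 * Er)"
        using main2 main3 by linarith
      hence "a * x * \<bar>fwJ (\<lambda>p. gh (L - ln (real p))) - c * (c ^ n * Q (gcut a (U j)))\<bar> \<le> 1 * x * (C0 * K ^ n * E + c * (2 * Er))"
        using a x a1 by (intro mult_mono) auto
      moreover have "\<bar>a * x * fwJ (\<lambda>p. gh (L - ln (real p))) - a * x * (c * (c ^ n * Q (gcut a (U j))))\<bar> =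
          a * x * \<bar>fwJ (\<lambda>p. gh (L - ln (real p))) - c * (c ^ n * Q (gcut a (U j)))\<bar>"
        unfolding right_diff_distrib[symmetric] using a x by (simp only: abs_mult)
      ultimately show ?thesis by simp
    qed
    have "\<bar>TS N J (cw a U) inner - a * x * (c * (c ^ n * Q (gcut a (U j))))\<bar> \<le>
        (Cp * x * E + 4 * K * x * E) + x * (C0 * K ^ n * E + c * (2 * Er))"
      using part1 part2 by linarith
    also have "\<dots> = C * x * E" unfolding C_def Er_def by (simp add: algebra_simps)
    also have "a * x * (c * (c ^ n * Q (gcut a (U j)))) = x * c ^ card I * (a * Q (gcut a (U j)))"
      unfolding n(1) by (simp add: mult_ac)
    finally show ?thesis unfolding Q_def E_def L_def J_def inner_def N_def .
  qed
  thus ?thesis by blast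
qed

lemma TS_ln_split:
  assumes I: "finite I"
  shows "TS N I f (\<lambda>p. if real p \<le> x then ln (real p) else 0) =
    (\<Sum>j\<in>I. TS N (I - {j}) f (\<lambda>p. \<Sum>y\<in>{1..N}. f j y * (if real (y * p) \<le> x then ln (real y) else 0)))"
proof -
  have "TS N I f (\<lambda>p. if real p \<le> x then ln (real p) else 0) =
      (\<Sum>d\<in>I \<rightarrow>\<^sub>E {1..N}. \<Sum>j\<in>I. (\<Prod>i\<in>I. f i (d i)) * (if real (\<Prod>i\<in>I. d i) \<le> x then ln (real (d j)) else 0))"
    unfolding TS_def
  proof (rule sum.cong[OF refl])
    fix d assume d: "d \<in> I \<rightarrow>\<^sub>E {1..N}"
    have "ln (real (\<Prod>i\<in>I. d i)) = (\<Sum>j\<in>I. ln (real (d j)))"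
      unfolding of_nat_prod by (rule ln_prod) (use d I in \<open>auto simp: PiE_iff Suc_le_eq\<close>)
    thus "(\<Prod>i\<in>I. f i (d i)) * (if real (\<Prod>i\<in>I. d i) \<le> x then ln (real (\<Prod>i\<in>I. d i)) else 0) =
        (\<Sum>j\<in>I. (\<Prod>i\<in>I. f i (d i)) * (if real (\<Prod>i\<in>I. d i) \<le> x then ln (real (d j)) else 0))"
      by (simp only: sum_distrib_left[symmetric]) simp
  qed
  also have "\<dots> = (\<Sum>j\<in>I. \<Sum>d\<in>I \<rightarrow>\<^sub>E {1..N}. (\<Prod>i\<in>I. f i (d i)) * (if real (\<Prod>i\<in>I. d i) \<le> x then ln (real (d j)) else 0))"
    by (rule sum.swap)
  also have "\<dots> = (\<Sum>j\<in>I. TS N (I - {j}) f (\<lambda>p. \<Sum>y\<in>{1..N}. f j y * (if real (y * p) \<le> x then ln (real y) else 0)))"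
  proof (rule sum.cong[OF refl])
    fix j assume j: "j \<in> I"
    define J where "J = I - {j}"
    have J: "finite J" "j \<notin> J" "I = insert j J" using I j by (auto simp: J_def)
    have "(\<Sum>d\<in>I \<rightarrow>\<^sub>E {1..N}. (\<Prod>i\<in>I. f i (d i)) * (if real (\<Prod>i\<in>I. d i) \<le> x then ln (real (d j)) else 0)) =
        (\<Sum>y\<in>{1..N}. \<Sum>d\<in>J \<rightarrow>\<^sub>E {1..N}. (\<Prod>i\<in>insert j J. f i ((d(j := y)) i)) *
          (if real (\<Prod>i\<in>insert j J. (d(j := y)) i) \<le> x then ln (real ((d(j := y)) j)) else 0))"
      unfolding J(3) by (rule sum_PiE_insert) (use J in auto)
    also have "\<dots> = (\<Sum>y\<in>{1..N}. \<Sum>d\<in>J \<rightarrow>\<^sub>E {1..N}. (\<Prod>i\<in>J. f i (d i)) *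
          (f j y * (if real (y * (\<Prod>i\<in>J. d i)) \<le> x then ln (real y) else 0)))"
    proof (intro sum.cong refl)
      fix y d
      have "(\<Prod>i\<in>J. f i ((d(j := y)) i)) = (\<Prod>i\<in>J. f i (d i))" "(\<Prod>i\<in>J. (d(j := y)) i) = (\<Prod>i\<in>J. d i)"
        using J by (auto intro!: prod.cong)
      thus "(\<Prod>i\<in>insert j J. f i ((d(j := y)) i)) *
          (if real (\<Prod>i\<in>insert j J. (d(j := y)) i) \<le> x then ln (real ((d(j := y)) j)) else 0) =
          (\<Prod>i\<in>J. f i (d i)) * (f j y * (if real (y * (\<Prod>i\<in>J. d i)) \<le> x then ln (real y) else 0))"
        using J by simp
    qed
    also have "\<dots> = (\<Sum>d\<in>J \<rightarrow>\<^sub>E {1..N}. \<Sum>y\<in>{1..N}. (\<Prod>i\<in>J. f i (d i)) *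
          (f j y * (if real (y * (\<Prod>i\<in>J. d i)) \<le> x then ln (real y) else 0)))"
      by (rule sum.swap)
    finally show "(\<Sum>d\<in>I \<rightarrow>\<^sub>E {1..N}. (\<Prod>i\<in>I. f i (d i)) * (if real (\<Prod>i\<in>I. d i) \<le> x then ln (real (d j)) else 0)) =
        TS N (I - {j}) f (\<lambda>p. \<Sum>y\<in>{1..N}. f j y * (if real (y * p) \<le> x then ln (real y) else 0))"
      unfolding TS_def J_def[symmetric] by (simp only: sum_distrib_left)
  qed
  finally show ?thesis .
qed

lemma derivation_real:
  assumes I: "finite I" "k \<in> I" "real (card I) * a = 1" and a: "a > 0" and L: "L > 0" "U k \<ge> L"
  shows "(\<Sum>j\<in>I. a * enn2real (Qn a (I - {j}) U (\<lambda>w. ennreal (gcut a (U j) w)) L)) = L * Phi a (I - {k}) U L"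
proof -
  define J where "J = I - {k}"
  have J: "finite J" "k \<notin> J" "I = insert k J" using I by (auto simp: J_def)
  have cJ: "real (card J + 1) * a = 1" using I(3) J by simp
  define q where "q j = Qn a (I - {j}) U (\<lambda>w. ennreal (gcut a (U j) w)) L" for j
  have "ennreal L * Qn a J U (\<lambda>w. ennreal (ker a w)) L = (\<Sum>j\<in>I. ennreal a * q j)"
    unfolding J(3) q_def by (rule Qn_derivation) (use J a L in auto)
  hence eq: "ennreal (L * Phi a J U L) = (\<Sum>j\<in>I. ennreal a * q j)"
    unfolding Qn_eq_Phi[OF J(1) a cJ L(1)] using L by (simp add: ennreal_mult')
  have qf: "q j = ennreal (enn2real (q j))" if "j \<in> I" for j
  proof -
    have "ennreal a * q j \<le> (\<Sum>j\<in>I. ennreal a * q j)" using I that by (intro member_le_sum) auto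
    also have "\<dots> < top" unfolding eq[symmetric] by simp
    finally have "ennreal a * q j < top" .
    hence "q j < top" using a by (auto simp: ennreal_mult_less_top)
    thus ?thesis by simp
  qed
  have "(\<Sum>j\<in>I. ennreal a * q j) = (\<Sum>j\<in>I. ennreal (a * enn2real (q j)))"
    using a qf by (intro sum.cong refl) (simp add: ennreal_mult')
  also have "\<dots> = ennreal (\<Sum>j\<in>I. a * enn2real (q j))" using a by (intro sum_ennreal) auto
  finally have "ennreal (L * Phi a J U L) = ennreal (\<Sum>j\<in>I. a * enn2real (q j))" unfolding eq .
  moreover have "L * Phi a J U L \<ge> 0" using Phi_bounds[OF J(1) a cJ L(1)] L by simp
  moreover have "(\<Sum>j\<in>I. a * enn2real (q j)) \<ge> 0" using a by (intro sum_nonneg) auto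
  ultimately show ?thesis unfolding q_def J_def by simp
qed

text \<open>\<open>log_weighted_term\<close> and \<open>derivation_real\<close> evaluate the sum S
  weighted by the logarithm of the product. Replacing that weight by L = ln x costs O(x), and
  division by L turns (1 + L) powr (1 - a) into L powr (- a).\<close>

theorem model_count:
  fixes I :: "nat set"
  assumes a: "0 < a" "a \<le> 1 / 2" and I: "finite I" "k \<in> I" "real (card I) * a = 1"
  shows "\<exists>C\<ge>0. \<forall>x\<ge>2. \<forall>U. U k \<ge> ln x \<longrightarrow> \<bar>NN a I U x - x * Phi a (I - {k}) U (ln x)\<bar> \<le> C * x * ln x powr (- a)"
proof -
  have a1: "a \<le> 1" using a by simp
  have G0: "Gamma (a + 1) > 0" using a by (intro Gamma_real_pos) auto
  obtain c' C0 where c': "c' \<ge> 0" "\<And>v. v \<ge> 0 \<Longrightarrow> \<bar>Lf a v - c' * v powr a\<bar> \<le> C0" using Lf_asymptotics[OF a(1) a1] by auto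
  define c where "c = c' * Gamma (a + 1)"
  have c: "c \<ge> 0" using c' G0 by (simp add: c_def)
  have T: "\<bar>Lf a v - c * (v powr a / Gamma (a + 1))\<bar> \<le> C0" if "v \<ge> 0" for v
    using c'(2)[OF that] G0 by (simp add: c_def)
  obtain C1 where C1: "\<And>x U j. x \<ge> 2 \<Longrightarrow> j \<in> I \<Longrightarrow>
    \<bar>TS (nat \<lfloor>x\<rfloor>) (I - {j}) (cw a U) (\<lambda>p. \<Sum>y\<in>{1..nat \<lfloor>x\<rfloor>}. cw a U j y * (if real (y * p) \<le> x then ln (real y) else 0)) -
      x * c ^ card I * (a * enn2real (Qn a (I - {j}) U (\<lambda>w. ennreal (gcut a (U j) w)) (ln x)))\<bar> \<le> C1 * x * (1 + ln x) powr (1 - a)"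
    using log_weighted_term[OF a I(1,3) c T] by blast
  define C2 where "C2 = 3 * (4 + real (card I) * \<bar>C1\<bar>)"
  have C20: "C2 \<ge> 0" by (simp add: C2_def)
  define J where "J = I - {k}"
  have J: "finite J" "k \<notin> J" "I = insert k J" using I by (auto simp: J_def)
  have cJ: "real (card J + 1) * a = 1" using I(3) J by simp
  have raw: "\<bar>NN a I U x - x * c ^ card I * Phi a J U (ln x)\<bar> \<le> C2 * x * ln x powr (- a)"
    if x: "x \<ge> 2" and U: "U k \<ge> ln x" for x U
  proof -
    define N where "N = nat \<lfloor>x\<rfloor>"
    define L where "L = ln x"
    \<comment> \<open>Yields 1 + L <= 3 * L, the origin of the factor 3 in C2.\<close>
    have L0: "L \<ge> 1 / 2"
    proof -
      have "ln 2 \<le> L" unfolding L_def using x by (subst ln_le_cancel_iff) auto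
      thus ?thesis using ln2_ge_two_thirds by linarith
    qed
    define E where "E = (1 + L) powr (1 - a)"
    have E1: "E \<ge> 1" unfolding E_def using L0 a by (intro ge_one_powr_ge_zero) auto
    have pN: "real p \<le> x \<longleftrightarrow> p \<le> N" for p :: nat unfolding N_def using x by linarith
    define S where "S = TS N I (cw a U) (\<lambda>p. if real p \<le> x then ln (real p) else 0)"
    have S1: "\<bar>S - x * c ^ card I * (L * Phi a J U L)\<bar> \<le> real (card I) * (\<bar>C1\<bar> * x * E)"
    proof -
      have "S - x * c ^ card I * (L * Phi a J U L) = (\<Sum>j\<in>I.
          TS N (I - {j}) (cw a U) (\<lambda>p. \<Sum>y\<in>{1..N}. cw a U j y * (if real (y * p) \<le> x then ln (real y) else 0)) -
          x * c ^ card I * (a * enn2real (Qn a (I - {j}) U (\<lambda>w. ennreal (gcut a (U j) w)) L)))"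
      proof -
        have D: "L * Phi a J U L = (\<Sum>j\<in>I. a * enn2real (Qn a (I - {j}) U (\<lambda>w. ennreal (gcut a (U j) w)) L))"
          unfolding J_def by (rule derivation_real[symmetric]) (use I a L0 U in \<open>auto simp: L_def\<close>)
        show ?thesis unfolding S_def TS_ln_split[OF I(1)] D by (simp only: sum_distrib_left sum_subtractf)
      qed
      hence "\<bar>S - x * c ^ card I * (L * Phi a J U L)\<bar> \<le> (\<Sum>j\<in>I. \<bar>
          TS N (I - {j}) (cw a U) (\<lambda>p. \<Sum>y\<in>{1..N}. cw a U j y * (if real (y * p) \<le> x then ln (real y) else 0)) -
          x * c ^ card I * (a * enn2real (Qn a (I - {j}) U (\<lambda>w. ennreal (gcut a (U j) w)) L))\<bar>)"
        by (simp only: sum_abs)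
      also have "\<dots> \<le> (\<Sum>j\<in>I. \<bar>C1\<bar> * x * E)"
      proof (rule sum_mono)
        fix j assume "j \<in> I"
        have "C1 * x * E \<le> \<bar>C1\<bar> * x * E" using x E1 by (intro mult_right_mono) auto
        thus "\<bar>TS N (I - {j}) (cw a U) (\<lambda>p. \<Sum>y\<in>{1..N}. cw a U j y * (if real (y * p) \<le> x then ln (real y) else 0)) -
          x * c ^ card I * (a * enn2real (Qn a (I - {j}) U (\<lambda>w. ennreal (gcut a (U j) w)) L))\<bar> \<le> \<bar>C1\<bar> * x * E"
          using C1[OF x \<open>j \<in> I\<close>, of U] unfolding N_def L_def E_def by linarith
      qed
      also have "\<dots> = real (card I) * (\<bar>C1\<bar> * x * E)" by simp
      finally show ?thesis .
    qed
    \<comment> \<open>Without the cut-offs the total weight of each n is tz 1 n = 1, so the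
      difference is at most the sum of ln x - ln n.\<close>
    have S2: "0 \<le> L * NN a I U x - S" "L * NN a I U x - S \<le> 4 * x"
    proof -
      have cw0: "0 \<le> cw a U i d" "cw a U i d \<le> tz a d" for i d using a by (auto simp: cw_def tz_nonneg)
      have eq: "L * NN a I U x - S = TS N I (cw a U) (\<lambda>p. if real p \<le> x then L - ln (real p) else 0)"
      proof -
        have "TS N I (cw a U) (\<lambda>p. if real p \<le> x then L - ln (real p) else 0) =
            TS N I (cw a U) (\<lambda>p. L * (if real p \<le> x then 1 else 0) + (-1) * (if real p \<le> x then ln (real p) else 0))"
          by (rule TS_cong[OF I(1)]) auto
        thus ?thesis unfolding TS_add TS_cmult NN_def S_def N_def by simp
      qed
      have nn: "0 \<le> (if real p \<le> x then L - ln (real p) else 0)" for p :: nat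
        unfolding L_def using x by (cases "p = 0") auto
      show "0 \<le> L * NN a I U x - S" unfolding eq using cw0 nn by (intro TS_nonneg) auto
      have "L * NN a I U x - S \<le> TS N I (\<lambda>_. tz a) (\<lambda>p. if real p \<le> x then L - ln (real p) else 0)"
        unfolding eq using nn by (intro TS_mono I cw0) auto
      also have "\<dots> = TS N I (\<lambda>_. tz a) (\<lambda>p. if p \<le> N then L - ln (real p) else 0)"
        using pN by (intro TS_cong[OF I(1)]) auto
      also have "\<dots> = (\<Sum>n\<in>{1..N}. tz (real (card I) * a) n * (L - ln (real n)))" by (rule TS_group[OF I(1)])
      also have "\<dots> = (\<Sum>n\<in>{1..N}. ln x - ln (real n))" unfolding I(3) L_def by (intro sum.cong) (auto simp: tz_one)
      also have "\<dots> \<le> 4 * x" unfolding N_def using x by (intro sum_ln_quotient_le) auto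
      finally show "L * NN a I U x - S \<le> 4 * x" .
    qed
    have "\<bar>L * NN a I U x - x * c ^ card I * (L * Phi a J U L)\<bar> \<le> 4 * x + real (card I) * (\<bar>C1\<bar> * x * E)"
      using S1 S2 by linarith
    also have "4 * x + real (card I) * (\<bar>C1\<bar> * x * E) \<le> 4 * x * E + real (card I) * (\<bar>C1\<bar> * x * E)"
      using mult_left_mono[OF E1, of "4 * x"] x by simp
    also have "\<dots> = (4 + real (card I) * \<bar>C1\<bar>) * x * E" by (simp add: algebra_simps)
    also have "\<dots> \<le> (4 + real (card I) * \<bar>C1\<bar>) * x * (3 * (L * L powr (- a)))"
    proof (rule mult_left_mono)
      have "E \<le> (3 * L) powr (1 - a)" unfolding E_def using L0 a by (intro powr_mono2) auto
      also have "\<dots> = 3 powr (1 - a) * L powr (1 - a)" using L0 by (simp add: powr_mult)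
      also have "\<dots> \<le> 3 powr 1 * L powr (1 - a)" using a by (intro mult_right_mono powr_mono) auto
      also have "L powr (1 - a) = L * L powr (- a)" using powr_add[of L 1 "- a"] L0 by simp
      finally show "E \<le> 3 * (L * L powr (- a))" by simp
    qed (use x in simp)
    also have "\<dots> = L * (C2 * x * L powr (- a))" by (simp add: C2_def algebra_simps)
    finally have "\<bar>L * NN a I U x - x * c ^ card I * (L * Phi a J U L)\<bar> \<le> L * (C2 * x * L powr (- a))" .
    moreover have "\<bar>L * NN a I U x - x * c ^ card I * (L * Phi a J U L)\<bar> = L * \<bar>NN a I U x - x * c ^ card I * Phi a J U L\<bar>"
    proof -
      have "L * NN a I U x - x * c ^ card I * (L * Phi a J U L) = L * (NN a I U x - x * c ^ card I * Phi a J U L)"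
        by (simp add: algebra_simps)
      thus ?thesis using L0 by (simp add: abs_mult)
    qed
    ultimately have "L * \<bar>NN a I U x - x * c ^ card I * Phi a J U L\<bar> \<le> L * (C2 * x * L powr (- a))" by simp
    moreover have "L > 0" using L0 by simp
    ultimately show ?thesis unfolding L_def by (simp only: mult_le_cancel_left_pos)
  qed
  \<comment> \<open>With every cut-off at ln x the count is the integer part of x and
    \<open>Phi\<close> is 1; letting x grow determines the constant.\<close>
  have "c ^ card I = 1"
  proof -
    have ev: "\<bar>1 - c ^ card I\<bar> \<le> 1 / x + C2 * ln x powr (- a)" if x: "x \<ge> 2" for x
    proof -
      define U where "U = (\<lambda>_::nat. ln x)"
      define N where "N = nat \<lfloor>x\<rfloor>"
      have N: "real N \<le> x" "x < real N + 1" unfolding N_def using x by linarith+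
      have "NN a I U x = TS N I (\<lambda>_. tz a) (\<lambda>p. if p \<le> N then 1 else 0)"
        unfolding NN_def N_def[symmetric]
      proof (rule TS_cong[OF I(1)])
        fix i d :: nat assume d: "d \<in> {1..N}"
        hence "real d \<le> x" using N by auto
        hence "ln (real d) \<le> ln x" using d by (intro ln_mono) auto
        thus "cw a U i d = tz a d" by (simp add: cw_def U_def)
      next
        fix p :: nat
        show "(if real p \<le> x then 1 else 0) = (if p \<le> N then 1 else (0::real))" using N by auto
      qed
      also have "\<dots> = (\<Sum>n\<in>{1..N}. tz (real (card I) * a) n * 1)" by (rule TS_group[OF I(1)])
      also have "\<dots> = (\<Sum>n\<in>{1..N}. 1)" unfolding I(3) by (intro sum.cong) (auto simp: tz_one)
      finally have "NN a I U x = real N" by simp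
      moreover have "Phi a J U (ln x) = 1" by (rule Phi_eq_1[OF J(1) a(1) cJ]) (use x in \<open>auto simp: U_def\<close>)
      ultimately have "\<bar>real N - x * c ^ card I\<bar> \<le> C2 * x * ln x powr (- a)" using raw[OF x, of U] by (simp add: U_def)
      hence "\<bar>x - x * c ^ card I\<bar> \<le> 1 + C2 * x * ln x powr (- a)" using N by linarith
      moreover have "\<bar>x - x * c ^ card I\<bar> = x * \<bar>1 - c ^ card I\<bar>"
        using abs_mult[of x "1 - c ^ card I"] x by (simp add: right_diff_distrib)
      moreover have "x * (1 / x + C2 * ln x powr (- a)) = 1 + C2 * x * ln x powr (- a)"
        using x by (simp add: distrib_left)
      ultimately have "x * \<bar>1 - c ^ card I\<bar> \<le> x * (1 / x + C2 * ln x powr (- a))" by simp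
      thus ?thesis using x by (simp only: mult_le_cancel_left_pos)
    qed
    have lim: "((\<lambda>x. 1 / x + C2 * ln x powr (- a)) \<longlongrightarrow> 0) at_top" using a by real_asymp
    have "\<bar>1 - c ^ card I\<bar> \<le> 0"
      by (rule tendsto_lowerbound[OF lim]) (auto intro!: eventually_at_top_linorderI[of 2] ev)
    thus ?thesis by simp
  qed
  thus ?thesis using raw C20 unfolding J_def by auto
qed

section \<open>From the model law to the uniform law\<close>

text \<open>The integrands agree everywhere, faces of the box included: where a base is 0, both
  \<open>powr\<close> and \<open>ker\<close> are 0. The condition on the sum of the u i keeps the
  last base nonnegative.\<close>

lemma dirichlet_F_eq_Phi:
  assumes k: "k \<ge> 2" and u: "\<And>i. i \<in> {1..k-1} \<Longrightarrow> u i \<ge> 0" "(\<Sum>i=1..k-1. u i) \<le> 1"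
  shows "dirichlet_F k u = Phi (1 / real k) {1..k-1} u 1"
proof -
  define a where "a = 1 / real k"
  define J where "J = {1..k-1}"
  have J: "finite J" by (simp add: J_def)
  have a: "a > 0" using k by (simp add: a_def)
  have G: "Gamma a > 0" using a by (intro Gamma_real_pos) auto
  define g where "g t = (\<Prod>i\<in>J. kerU a (u i) (t i)) * ker a (1 - (\<Sum>i\<in>J. t i))" for t
  have gm: "g \<in> borel_measurable (\<Pi>\<^sub>M i\<in>J. lborel)" unfolding g_def by measurable
  have g0: "g t \<ge> 0" for t unfolding g_def by (intro mult_nonneg_nonneg prod_nonneg ker_nonneg kerU_nonneg a)
  have kk: "k = Suc (card J)" using k by (simp add: J_def)
  have eq: "indicator (\<Pi>\<^sub>E i\<in>J. {0..u i}) t *\<^sub>R ((\<Prod>i\<in>J. t i powr (a - 1)) * (1 - (\<Sum>i\<in>J. t i)) powr (a - 1)) =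
      Gamma a ^ k * g t" if t: "t \<in> space (\<Pi>\<^sub>M i\<in>J. lborel)" for t
  proof (cases "t \<in> (\<Pi>\<^sub>E i\<in>J. {0..u i})")
    case True
    have 1: "kerU a (u i) (t i) = t i powr (a - 1) / Gamma a" if "i \<in> J" for i
    proof -
      have "0 \<le> t i" "t i \<le> u i" using True that by (auto simp: PiE_iff)
      thus ?thesis by (cases "t i = 0") (auto simp: kerU_def ker_def)
    qed
    have "(\<Sum>i\<in>J. t i) \<le> (\<Sum>i\<in>J. u i)" using True by (intro sum_mono) (auto simp: PiE_iff)
    hence "(\<Sum>i\<in>J. t i) \<le> 1" using u unfolding J_def by linarith
    hence 2: "ker a (1 - (\<Sum>i\<in>J. t i)) = (1 - (\<Sum>i\<in>J. t i)) powr (a - 1) / Gamma a"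
      by (cases "(\<Sum>i\<in>J. t i) = 1") (auto simp: ker_def)
    have "(\<Prod>i\<in>J. kerU a (u i) (t i)) = (\<Prod>i\<in>J. t i powr (a - 1)) / Gamma a ^ card J"
      using 1 by (simp add: prod_dividef)
    thus ?thesis using True G unfolding g_def 2 kk by simp
  next
    case False
    then obtain i where i: "i \<in> J" "\<not> (0 \<le> t i \<and> t i \<le> u i)" using t by (auto simp: space_PiM PiE_iff)
    hence "kerU a (u i) (t i) = 0" by (auto simp: kerU_def ker_def)
    hence "g t = 0" unfolding g_def using J i by auto
    thus ?thesis using False by simp
  qed
  have "set_lebesgue_integral (\<Pi>\<^sub>M i\<in>J. lborel) (\<Pi>\<^sub>E i\<in>J. {0..u i})
       (\<lambda>t. (\<Prod>i\<in>J. t i powr (a - 1)) * (1 - (\<Sum>i\<in>J. t i)) powr (a - 1)) =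
       (\<integral>t. Gamma a ^ k * g t \<partial>(\<Pi>\<^sub>M i\<in>J. lborel))"
    unfolding set_lebesgue_integral_def by (rule Bochner_Integration.integral_cong) (use eq in auto)
  also have "\<dots> = Gamma a ^ k * (\<integral>t. g t \<partial>(\<Pi>\<^sub>M i\<in>J. lborel))" by simp
  also have "(\<integral>t. g t \<partial>(\<Pi>\<^sub>M i\<in>J. lborel)) = enn2real (\<integral>\<^sup>+t. ennreal (g t) \<partial>(\<Pi>\<^sub>M i\<in>J. lborel))"
    by (rule integral_eq_nn_integral) (use gm g0 in auto)
  also have "\<dots> = Phi a J u 1" unfolding Phi_def Qn_def g_def
    using a by (simp add: ennreal_mult' prod_ennreal[symmetric] kerU_nonneg ker_nonneg prod_nonneg)
  finally show ?thesis using G unfolding dirichlet_F_def a_def J_def by simp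
qed

text \<open>There is no denominator because, by \<open>sum_tup_tz\<close>, the weights have total
  mass 1 when card I * a = 1.\<close>

definition model_prob :: "real \<Rightarrow> nat set \<Rightarrow> nat set \<Rightarrow> (nat \<Rightarrow> real) \<Rightarrow> nat \<Rightarrow> real" where
  "model_prob a I J Y n = (\<Sum>d\<in>{d \<in> tup I n. \<forall>i\<in>J. real (d i) \<le> Y i}. \<Prod>i\<in>I. tz a (d i))"

lemma model_prob_mono:
  assumes "finite I" "a \<ge> 0" "n > 0" "\<And>i. i \<in> J \<Longrightarrow> Y i \<le> Y' i"
  shows "model_prob a I J Y n \<le> model_prob a I J Y' n"
  unfolding model_prob_def using assms by (intro sum_mono2 prod_nonneg) (auto intro: tz_nonneg order_trans)

lemma model_prob_nonneg: "a \<ge> 0 \<Longrightarrow> model_prob a I J Y n \<ge> 0"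
  unfolding model_prob_def by (intro sum_nonneg prod_nonneg) (auto intro: tz_nonneg)

lemma model_prob_le_1:
  assumes "finite I" "a \<ge> 0" "n > 0" "real (card I) * a = 1"
  shows "model_prob a I J Y n \<le> 1"
proof -
  have "model_prob a I J Y n \<le> (\<Sum>d\<in>tup I n. \<Prod>i\<in>I. tz a (d i))"
    unfolding model_prob_def using assms by (intro sum_mono2 prod_nonneg) (auto intro: tz_nonneg)
  also have "\<dots> = 1" using assms by (simp add: sum_tup_tz tz_one)
  finally show ?thesis .
qed

text \<open>A cut-off of at least ln x is never effective on a divisor of n <= x, so the coordinates
  outside J remain free.\<close>

lemma sum_model_prob_eq_NN:
  assumes I: "finite I" "J \<subseteq> I" and x: "x \<ge> 1"
    and U: "\<And>i. i \<in> J \<Longrightarrow> Y i > 0 \<and> U i = ln (Y i)" "\<And>i. i \<in> I - J \<Longrightarrow> U i \<ge> ln x"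
  shows "(\<Sum>n\<in>{1..nat \<lfloor>x\<rfloor>}. model_prob a I J Y n) = NN a I U x"
proof -
  define N where "N = nat \<lfloor>x\<rfloor>"
  have pN: "real p \<le> x \<longleftrightarrow> p \<le> N" for p :: nat unfolding N_def using x by linarith
  have "NN a I U x = TS N I (cw a U) (\<lambda>p. if p \<le> N then 1 else 0)"
    unfolding NN_def N_def[symmetric] pN ..
  also have "\<dots> = (\<Sum>n\<in>{1..N}. (\<Sum>d\<in>tup I n. \<Prod>i\<in>I. cw a U i (d i)))"
    unfolding TS_group_tup[OF I(1)] by simp
  also have "\<dots> = (\<Sum>n\<in>{1..N}. model_prob a I J Y n)"
  proof (rule sum.cong[OF refl])
    fix n assume n: "n \<in> {1..N}"
    have "(\<Prod>i\<in>I. cw a U i (d i)) = (if \<forall>i\<in>J. real (d i) \<le> Y i then \<Prod>i\<in>I. tz a (d i) else 0)"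
      if d: "d \<in> tup I n" for d
    proof -
      have d1: "d i \<ge> 1" "real (d i) \<le> x" if "i \<in> I" for i
      proof -
        show "d i \<ge> 1" using tup_ge_1[OF d that] .
        have "d i \<le> n" using tup_dvd[OF I(1) d that] n by (auto dest: dvd_imp_le)
        thus "real (d i) \<le> x" using n pN by auto
      qed
      have J: "ln (real (d i)) \<le> U i \<longleftrightarrow> real (d i) \<le> Y i" if "i \<in> J" for i
        using U(1)[OF that] d1[of i] that I by auto
      have nJ: "ln (real (d i)) \<le> U i" if "i \<in> I - J" for i
      proof -
        have "ln (real (d i)) \<le> ln x" using d1[of i] that by (intro ln_mono) auto
        thus ?thesis using U(2)[OF that] by simp
      qed
      show ?thesis
      proof (cases "\<forall>i\<in>J. real (d i) \<le> Y i")
        case True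
        have "cw a U i (d i) = tz a (d i)" if "i \<in> I" for i
          using True J nJ that by (cases "i \<in> J") (auto simp: cw_def)
        thus ?thesis using True by auto
      next
        case False
        then obtain i where i: "i \<in> J" "\<not> real (d i) \<le> Y i" by auto
        hence "cw a U i (d i) = 0" using J by (simp add: cw_def)
        hence "(\<Prod>i\<in>I. cw a U i (d i)) = 0" using i I by (intro prod_zero) auto
        thus ?thesis using False by auto
      qed
    qed
    thus "(\<Sum>d\<in>tup I n. \<Prod>i\<in>I. cw a U i (d i)) = model_prob a I J Y n"
      unfolding model_prob_def using I n by (simp add: sum.inter_filter)
  qed
  finally show ?thesis unfolding N_def by simp
qed

section \<open>Factorizations of products of coprime numbers\<close>

lemma gcd_mult_coprime_parts:
  fixes b e s q :: nat
  assumes "coprime s q" "b dvd s" "e dvd q"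
  shows "gcd (b * e) s = b" "gcd (b * e) q = e"
proof -
  have "gcd (b * e) s = gcd b s"
    by (rule gcd_mult_left_right_cancel[OF coprime_divisors[OF dvd_refl assms(3,1)]])
  thus "gcd (b * e) s = b" using assms(2) by (simp add: gcd_nat.absorb1)
  have "gcd (b * e) q = gcd e q"
    using coprime_divisors[OF assms(2) dvd_refl assms(1)] by (intro gcd_mult_left_left_cancel) (simp only: coprime_commute[of q b])
  thus "gcd (b * e) q = e" using assms(3) by (simp add: gcd_nat.absorb1)
qed

text \<open>Each coordinate splits uniquely into its gcd with s and its gcd with q.\<close>

lemma sum_tup_coprime:
  fixes f :: "(nat \<Rightarrow> nat) \<Rightarrow> 'a :: comm_monoid_add"
  assumes I: "finite I" and co: "coprime s q" and pos: "s > 0" "q > 0"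
  shows "(\<Sum>d\<in>tup I (s * q). f d) = (\<Sum>e\<in>tup I q. \<Sum>b\<in>tup I s. f (\<lambda>i\<in>I. b i * e i))"
proof -
  let ?m = "\<lambda>(e, b). \<lambda>i\<in>I. b i * e i :: nat"
  let ?g = "\<lambda>d. (\<lambda>i\<in>I. gcd (d i) q, \<lambda>i\<in>I. gcd (d i) s)"
  have parts: "gcd (d i) s * gcd (d i) q = d i" if di: "d \<in> tup I (s * q)" "i \<in> I" for d i
  proof -
    obtain b e where "d i = b * e" "b dvd s" "e dvd q" using division_decomp[OF tup_dvd[OF I di]] by blast
    thus ?thesis using gcd_mult_coprime_parts[OF co, of b e] by simp
  qed
  have "(\<Sum>d\<in>tup I (s * q). f d) = (\<Sum>p\<in>tup I q \<times> tup I s. f (?m p))"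
  proof (rule sum.reindex_bij_witness[of _ ?m ?g])
    fix d assume d: "d \<in> tup I (s * q)"
    have ext: "d \<in> extensional I" using d by (auto simp: tup_def PiE_def)
    show m: "?m (?g d) = d"
      using parts[OF d] ext by (auto simp: fun_eq_iff extensional_def)
    show "f (?m (?g d)) = f d" unfolding m ..
    define A B where "A = (\<Prod>i\<in>I. gcd (d i) s)" and "B = (\<Prod>i\<in>I. gcd (d i) q)"
    have "A * B = (\<Prod>i\<in>I. d i)" unfolding A_def B_def prod.distrib[symmetric] using parts[OF d] by simp
    hence AB: "A * B = s * q" using d by (simp add: tup_def)
    have "coprime A q" unfolding A_def using co by (intro prod_coprime_left) (auto intro: coprime_divisors[of _ s])
    have "coprime B s" unfolding B_def using co
      by (intro prod_coprime_left) (auto simp: coprime_commute intro: coprime_divisors[of _ s _ q])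
    \<comment> \<open>From A * B = s * q with A coprime to q and B coprime to s, the two parts must
      be s and q themselves.\<close>
    have "A dvd s" using AB \<open>coprime A q\<close> by (metis coprime_dvd_mult_left_iff dvd_triv_left)
    moreover have "s dvd A" using AB \<open>coprime B s\<close> by (metis coprime_commute coprime_dvd_mult_left_iff dvd_triv_left)
    ultimately have "A = s" by (rule dvd_antisym)
    hence "B = q" using AB pos by simp
    have "d i \<ge> 1" if "i \<in> I" for i using tup_ge_1[OF d that] .
    thus "?g d \<in> tup I q \<times> tup I s"
      using \<open>A = s\<close> \<open>B = q\<close> pos unfolding A_def B_def by (auto simp: tup_def Suc_le_eq)
  next
    fix p assume "p \<in> tup I q \<times> tup I s"
    then obtain e b where p: "p = (e, b)" "e \<in> tup I q" "b \<in> tup I s" by auto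
    have "b i dvd s" "e i dvd q" if "i \<in> I" for i using tup_dvd[OF I] p that by auto
    hence gc: "gcd (b i * e i) s = b i" "gcd (b i * e i) q = e i" if "i \<in> I" for i
      using gcd_mult_coprime_parts[OF co] that by auto
    have "e \<in> extensional I" "b \<in> extensional I" using p by (auto simp: tup_def PiE_def)
    thus "?g (?m p) = p" using gc unfolding p(1) by (auto simp: fun_eq_iff extensional_def)
    show "?m p \<in> tup I (s * q)" using p by (auto simp: tup_def PiE_iff prod.distrib)
  qed
  also have "\<dots> = (\<Sum>e\<in>tup I q. \<Sum>b\<in>tup I s. f (\<lambda>i\<in>I. b i * e i))"
    by (simp add: sum.cartesian_product split_def)
  finally show ?thesis .
qed

text \<open>The factors of a squarefree number are pairwise coprime.\<close>

lemma tz_prod_squarefree: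
  assumes "finite I" "squarefree (\<Prod>i\<in>I. b i)"
  shows "(\<Prod>i\<in>I. tz a (b i)) = tz a (\<Prod>i\<in>I. b i)"
  using assms
proof (induction I rule: finite_induct)
  case (insert j I)
  define P where "P = (\<Prod>i\<in>I. b i)"
  have sq: "squarefree (b j * P)" using insert by (simp add: P_def)
  have nz: "b j > 0" "P > 0" using sq by (auto intro: Nat.gr0I)
  have "coprime (b j) P"
  proof (rule coprimeI)
    fix c assume "c dvd b j" "c dvd P"
    hence "c ^ 2 dvd b j * P" by (simp add: power2_eq_square mult_dvd_mono)
    thus "c dvd 1" using sq squarefreeD by blast
  qed
  moreover have "squarefree P" using sq squarefree_multD by blast
  ultimately show ?case using insert nz by (simp add: P_def tz_mult_coprime)
qed simp

text \<open>All factorizations of a squarefree s carry the same weight tz a s, and the total mass is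
  1.\<close>

lemma tz_eq_inverse_card_tup:
  assumes "finite I" "real (card I) * a = 1" "squarefree s" "b \<in> tup I s"
  shows "(\<Prod>i\<in>I. tz a (b i)) = 1 / real (card (tup I s))"
proof -
  have s: "s > 0" using assms(3) by (auto intro: Nat.gr0I)
  have *: "(\<Prod>i\<in>I. tz a (d i)) = tz a s" if "d \<in> tup I s" for d
    using tz_prod_squarefree[OF assms(1), of d a] that assms(3) by (simp add: tup_def)
  have "(\<Sum>d\<in>tup I s. \<Prod>i\<in>I. tz a (d i)) = 1" using assms s by (simp add: sum_tup_tz tz_one)
  hence "real (card (tup I s)) * tz a s = 1" using * by simp
  moreover have "card (tup I s) \<noteq> 0" using assms(1,4) s by auto
  ultimately show ?thesis using *[OF assms(4)] by (simp add: field_simps)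
qed

text \<open>If the law of the tuple at \<open>s * q\<close> is a product, the factor coming from \<open>q\<close> moves each
  coordinate by a factor between \<open>1\<close> and \<open>q\<close>, whatever its distribution is.\<close>

lemma sandwich_coprime:
  assumes I: "finite I" "J \<subseteq> I" and a: "a \<ge> 0" and co: "coprime s q" and pos: "s > 0" "q > 0"
    and w: "\<And>b e. b \<in> tup I s \<Longrightarrow> e \<in> tup I q \<Longrightarrow> w (\<lambda>i\<in>I. b i * e i) = (\<Prod>i\<in>I. tz a (b i)) * v e"
    and v: "\<And>e. e \<in> tup I q \<Longrightarrow> v e \<ge> 0" "(\<Sum>e\<in>tup I q. v e) = 1"
    and Y: "\<And>i. i \<in> J \<Longrightarrow> Y i \<ge> 0"
  shows "model_prob a I J (\<lambda>i. Y i / real q) s \<le> (\<Sum>d\<in>{d \<in> tup I (s * q). \<forall>i\<in>J. real (d i) \<le> Y i}. w d)"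
    and "(\<Sum>d\<in>{d \<in> tup I (s * q). \<forall>i\<in>J. real (d i) \<le> Y i}. w d) \<le> model_prob a I J Y s"
proof -
  \<comment> \<open>The probability under the law at s, given the part e of the tuple that comes
    from q.\<close>
  define H where "H e = (\<Sum>b\<in>{b \<in> tup I s. \<forall>i\<in>J. real (b i * e i) \<le> Y i}. \<Prod>i\<in>I. tz a (b i))" for e
  have "(\<Sum>d\<in>{d \<in> tup I (s * q). \<forall>i\<in>J. real (d i) \<le> Y i}. w d) =
      (\<Sum>d\<in>tup I (s * q). if \<forall>i\<in>J. real (d i) \<le> Y i then w d else 0)"
    using I pos by (simp add: sum.inter_filter)
  also have "\<dots> = (\<Sum>e\<in>tup I q. \<Sum>b\<in>tup I s. if \<forall>i\<in>J. real ((\<lambda>i\<in>I. b i * e i) i) \<le> Y i then w (\<lambda>i\<in>I. b i * e i) else 0)"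
    by (rule sum_tup_coprime[OF I(1) co pos])
  also have "\<dots> = (\<Sum>e\<in>tup I q. \<Sum>b\<in>tup I s. v e * (if \<forall>i\<in>J. real (b i * e i) \<le> Y i then \<Prod>i\<in>I. tz a (b i) else 0))"
  proof (intro sum.cong refl)
    fix e b assume eb: "e \<in> tup I q" "b \<in> tup I s"
    have "(\<forall>i\<in>J. real ((\<lambda>i\<in>I. b i * e i) i) \<le> Y i) \<longleftrightarrow> (\<forall>i\<in>J. real (b i * e i) \<le> Y i)" using I(2) by (intro ball_cong) auto
    thus "(if \<forall>i\<in>J. real ((\<lambda>i\<in>I. b i * e i) i) \<le> Y i then w (\<lambda>i\<in>I. b i * e i) else 0) =
        v e * (if \<forall>i\<in>J. real (b i * e i) \<le> Y i then \<Prod>i\<in>I. tz a (b i) else 0)"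
      using w[OF eb(2,1)] by simp
  qed
  also have "\<dots> = (\<Sum>e\<in>tup I q. v e * H e)"
    unfolding H_def using I pos by (simp add: sum.inter_filter sum_distrib_left)
  finally have eq: "(\<Sum>d\<in>{d \<in> tup I (s * q). \<forall>i\<in>J. real (d i) \<le> Y i}. w d) = (\<Sum>e\<in>tup I q. v e * H e)" .
  have H: "model_prob a I J (\<lambda>i. Y i / real q) s \<le> H e \<and> H e \<le> model_prob a I J Y s" if e: "e \<in> tup I q" for e
  proof -
    have e1: "1 \<le> e i" "e i \<le> q" if "i \<in> J" for i
      using tup_ge_1[OF e] tup_dvd[OF I(1) e] that I pos by (auto dest: dvd_imp_le)
    have fin: "finite {b \<in> tup I s. P b}" for P using I pos by simp
    have nn: "(\<Prod>i\<in>I. tz a (b i)) \<ge> 0" for b using a by (intro prod_nonneg) (auto intro: tz_nonneg)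
    have "real (b i * e i) \<le> Y i" if "real (b i) \<le> Y i / real q" "i \<in> J" for b i
    proof -
      have "real (b i) * real (e i) \<le> (Y i / real q) * real q" using that e1[of i] Y[of i] by (intro mult_mono) auto
      thus ?thesis using pos by simp
    qed
    hence 1: "{b \<in> tup I s. \<forall>i\<in>J. real (b i) \<le> Y i / real q} \<subseteq> {b \<in> tup I s. \<forall>i\<in>J. real (b i * e i) \<le> Y i}" by blast
    have "real (b i) \<le> Y i" if "real (b i * e i) \<le> Y i" "i \<in> J" for b i
    proof -
      have "b i \<le> b i * e i" using e1[OF that(2)] by simp
      hence "real (b i) \<le> real (b i * e i)" by (simp only: of_nat_le_iff)
      thus ?thesis using that by linarith
    qed
    hence 2: "{b \<in> tup I s. \<forall>i\<in>J. real (b i * e i) \<le> Y i} \<subseteq> {b \<in> tup I s. \<forall>i\<in>J. real (b i) \<le> Y i}" by blast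
    show ?thesis unfolding model_prob_def H_def by (intro conjI sum_mono2 fin 1 2 nn)
  qed
  have "model_prob a I J (\<lambda>i. Y i / real q) s = (\<Sum>e\<in>tup I q. v e * model_prob a I J (\<lambda>i. Y i / real q) s)"
    using v(2) by (simp add: sum_distrib_right[symmetric])
  also have "\<dots> \<le> (\<Sum>e\<in>tup I q. v e * H e)" using H v(1) by (intro sum_mono mult_left_mono) auto
  finally show "model_prob a I J (\<lambda>i. Y i / real q) s \<le> (\<Sum>d\<in>{d \<in> tup I (s * q). \<forall>i\<in>J. real (d i) \<le> Y i}. w d)" unfolding eq .
  have "(\<Sum>e\<in>tup I q. v e * H e) \<le> (\<Sum>e\<in>tup I q. v e * model_prob a I J Y s)" using H v(1) by (intro sum_mono mult_left_mono) auto
  also have "\<dots> = model_prob a I J Y s" using v(2) by (simp add: sum_distrib_right[symmetric])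
  finally show "(\<Sum>d\<in>{d \<in> tup I (s * q). \<forall>i\<in>J. real (d i) \<le> Y i}. w d) \<le> model_prob a I J Y s" unfolding eq .
qed

definition uniform_prob :: "nat set \<Rightarrow> nat set \<Rightarrow> (nat \<Rightarrow> real) \<Rightarrow> nat \<Rightarrow> real" where
  "uniform_prob I J Y n = real (card {d \<in> tup I n. \<forall>i\<in>J. real (d i) \<le> Y i}) / real (card (tup I n))"

text \<open>The two laws coincide at the squarefree s, so at s * q both are products with the same
  factor at s. By \<open>sandwich_coprime\<close> both probabilities lie in one interval, whose
  length is the bound.\<close>

lemma uniform_model_diff:
  assumes I: "finite I" "I \<noteq> {}" "J \<subseteq> I" and a: "a \<ge> 0" "real (card I) * a = 1"
    and co: "coprime s q" and s: "squarefree s" and q: "q > 0"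
    and Y: "\<And>i. i \<in> J \<Longrightarrow> Y i \<ge> 0"
  shows "\<bar>uniform_prob I J Y (s * q) - model_prob a I J Y (s * q)\<bar> \<le> model_prob a I J Y s - model_prob a I J (\<lambda>i. Y i / real q) s"
proof -
  have pos: "s > 0" using s by (auto intro: Nat.gr0I)
  have ne: "card (tup I n) > 0" if "n > 0" for n
  proof -
    obtain j where j: "j \<in> I" using I by auto
    have "(\<lambda>i\<in>I. if i = j then n else 1) \<in> tup I n" using I j that by (auto simp: tup_def PiE_iff Suc_le_eq)
    thus ?thesis using I that by (auto simp: card_gt_0_iff)
  qed
  have cm: "card (tup I (s * q)) = card (tup I s) * card (tup I q)"
    using sum_tup_coprime[OF I(1) co pos q, of "\<lambda>_. 1 :: nat"] by simp
  note S = sandwich_coprime[where J = J and Y = Y, OF I(1,3) a(1) co pos q]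
  have uniform_prob: "uniform_prob I J Y (s * q) = (\<Sum>d\<in>{d \<in> tup I (s * q). \<forall>i\<in>J. real (d i) \<le> Y i}. 1 / real (card (tup I (s * q))))"
    unfolding uniform_prob_def by simp
  have w: "1 / real (card (tup I (s * q))) = (\<Prod>i\<in>I. tz a (b i)) * (1 / real (card (tup I q)))" if "b \<in> tup I s" for b
    using tz_eq_inverse_card_tup[OF I(1) a(2) s that] by (simp add: cm)
  have v: "(\<Sum>e\<in>tup I q. 1 / real (card (tup I q))) = 1" using ne[OF q] by simp
  have 1: "model_prob a I J (\<lambda>i. Y i / real q) s \<le> uniform_prob I J Y (s * q)" "uniform_prob I J Y (s * q) \<le> model_prob a I J Y s"
    unfolding uniform_prob by (rule S[where v = "\<lambda>_. 1 / real (card (tup I q))"]; use w v Y in auto)+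
  have w': "(\<Prod>i\<in>I. tz a ((\<lambda>i\<in>I. b i * e i) i)) = (\<Prod>i\<in>I. tz a (b i)) * (\<Prod>i\<in>I. tz a (e i))"
    if "b \<in> tup I s" "e \<in> tup I q" for b e
  proof -
    have "tz a ((\<lambda>i\<in>I. b i * e i) i) = tz a (b i) * tz a (e i)" if i: "i \<in> I" for i
    proof -
      have "coprime (b i) (e i)" using co tup_dvd[OF I(1) \<open>b \<in> _\<close> i] tup_dvd[OF I(1) \<open>e \<in> _\<close> i] by (auto intro: coprime_divisors)
      moreover have "b i \<ge> 1" "e i \<ge> 1" using tup_ge_1[OF \<open>b \<in> _\<close> i] tup_ge_1[OF \<open>e \<in> _\<close> i] by auto
      ultimately show ?thesis using i by (simp add: tz_mult_coprime)
    qed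
    thus ?thesis by (simp add: prod.distrib)
  qed
  have v': "(\<Sum>e\<in>tup I q. \<Prod>i\<in>I. tz a (e i)) = 1" using I q a by (simp add: sum_tup_tz tz_one)
  have nn: "(\<Prod>i\<in>I. tz a (e i)) \<ge> 0" for e using a by (intro prod_nonneg) (auto intro: tz_nonneg)
  have 2: "model_prob a I J (\<lambda>i. Y i / real q) s \<le> model_prob a I J Y (s * q)" "model_prob a I J Y (s * q) \<le> model_prob a I J Y s"
    unfolding model_prob_def[of a I J Y "s * q"]
    by (rule S[where v = "\<lambda>e. \<Prod>i\<in>I. tz a (e i)"]; use w' v' nn Y in blast)+
  show ?thesis using 1 2 by linarith
qed

text \<open>In n = m * D^2 with m squarefree, the primes common to m and D are moved into g = gcd m
  D. The bound g <= D is what makes the sum over q = D^2 * g converge.\<close>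

lemma squarefree_coprime_decomposition:
  assumes "n > 0"
  obtains D g s :: nat where "n = s * (D\<^sup>2 * g)" "squarefree s" "coprime s (D\<^sup>2 * g)" "g \<le> D" "D > 0" "g > 0" "s > 0"
proof -
  define D m where "D = square_part n" and "m = squarefree_part n"
  have n: "n = m * D\<^sup>2" and m: "squarefree m" using assms unfolding D_def m_def
    by (auto simp: squarefree_decompose squarefree_squarefree_part)
  have pos: "D > 0" "m > 0" using n assms by (auto intro: Nat.gr0I)
  define g where "g = gcd m D"
  obtain s where s: "m = g * s" unfolding g_def by (metis dvd_def gcd_dvd1)
  have pos': "g > 0" "s > 0" using pos s by (auto intro: Nat.gr0I)
  have cog: "coprime s g"
  proof (rule coprimeI)
    fix c assume "c dvd s" "c dvd g"
    hence "c ^ 2 dvd m" unfolding s by (simp add: power2_eq_square mult_dvd_mono)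
    thus "c dvd 1" using m squarefreeD by blast
  qed
  have coD: "coprime s D"
  proof (rule coprimeI)
    fix c assume c: "c dvd s" "c dvd D"
    hence "c dvd m" unfolding s by simp
    hence "c dvd g" unfolding g_def using c by simp
    thus "c dvd 1" using c cog coprime_common_divisor by blast
  qed
  show thesis
  proof (rule that[of s D g])
    show "n = s * (D\<^sup>2 * g)" unfolding n s by simp
    show "squarefree s" using m unfolding s by (rule squarefree_multD)
    show "coprime s (D\<^sup>2 * g)" using cog coD by simp
    show "g \<le> D" unfolding g_def using pos by (intro dvd_imp_le) auto
  qed (use pos pos' in auto)
qed

section \<open>The divisor counts, and averages of the two laws over n\<close>

lemma tau_eq_card_tup: "tau k n = card (tup {1..k} n)"
  by (simp add: tau_def tup_def)

text \<open>The last factor, which has no cut-off, is n divided by the product of the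
  others.\<close>

lemma divisor_count_eq:
  assumes k: "k \<ge> 1" and n: "n > 0"
  shows "divisor_count k u n = card {d \<in> tup {1..k} n. \<forall>i\<in>{1..k-1}. real (d i) \<le> real n powr u i}"
proof -
  define J where "J = {1..k-1}"
  have J: "finite J" "k \<notin> J" "{1..k} = insert k J" using k by (auto simp: J_def)
  define A where "A = {d \<in> J \<rightarrow>\<^sub>E {1..}. (\<forall>i\<in>J. real (d i) \<le> real n powr u i) \<and> (\<Prod>i\<in>J. d i) dvd n}"
  define B where "B = {d \<in> tup (insert k J) n. \<forall>i\<in>J. real (d i) \<le> real n powr u i}"
  have upd: "(\<Prod>i\<in>J. (d(k := y)) i) = (\<Prod>i\<in>J. d i)" for d :: "nat \<Rightarrow> nat" and y
    using J by (intro prod.cong) auto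
  have "bij_betw (\<lambda>d. d(k := n div (\<Prod>i\<in>J. d i))) A B"
  proof (rule bij_betw_byWitness[where f' = "\<lambda>d. restrict d J"])
    show "\<forall>d\<in>A. restrict (d(k := n div (\<Prod>i\<in>J. d i))) J = d"
      using J by (auto simp: A_def fun_eq_iff PiE_def extensional_def)
    show "\<forall>d\<in>B. (restrict d J)(k := n div (\<Prod>i\<in>J. restrict d J i)) = d"
    proof
      fix d assume d: "d \<in> B"
      have p: "d k * (\<Prod>i\<in>J. d i) = n" using d J by (simp add: B_def tup_def)
      hence "(\<Prod>i\<in>J. d i) > 0" using n by (intro Nat.gr0I) auto
      hence "n div (\<Prod>i\<in>J. d i) = d k" using p by auto
      thus "(restrict d J)(k := n div (\<Prod>i\<in>J. restrict d J i)) = d"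
        using d J by (auto simp: B_def tup_def fun_eq_iff PiE_def extensional_def)
    qed
    show "(\<lambda>d. d(k := n div (\<Prod>i\<in>J. d i))) ` A \<subseteq> B"
    proof (rule image_subsetI)
      fix d assume d: "d \<in> A"
      hence dv: "(\<Prod>i\<in>J. d i) dvd n" by (simp add: A_def)
      hence "n div (\<Prod>i\<in>J. d i) \<ge> 1" using n by (auto elim!: dvdE intro!: Nat.gr0I simp: Suc_le_eq)
      moreover have "n div (\<Prod>i\<in>J. d i) * (\<Prod>i\<in>J. d i) = n" using dv by simp
      moreover have "(\<Prod>i\<in>insert k J. (d(k := n div (\<Prod>i\<in>J. d i))) i) = n div (\<Prod>i\<in>J. d i) * (\<Prod>i\<in>J. d i)"
        unfolding prod.insert[OF J(1,2)] upd by simp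
      moreover have "d(k := n div (\<Prod>i\<in>J. d i)) \<in> insert k J \<rightarrow>\<^sub>E {1..}"
        using d J(2) \<open>n div (\<Prod>i\<in>J. d i) \<ge> 1\<close> by (auto simp: A_def PiE_iff extensional_def)
      moreover have "\<forall>i\<in>J. real ((d(k := n div (\<Prod>i\<in>J. d i))) i) \<le> real n powr u i" using d J(2) by (auto simp: A_def)
      ultimately show "d(k := n div (\<Prod>i\<in>J. d i)) \<in> B" unfolding B_def tup_def by simp
    qed
    show "(\<lambda>d. restrict d J) ` B \<subseteq> A"
    proof (rule image_subsetI)
      fix d assume d: "d \<in> B"
      have "d k * (\<Prod>i\<in>J. d i) = n" using d J by (simp add: B_def tup_def)
      hence "(\<Prod>i\<in>J. d i) dvd n" by (metis dvd_triv_right)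
      thus "restrict d J \<in> A" using d by (auto simp: A_def B_def tup_def PiE_iff)
    qed
  qed
  thus ?thesis unfolding divisor_count_def J_def[symmetric] J(3) A_def[symmetric] B_def[symmetric] by (rule bij_betw_same_card)
qed

text \<open>z is a frozen value of n in the thresholds c * z powr u i. Their logarithms differ from
  ln y * u i by at most 1 + |ln c|, which \<open>Phi_Holder\<close> converts into the stated error;
  the error of \<open>model_count\<close> is dominated by it.\<close>

lemma NN_close_Phi:
  assumes a: "0 < a" "a \<le> 1 / 2" and I: "finite I" "k \<in> I" "real (card I) * a = 1"
  shows "\<exists>K\<ge>0. \<forall>y z c u U. y \<ge> 2 \<longrightarrow> \<bar>ln z - ln y\<bar> \<le> 1 \<longrightarrow> (\<forall>i\<in>I - {k}. 0 \<le> u i \<and> u i \<le> 1 \<and> U i = ln c + u i * ln z) \<longrightarrow> U k \<ge> ln y \<longrightarrow>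
    \<bar>NN a I U y - y * Phi a (I - {k}) u 1\<bar> \<le> K * y * ((1 + \<bar>ln c\<bar>) / ln y) powr a"
proof -
  define J where "J = I - {k}"
  have J: "finite J" "k \<notin> J" "I = insert k J" using I by (auto simp: J_def)
  have cJ: "real (card J + 1) * a = 1" using I(3) J by simp
  obtain C where C: "C \<ge> 0" "\<And>x U. x \<ge> 2 \<Longrightarrow> U k \<ge> ln x \<Longrightarrow> \<bar>NN a I U x - x * Phi a J U (ln x)\<bar> \<le> C * x * ln x powr (- a)"
    using model_count[OF a I] unfolding J_def by blast
  obtain H where H: "H \<ge> 0" "\<And>U U' (L :: real). L > 0 \<Longrightarrow> \<bar>Phi a J U L - Phi a J U' L\<bar> \<le> H * (\<Sum>i\<in>J. (\<bar>U i - U' i\<bar> / L) powr a)"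
  proof (rule Phi_Holder[OF a])
    fix C assume C: "C \<ge> 0" "\<And>(J :: nat set) U U' (L :: real). finite J \<Longrightarrow> real (card J + 1) * a = 1 \<Longrightarrow> L > 0 \<Longrightarrow>
      \<bar>Phi a J U L - Phi a J U' L\<bar> \<le> C * (\<Sum>i\<in>J. (\<bar>U i - U' i\<bar> / L) powr a)"
    show thesis by (rule that[OF C(1) C(2)[OF J(1) cJ]])
  qed
  show ?thesis
  proof (rule exI[of _ "C + H * real (card J)"], intro conjI allI impI)
    show "0 \<le> C + H * real (card J)" using C H by simp
    fix y z c :: real and u U :: "nat \<Rightarrow> real"
    assume y: "y \<ge> 2" and z: "\<bar>ln z - ln y\<bar> \<le> 1"
      and u: "\<forall>i\<in>I - {k}. 0 \<le> u i \<and> u i \<le> 1 \<and> U i = ln c + u i * ln z" and Uk: "U k \<ge> ln y"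
    define L where "L = ln y"
    define R where "R = ((1 + \<bar>ln c\<bar>) / L) powr a"
    have L: "L > 0" using y by (simp add: L_def)
    have "\<bar>Phi a J U L - Phi a J (\<lambda>i. L * u i) L\<bar> \<le> H * (\<Sum>i\<in>J. (\<bar>U i - L * u i\<bar> / L) powr a)" by (rule H(2)[OF L])
    also have "\<dots> \<le> H * (\<Sum>i\<in>J. R)"
    proof (intro mult_left_mono sum_mono H(1))
      fix i assume i: "i \<in> J"
      have ui: "0 \<le> u i" "u i \<le> 1" "U i = ln c + u i * ln z" using u i by (auto simp: J_def)
      have "U i - L * u i = ln c + u i * (ln z - ln y)" unfolding ui(3) L_def by (simp add: algebra_simps)
      moreover have "\<bar>u i * (ln z - ln y)\<bar> \<le> 1 * 1" unfolding abs_mult using ui z by (intro mult_mono) auto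
      ultimately have "\<bar>U i - L * u i\<bar> \<le> 1 + \<bar>ln c\<bar>" by linarith
      thus "(\<bar>U i - L * u i\<bar> / L) powr a \<le> R" unfolding R_def using L a by (intro powr_mono2 divide_right_mono) auto
    qed
    also have "\<dots> = H * real (card J) * R" by simp
    finally have 1: "\<bar>Phi a J U L - Phi a J u 1\<bar> \<le> H * real (card J) * R" unfolding Phi_scale[OF J(1) a(1) cJ L] .
    have "L powr (- a) \<le> R"
    proof -
      have "L powr (- a) = (1 / L) powr a" using L by (simp add: powr_minus powr_divide field_simps)
      also have "\<dots> \<le> R" unfolding R_def using L a by (intro powr_mono2 divide_right_mono) auto
      finally show ?thesis .
    qed
    hence "C * y * L powr (- a) \<le> C * y * R" using C y by (intro mult_left_mono) auto
    hence 2: "\<bar>NN a I U y - y * Phi a J U L\<bar> \<le> C * y * R" using C(2)[of y U] y Uk unfolding L_def by linarith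
    have 3: "\<bar>y * Phi a J U L - y * Phi a J u 1\<bar> \<le> y * (H * real (card J) * R)"
    proof -
      have "y * Phi a J U L - y * Phi a J u 1 = y * (Phi a J U L - Phi a J u 1)" by (simp add: algebra_simps)
      moreover have "\<bar>y\<bar> * \<bar>Phi a J U L - Phi a J u 1\<bar> \<le> y * (H * real (card J) * R)" using 1 y by (intro mult_mono) auto
      ultimately show ?thesis by (simp add: abs_mult)
    qed
    have "C * y * R + y * (H * real (card J) * R) = (C + H * real (card J)) * y * R" by (simp add: algebra_simps)
    thus "\<bar>NN a I U y - y * Phi a (I - {k}) u 1\<bar> \<le> (C + H * real (card J)) * y * ((1 + \<bar>ln c\<bar>) / ln y) powr a"
      using 2 3 unfolding R_def L_def J_def by linarith
  qed
qed

text \<open>c = 1 is the actual average of the model law; c = q and c = 1 / q are the enlarged and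
  the reduced thresholds caused by the non-squarefree part q.\<close>

definition model_total :: "real \<Rightarrow> nat set \<Rightarrow> nat set \<Rightarrow> real \<Rightarrow> (nat \<Rightarrow> real) \<Rightarrow> real \<Rightarrow> real" where
  "model_total a I J c u y = (\<Sum>n\<in>{1..nat \<lfloor>y\<rfloor>}. model_prob a I J (\<lambda>i. c * real n powr u i) n)"

lemma model_total_bounds:
  assumes "finite I" "a \<ge> 0" "real (card I) * a = 1" "y \<ge> 0"
  shows "0 \<le> model_total a I J c u y" "model_total a I J c u y \<le> y"
proof -
  show "0 \<le> model_total a I J c u y" unfolding model_total_def using assms by (intro sum_nonneg model_prob_nonneg)
  have "model_total a I J c u y \<le> (\<Sum>n\<in>{1..nat \<lfloor>y\<rfloor>}. 1)" unfolding model_total_def using assms by (intro sum_mono model_prob_le_1) auto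
  also have "\<dots> \<le> y" using assms by simp
  finally show "model_total a I J c u y \<le> y" .
qed

text \<open>On \<open>(y/2, y]\<close> the thresholds \<open>n powr u i\<close> vary by a bounded factor only, so freezing them at
  either end of the block costs no more than the Hoelder modulus of the limit law at distance
  of order \<open>1 / ln y\<close>; halving then sums the blocks.\<close>

lemma model_total_asymptotics:
  assumes a: "0 < a" "a \<le> 1 / 2" and I: "finite I" "k \<in> I" "real (card I) * a = 1"
  shows "\<exists>K\<ge>0. \<forall>y c u. y \<ge> 2 \<longrightarrow> c > 0 \<longrightarrow> (\<forall>i\<in>I - {k}. 0 \<le> u i \<and> u i \<le> 1) \<longrightarrow>
    \<bar>model_total a I (I - {k}) c u y - y * Phi a (I - {k}) u 1\<bar> \<le> K * y * ((1 + \<bar>ln c\<bar>) / ln y) powr a"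
proof -
  define J where "J = I - {k}"
  have J: "finite J" "k \<notin> J" "I = insert k J" "J \<subseteq> I" using I by (auto simp: J_def)
  have cJ: "real (card J + 1) * a = 1" using I(3) J by simp
  obtain K1 where K1: "K1 \<ge> 0" "\<And>y z c u U. y \<ge> 2 \<Longrightarrow> \<bar>ln z - ln y\<bar> \<le> 1 \<Longrightarrow> (\<forall>i\<in>J. 0 \<le> u i \<and> u i \<le> 1 \<and> U i = ln c + u i * ln z) \<Longrightarrow>
      U k \<ge> ln y \<Longrightarrow> \<bar>NN a I U y - y * Phi a J u 1\<bar> \<le> K1 * y * ((1 + \<bar>ln c\<bar>) / ln y) powr a"
    using NN_close_Phi[OF a I] unfolding J_def by blast
  \<comment> \<open>The halving step requires 7/4 * K1 + 3/4 * K <= K, and the range 2 <= y < 4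
    requires K >= 2.\<close>
  define K where "K = 8 * K1 + 2"
  have "\<bar>model_total a I J c u y - y * Phi a J u 1\<bar> \<le> K * y * ((1 + \<bar>ln c\<bar>) / ln y) powr a"
    if c: "c > 0" and u: "\<forall>i\<in>J. 0 \<le> u i \<and> u i \<le> 1" and y: "y \<ge> 2" for y c u
  proof -
    define F where "F = Phi a J u 1"
    define R where "R y = ((1 + \<bar>ln c\<bar>) / ln y) powr a" for y
    have F: "0 \<le> F" "F \<le> 1" unfolding F_def using Phi_bounds[OF J(1) a(1) cJ, of 1 u] by auto
    define T where "T z y = (\<Sum>n\<in>{1..nat \<lfloor>y\<rfloor>}. model_prob a I J (\<lambda>i. c * z powr u i) n)" for z y :: real
    have TN: "\<bar>T z w - w * F\<bar> \<le> K1 * w * R w" if w: "w \<ge> 2" "z > 0" "\<bar>ln z - ln w\<bar> \<le> 1" for z w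
    proof -
      define U where "U i = (if i = k then ln w else ln c + u i * ln z)" for i
      have "T z w = NN a I U w" unfolding T_def
      proof (rule sum_model_prob_eq_NN[OF I(1) J(4)])
        show "w \<ge> 1" using w by simp
        fix i assume "i \<in> J"
        hence "i \<noteq> k" using J by auto
        thus "0 < c * z powr u i \<and> U i = ln (c * z powr u i)" using c w by (simp add: U_def ln_mult ln_powr)
      qed (use J in \<open>auto simp: U_def\<close>)
      thus ?thesis unfolding F_def R_def using K1(2)[OF w(1,3), of u U c] u J(2) by (auto simp: U_def)
    qed
    \<comment> \<open>Halving y enlarges the error rate by at most 2 powr a <= sqrt 2 < 3/2. With
      the factor 1/2 from y itself, the block errors are dominated by a geometric series of ratio
      3/4.\<close>
    have R2: "R (y / 2) \<le> 3 / 2 * R y" if "y \<ge> 4" for y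
    proof -
      have "ln y = ln (y / 2) + ln 2" using that by (simp add: ln_div)
      moreover have "ln 2 \<le> ln (y / 2)" using that by (subst ln_le_cancel_iff) auto
      moreover have "ln (2::real) > 0" by simp
      ultimately have l: "ln y \<le> 2 * ln (y / 2)" "ln (y / 2) > 0" "ln y > 0" by linarith+
      have "(1 + \<bar>ln c\<bar>) * ln y \<le> (1 + \<bar>ln c\<bar>) * (2 * ln (y / 2))" using l by (intro mult_left_mono) auto
      hence "(1 + \<bar>ln c\<bar>) / ln (y / 2) \<le> 2 * ((1 + \<bar>ln c\<bar>) / ln y)"
        unfolding times_divide_eq_right using l by (subst frac_le_eq; simp add: field_simps divide_le_0_iff)
      hence "R (y / 2) \<le> (2 * ((1 + \<bar>ln c\<bar>) / ln y)) powr a" unfolding R_def using l a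
        by (intro powr_mono2) auto
      also have "\<dots> = 2 powr a * R y" unfolding R_def using l by (subst powr_mult) auto
      also have "2 powr a \<le> 3 / 2"
      proof -
        have "2 powr a \<le> 2 powr (1 / 2)" using a by (intro powr_mono) auto
        also have "\<dots> = sqrt 2" by (simp add: powr_half_sqrt)
        also have "\<dots> \<le> 3 / 2" by (rule real_le_lsqrt) (auto simp: power2_eq_square)
        finally show ?thesis .
      qed
      finally show ?thesis by (simp add: R_def mult_right_mono)
    qed
    have step: "\<bar>model_total a I J c u y - model_total a I J c u (y / 2) - (y / 2) * F\<bar> \<le> 7 / 4 * (K1 * y * R y)" if y: "y \<ge> 4" for y
    proof -
      define N M where "N = nat \<lfloor>y\<rfloor>" and "M = nat \<lfloor>y / 2\<rfloor>"
      have MN: "M \<le> N" unfolding M_def N_def using y by (intro nat_mono floor_mono) auto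
      have split: "(\<Sum>n\<in>{1..N}. f n) - (\<Sum>n\<in>{1..M}. f n) = (\<Sum>n\<in>{M<..N}. f n)" for f :: "nat \<Rightarrow> real"
      proof -
        have "{1..N} = {1..M} \<union> {M<..N}" "{1..M} \<inter> {M<..N} = {}" using MN by auto
        thus ?thesis by (simp add: sum.union_disjoint)
      qed
      have ran: "real n \<le> y" "y / 2 \<le> real n" "n > 0" if "n \<in> {M<..N}" for n
        using that y unfolding M_def N_def by (auto simp: le_nat_iff nat_less_iff le_floor_iff floor_less_iff)
      have up: "model_total a I J c u y - model_total a I J c u (y / 2) \<le> T y y - T y (y / 2)"
        unfolding model_total_def T_def N_def[symmetric] M_def[symmetric] split
        using c u ran a I by (intro sum_mono model_prob_mono mult_left_mono powr_mono2) auto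
      have lo: "T (y / 2) y - T (y / 2) (y / 2) \<le> model_total a I J c u y - model_total a I J c u (y / 2)"
        unfolding model_total_def T_def N_def[symmetric] M_def[symmetric] split
        using c u ran a I y by (intro sum_mono model_prob_mono mult_left_mono powr_mono2) auto
      have l: "ln y = ln (y / 2) + ln 2" using y by (simp add: ln_div)
      have l2: "0 \<le> ln (2::real)" "ln (2::real) \<le> 1" using ln_le_minus_one[of 2] by auto
      have t: "\<bar>T y y - y * F\<bar> \<le> K1 * y * R y" "\<bar>T (y / 2) y - y * F\<bar> \<le> K1 * y * R y"
        "\<bar>T y (y / 2) - (y / 2) * F\<bar> \<le> K1 * (y / 2) * R (y / 2)" "\<bar>T (y / 2) (y / 2) - (y / 2) * F\<bar> \<le> K1 * (y / 2) * R (y / 2)"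
        using y l l2 by (intro TN; linarith)+
      have "K1 * (y / 2) * R (y / 2) \<le> K1 * (y / 2) * (3 / 2 * R y)" using K1 y R2[OF y] by (intro mult_left_mono) auto
      also have "\<dots> = 3 / 4 * (K1 * y * R y)" by simp
      finally show ?thesis using t up lo by linarith
    qed
    have "\<forall>y. 2 \<le> y \<longrightarrow> y < 2 ^ (m + 2) \<longrightarrow> \<bar>model_total a I J c u y - y * F\<bar> \<le> K * y * R y" for m
    proof (induction m)
      case 0
      show ?case
      proof (intro allI impI)
        fix y :: real assume y: "2 \<le> y" "y < 2 ^ (0 + 2)"
        have S: "0 \<le> model_total a I J c u y" "model_total a I J c u y \<le> y" using model_total_bounds[OF I(1) _ I(3)] a y by auto
        have "0 \<le> y * F" "y * F \<le> y * 1" using y F by (auto intro!: mult_left_mono)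
        hence 1: "\<bar>model_total a I J c u y - y * F\<bar> \<le> y" using S by linarith
        have "ln y \<le> ln 4" using y by (subst ln_le_cancel_iff) auto
        also have "ln (4::real) = 2 * ln 2" using ln_realpow[of 2 2] by simp
        also have "\<dots> \<le> 2" using ln_le_minus_one[of 2] by simp
        finally have l: "ln y \<le> 2" "ln y > 0" using y by auto
        have "1 / 2 = (1 / 2) powr (1::real)" by simp
        also have "\<dots> \<le> (1 / 2) powr a" using a by (intro powr_mono') auto
        also have "\<dots> \<le> R y" unfolding R_def using l a by (intro powr_mono2) (auto simp: field_simps)
        finally have "K * (1 / 2) \<le> K * R y" using K1 by (intro mult_left_mono) (auto simp: K_def)
        moreover have "1 \<le> K * (1 / 2)" using K1(1) by (simp add: K_def)
        ultimately have "1 \<le> K * R y" by linarith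
        hence "y * 1 \<le> y * (K * R y)" using y by (intro mult_left_mono) auto
        thus "\<bar>model_total a I J c u y - y * F\<bar> \<le> K * y * R y" using 1 by (simp add: algebra_simps)
      qed
    next
      case (Suc m)
      show ?case
      proof (intro allI impI)
        fix y :: real assume y: "2 \<le> y" "y < 2 ^ (Suc m + 2)"
        show "\<bar>model_total a I J c u y - y * F\<bar> \<le> K * y * R y"
        proof (cases "y \<ge> 4")
          case False
          hence "y < 2 ^ (0 + 2)" by simp
          also have "\<dots> \<le> (2::real) ^ (m + 2)" by (intro power_increasing) auto
          finally show ?thesis using Suc.IH y by blast
        next
          case True
          have "2 \<le> y / 2" "y / 2 < 2 ^ (m + 2)" using True y by auto
          hence IH: "\<bar>model_total a I J c u (y / 2) - (y / 2) * F\<bar> \<le> K * (y / 2) * R (y / 2)" using Suc.IH by blast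
          have "K * (y / 2) * R (y / 2) \<le> K * (y / 2) * (3 / 2 * R y)" using K1 True R2[OF True] by (intro mult_left_mono) (auto simp: K_def)
          also have "\<dots> = 3 / 4 * (K * y * R y)" by simp
          finally have "\<bar>model_total a I J c u y - y * F\<bar> \<le> 7 / 4 * (K1 * y * R y) + 3 / 4 * (K * y * R y)"
            using IH step[OF True] by linarith
          moreover have "K * y * R y = 8 * (K1 * y * R y) + 2 * (y * R y)" by (simp add: K_def algebra_simps)
          moreover have "y * R y \<ge> 0" using y by (simp add: R_def)
          moreover have "K1 * y * R y \<ge> 0" using y K1 by (simp add: R_def)
          ultimately show ?thesis by linarith
        qed
      qed
    qed
    moreover obtain m where "y < 2 ^ (m + 2)"
    proof -
      obtain m where "y < 2 ^ m" using real_arch_pow[of 2 y] by auto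
      also have "(2::real) ^ m \<le> 2 ^ (m + 2)" by (intro power_increasing) auto
      finally show ?thesis using that by blast
    qed
    ultimately show ?thesis using y unfolding F_def R_def by blast
  qed
  moreover have "K \<ge> 0" using K1 by (simp add: K_def)
  ultimately show ?thesis unfolding J_def by blast
qed

text \<open>For q^2 <= x both averages have the same main term at x / q, and ln (x / q) is at least
  ln x / 2. Otherwise the trivial bound x / q suffices, since 1 + ln q is then at least ln x / 2.
  Enlarging (1 + ln q) powr a to 1 + ln q is harmless for the sum over q.\<close>

lemma model_total_spread:
  assumes a: "0 < a" "a \<le> 1 / 2" and I: "finite I" "k \<in> I" "real (card I) * a = 1"
  shows "\<exists>K\<ge>0. \<forall>x u. \<forall>q::nat. x \<ge> 2 \<longrightarrow> q \<ge> 1 \<longrightarrow> (\<forall>i\<in>I - {k}. 0 \<le> u i \<and> u i \<le> 1) \<longrightarrow>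
    model_total a I (I - {k}) (real q) u (x / real q) - model_total a I (I - {k}) (1 / real q) u (x / real q) \<le>
      K * x * ln x powr (- a) * ((1 + ln (real q)) / real q)"
proof -
  define J where "J = I - {k}"
  obtain K where K: "K \<ge> 0" "\<And>y c u. y \<ge> 2 \<Longrightarrow> c > 0 \<Longrightarrow> (\<forall>i\<in>J. 0 \<le> u i \<and> u i \<le> 1) \<Longrightarrow>
      \<bar>model_total a I J c u y - y * Phi a J u 1\<bar> \<le> K * y * ((1 + \<bar>ln c\<bar>) / ln y) powr a"
    using model_total_asymptotics[OF a I] unfolding J_def by blast
  have "model_total a I J (real q) u (x / real q) - model_total a I J (1 / real q) u (x / real q) \<le>
      (4 * K + 2) * x * ln x powr (- a) * ((1 + ln (real q)) / real q)"
    if x: "x \<ge> 2" and q: "q \<ge> 1" and u: "\<forall>i\<in>J. 0 \<le> u i \<and> u i \<le> 1" for x u and q :: nat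
  proof -
    define X where "X = x / real q"
    define B where "B = (1 + ln (real q)) * ln x powr (- a)"
    have L: "ln x > 0" using x by simp
    have lq: "ln (real q) \<ge> 0" using q by simp
    have X: "X > 0" using x q by (simp add: X_def)
    have pB: "((1 + ln (real q)) / w) powr a \<le> 2 * B" if w: "w \<ge> ln x / 2" for w
    proof -
      have "((1 + ln (real q)) / w) powr a \<le> ((1 + ln (real q)) / (ln x / 2)) powr a"
        using w L lq a by (intro powr_mono2 divide_left_mono mult_pos_pos) auto
      also have "(1 + ln (real q)) / (ln x / 2) = 2 * (1 + ln (real q)) / ln x" by simp
      also have "\<dots> powr a = (2 * (1 + ln (real q))) powr a * ln x powr (- a)"
        using L lq by (simp add: powr_divide powr_minus field_simps)
      also have "\<dots> \<le> (2 * (1 + ln (real q))) powr 1 * ln x powr (- a)"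
        using lq a by (intro mult_right_mono powr_mono) auto
      finally show ?thesis using lq by (simp add: B_def algebra_simps)
    qed
    have "model_total a I J (real q) u X - model_total a I J (1 / real q) u X \<le> (4 * K + 2) * X * B"
    proof (cases "real q ^ 2 \<le> x")
      case True
      have "2 \<le> X"
      proof (cases "q = 1")
        case False
        hence "2 \<le> real q" using q by simp
        also have "real q \<le> X" using True q by (simp add: X_def field_simps power2_eq_square)
        finally show ?thesis .
      qed (use x in \<open>simp add: X_def\<close>)
      have "2 * ln (real q) = ln (real q ^ 2)" using q by (simp add: ln_realpow)
      also have "\<dots> \<le> ln x" using True q x by (subst ln_le_cancel_iff) auto
      finally have "ln X \<ge> ln x / 2" using x q by (simp add: X_def ln_div)
      note p = pB[OF this]
      have "\<bar>model_total a I J (real q) u X - X * Phi a J u 1\<bar> \<le> K * X * ((1 + \<bar>ln (real q)\<bar>) / ln X) powr a"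
        using K(2)[OF \<open>2 \<le> X\<close> _ u, of "real q"] q by simp
      moreover have "\<bar>model_total a I J (1 / real q) u X - X * Phi a J u 1\<bar> \<le> K * X * ((1 + \<bar>ln (1 / real q)\<bar>) / ln X) powr a"
        using K(2)[OF \<open>2 \<le> X\<close> _ u, of "1 / real q"] q by simp
      moreover have "\<bar>ln (1 / real q)\<bar> = ln (real q)" "\<bar>ln (real q)\<bar> = ln (real q)" using q lq by (simp_all add: ln_div)
      moreover have "K * X * ((1 + ln (real q)) / ln X) powr a \<le> K * X * (2 * B)"
        using p K X by (intro mult_left_mono) auto
      ultimately have "model_total a I J (real q) u X - model_total a I J (1 / real q) u X \<le> 2 * (K * X * (2 * B))" by simp
      also have "\<dots> = (4 * K) * X * B" by simp
      also have "\<dots> \<le> (4 * K + 2) * X * B" using X lq by (intro mult_right_mono) (auto simp: B_def)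
      finally show ?thesis .
    next
      case False
      have "model_total a I J (real q) u X - model_total a I J (1 / real q) u X \<le> X - 0"
        using model_total_bounds[OF I(1) _ I(3)] a X by (intro diff_mono) auto
      moreover have "1 \<le> 2 * B"
      proof -
        have "ln x \<le> ln (real q ^ 2)" using False x q by (subst ln_le_cancel_iff) auto
        hence l: "ln x \<le> 2 * ln (real q)" using q by (simp add: ln_realpow)
        hence w: "1 + ln (real q) \<ge> ln x / 2" by simp
        have "1 = ((1 + ln (real q)) / (1 + ln (real q))) powr a" using lq by simp
        also have "\<dots> \<le> 2 * B" by (rule pB[OF w])
        finally show ?thesis .
      qed
      hence "X * 1 \<le> X * (2 * B)" using X by (intro mult_left_mono) auto
      moreover have "X * (2 * B) \<le> (4 * K + 2) * X * B" using X K lq by (simp add: B_def algebra_simps)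
      ultimately show ?thesis by simp
    qed
    also have "\<dots> = (4 * K + 2) * x * ln x powr (- a) * ((1 + ln (real q)) / real q)" by (simp add: X_def B_def)
    finally show ?thesis unfolding X_def .
  qed
  moreover have "4 * K + 2 \<ge> 0" using K by simp
  ultimately show ?thesis unfolding J_def by blast
qed

text \<open>With v = D * g, the condition g <= D gives D^2 * g >= v powr (3/2), and the logarithm
  costs v powr (1/4). The remaining power v powr (-5/4) separates into two convergent
  series.\<close>

lemma pair_sum_bound:
  "\<exists>Z\<ge>0. \<forall>N::nat. (\<Sum>(D, g)\<in>{(D, g). D \<in> {1..N} \<and> g \<in> {1..N} \<and> g \<le> D}.
      (1 + ln (real (D\<^sup>2 * g))) / real (D\<^sup>2 * g)) \<le> Z"
proof -
  have sm: "summable (\<lambda>n. real n powr (- (5 / 4)))" by (subst summable_real_powr_iff) simp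
  define z where "z = (\<Sum>n. real n powr (- (5 / 4)))"
  have z0: "z \<ge> 0" unfolding z_def by (rule suminf_nonneg[OF sm]) simp
  have zb: "(\<Sum>n\<in>{1..N}. real n powr (- (5 / 4))) \<le> z" for N :: nat
    unfolding z_def by (rule sum_le_suminf[OF sm]) auto
  have term_le: "(1 + ln (real (D\<^sup>2 * g))) / real (D\<^sup>2 * g) \<le> 8 * (real D powr (- (5 / 4)) * real g powr (- (5 / 4)))"
    if "D \<ge> 1" "g \<ge> 1" "g \<le> D" for D g :: nat
  proof -
    define v where "v = real D * real g"
    have D: "real D \<ge> 1" and g: "real g \<ge> 1" "real g \<le> real D" using that by auto
    have v: "v \<ge> 1" unfolding v_def using mult_mono[of 1 "real D" 1 "real g"] D g by simp
    have "1 + ln (real (D\<^sup>2 * g)) = 1 + 2 * ln (real D) + ln (real g)" using D g by (simp add: ln_mult ln_realpow)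
    also have "\<dots> \<le> 1 + 2 * ln v" using D g by (simp add: v_def ln_mult)
    also have "\<dots> = 1 + 8 * ln (v powr (1 / 4))" using v by (simp add: ln_powr)
    also have "\<dots> \<le> 8 * v powr (1 / 4)" using ln_le_minus_one[of "v powr (1 / 4)"] v by simp
    finally have 1: "1 + ln (real (D\<^sup>2 * g)) \<le> 8 * v powr (1 / 4)" .
    have "v powr (3 / 2) = real D powr (3 / 2) * real g powr (1 + 1 / 2)" unfolding v_def using D g by (simp add: powr_mult)
    also have "\<dots> = real D powr (3 / 2) * (real g * real g powr (1 / 2))" using g by (subst powr_add) simp
    also have "\<dots> \<le> real D powr (3 / 2) * (real g * real D powr (1 / 2))" using g D by (intro mult_left_mono powr_mono2) auto
    also have "\<dots> = real D powr (3 / 2 + 1 / 2) * real g" by (subst powr_add) simp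
    also have "\<dots> = real (D\<^sup>2 * g)" using D by simp
    finally have 2: "v powr (3 / 2) \<le> real (D\<^sup>2 * g)" .
    have "(1 + ln (real (D\<^sup>2 * g))) / real (D\<^sup>2 * g) \<le> 8 * v powr (1 / 4) / v powr (3 / 2)"
      using 1 2 v that by (intro frac_le) auto
    also have "\<dots> = 8 * v powr (1 / 4 - 3 / 2)" using v by (subst powr_diff) auto
    also have "\<dots> = 8 * (real D powr (- (5 / 4)) * real g powr (- (5 / 4)))" unfolding v_def using D g by (simp add: powr_mult)
    finally show ?thesis .
  qed
  show ?thesis
  proof (rule exI[of _ "8 * (z * z)"], intro conjI allI)
    show "0 \<le> 8 * (z * z)" by simp
    fix N :: nat
    define P where "P = {(D, g). D \<in> {1..N} \<and> g \<in> {1..N} \<and> g \<le> D}"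
    have sub: "P \<subseteq> {1..N} \<times> {1..N}" by (auto simp: P_def)
    have "(\<Sum>(D, g)\<in>P. (1 + ln (real (D\<^sup>2 * g))) / real (D\<^sup>2 * g)) \<le>
        (\<Sum>(D, g)\<in>P. 8 * (real D powr (- (5 / 4)) * real g powr (- (5 / 4))))"
      by (rule sum_mono) (use term_le in \<open>auto simp: P_def\<close>)
    also have "\<dots> \<le> (\<Sum>(D, g)\<in>{1..N} \<times> {1..N}. 8 * (real D powr (- (5 / 4)) * real g powr (- (5 / 4))))"
      by (rule sum_mono2[OF _ sub]) auto
    also have "\<dots> = 8 * ((\<Sum>D\<in>{1..N}. real D powr (- (5 / 4))) * (\<Sum>g\<in>{1..N}. real g powr (- (5 / 4))))"
      unfolding sum_product sum.cartesian_product[symmetric] by (simp only: sum_distrib_left)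
    also have "\<dots> \<le> 8 * (z * z)" using zb[of N] z0 by (intro mult_left_mono mult_mono sum_nonneg) auto
    finally show "(\<Sum>(D, g)\<in>{(D, g). D \<in> {1..N} \<and> g \<in> {1..N} \<and> g \<le> D}.
      (1 + ln (real (D\<^sup>2 * g))) / real (D\<^sup>2 * g)) \<le> 8 * (z * z)" unfolding P_def .
  qed
qed

text \<open>Each n is charged to its pair (D, g) and its squarefree part s. For fixed q = D^2 * g
  the discrepancies over s <= x / q add up to the quantity in \<open>model_total_spread\<close>, and
  \<open>pair_sum_bound\<close> sums over the pairs.\<close>

lemma uniform_model_average:
  assumes a: "0 < a" "a \<le> 1 / 2" and I: "finite I" "k \<in> I" "real (card I) * a = 1"
  shows "\<exists>K\<ge>0. \<forall>x u. x \<ge> 2 \<longrightarrow> (\<forall>i\<in>I - {k}. 0 \<le> u i \<and> u i \<le> 1) \<longrightarrow>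
    (\<Sum>n\<in>{1..nat \<lfloor>x\<rfloor>}. \<bar>uniform_prob I (I - {k}) (\<lambda>i. real n powr u i) n - model_prob a I (I - {k}) (\<lambda>i. real n powr u i) n\<bar>) \<le>
      K * x * ln x powr (- a)"
proof -
  define J where "J = I - {k}"
  have J: "J \<subseteq> I" by (auto simp: J_def)
  obtain K where K: "K \<ge> 0" "\<And>x u (q::nat). x \<ge> 2 \<Longrightarrow> q \<ge> 1 \<Longrightarrow> (\<forall>i\<in>J. 0 \<le> u i \<and> u i \<le> 1) \<Longrightarrow>
    model_total a I J (real q) u (x / real q) - model_total a I J (1 / real q) u (x / real q) \<le> K * x * ln x powr (- a) * ((1 + ln (real q)) / real q)"
    using model_total_spread[OF a I] unfolding J_def by blast
  obtain Z where Z: "Z \<ge> 0" "\<And>N::nat. (\<Sum>(D, g)\<in>{(D, g). D \<in> {1..N} \<and> g \<in> {1..N} \<and> g \<le> D}.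
      (1 + ln (real (D\<^sup>2 * g))) / real (D\<^sup>2 * g)) \<le> Z" using pair_sum_bound by blast
  obtain fD fg fs :: "nat \<Rightarrow> nat" where dec: "\<And>n. n > 0 \<Longrightarrow> n = fs n * ((fD n)\<^sup>2 * fg n) \<and> squarefree (fs n) \<and>
      coprime (fs n) ((fD n)\<^sup>2 * fg n) \<and> fg n \<le> fD n \<and> fD n > 0 \<and> fg n > 0 \<and> fs n > 0"
  proof -
    have "\<exists>p. n > 0 \<longrightarrow> n = snd (snd p) * ((fst p)\<^sup>2 * fst (snd p)) \<and> squarefree (snd (snd p)) \<and>
      coprime (snd (snd p)) ((fst p)\<^sup>2 * fst (snd p)) \<and> fst (snd p) \<le> fst p \<and> fst p > 0 \<and> fst (snd p) > 0 \<and> snd (snd p) > 0" for n :: nat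
    proof (cases "n > 0")
      case True
      obtain D g s where "n = s * (D\<^sup>2 * g)" "squarefree s" "coprime s (D\<^sup>2 * g)" "g \<le> D" "D > 0" "g > 0" "s > 0"
        using squarefree_coprime_decomposition[OF True] by metis
      thus ?thesis by (intro exI[of _ "(D, g, s)"]) simp
    qed simp
    then obtain p where "\<And>n :: nat. n > 0 \<longrightarrow> n = snd (snd (p n)) * ((fst (p n))\<^sup>2 * fst (snd (p n))) \<and> squarefree (snd (snd (p n))) \<and>
      coprime (snd (snd (p n))) ((fst (p n))\<^sup>2 * fst (snd (p n))) \<and> fst (snd (p n)) \<le> fst (p n) \<and> fst (p n) > 0 \<and> fst (snd (p n)) > 0 \<and> snd (snd (p n)) > 0"
      by metis
    thus ?thesis using that[of "\<lambda>n. snd (snd (p n))" "\<lambda>n. fst (p n)" "\<lambda>n. fst (snd (p n))"] by blast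
  qed
  have "(\<Sum>n\<in>{1..nat \<lfloor>x\<rfloor>}. \<bar>uniform_prob I J (\<lambda>i. real n powr u i) n - model_prob a I J (\<lambda>i. real n powr u i) n\<bar>) \<le> (K * Z) * x * ln x powr (- a)"
    if x: "x \<ge> 2" and u: "\<forall>i\<in>J. 0 \<le> u i \<and> u i \<le> 1" for x u
  proof -
    define N where "N = nat \<lfloor>x\<rfloor>"
    define P where "P = {(D, g). D \<in> {1..N} \<and> g \<in> {1..N} \<and> g \<le> D}"
    \<comment> \<open>For n = s * q one has s powr u i <= n powr u i <= q * s powr u i, so the
      window can be expressed through q and s alone.\<close>
    define Dl where "Dl q s = model_prob a I J (\<lambda>i. real q * real s powr u i) s - model_prob a I J (\<lambda>i. 1 / real q * real s powr u i) s" for q s :: nat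
    have finP: "finite P" by (rule finite_subset[of _ "{1..N} \<times> {1..N}"]) (auto simp: P_def)
    have Dl0: "Dl q s \<ge> 0" if "q > 0" "s > 0" for q s
    proof -
      have "1 / real q \<le> 1" "1 \<le> real q" using that by auto
      hence "1 / real q \<le> real q" by linarith
      hence "model_prob a I J (\<lambda>i. 1 / real q * real s powr u i) s \<le> model_prob a I J (\<lambda>i. real q * real s powr u i) s"
        using that I a by (intro model_prob_mono mult_right_mono) auto
      thus ?thesis unfolding Dl_def by simp
    qed
    have pw: "\<bar>uniform_prob I J (\<lambda>i. real n powr u i) n - model_prob a I J (\<lambda>i. real n powr u i) n\<bar> \<le> Dl ((fD n)\<^sup>2 * fg n) (fs n)" if n: "n > 0" for n
    proof -
      define q s where "q = (fD n)\<^sup>2 * fg n" and "s = fs n"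
      have d: "n = s * q" "squarefree s" "coprime s q" "q > 0" "s > 0" using dec[OF n] by (auto simp: q_def s_def)
      have "\<bar>uniform_prob I J (\<lambda>i. real n powr u i) n - model_prob a I J (\<lambda>i. real n powr u i) n\<bar> \<le>
          model_prob a I J (\<lambda>i. real n powr u i) s - model_prob a I J (\<lambda>i. real n powr u i / real q) s"
        unfolding d(1) by (rule uniform_model_diff) (use I J a d in auto)
      also have "\<dots> \<le> Dl q s" unfolding Dl_def
      proof (intro diff_mono model_prob_mono)
        fix i assume i: "i \<in> J"
        have "real n powr u i = real s powr u i * real q powr u i" unfolding d(1) by (simp add: powr_mult)
        also have "\<dots> \<le> real s powr u i * real q powr 1" using u i d by (intro mult_left_mono powr_mono) auto
        finally show "real n powr u i \<le> real q * real s powr u i" using d by (simp add: mult.commute)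
        have "s \<le> n" using d by simp
        hence "real s powr u i \<le> real n powr u i" using u i by (intro powr_mono2) auto
        thus "1 / real q * real s powr u i \<le> real n powr u i / real q" by (simp add: divide_right_mono)
      qed (use I a d in auto)
      finally show ?thesis unfolding q_def s_def .
    qed
    define A where "A = (SIGMA p:P. {1..nat \<lfloor>x / real ((fst p)\<^sup>2 * snd p)\<rfloor>})"
    define \<phi> where "\<phi> n = ((fD n, fg n), fs n)" for n
    have inj: "inj_on \<phi> {1..N}"
    proof (rule inj_onI)
      fix m n assume mn: "m \<in> {1..N}" "n \<in> {1..N}" "\<phi> m = \<phi> n"
      have "m = fs m * ((fD m)\<^sup>2 * fg m)" using dec[of m] mn by auto
      also have "\<dots> = fs n * ((fD n)\<^sup>2 * fg n)" using mn by (simp add: \<phi>_def)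
      also have "\<dots> = n" using dec[of n] mn by auto
      finally show "m = n" .
    qed
    have im: "\<phi> ` {1..N} \<subseteq> A"
    proof (rule image_subsetI)
      fix n assume n: "n \<in> {1..N}"
      define D g s where "D = fD n" and "g = fg n" and "s = fs n"
      have d: "n = s * (D\<^sup>2 * g)" "g \<le> D" "D > 0" "g > 0" "s > 0" using dec[of n] n by (auto simp: D_def g_def s_def)
      have "D \<le> n" unfolding d(1) using d by (simp add: power2_eq_square)
      hence "(D, g) \<in> P" using d n by (auto simp: P_def)
      moreover have "real s \<le> x / real (D\<^sup>2 * g)"
      proof -
        have "real n \<le> x" using n x unfolding N_def by (auto simp: le_nat_iff le_floor_iff)
        thus ?thesis using d by (simp add: d(1) field_simps)
      qed
      hence "s \<in> {1..nat \<lfloor>x / real (D\<^sup>2 * g)\<rfloor>}" using d(5) unfolding in_upto_iff by simp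
      ultimately show "\<phi> n \<in> A" unfolding A_def \<phi>_def D_def[symmetric] g_def[symmetric] s_def[symmetric] by simp
    qed
    have "(\<Sum>n\<in>{1..N}. \<bar>uniform_prob I J (\<lambda>i. real n powr u i) n - model_prob a I J (\<lambda>i. real n powr u i) n\<bar>) \<le>
        (\<Sum>n\<in>{1..N}. (\<lambda>(p, s). Dl ((fst p)\<^sup>2 * snd p) s) (\<phi> n))"
      by (rule sum_mono) (use pw in \<open>auto simp: \<phi>_def\<close>)
    also have "\<dots> = (\<Sum>t\<in>\<phi> ` {1..N}. (\<lambda>(p, s). Dl ((fst p)\<^sup>2 * snd p) s) t)"
      using sum.reindex[OF inj, of "\<lambda>(p, s). Dl ((fst p)\<^sup>2 * snd p) s"] by (simp add: o_def)
    also have "\<dots> \<le> (\<Sum>(p, s)\<in>A. Dl ((fst p)\<^sup>2 * snd p) s)"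
      by (rule sum_mono2[OF _ im]) (use finP in \<open>auto simp: A_def P_def intro!: Dl0\<close>)
    also have "\<dots> = (\<Sum>p\<in>P. \<Sum>s\<in>{1..nat \<lfloor>x / real ((fst p)\<^sup>2 * snd p)\<rfloor>}. Dl ((fst p)\<^sup>2 * snd p) s)"
      unfolding A_def by (rule sum.Sigma[symmetric]) (use finP in auto)
    also have "\<dots> \<le> (\<Sum>p\<in>P. K * x * ln x powr (- a) * ((1 + ln (real ((fst p)\<^sup>2 * snd p))) / real ((fst p)\<^sup>2 * snd p)))"
    proof (rule sum_mono)
      fix p assume p: "p \<in> P"
      define q where "q = (fst p)\<^sup>2 * snd p"
      have "fst p \<ge> 1" "snd p \<ge> 1" using p by (auto simp: P_def)
      hence "q \<ge> 1" unfolding q_def by simp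
      have "(\<Sum>s\<in>{1..nat \<lfloor>x / real q\<rfloor>}. Dl q s) = model_total a I J (real q) u (x / real q) - model_total a I J (1 / real q) u (x / real q)"
        unfolding Dl_def model_total_def sum_subtractf ..
      also have "\<dots> \<le> K * x * ln x powr (- a) * ((1 + ln (real q)) / real q)" by (rule K(2)[OF x \<open>q \<ge> 1\<close> u])
      finally show "(\<Sum>s\<in>{1..nat \<lfloor>x / real ((fst p)\<^sup>2 * snd p)\<rfloor>}. Dl ((fst p)\<^sup>2 * snd p) s) \<le>
          K * x * ln x powr (- a) * ((1 + ln (real ((fst p)\<^sup>2 * snd p))) / real ((fst p)\<^sup>2 * snd p))" unfolding q_def .
    qed
    also have "\<dots> = K * x * ln x powr (- a) * (\<Sum>(D, g)\<in>P. (1 + ln (real (D\<^sup>2 * g))) / real (D\<^sup>2 * g))"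
      unfolding sum_distrib_left[symmetric] by (simp only: case_prod_unfold)
    also have "\<dots> \<le> K * x * ln x powr (- a) * Z" using Z(2)[of N] K x unfolding P_def by (intro mult_left_mono) auto
    also have "\<dots> = (K * Z) * x * ln x powr (- a)" by simp
    finally show ?thesis unfolding N_def .
  qed
  moreover have "K * Z \<ge> 0" using K Z by simp
  ultimately show ?thesis unfolding J_def by blast
qed

theorem theorem1:
  fixes k :: nat
  assumes "k \<ge> 2"
  shows "\<exists>C::real. \<forall>x::real. \<forall>u::nat \<Rightarrow> real.
           x \<ge> 2 \<longrightarrow> (\<forall>i\<in>{1..k-1}. u i \<ge> 0) \<longrightarrow> (\<Sum>i=1..k-1. u i) \<le> 1 \<longrightarrow>
           \<bar>1 / x * (\<Sum>n\<in>{n::nat. 1 \<le> n \<and> real n \<le> x}. 1 / real (tau k n) * real (divisor_count k u n))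
              - dirichlet_F k u\<bar>
             \<le> C * (1 / ln x powr (1 / real k))"
proof -
  define a where "a = 1 / real k"
  define I where "I = {1..k}"
  define J where "J = {1..k-1}"
  have a: "0 < a" "a \<le> 1 / 2" using assms by (auto simp: a_def field_simps)
  have I: "finite I" "k \<in> I" "real (card I) * a = 1" using assms by (auto simp: I_def a_def)
  have J: "I - {k} = J" using assms by (auto simp: I_def J_def)
  obtain K1 where K1: "\<And>y c u. y \<ge> 2 \<Longrightarrow> c > 0 \<Longrightarrow> (\<forall>i\<in>J. 0 \<le> u i \<and> u i \<le> 1) \<Longrightarrow>
      \<bar>model_total a I J c u y - y * Phi a J u 1\<bar> \<le> K1 * y * ((1 + \<bar>ln c\<bar>) / ln y) powr a"
    using model_total_asymptotics[OF a I] unfolding J by blast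
  obtain K2 where K2: "\<And>x u. x \<ge> 2 \<Longrightarrow> (\<forall>i\<in>J. 0 \<le> u i \<and> u i \<le> 1) \<Longrightarrow>
      (\<Sum>n\<in>{1..nat \<lfloor>x\<rfloor>}. \<bar>uniform_prob I J (\<lambda>i. real n powr u i) n - model_prob a I J (\<lambda>i. real n powr u i) n\<bar>) \<le> K2 * x * ln x powr (- a)"
    using uniform_model_average[OF a I] unfolding J by blast
  show ?thesis
  proof (rule exI[of _ "K1 + K2"], intro allI impI)
    fix x :: real and u :: "nat \<Rightarrow> real"
    assume x: "x \<ge> 2" and u0: "\<forall>i\<in>{1..k-1}. u i \<ge> 0" and us: "(\<Sum>i=1..k-1. u i) \<le> 1"
    have u: "\<forall>i\<in>J. 0 \<le> u i \<and> u i \<le> 1"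
    proof
      fix i assume i: "i \<in> J"
      have "u i \<le> (\<Sum>i\<in>J. u i)" using u0 i by (intro member_le_sum) (auto simp: J_def)
      thus "0 \<le> u i \<and> u i \<le> 1" using u0 us i by (auto simp: J_def)
    qed
    define L where "L = ln x powr (- a)"
    define S where "S = (\<Sum>n\<in>{n::nat. 1 \<le> n \<and> real n \<le> x}. 1 / real (tau k n) * real (divisor_count k u n))"
    have set: "{n::nat. 1 \<le> n \<and> real n \<le> x} = {1..nat \<lfloor>x\<rfloor>}" using in_upto_iff[of _ x] by blast
    have S: "S = (\<Sum>n\<in>{1..nat \<lfloor>x\<rfloor>}. uniform_prob I J (\<lambda>i. real n powr u i) n)" unfolding S_def set
    proof (rule sum.cong[OF refl])
      fix n assume "n \<in> {1..nat \<lfloor>x\<rfloor>}"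
      hence "n > 0" by simp
      thus "1 / real (tau k n) * real (divisor_count k u n) = uniform_prob I J (\<lambda>i. real n powr u i) n"
        using divisor_count_eq[of k n u] assms unfolding uniform_prob_def tau_eq_card_tup I_def J_def by simp
    qed
    have "\<bar>S - model_total a I J 1 u x\<bar> \<le> (\<Sum>n\<in>{1..nat \<lfloor>x\<rfloor>}. \<bar>uniform_prob I J (\<lambda>i. real n powr u i) n - model_prob a I J (\<lambda>i. real n powr u i) n\<bar>)"
      unfolding S model_total_def sum_subtractf[symmetric] by simp
    also have "\<dots> \<le> K2 * x * L" unfolding L_def by (rule K2[OF x u])
    finally have 1: "\<bar>S - model_total a I J 1 u x\<bar> \<le> K2 * x * L" .
    have "(1 / ln x) powr a = L" unfolding L_def using x by (simp add: powr_divide powr_minus field_simps)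
    hence 2: "\<bar>model_total a I J 1 u x - x * Phi a J u 1\<bar> \<le> K1 * x * L" using K1[OF x _ u, of 1] by simp
    have F: "dirichlet_F k u = Phi a J u 1" unfolding a_def J_def using assms u0 us by (intro dirichlet_F_eq_Phi) auto
    have "\<bar>S - x * dirichlet_F k u\<bar> \<le> (K1 + K2) * x * L" using 1 2 unfolding F by (simp add: algebra_simps)
    moreover have "\<bar>S - x * dirichlet_F k u\<bar> = x * \<bar>1 / x * S - dirichlet_F k u\<bar>"
      using abs_mult[of x "1 / x * S - dirichlet_F k u"] x by (simp add: right_diff_distrib)
    ultimately have "x * \<bar>1 / x * S - dirichlet_F k u\<bar> \<le> x * ((K1 + K2) * L)" by (simp add: algebra_simps)
    moreover have "L = 1 / ln x powr (1 / real k)" using x by (simp add: L_def a_def powr_minus field_simps)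
    moreover have "x > 0" using x by simp
    ultimately show "\<bar>1 / x * (\<Sum>n\<in>{n::nat. 1 \<le> n \<and> real n \<le> x}. 1 / real (tau k n) * real (divisor_count k u n))
              - dirichlet_F k u\<bar> \<le> (K1 + K2) * (1 / ln x powr (1 / real k))"
      unfolding S_def by (simp only: mult_le_cancel_left_pos)
  qed
qed

end
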